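(* Let $d\ge3$, $\lambda>0$, and let $V$ be a potential of the admissible form described in the context. Let $\Omega',\Omega\subset\mathbb{R}^d$ be two bounded Lipschitz open domains with $\overline{\Omega'}\subset\Omega$ and $\operatorname{supp}V\subset\Omega'$. Then there is a constant $C>0$ such that every $u\in H^1(\Omega)$ solving $$(\Delta+\lambda-V)u=0\quad\text{in }\Omega$$ satisfies $$\|u\|_{H^1(\Omega')}\le C\,\|u\|_{L^2(\Omega)} .$$
   Context: Admissible potentials. $V=V^0+\gamma^s+\alpha\,\mathrm{d}\sigma$ where: $V^0\in L^{d/2}(\mathbb{R}^d;\mathbb{R})$ has compact support; $\mathrm{d}\sigma$ is the surface measure of a compact hypersurface $\Gamma\subset\mathbb{R}^d$ locally described by graphs of Lipschitz functions, and $\alpha\in L^\infty(\Gamma;\mathbb{R})$; $\gamma^s=\chi^2D^sg$ for some $0\le s<1$, $g\in L^\infty(\mathbb{R}^d;\mathbb{R})$, and $\chi\in C^\infty(\mathbb{R}^d;[0,1])$ a compactly supported cut-off. Here $\widehat{D^sf}(\xi)=|\xi|^s\widehat f(\xi)$ and $D^sg$ is understood by duality. $V$ acts by multiplication: $\langle Vu,\varphi\rangle=\int V^0u\varphi\,dx+\int g\,D^s(\chi u\,\chi\varphi)\,dx+\int_\Gamma\alpha u\varphi\,\mathrm{d}\sigma$. The equation is understood weakly (tested against $\varphi\in H^1_0(\Omega)$). The constant $C$ may depend on $d,\lambda,V,\Omega,\Omega'$ but not on $u$. *)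

theory Defs
  imports "HOL-Analysis.Analysis"
begin

section \<open>Smooth functions and test functions\<close>

fun times_differentiable ::
    "nat \<Rightarrow> ('a::real_normed_vector \<Rightarrow> 'b::real_normed_vector) \<Rightarrow> bool" where
  "times_differentiable 0 f \<longleftrightarrow> continuous_on UNIV f"
| "times_differentiable (Suc k) f \<longleftrightarrow>
     (\<forall>x. f differentiable (at x)) \<and>
     (\<forall>v. times_differentiable k (\<lambda>x. frechet_derivative f (at x) v))"

definition smooth :: "('a::real_normed_vector \<Rightarrow> 'b::real_normed_vector) \<Rightarrow> bool" where
  "smooth f \<longleftrightarrow> (\<forall>k. times_differentiable k f)"

definition test_functions :: "(real ^ 'n) set \<Rightarrow> (real ^ 'n \<Rightarrow> complex) set" where
  "test_functions \<Omega> =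
     {\<phi>. smooth \<phi> \<and> compact (closure {x. \<phi> x \<noteq> 0}) \<and> closure {x. \<phi> x \<noteq> 0} \<subseteq> \<Omega>}"

definition partial :: "'n \<Rightarrow> (real ^ 'n \<Rightarrow> complex) \<Rightarrow> real ^ 'n \<Rightarrow> complex" where
  "partial i \<phi> x = frechet_derivative \<phi> (at x) (axis i 1)"


section \<open>The Sobolev spaces $H^1$ and $H^1_0$\<close>

text \<open>Elements of the function spaces over an open set \<open>\<Omega>\<close> are represented by functions on the
  whole space; their values outside \<open>\<Omega>\<close>, and on null sets, are irrelevant.\<close>

definition L2_space :: "(real ^ 'n) set \<Rightarrow> (real ^ 'n \<Rightarrow> complex) set" where
  "L2_space \<Omega> = {u. u \<in> borel_measurable (lebesgue_on \<Omega>) \<and>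
                    integrable (lebesgue_on \<Omega>) (\<lambda>x. (cmod (u x))\<^sup>2)}"

definition L2_norm :: "(real ^ 'n) set \<Rightarrow> (real ^ 'n \<Rightarrow> complex) \<Rightarrow> real" where
  "L2_norm \<Omega> u = sqrt (LINT x|lebesgue_on \<Omega>. (cmod (u x))\<^sup>2)"

definition locally_integrable :: "(real ^ 'n) set \<Rightarrow> (real ^ 'n \<Rightarrow> complex) \<Rightarrow> bool" where
  "locally_integrable \<Omega> u \<longleftrightarrow> (\<forall>K. compact K \<and> K \<subseteq> \<Omega> \<longrightarrow> set_integrable lebesgue K u)"

definition is_weak_partial ::
    "(real ^ 'n) set \<Rightarrow> 'n \<Rightarrow> (real ^ 'n \<Rightarrow> complex) \<Rightarrow> (real ^ 'n \<Rightarrow> complex) \<Rightarrow> bool" where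
  "is_weak_partial \<Omega> i u w \<longleftrightarrow>
     locally_integrable \<Omega> u \<and> locally_integrable \<Omega> w \<and>
     (\<forall>\<phi>\<in>test_functions \<Omega>.
        (LINT x|lebesgue_on \<Omega>. u x * partial i \<phi> x) = - (LINT x|lebesgue_on \<Omega>. w x * \<phi> x))"

definition weak_partial ::
    "(real ^ 'n) set \<Rightarrow> 'n \<Rightarrow> (real ^ 'n \<Rightarrow> complex) \<Rightarrow> real ^ 'n \<Rightarrow> complex" where
  "weak_partial \<Omega> i u = (SOME w. is_weak_partial \<Omega> i u w)"

definition H1 :: "(real ^ 'n) set \<Rightarrow> (real ^ 'n \<Rightarrow> complex) set" where
  "H1 \<Omega> = {u \<in> L2_space \<Omega>. \<forall>i. \<exists>w\<in>L2_space \<Omega>. is_weak_partial \<Omega> i u w}"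

definition H1_norm :: "(real ^ 'n) set \<Rightarrow> (real ^ 'n \<Rightarrow> complex) \<Rightarrow> real" where
  "H1_norm \<Omega> u =
     sqrt ((L2_norm \<Omega> u)\<^sup>2 + (\<Sum>i\<in>UNIV. (L2_norm \<Omega> (weak_partial \<Omega> i u))\<^sup>2))"

definition H1_0 :: "(real ^ 'n) set \<Rightarrow> (real ^ 'n \<Rightarrow> complex) set" where
  "H1_0 \<Omega> = {\<phi> \<in> H1 \<Omega>. \<exists>\<psi>. (\<forall>k. \<psi> k \<in> test_functions \<Omega>) \<and>
                (\<lambda>k::nat. H1_norm \<Omega> (\<lambda>x. \<psi> k x - \<phi> x)) \<longlonglongrightarrow> 0}"


section \<open>Lipschitz graphs, Lipschitz open sets, surface measure\<close>

text \<open>A Lipschitz function on the hyperplane orthogonal to the unit vector \<open>e\<close> is encoded as a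
  Lipschitz function on the whole space that is constant in direction \<open>e\<close>. Its graph over that
  hyperplane is \<open>{x. x \<bullet> e = h x}\<close>.\<close>

definition lipschitz_chart :: "real ^ 'n \<Rightarrow> (real ^ 'n \<Rightarrow> real) \<Rightarrow> bool" where
  "lipschitz_chart e h \<longleftrightarrow>
     norm e = 1 \<and> (\<exists>L. L-lipschitz_on UNIV h) \<and> (\<forall>x t. h (x + t *\<^sub>R e) = h x)"

definition lipschitz_open :: "(real ^ 'n) set \<Rightarrow> bool" where
  "lipschitz_open \<Omega> \<longleftrightarrow> open \<Omega> \<and>
     (\<forall>p\<in>frontier \<Omega>. \<exists>e h U. lipschitz_chart e h \<and> open U \<and> p \<in> U \<and>
         \<Omega> \<inter> U = {x \<in> U. h x < x \<bullet> e})"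

definition lipschitz_hypersurface :: "(real ^ 'n) set \<Rightarrow> bool" where
  "lipschitz_hypersurface \<Gamma> \<longleftrightarrow>
     (\<forall>p\<in>\<Gamma>. \<exists>e h U. lipschitz_chart e h \<and> open U \<and> p \<in> U \<and> \<Gamma> \<inter> U = {x \<in> U. x \<bullet> e = h x})"

text \<open>The surface measure of the graph of a function \<open>h\<close> over the hyperplane \<open>e\<^sup>\<bottom>\<close> is the image of
  $\sqrt{1+|\nabla h|^2}\,dy$ under $y \mapsto y + h(y)e$. By Fubini, integration over \<open>e\<^sup>\<bottom>\<close> of a
  function is the same as integration over the slab \<open>0 \<le> x \<bullet> e \<le> 1\<close> of its extension that is
  constant in direction \<open>e\<close>; the point of the graph above the projection of \<open>x\<close> is
  \<open>x + (h x - x \<bullet> e) *\<^sub>R e\<close>. The points where \<open>h\<close> is not differentiable form a null set by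
  Rademacher's theorem and are left out of the integral.\<close>

definition graph_area :: "real ^ 'n \<Rightarrow> (real ^ 'n \<Rightarrow> real) \<Rightarrow> (real ^ 'n) set \<Rightarrow> ennreal" where
  "graph_area e h A =
     (\<integral>\<^sup>+x\<in>{x. 0 \<le> x \<bullet> e \<and> x \<bullet> e \<le> 1 \<and> h differentiable (at x) \<and> x + (h x - x \<bullet> e) *\<^sub>R e \<in> A}.
        ennreal (sqrt (1 + (onorm (frechet_derivative h (at x)))\<^sup>2)) \<partial>lborel)"

definition is_surface_measure :: "(real ^ 'n) set \<Rightarrow> (real ^ 'n) measure \<Rightarrow> bool" where
  "is_surface_measure \<Gamma> \<sigma> \<longleftrightarrow>
     sets \<sigma> = sets borel \<and> emeasure \<sigma> (- \<Gamma>) = 0 \<and>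
     (\<forall>e h U A. lipschitz_chart e h \<and> open U \<and> \<Gamma> \<inter> U = {x \<in> U. x \<bullet> e = h x} \<and>
        A \<in> sets borel \<and> A \<subseteq> U \<longrightarrow> emeasure \<sigma> A = graph_area e h A)"

text \<open>The trace on \<open>\<Gamma> \<inter> \<Omega>\<close> of a function in $H^1(\Omega)$, where \<open>\<sigma>\<close> is the surface measure of \<open>\<Gamma>\<close>:
  the limit in $L^2_{loc}(\sigma)$ of the restrictions of smooth functions converging to it in
  $H^1_{loc}(\Omega)$.\<close>

definition is_trace ::
    "(real ^ 'n) set \<Rightarrow> (real ^ 'n) measure \<Rightarrow> (real ^ 'n \<Rightarrow> complex) \<Rightarrow> (real ^ 'n \<Rightarrow> complex) \<Rightarrow> bool"
  where
  "is_trace \<Omega> \<sigma> u T \<longleftrightarrow>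
     T \<in> borel_measurable borel \<and>
     (\<exists>v. (\<forall>k::nat. v k \<in> test_functions UNIV) \<and>
        (\<forall>W. open W \<and> bounded W \<and> closure W \<subseteq> \<Omega> \<longrightarrow>
           (\<lambda>k. H1_norm W (\<lambda>x. v k x - u x)) \<longlonglongrightarrow> 0 \<and>
           (\<lambda>k. \<integral>\<^sup>+x\<in>W. ennreal ((cmod (v k x - T x))\<^sup>2) \<partial>\<sigma>) \<longlonglongrightarrow> 0))"

definition H1_trace ::
    "(real ^ 'n) set \<Rightarrow> (real ^ 'n) measure \<Rightarrow> (real ^ 'n \<Rightarrow> complex) \<Rightarrow> real ^ 'n \<Rightarrow> complex" where
  "H1_trace \<Omega> \<sigma> u = (SOME T. is_trace \<Omega> \<sigma> u T)"


section \<open>The operator $D^s$\<close>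

definition fourier :: "(real ^ 'n \<Rightarrow> complex) \<Rightarrow> real ^ 'n \<Rightarrow> complex" where
  "fourier f \<xi> = (LINT x|lebesgue. cis (- (x \<bullet> \<xi>)) * f x)"

text \<open>The case distinction is needed because \<open>0 powr 0 = 0\<close>, while $D^0$ is the identity.\<close>

definition frac_symbol :: "real \<Rightarrow> real ^ 'n \<Rightarrow> real" where
  "frac_symbol s \<xi> = (if s = 0 then 1 else norm \<xi> powr s)"

text \<open>$D^s$ is only applied to compactly supported functions of class $W^{1,1}$, which $D^s$
  maps into $L^1$ when $0 \le s < 1$.\<close>

definition is_frac_deriv ::
    "real \<Rightarrow> (real ^ 'n \<Rightarrow> complex) \<Rightarrow> (real ^ 'n \<Rightarrow> complex) \<Rightarrow> bool" where
  "is_frac_deriv s f F \<longleftrightarrow>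
     integrable lebesgue F \<and> (\<forall>\<xi>. fourier F \<xi> = of_real (frac_symbol s \<xi>) * fourier f \<xi>)"

definition frac_deriv :: "real \<Rightarrow> (real ^ 'n \<Rightarrow> complex) \<Rightarrow> real ^ 'n \<Rightarrow> complex" where
  "frac_deriv s f = (SOME F. is_frac_deriv s f F)"


section \<open>Admissible potentials\<close>

text \<open>The data of $V = V^0 + \chi^2 D^s g + \alpha\,d\sigma$.\<close>

record ('n::finite) potential =
  regular :: "real ^ 'n \<Rightarrow> real"      \<comment> \<open>$V^0$\<close>
  exponent :: real                    \<comment> \<open>$s$\<close>
  frac_coeff :: "real ^ 'n \<Rightarrow> real"   \<comment> \<open>$g$\<close>
  cutoff :: "real ^ 'n \<Rightarrow> real"       \<comment> \<open>$\chi$\<close>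
  surface :: "(real ^ 'n) set"        \<comment> \<open>$\Gamma$\<close>
  surf_measure :: "(real ^ 'n) measure"  \<comment> \<open>$d\sigma$\<close>
  strength :: "real ^ 'n \<Rightarrow> real"     \<comment> \<open>$\alpha$\<close>

definition admissible :: "'n::finite potential \<Rightarrow> bool" where
  "admissible V \<longleftrightarrow>
     regular V \<in> borel_measurable lebesgue \<and>
     integrable lebesgue (\<lambda>x. \<bar>regular V x\<bar> powr (real CARD('n) / 2)) \<and>
     (\<exists>K. compact K \<and> (AE x in lebesgue. x \<notin> K \<longrightarrow> regular V x = 0)) \<and>
     0 \<le> exponent V \<and> exponent V < 1 \<and>
     frac_coeff V \<in> borel_measurable lebesgue \<and>
     (\<exists>M. AE x in lebesgue. \<bar>frac_coeff V x\<bar> \<le> M) \<and>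
     smooth (cutoff V) \<and> (\<forall>x. 0 \<le> cutoff V x \<and> cutoff V x \<le> 1) \<and>
     compact (closure {x. cutoff V x \<noteq> 0}) \<and>
     compact (surface V) \<and> lipschitz_hypersurface (surface V) \<and>
     is_surface_measure (surface V) (surf_measure V) \<and>
     strength V \<in> borel_measurable borel \<and>
     (\<exists>M. AE x in surf_measure V. \<bar>strength V x\<bar> \<le> M)"

text \<open>\<open>V\<close> as a distribution. The term \<open>\<chi>\<^sup>2 D\<^sup>s g\<close> acts by duality.\<close>

definition distribution :: "'n::finite potential \<Rightarrow> (real ^ 'n \<Rightarrow> complex) \<Rightarrow> complex" where
  "distribution V \<phi> =
     (LINT x|lebesgue. of_real (regular V x) * \<phi> x)
     + (LINT x|lebesgue. of_real (frac_coeff V x)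
          * frac_deriv (exponent V) (\<lambda>y. of_real ((cutoff V y)\<^sup>2) * \<phi> y) x)
     + (LINT x:surface V|surf_measure V. of_real (strength V x) * \<phi> x)"

definition supp :: "'n::finite potential \<Rightarrow> (real ^ 'n) set" where
  "supp V = - \<Union>{W. open W \<and> (\<forall>\<phi>\<in>test_functions W. distribution V \<phi> = 0)}"

text \<open>$\langle Vu,\varphi\rangle$ for $u \in H^1(\Omega)$ and $\varphi \in H^1_0(\Omega)$. The function
  $\varphi$ is extended by zero outside \<open>\<Omega>\<close>, so all three integrals only involve values in \<open>\<Omega>\<close>.
  The pairing is bilinear: there is no complex conjugation.\<close>

definition pairing ::
    "(real ^ 'n) set \<Rightarrow> 'n potential \<Rightarrow> (real ^ 'n \<Rightarrow> complex) \<Rightarrow> (real ^ 'n \<Rightarrow> complex) \<Rightarrow> complex"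
  where
  "pairing \<Omega> V u \<phi> =
     (LINT x|lebesgue_on \<Omega>. of_real (regular V x) * u x * \<phi> x)
     + (LINT x|lebesgue. of_real (frac_coeff V x)
          * frac_deriv (exponent V)
              (\<lambda>y. if y \<in> \<Omega> then (of_real (cutoff V y) * u y) * (of_real (cutoff V y) * \<phi> y)
                   else 0) x)
     + (LINT x:(surface V \<inter> \<Omega>)|surf_measure V.
          of_real (strength V x) * H1_trace \<Omega> (surf_measure V) u x * H1_trace \<Omega> (surf_measure V) \<phi> x)"

text \<open>Weak form of $(\Delta + \lambda - V)u = 0$ in \<open>\<Omega>\<close>.\<close>

definition weak_solution ::
    "(real ^ 'n) set \<Rightarrow> real \<Rightarrow> 'n potential \<Rightarrow> (real ^ 'n \<Rightarrow> complex) \<Rightarrow> bool" where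
  "weak_solution \<Omega> lam V u \<longleftrightarrow>
     (\<forall>\<phi>\<in>H1_0 \<Omega>.
        - (\<Sum>i\<in>UNIV. (LINT x|lebesgue_on \<Omega>. weak_partial \<Omega> i u x * weak_partial \<Omega> i \<phi> x))
        + of_real lam * (LINT x|lebesgue_on \<Omega>. u x * \<phi> x)
        - pairing \<Omega> V u \<phi> = 0)"

end

theory Submission
  imports "HOL-Probability.Probability" Defs
begin


section \<open>Smooth functions\<close>

text \<open>This is a Caccioppoli estimate for the Laplacian with a form-bounded perturbation. Take
  a smooth cut-off \<open>e\<close> with compact support in \<Omega> that equals 1 near the closure
  of \<Omega>', and test the equation with \<open>(e x)\<^sup>2 *\<^sub>R cnj (u x)\<close>. In the
  real part the cross terms combine to |grad (e u)|^2 - |u grad e|^2, so ||grad (e u)||^2 is at most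
  a multiple of ||u||^2 plus the modulus of the pairing with V
  (\<open>Caccioppoli_estimate\<close>). Everything therefore rests on V being an infinitesimal form
  perturbation: for every \<epsilon> > 0 the pairing is at most \<epsilon> ||grad (e u)||^2 + C ||e
  u||^2, with C depending on \<epsilon> but not on u (\<open>pairing_bound\<close>). With \<epsilon>
  = 1/2 the gradient term is absorbed, and on \<Omega>' the gradient of e u is that of u.

  The regular part V^0 is cut at a large height into a bounded function and one that is small in
  L^{d/2}. The second is handled by a weighted Sobolev inequality (\<open>weighted_Sobolev\<close>,
  \<open>potential_form_bound\<close>), proved by truncation: an averaging argument over
  translations (\<open>Faber_Krahn_L1\<close>) relates the measures of {|u|^2 > s} and {|u|^2 > 2
  s}, and the resulting recursion is summed over dyadic levels. The exponent 1 - 2/d in that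
  recursion is positive because d >= 3.

  In the fractional part D^s is applied to |chi e u|^2, whose translates differ in L^1 by O(|y|)
  with a constant given by the energy. D^s is an average of differences: short displacements
  contribute a small multiple of that constant, long ones a multiple of the L^1 norm
  (\<open>frac_deriv_bound\<close>). The symbol is computed with Gaussians, and
  \<open>fourier_unique\<close> makes the chosen \<open>frac_deriv\<close> unambiguous almost
  everywhere.

  On the surface, integrating a directional derivative along lines that cross a Lipschitz graph once
  bounds the integral of |v|^2 over the graph by that of 2 |v| |grad v| over the space
  (\<open>slab_integral_le\<close>, \<open>surface_form_bound\<close>), which Young's inequality
  splits with a small weight on the gradient.

  These bounds are first shown for smooth functions with compact support. Mollification
  (\<open>friedrichs\<close>, \<open>H1_localize\<close>) and passage to the limit, mostly by
  Fatou's lemma (\<open>H1_form_extension\<close>, \<open>trace_form_bound\<close>), carry them to e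
  u. The choice operators \<open>weak_partial\<close> and \<open>H1_trace\<close> are pinned down
  almost everywhere by the du Bois-Reymond lemma and by \<open>is_trace_exists\<close> and
  \<open>is_trace_unique\<close>.\<close>

text \<open>\<open>times_differentiable\<close> speaks of the chosen
  \<open>frechet_derivative\<close>. Uniqueness of derivatives lets any explicit formula stand for
  it, and this drives the inductions of the closure rules below.\<close>

lemma times_differentiable_cong_has_derivative:
  assumes "\<And>x. (f has_derivative f' x) (at x)"
  shows "times_differentiable (Suc k) f \<longleftrightarrow> (\<forall>v. times_differentiable k (\<lambda>x. f' x v))"
proof -
  have "frechet_derivative f (at x) = f' x" for x
    using frechet_derivative_at[OF assms[of x]] by simp
  moreover have "f differentiable (at x)" for x
    using assms differentiable_def by blast
  ultimately show ?thesis by simp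
qed

lemma times_differentiable_has_derivative:
  assumes "times_differentiable (Suc k) f"
  shows "(f has_derivative frechet_derivative f (at x)) (at x)"
  using assms frechet_derivative_works by auto

lemma times_differentiable_Suc_D: "times_differentiable (Suc k) f \<Longrightarrow> times_differentiable k f"
proof (induction k arbitrary: f)
  case 0
  then show ?case
    by (auto intro!: continuous_at_imp_continuous_on differentiable_imp_continuous_within)
next
  case (Suc k)
  then show ?case by (metis times_differentiable.simps(2))
qed

lemma times_differentiable_continuous: "times_differentiable k f \<Longrightarrow> continuous_on UNIV f"
  by (induction k) (use times_differentiable_Suc_D in auto)

lemma times_differentiable_const [simp]: "times_differentiable k (\<lambda>x. c)"
proof (induction k arbitrary: c)
  case (Suc k)
  then show ?case
    by (subst times_differentiable_cong_has_derivative[of _ "\<lambda>_ _. 0"]) auto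
qed auto

lemma times_differentiable_linear:
  assumes "bounded_linear L" shows "times_differentiable k L"
proof (cases k)
  case 0
  then show ?thesis using assms linear_continuous_on by auto
next
  case (Suc j)
  show ?thesis unfolding Suc
    by (subst times_differentiable_cong_has_derivative[of _ "\<lambda>_. L"])
       (auto intro: bounded_linear.has_derivative[OF assms has_derivative_ident, simplified])
qed

lemma times_differentiable_add:
  "times_differentiable k f \<Longrightarrow> times_differentiable k g \<Longrightarrow> times_differentiable k (\<lambda>x. f x + g x)"
proof (induction k arbitrary: f g)
  case 0
  then show ?case by (simp add: continuous_on_add)
next
  case (Suc k)
  have "((\<lambda>x. f x + g x) has_derivative
     (\<lambda>v. frechet_derivative f (at x) v + frechet_derivative g (at x) v)) (at x)" for x
    by (intro has_derivative_add Suc.prems[THEN times_differentiable_has_derivative])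
  then show ?case
    using Suc by (subst times_differentiable_cong_has_derivative) auto
qed

text \<open>Leibniz rule for an arbitrary bounded bilinear map, so that products, scalar multiples
  and inner products are covered at once.\<close>

lemma times_differentiable_bilinear:
  assumes "bounded_bilinear B"
  shows "times_differentiable k f \<Longrightarrow> times_differentiable k g \<Longrightarrow> times_differentiable k (\<lambda>x. B (f x) (g x))"
proof (induction k arbitrary: f g)
  case 0
  then show ?case using bounded_bilinear.continuous_on[OF assms] by auto
next
  case (Suc k)
  have "((\<lambda>x. B (f x) (g x)) has_derivative
     (\<lambda>v. B (f x) (frechet_derivative g (at x) v) + B (frechet_derivative f (at x) v) (g x))) (at x)" for x
    by (intro bounded_bilinear.FDERIV[OF assms] Suc.prems[THEN times_differentiable_has_derivative])
  moreover have "times_differentiable k f" "times_differentiable k g"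
    using Suc.prems times_differentiable_Suc_D by auto
  ultimately show ?case
    using Suc by (subst times_differentiable_cong_has_derivative) (auto intro!: times_differentiable_add)
qed

lemma times_differentiable_linear_compose:
  assumes "bounded_linear L"
  shows "times_differentiable k f \<Longrightarrow> times_differentiable k (\<lambda>x. L (f x))"
proof (induction k arbitrary: f)
  case 0
  then show ?case using bounded_linear.continuous_on[OF assms] by auto
next
  case (Suc k)
  have "((\<lambda>x. L (f x)) has_derivative (\<lambda>v. L (frechet_derivative f (at x) v))) (at x)" for x
    by (intro bounded_linear.has_derivative[OF assms] Suc.prems[THEN times_differentiable_has_derivative])
  then show ?case
    using Suc by (subst times_differentiable_cong_has_derivative) auto
qed

text \<open>The outer function lives on the real line, where a derivative is multiplication by its
  value at 1. The chain rule thus yields a product, and the bilinear rule closes the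
  induction.\<close>

lemma times_differentiable_real_compose:
  fixes F :: "real \<Rightarrow> real" and q :: "'a::real_normed_vector \<Rightarrow> real"
  shows "times_differentiable k F \<Longrightarrow> times_differentiable k q \<Longrightarrow> times_differentiable k (\<lambda>x. F (q x))"
proof (induction k arbitrary: F q)
  case 0
  then show ?case by (auto intro: continuous_on_compose2)
next
  case (Suc k)
  have lin: "frechet_derivative F (at y) v = v * frechet_derivative F (at y) 1" for y v
    using linear_frechet_derivative[of F "at y"] Suc.prems(1) linear_cmul[of "frechet_derivative F (at y)" v 1]
    by (auto simp: frechet_derivative_works has_derivative_def bounded_linear.linear)
  have "((\<lambda>x. F (q x)) has_derivative
     (\<lambda>v. frechet_derivative F (at (q x)) (frechet_derivative q (at x) v))) (at x)" for x
    using times_differentiable_has_derivative[OF Suc.prems(1)] times_differentiable_has_derivative[OF Suc.prems(2)]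
      has_derivative_compose by blast
  then have "((\<lambda>x. F (q x)) has_derivative
     (\<lambda>v. frechet_derivative q (at x) v * frechet_derivative F (at (q x)) 1)) (at x)" for x
    by (subst (asm) lin)
  moreover have "times_differentiable k (\<lambda>x. frechet_derivative F (at (q x)) 1)"
    using Suc.IH[of "\<lambda>y. frechet_derivative F (at y) 1" q] Suc.prems times_differentiable_Suc_D by auto
  ultimately show ?case
    using Suc.prems
    by (subst times_differentiable_cong_has_derivative)
       (auto intro!: times_differentiable_bilinear[OF bounded_bilinear_mult])
qed

lemma smooth_const: "smooth (\<lambda>x. c)"
  by (simp add: smooth_def)

lemma smooth_linear: "bounded_linear L \<Longrightarrow> smooth L"
  by (simp add: smooth_def times_differentiable_linear)

lemma smooth_add: "smooth f \<Longrightarrow> smooth g \<Longrightarrow> smooth (\<lambda>x. f x + g x)"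
  by (simp add: smooth_def times_differentiable_add)

lemma smooth_bilinear: "bounded_bilinear B \<Longrightarrow> smooth f \<Longrightarrow> smooth g \<Longrightarrow> smooth (\<lambda>x. B (f x) (g x))"
  by (simp add: smooth_def times_differentiable_bilinear)

lemma smooth_linear_compose: "bounded_linear L \<Longrightarrow> smooth f \<Longrightarrow> smooth (\<lambda>x. L (f x))"
  by (simp add: smooth_def times_differentiable_linear_compose)

lemma smooth_real_compose:
  fixes F :: "real \<Rightarrow> real"
  shows "smooth F \<Longrightarrow> smooth q \<Longrightarrow> smooth (\<lambda>x. F (q x))"
  by (simp add: smooth_def times_differentiable_real_compose)

lemma smooth_continuous: "smooth f \<Longrightarrow> continuous_on A f"
  by (meson smooth_def times_differentiable_continuous continuous_on_subset subset_UNIV)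

lemma smooth_has_derivative: "smooth f \<Longrightarrow> (f has_derivative frechet_derivative f (at x)) (at x)"
  by (meson smooth_def times_differentiable_has_derivative)

lemma smooth_frechet_derivative: "smooth f \<Longrightarrow> smooth (\<lambda>x. frechet_derivative f (at x) v)"
  by (metis smooth_def times_differentiable.simps(2))

lemma smooth_shift:
  assumes "smooth f" shows "smooth (\<lambda>x. f (a - x))"
proof -
  have "times_differentiable k f \<Longrightarrow> times_differentiable k (\<lambda>x. f (a - x))" for k and f :: "'a \<Rightarrow> 'b"
  proof (induction k arbitrary: f)
    case 0
    then have "continuous_on UNIV f" by simp
    then show ?case
      using continuous_on_compose2[of UNIV f UNIV "\<lambda>x. a - x"]
      by (simp add: continuous_on_diff)
  next
    case (Suc k)
    have "((\<lambda>x. a - x) has_derivative (\<lambda>v. - v)) (at x)" for x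
      using has_derivative_diff[OF has_derivative_const has_derivative_ident] by simp
    then have d: "((\<lambda>x. f (a - x)) has_derivative (\<lambda>v. frechet_derivative f (at (a - x)) (- v))) (at x)" for x
      by (rule has_derivative_compose[of "\<lambda>x. a - x", OF _ times_differentiable_has_derivative[OF Suc.prems]])
    have "times_differentiable k (\<lambda>x. frechet_derivative f (at (a - x)) (- v))" for v
      by (rule Suc.IH[of "\<lambda>x. frechet_derivative f (at x) (- v)"]) (use Suc.prems in simp)
    then show ?case
      using times_differentiable_cong_has_derivative[OF d] by blast
  qed
  then show ?thesis using assms unfolding smooth_def by blast
qed

section \<open>Flat exponentials and bump functions\<close>

text \<open>The polynomial factor makes the family closed under differentiation, so one induction
  proves smoothness of all its members, including exp (-1/t) itself.\<close>

definition flat_exp :: "real poly \<Rightarrow> real \<Rightarrow> real" where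
  "flat_exp p t = (if t > 0 then poly p (1 / t) * exp (- (1 / t)) else 0)"

lemma flat_exp_tendsto_0: "((\<lambda>t. poly p (1 / t) * exp (- (1 / t))) \<longlongrightarrow> 0) (at_right (0::real))"
proof -
  have m: "((\<lambda>x::real. x ^ n * exp (- x)) \<longlongrightarrow> 0) at_top" for n
    using tendsto_power_div_exp_0[of n] by (simp add: exp_minus field_simps)
  have "((\<lambda>x::real. (\<Sum>i\<le>degree p. coeff p i * (x ^ i * exp (- x)))) \<longlongrightarrow> (\<Sum>i\<le>degree p. coeff p i * 0)) at_top"
    by (intro tendsto_intros m)
  then have "((\<lambda>x::real. poly p x * exp (- x)) \<longlongrightarrow> 0) at_top"
    by (simp add: poly_altdef sum_distrib_right mult.assoc)
  moreover have "filterlim (\<lambda>t::real. 1 / t) at_top (at_right 0)"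
    using filterlim_inverse_at_top_right by (simp add: inverse_eq_divide)
  ultimately show ?thesis by (rule filterlim_compose)
qed

text \<open>For t > 0 the derivative is (1/t^2) (p - p')(1/t) exp (-1/t), which is where the
  polynomial \<open>[:0, 0, 1:] * (p - pderiv p)\<close> comes from. At t = 0 all difference
  quotients tend to 0.\<close>

lemma flat_exp_has_derivative:
  "(flat_exp p has_field_derivative flat_exp ([:0, 0, 1:] * (p - pderiv p)) t) (at t)"
proof -
  consider "t > 0" | "t < 0" | "t = 0" by linarith
  then show ?thesis
  proof cases
    case 1
    have "((\<lambda>t. poly p (1 / t) * exp (- (1 / t))) has_field_derivative
        flat_exp ([:0, 0, 1:] * (p - pderiv p)) t) (at t)"
    proof -
      have i: "((\<lambda>t. 1 / t) has_field_derivative - (1 / t\<^sup>2)) (at t)"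
        using 1 by (auto intro!: derivative_eq_intros simp: power2_eq_square)
      have "((\<lambda>t. poly p (1 / t) * exp (- (1 / t))) has_field_derivative
          (poly (pderiv p) (1 / t) * - (1 / t\<^sup>2)) * exp (- (1 / t)) +
          (exp (- (1 / t)) * - (- (1 / t\<^sup>2))) * poly p (1 / t)) (at t)"
        by (intro DERIV_mult DERIV_chain2[OF poly_DERIV i] DERIV_chain2[OF DERIV_exp] DERIV_minus i)
      then show ?thesis
        using 1 by (simp add: flat_exp_def field_simps power2_eq_square)
    qed
    then show ?thesis
      by (rule has_field_derivative_transform_within_open[where S="{0<..}"]) (use 1 in \<open>auto simp: flat_exp_def\<close>)
  next
    case 2
    have "((\<lambda>t. 0) has_field_derivative flat_exp ([:0, 0, 1:] * (p - pderiv p)) t) (at t)"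
      using 2 by (auto simp: flat_exp_def)
    then show ?thesis
      by (rule has_field_derivative_transform_within_open[where S="{..<0}"]) (use 2 in \<open>auto simp: flat_exp_def\<close>)
  next
    case 3
    \<comment> \<open>Dividing by h multiplies the polynomial in 1/h by its variable, which gives
      \<open>pCons 0 p\<close>.\<close>
    have "((\<lambda>h. flat_exp p h / h) \<longlongrightarrow> 0) (at_right 0)"
      by (rule Lim_transform_eventually[OF flat_exp_tendsto_0[of "pCons 0 p"]])
         (auto simp: flat_exp_def eventually_at_filter)
    moreover have "((\<lambda>h. flat_exp p h / h) \<longlongrightarrow> 0) (at_left 0)"
      by (rule Lim_transform_eventually[OF tendsto_const])
         (auto simp: flat_exp_def eventually_at_filter)
    ultimately show ?thesis
      unfolding 3 has_field_derivative_iff by (auto simp: flat_exp_def filterlim_split_at)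
  qed
qed

lemma smooth_flat_exp: "smooth (flat_exp p)"
proof -
  have "times_differentiable k (flat_exp p)" for k
  proof (induction k arbitrary: p)
    case 0
    show ?case
      by (simp, rule DERIV_continuous_on, rule has_field_derivative_at_within, rule flat_exp_has_derivative)
  next
    case (Suc k)
    have "(flat_exp p has_derivative (\<lambda>v. v * flat_exp ([:0, 0, 1:] * (p - pderiv p)) t)) (at t)" for t
      using flat_exp_has_derivative[of p t] unfolding has_field_derivative_def
      by (simp only: mult_commute_abs)
    from times_differentiable_cong_has_derivative[OF this] show ?case
      using times_differentiable_bilinear[OF bounded_bilinear_mult times_differentiable_const Suc.IH] by blast
  qed
  then show ?thesis by (simp add: smooth_def)
qed

text \<open>The flat exponential of r^2 - |x|^2, whose argument is positive exactly on the open
  ball.\<close>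

lemma smooth_bump_exists:
  assumes "r > 0"
  obtains b :: "'a::euclidean_space \<Rightarrow> real"
  where "smooth b" "\<And>x. b x \<ge> 0" "\<And>x. b x \<noteq> 0 \<longleftrightarrow> norm x < r"
proof
  let ?b = "\<lambda>x::'a. flat_exp 1 (r\<^sup>2 + (- (x \<bullet> x)))"
  have "smooth (\<lambda>x::'a. x \<bullet> x)"
    by (rule smooth_bilinear[OF bounded_bilinear_inner]) (rule smooth_linear, rule bounded_linear_ident)+
  then have "smooth (\<lambda>x::'a. - (x \<bullet> x))"
    by (rule smooth_linear_compose[OF bounded_linear_minus[OF bounded_linear_ident]])
  then show "smooth ?b"
    by (rule smooth_real_compose[OF smooth_flat_exp smooth_add[OF smooth_const]])
  show "?b x \<ge> 0" for x by (simp add: flat_exp_def)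
  have "(norm x)\<^sup>2 < r\<^sup>2 \<longleftrightarrow> norm x < r" for x :: 'a
    using assms by (meson norm_ge_zero less_imp_le power2_less_imp_less power_strict_mono zero_less_numeral)
  then show "?b x \<noteq> 0 \<longleftrightarrow> norm x < r" for x
    by (simp add: flat_exp_def power2_norm_eq_inner[symmetric])
qed


section \<open>Translations in $L^1$ and $L^2$\<close>

lemma lborel_distr_reflect: "distr lborel borel (\<lambda>x::'a::euclidean_space. a - x) = lborel"
  using lborel_affine[of "-1::real" a] by (simp add: density_1)

lemma lborel_distr_shift: "distr lborel borel (\<lambda>x::'a::euclidean_space. x + a) = lborel"
proof -
  have "(\<lambda>x. x + a) = (+) a" by (auto simp: add.commute)
  then show ?thesis using lborel_distr_plus[of a] by simp
qed

lemma nn_integral_lborel_shift: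
  fixes f :: "'a::euclidean_space \<Rightarrow> ennreal"
  assumes "f \<in> borel_measurable borel"
  shows "(\<integral>\<^sup>+x. f (x + a) \<partial>lborel) = (\<integral>\<^sup>+x. f x \<partial>lborel)"
  by (subst lborel_distr_shift[of a, symmetric]) (simp add: nn_integral_distr assms)

lemma nn_integral_lborel_reflect:
  fixes f :: "'a::euclidean_space \<Rightarrow> ennreal"
  assumes "f \<in> borel_measurable borel"
  shows "(\<integral>\<^sup>+x. f (a - x) \<partial>lborel) = (\<integral>\<^sup>+x. f x \<partial>lborel)"
  by (subst lborel_distr_reflect[of a, symmetric]) (simp add: nn_integral_distr assms)

lemma nn_integral_lborel_scale:
  fixes f :: "'a::euclidean_space \<Rightarrow> ennreal"
  assumes [measurable]: "f \<in> borel_measurable borel" and "c > 0"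
  shows "(\<integral>\<^sup>+x. f x \<partial>lborel) = ennreal (c ^ DIM('a)) * (\<integral>\<^sup>+x. f (c *\<^sub>R x) \<partial>lborel)"
  using assms(2)
  by (subst lborel_affine[of c 0])
     (simp_all add: nn_integral_density nn_integral_distr nn_integral_cmult)

lemma integral_lborel_shift:
  fixes f :: "'a::euclidean_space \<Rightarrow> 'b::{banach, second_countable_topology}"
  assumes "f \<in> borel_measurable borel"
  shows "(LINT x|lborel. f (x + a)) = (LINT x|lborel. f x)"
  by (subst lborel_distr_shift[of a, symmetric]) (simp add: integral_distr assms)

lemma integral_lborel_reflect:
  fixes f :: "'a::euclidean_space \<Rightarrow> 'b::{banach, second_countable_topology}"
  assumes "f \<in> borel_measurable borel"
  shows "(LINT x|lborel. f (a - x)) = (LINT x|lborel. f x)"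
  by (subst lborel_distr_reflect[of a, symmetric]) (simp add: integral_distr assms)

lemma integrable_lborel_shift:
  fixes f :: "'a::euclidean_space \<Rightarrow> 'b::{banach, second_countable_topology}"
  assumes "integrable lborel f"
  shows "integrable lborel (\<lambda>x. f (x + a))"
  using assms integrable_distr_eq[of "\<lambda>x::'a. x + a" lborel borel f] borel_measurable_integrable[OF assms]
  by (simp add: lborel_distr_shift)

lemma integrable_lborel_reflect:
  fixes f :: "'a::euclidean_space \<Rightarrow> 'b::{banach, second_countable_topology}"
  assumes "integrable lborel f"
  shows "integrable lborel (\<lambda>x. f (a - x))"
  using assms integrable_distr_eq[of "\<lambda>x::'a. a - x" lborel borel f] borel_measurable_integrable[OF assms]
  by (simp add: lborel_distr_reflect)

section \<open>Continuity of translations in the mean\<close>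

text \<open>Triangle inequality through g. The error f - g enters once in place and once translated,
  with the same norm by translation invariance; hence the factor 2.\<close>

lemma L1_modulus_approx:
  fixes f g :: "'a::euclidean_space \<Rightarrow> 'b::{banach, second_countable_topology}"
  assumes f: "integrable lborel f" and g: "integrable lborel g"
  shows "(LINT x|lborel. norm (f (x + z) - f x))
    \<le> 2 * (LINT x|lborel. norm (f x - g x)) + (LINT x|lborel. norm (g (x + z) - g x))"
proof -
  note [simp] = integrable_lborel_shift[OF f] integrable_lborel_shift[OF g] f g
  have fg: "integrable lborel (\<lambda>x. norm (f x - g x))" by simp
  have "(LINT x|lborel. norm (f (x + z) - f x)) \<le>
      (LINT x|lborel. norm (f x - g x) + norm (f (x + z) - g (x + z)) + norm (g (x + z) - g x))"
  proof (rule integral_mono)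
    fix x
    have "f (x + z) - f x = - (f x - g x) + (f (x + z) - g (x + z)) + (g (x + z) - g x)" by simp
    then show "norm (f (x + z) - f x) \<le> norm (f x - g x) + norm (f (x + z) - g (x + z)) + norm (g (x + z) - g x)"
      by (metis norm_triangle_mono norm_triangle_ineq order_refl norm_minus_cancel)
  qed auto
  also have "\<dots> = (LINT x|lborel. norm (f x - g x)) + (LINT x|lborel. norm (f (x + z) - g (x + z)))
      + (LINT x|lborel. norm (g (x + z) - g x))"
    by simp
  also have "(LINT x|lborel. norm (f (x + z) - g (x + z))) = (LINT x|lborel. norm (f x - g x))"
    by (rule integral_lborel_shift[of "\<lambda>x. norm (f x - g x)"])
       (use borel_measurable_integrable[OF fg] in simp)
  finally show ?thesis by simp
qed

text \<open>Openness makes 1_U(x) 1_U(x + z_k) converge to 1_U(x) at every point, so dominated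
  convergence applies to the product; the L^1 distance of the two indicators is twice the measure of
  U minus twice the integral of that product.\<close>

lemma indicator_translation_open:
  fixes U :: "'a::euclidean_space set"
  assumes U: "open U" "emeasure lborel U < \<infinity>" and z: "z \<longlonglongrightarrow> 0"
  shows "(\<lambda>k. LINT x|lborel. \<bar>indicator U (x + z k) - indicator U x\<bar> :: real) \<longlonglongrightarrow> 0"
proof -
  have [measurable]: "U \<in> sets borel" using U by simp
  have i: "integrable lborel (indicator U :: 'a \<Rightarrow> real)" using U by (simp add: integrable_indicator_iff)
  note [simp] = integrable_lborel_shift[OF i] i
  have ip: "integrable lborel (\<lambda>x. indicator U x * indicator U (x + z k) :: real)" for k
    by (rule Bochner_Integration.integrable_bound[OF i]) (auto simp: indicator_def)
  have "(\<lambda>k. LINT x|lborel. indicator U x * indicator U (x + z k) :: real) \<longlonglongrightarrow> (LINT x|lborel. indicator U x)"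
  proof (rule integral_dominated_convergence[where w="indicator U"])
    show "AE x in lborel. (\<lambda>k. indicator U x * indicator U (x + z k) :: real) \<longlonglongrightarrow> indicator U x"
    proof (intro AE_I2)
      fix x
      show "(\<lambda>k. indicator U x * indicator U (x + z k) :: real) \<longlonglongrightarrow> indicator U x"
      proof (cases "x \<in> U")
        case True
        have "(\<lambda>k. x + z k) \<longlonglongrightarrow> x" using tendsto_add[OF tendsto_const z, of x] by simp
        then have "\<forall>\<^sub>F k in sequentially. x + z k \<in> U" using U True topological_tendstoD by blast
        then show ?thesis using True by (intro tendsto_eventually) (auto elim!: eventually_mono)
      qed auto
    qed
  qed (auto simp: indicator_def)
  moreover have "(LINT x|lborel. \<bar>indicator U (x + z k) - indicator U x\<bar>) =
     2 * (LINT x|lborel. indicator U x) - 2 * (LINT x|lborel. indicator U x * indicator U (x + z k) :: real)" for k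
  proof -
    have "(LINT x|lborel. \<bar>indicator U (x + z k) - indicator U x\<bar>) =
       (LINT x|lborel. indicator U (x + z k) + indicator U x - 2 * (indicator U x * indicator U (x + z k)) :: real)"
      by (rule Bochner_Integration.integral_cong) (auto simp: indicator_def)
    also have "\<dots> = (LINT x|lborel. indicator U (x + z k)) + (LINT x|lborel. indicator U x)
        - 2 * (LINT x|lborel. indicator U x * indicator U (x + z k) :: real)"
      using ip[of k] by simp
    also have "(LINT x|lborel. indicator U (x + z k)) = (LINT x|lborel. indicator U x :: real)"
      by (rule integral_lborel_shift) simp
    finally show ?thesis by simp
  qed
  ultimately show ?thesis
    using tendsto_diff[OF tendsto_const tendsto_mult_left,
        of "\<lambda>k. LINT x|lborel. indicator U x * indicator U (x + z k) :: real" "LINT x|lborel. indicator U x"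
           sequentially "2 * (LINT x|lborel. indicator U x)" 2]
    by simp
qed

text \<open>Induction over integrable functions: indicators are reduced to open sets by outer
  regularity, sums are immediate, and limits are controlled by
  \<open>L1_modulus_approx\<close>.\<close>

lemma L1_translation_sequentially:
  fixes f :: "'a::euclidean_space \<Rightarrow> 'b::{banach, second_countable_topology}"
  assumes "integrable lborel f" and z: "z \<longlonglongrightarrow> 0"
  shows "(\<lambda>k. LINT x|lborel. norm (f (x + z k) - f x)) \<longlonglongrightarrow> 0"
  using assms(1)
proof (induction rule: integrable_induct)
  case (base A c)
  then have [measurable]: "A \<in> sets borel" by simp
  have iA: "integrable lborel (indicator A :: 'a \<Rightarrow> real)" using base by (simp add: integrable_indicator_iff)
  have ind: "(\<lambda>k. LINT x|lborel. norm (indicator A (x + z k) - indicator A x :: real)) \<longlonglongrightarrow> 0"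
  proof (rule LIMSEQ_I)
    fix r :: real assume r: "r > 0"
    then have "0 < r / 4" by simp
    \<comment> \<open>The error r/4 is counted twice by \<open>L1_modulus_approx\<close>; the
      remaining r/2 is left for the open set.\<close>
    from outer_regular_lborel[OF \<open>A \<in> sets borel\<close> this]
    obtain U where U: "open U" "A \<subseteq> U" "emeasure lborel (U - A) < ennreal (r / 4)" .
    have [measurable]: "U \<in> sets borel" using U by simp
    have Us: "emeasure lborel U \<le> emeasure lborel A + emeasure lborel (U - A)"
      using emeasure_subadditive[of A lborel "U - A"] U(2) by (simp add: Un_absorb1)
    have UA: "emeasure lborel (U - A) < \<infinity>"
      using U(3) by (rule order.strict_trans) simp
    have "emeasure lborel A + emeasure lborel (U - A) < \<infinity>"
      using base UA by simp
    with Us have Uf: "emeasure lborel U < \<infinity>"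
      by (rule order.strict_trans1)
    then have iU: "integrable lborel (indicator U :: 'a \<Rightarrow> real)" by (simp add: integrable_indicator_iff)
    have d: "(LINT x|lborel. norm (indicator A x - indicator U x :: real)) < r / 4"
    proof -
      have "(LINT x|lborel. norm (indicator A x - indicator U x :: real)) = (LINT x|lborel. indicator (U - A) x)"
        using U(2) by (intro Bochner_Integration.integral_cong) (auto simp: indicator_def)
      also have "\<dots> = measure lborel (U - A)" by simp
      also have "\<dots> < r / 4"
        using U(3) UA by (simp add: emeasure_eq_ennreal_measure ennreal_less_iff)
      finally show ?thesis .
    qed
    from LIMSEQ_D[OF indicator_translation_open[OF U(1) Uf z], of "r/2"] r
    obtain N where N: "\<And>k. k \<ge> N \<Longrightarrow> (LINT x|lborel. \<bar>indicator U (x + z k) - indicator U x\<bar> :: real) < r / 2"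
      by fastforce
    show "\<exists>N. \<forall>k\<ge>N. norm ((LINT x|lborel. norm (indicator A (x + z k) - indicator A x :: real)) - 0) < r"
    proof (intro exI allI impI)
      fix k assume "k \<ge> N"
      then show "norm ((LINT x|lborel. norm (indicator A (x + z k) - indicator A x :: real)) - 0) < r"
        using L1_modulus_approx[OF iA iU, of "z k"] N[of k] d by simp
    qed
  qed
  have "(LINT x|lborel. norm (indicator A (x + z k) *\<^sub>R c - indicator A x *\<^sub>R c)) =
     (LINT x|lborel. norm (indicator A (x + z k) - indicator A x :: real)) * norm c" for k
  proof -
    have "norm (indicator A (x + z k) *\<^sub>R c - indicator A x *\<^sub>R c) =
        norm (indicator A (x + z k) - indicator A x :: real) * norm c" for x
      by (metis norm_scaleR scaleR_diff_left real_norm_def)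
    then show ?thesis by (simp only: integral_mult_left_zero)
  qed
  then show ?case using tendsto_mult_right[OF ind, of "norm c"] by (simp only: mult_zero_left)
next
  case (add f g)
  have le: "(LINT x|lborel. norm (f (x + z k) + g (x + z k) - (f x + g x))) \<le>
    (LINT x|lborel. norm (f (x + z k) - f x)) + (LINT x|lborel. norm (g (x + z k) - g x))" for k
  proof -
    have "(LINT x|lborel. norm (f (x + z k) + g (x + z k) - (f x + g x))) \<le>
       (LINT x|lborel. norm (f (x + z k) - f x) + norm (g (x + z k) - g x))"
      using integrable_lborel_shift[OF add(1), of "z k"] integrable_lborel_shift[OF add(2), of "z k"] add(1,2)
      by (intro integral_mono) (auto intro!: norm_diff_triangle_ineq)
    then show ?thesis using add(1,2) by (simp add: integrable_lborel_shift)
  qed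
  show ?case
    by (rule Lim_null_comparison[OF _ tendsto_add_zero[OF add(3,4)]]) (use le in simp)
next
  case (lim f s)
  have conv: "(\<lambda>i. LINT x|lborel. norm (f x - s i x)) \<longlonglongrightarrow> (LINT x|lborel. norm (f x - f x))"
  proof (rule integral_dominated_convergence[where w="\<lambda>x. 3 * norm (f x)"])
    show "AE x in lborel. (\<lambda>i. norm (f x - s i x)) \<longlonglongrightarrow> norm (f x - f x)"
      using lim(2) by (intro AE_I2 tendsto_intros) auto
    show "AE x in lborel. norm (norm (f x - s i x)) \<le> 3 * norm (f x)" for i
    proof (intro AE_I2)
      fix x show "norm (norm (f x - s i x)) \<le> 3 * norm (f x)"
        using lim(3)[of x i] norm_triangle_ineq4[of "f x" "s i x"] by simp
    qed
  qed (use lim in auto)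
  show ?case
  proof (rule LIMSEQ_I)
    fix r :: real assume r: "r > 0"
    from LIMSEQ_D[OF conv, of "r/4"] r
    obtain i where i: "(LINT x|lborel. norm (f x - s i x)) < r / 4" by fastforce
    from LIMSEQ_D[OF lim(5)[of i], of "r/2"] r
    obtain N where N: "\<And>k. k \<ge> N \<Longrightarrow> (LINT x|lborel. norm (s i (x + z k) - s i x)) < r / 2"
      by fastforce
    show "\<exists>N. \<forall>k\<ge>N. norm ((LINT x|lborel. norm (f (x + z k) - f x)) - 0) < r"
    proof (intro exI allI impI)
      fix k assume "k \<ge> N"
      then show "norm ((LINT x|lborel. norm (f (x + z k) - f x)) - 0) < r"
        using L1_modulus_approx[OF lim(4,1), of "z k" i] N[of k] i by simp
    qed
  qed
qed

lemma L1_translation: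
  fixes f :: "'a::euclidean_space \<Rightarrow> 'b::{banach, second_countable_topology}"
  assumes "integrable lborel f"
  shows "((\<lambda>z. LINT x|lborel. norm (f (x + z) - f x)) \<longlongrightarrow> 0) (at 0)"
  using L1_translation_sequentially[OF assms] by (auto simp: tendsto_at_iff_sequentially o_def)

text \<open>The field a -> |a| a is monotone in a strong sense: its increment paired with a - b is
  at least (|a| + |b|) |a - b|^2 / 2, and |a| + |b| >= |a - b|. Cauchy-Schwarz then gives the claim.
  It reduces continuity in L^2 to continuity in L^1.\<close>

lemma norm_diff_squared_le:
  fixes a b :: "'a::real_inner"
  shows "(norm (a - b))\<^sup>2 \<le> 2 * norm (norm a *\<^sub>R a - norm b *\<^sub>R b)"
proof (cases "a = b")
  case False
  define A B where "A = norm a" and "B = norm b"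
  have AB: "A \<ge> 0" "B \<ge> 0" "A * A = a \<bullet> a" "B * B = b \<bullet> b"
    by (auto simp: A_def B_def norm_eq_sqrt_inner)
  have e: "(A *\<^sub>R a - B *\<^sub>R b) \<bullet> (a - b) = (A + B) / 2 * (norm (a - b))\<^sup>2 + (A - B)\<^sup>2 * (A + B) / 2"
    unfolding power2_norm_eq_inner
    by (simp add: inner_simps AB(3,4)[symmetric] inner_commute power2_eq_square field_simps)
  have "norm (a - b) \<le> A + B" unfolding A_def B_def by (rule norm_triangle_ineq4)
  then have "norm (a - b) * (norm (a - b))\<^sup>2 \<le> (A + B) * (norm (a - b))\<^sup>2"
    by (rule mult_right_mono) simp
  also have "\<dots> \<le> 2 * ((A *\<^sub>R a - B *\<^sub>R b) \<bullet> (a - b))"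
    unfolding e using AB by simp
  also have "\<dots> \<le> 2 * (norm (A *\<^sub>R a - B *\<^sub>R b) * norm (a - b))"
    using norm_cauchy_schwarz by (intro mult_left_mono) auto
  finally have "norm (a - b) * (norm (a - b))\<^sup>2 \<le> norm (a - b) * (2 * norm (A *\<^sub>R a - B *\<^sub>R b))"
    by (simp add: algebra_simps)
  then show ?thesis using False by (simp add: A_def B_def)
qed simp

text \<open>If f is square integrable then |f| f is integrable, and by
  \<open>norm_diff_squared_le\<close> the L^1 modulus of the latter dominates the squared L^2
  modulus of f.\<close>

lemma L2_translation:
  fixes f :: "'a::euclidean_space \<Rightarrow> complex"
  assumes [measurable]: "f \<in> borel_measurable borel" and f: "integrable lborel (\<lambda>x. (cmod (f x))\<^sup>2)"
  shows "((\<lambda>z. \<integral>\<^sup>+x. ennreal ((cmod (f (x + z) - f x))\<^sup>2) \<partial>lborel) \<longlongrightarrow> 0) (at 0)"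
proof -
  let ?h = "\<lambda>x. norm (f x) *\<^sub>R f x"
  have h: "integrable lborel ?h"
    by (rule Bochner_Integration.integrable_bound[OF f]) (auto simp: power2_eq_square norm_mult)
  have le: "(\<integral>\<^sup>+x. ennreal ((cmod (f (x + z) - f x))\<^sup>2) \<partial>lborel)
     \<le> ennreal (2 * (LINT x|lborel. norm (?h (x + z) - ?h x)))" for z
  proof -
    have "(\<integral>\<^sup>+x. ennreal ((cmod (f (x + z) - f x))\<^sup>2) \<partial>lborel)
       \<le> (\<integral>\<^sup>+x. ennreal (2 * norm (?h (x + z) - ?h x)) \<partial>lborel)"
      by (intro nn_integral_mono ennreal_leI norm_diff_squared_le)
    also have "\<dots> = ennreal (LINT x|lborel. 2 * norm (?h (x + z) - ?h x))"
      using integrable_lborel_shift[OF h, of z] h by (intro nn_integral_eq_integral) auto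
    finally show ?thesis by simp
  qed
  have "((\<lambda>z. ennreal (2 * (LINT x|lborel. norm (?h (x + z) - ?h x)))) \<longlongrightarrow> ennreal (2 * 0)) (at 0)"
    by (rule tendsto_ennrealI, rule tendsto_mult_left, rule L1_translation[OF h])
  then show ?thesis
    by (intro tendsto_sandwich[OF _ always_eventually[OF allI[OF le]] tendsto_const]) simp_all
qed

section \<open>Approximate identities\<close>

definition convolve :: "('a::euclidean_space \<Rightarrow> complex) \<Rightarrow> ('a \<Rightarrow> real) \<Rightarrow> 'a \<Rightarrow> complex" where
  "convolve f g x = (LINT y|lborel. g y *\<^sub>R f (x - y))"

text \<open>Since \<open>g\<close> has mass one, the difference is the \<open>g\<close>-average of
  f(x - y) - f(x). If the right-hand side is infinite there is nothing to show; otherwise the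
  integrand is integrable and the norm moves inside.\<close>

lemma convolve_diff_le:
  fixes f :: "'a::euclidean_space \<Rightarrow> complex"
  assumes [measurable]: "f \<in> borel_measurable borel" "g \<in> borel_measurable borel"
    and g: "\<And>x. g x \<ge> 0" "(\<integral>\<^sup>+x. ennreal (g x) \<partial>lborel) = 1"
  shows "ennreal (cmod (convolve f g x - f x)) \<le> (\<integral>\<^sup>+y. ennreal (g y) * ennreal (cmod (f (x - y) - f x)) \<partial>lborel)"
    (is "_ \<le> ?R")
proof (cases "?R = \<infinity>")
  case False
  have ig: "integrable lborel g" "(LINT y|lborel. g y) = 1"
    using g by (auto simp: integrable_iff_bounded integral_eq_nn_integral)
  have fin: "integrable lborel (\<lambda>y. g y *\<^sub>R (f (x - y) - f x))"
    using False g by (auto simp: integrable_iff_bounded norm_mult ennreal_mult top.not_eq_extremum)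
  have ic: "integrable lborel (\<lambda>y. g y *\<^sub>R f x)" using ig by simp
  have "convolve f g x = (LINT y|lborel. g y *\<^sub>R (f (x - y) - f x) + g y *\<^sub>R f x)"
    unfolding convolve_def by (simp add: scaleR_diff_right)
  also have "\<dots> = (LINT y|lborel. g y *\<^sub>R (f (x - y) - f x)) + f x"
    using Bochner_Integration.integral_add[OF fin ic] ig by simp
  finally have "convolve f g x - f x = (LINT y|lborel. g y *\<^sub>R (f (x - y) - f x))" by simp
  then have "ennreal (cmod (convolve f g x - f x)) \<le> (\<integral>\<^sup>+y. ennreal (norm (g y *\<^sub>R (f (x - y) - f x))) \<partial>lborel)"
    using integral_norm_bound_ennreal[OF fin] by simp
  also have "\<dots> = ?R" using g by (simp add: ennreal_mult)
  finally show ?thesis .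
qed simp

lemma convolve_measurable [measurable]:
  assumes [measurable]: "f \<in> borel_measurable borel" "g \<in> borel_measurable borel"
  shows "convolve f g \<in> borel_measurable borel"
  unfolding convolve_def by measurable

lemma convolve_L1_diff:
  fixes f :: "'a::euclidean_space \<Rightarrow> complex"
  assumes [measurable]: "f \<in> borel_measurable borel" "g \<in> borel_measurable borel"
    and g: "\<And>x. g x \<ge> 0" "(\<integral>\<^sup>+x. ennreal (g x) \<partial>lborel) = 1"
  shows "(\<integral>\<^sup>+x. ennreal (cmod (convolve f g x - f x)) \<partial>lborel)
     \<le> (\<integral>\<^sup>+y. ennreal (g y) * (\<integral>\<^sup>+x. ennreal (cmod (f (x + (- y)) - f x)) \<partial>lborel) \<partial>lborel)"
proof -
  have "(\<integral>\<^sup>+x. ennreal (cmod (convolve f g x - f x)) \<partial>lborel)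
     \<le> (\<integral>\<^sup>+x. (\<integral>\<^sup>+y. ennreal (g y) * ennreal (cmod (f (x - y) - f x)) \<partial>lborel) \<partial>lborel)"
    by (intro nn_integral_mono convolve_diff_le assms)
  also have "\<dots> = (\<integral>\<^sup>+y. (\<integral>\<^sup>+x. ennreal (g y) * ennreal (cmod (f (x - y) - f x)) \<partial>lborel) \<partial>lborel)"
    by (rule lborel_pair.Fubini') measurable
  finally show ?thesis by (simp add: nn_integral_cmult)
qed

text \<open>Jensen's inequality for the density \<open>g\<close>, in the form of Cauchy-Schwarz with
  \<open>g\<close> split into two square roots, followed by Tonelli.\<close>

lemma convolve_L2_diff:
  fixes f :: "'a::euclidean_space \<Rightarrow> complex"
  assumes [measurable]: "f \<in> borel_measurable borel" "g \<in> borel_measurable borel"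
    and g: "\<And>x. g x \<ge> 0" "(\<integral>\<^sup>+x. ennreal (g x) \<partial>lborel) = 1"
  shows "(\<integral>\<^sup>+x. ennreal ((cmod (convolve f g x - f x))\<^sup>2) \<partial>lborel)
     \<le> (\<integral>\<^sup>+y. ennreal (g y) * (\<integral>\<^sup>+x. ennreal ((cmod (f (x + (- y)) - f x))\<^sup>2) \<partial>lborel) \<partial>lborel)"
proof -
  have p: "ennreal ((cmod (convolve f g x - f x))\<^sup>2) \<le>
     (\<integral>\<^sup>+y. ennreal (g y) * ennreal ((cmod (f (x - y) - f x))\<^sup>2) \<partial>lborel)" for x
  proof -
    let ?u = "\<lambda>y. ennreal (sqrt (g y))" and ?v = "\<lambda>y. ennreal (sqrt (g y) * cmod (f (x - y) - f x))"
    have "ennreal ((cmod (convolve f g x - f x))\<^sup>2) = (ennreal (cmod (convolve f g x - f x)))\<^sup>2"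
      by (simp add: ennreal_power)
    also have "\<dots> \<le> (\<integral>\<^sup>+y. ennreal (g y) * ennreal (cmod (f (x - y) - f x)) \<partial>lborel)\<^sup>2"
      by (intro power_mono convolve_diff_le assms) simp
    also have "(\<integral>\<^sup>+y. ennreal (g y) * ennreal (cmod (f (x - y) - f x)) \<partial>lborel) = (\<integral>\<^sup>+y. ?u y * ?v y \<partial>lborel)"
      using g(1) by (intro nn_integral_cong) (simp add: ennreal_mult[symmetric] mult.assoc[symmetric])
    also have "(\<integral>\<^sup>+y. ?u y * ?v y \<partial>lborel)\<^sup>2 \<le> (\<integral>\<^sup>+y. ?u y ^ 2 \<partial>lborel) * (\<integral>\<^sup>+y. ?v y ^ 2 \<partial>lborel)"
      by (rule Cauchy_Schwarz_nn_integral) measurable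
    also have "(\<integral>\<^sup>+y. ?u y ^ 2 \<partial>lborel) = 1"
      using g by (simp add: ennreal_power)
    also have "(\<integral>\<^sup>+y. ?v y ^ 2 \<partial>lborel) = (\<integral>\<^sup>+y. ennreal (g y) * ennreal ((cmod (f (x - y) - f x))\<^sup>2) \<partial>lborel)"
      using g(1) by (intro nn_integral_cong) (simp add: ennreal_power ennreal_mult[symmetric] power_mult_distrib)
    finally show ?thesis by simp
  qed
  have "(\<integral>\<^sup>+x. ennreal ((cmod (convolve f g x - f x))\<^sup>2) \<partial>lborel)
     \<le> (\<integral>\<^sup>+x. (\<integral>\<^sup>+y. ennreal (g y) * ennreal ((cmod (f (x - y) - f x))\<^sup>2) \<partial>lborel) \<partial>lborel)"
    by (intro nn_integral_mono p)
  also have "\<dots> = (\<integral>\<^sup>+y. (\<integral>\<^sup>+x. ennreal (g y) * ennreal ((cmod (f (x - y) - f x))\<^sup>2) \<partial>lborel) \<partial>lborel)"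
    by (rule lborel_pair.Fubini') measurable
  finally show ?thesis by (simp add: nn_integral_cmult)
qed

text \<open>The common conclusion for a kernel concentrated near the origin.\<close>

lemma kernel_average_tendsto_0:
  fixes \<omega> :: "'a::euclidean_space \<Rightarrow> ennreal" and g :: "nat \<Rightarrow> 'a \<Rightarrow> real"
  assumes \<omega>: "(\<omega> \<longlongrightarrow> 0) (at 0)" "\<omega> 0 = 0"
    and [measurable]: "\<And>k. g k \<in> borel_measurable borel"
    and g: "\<And>k x. g k x \<ge> 0" "\<And>k. (\<integral>\<^sup>+x. ennreal (g k x) \<partial>lborel) = 1"
    and supp: "\<And>k x. g k x \<noteq> 0 \<Longrightarrow> norm x < r k" and r: "r \<longlonglongrightarrow> 0"
  shows "(\<lambda>k. \<integral>\<^sup>+y. ennreal (g k y) * \<omega> (- y) \<partial>lborel) \<longlonglongrightarrow> 0"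
proof (rule order_tendstoI)
  fix e :: ennreal assume "0 < e"
  then obtain e' where e': "0 < e'" "e' < e" using dense by blast
  have "\<forall>\<^sub>F z in at 0. \<omega> z < e'" using \<omega>(1) e'(1) order_tendstoD(2) by blast
  then obtain d where d: "d > 0" "\<And>z. z \<noteq> 0 \<Longrightarrow> norm z < d \<Longrightarrow> \<omega> z < e'"
    by (auto simp: eventually_at)
  then have d': "\<And>z. norm z < d \<Longrightarrow> \<omega> z \<le> e'" using \<omega>(2) by (metis less_imp_le zero_le)
  have "\<forall>\<^sub>F k in sequentially. r k < d" using r d(1) order_tendstoD(2) by blast
  then show "\<forall>\<^sub>F k in sequentially. (\<integral>\<^sup>+y. ennreal (g k y) * \<omega> (- y) \<partial>lborel) < e"
  proof eventually_elim
    case (elim k)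
    have "(\<integral>\<^sup>+y. ennreal (g k y) * \<omega> (- y) \<partial>lborel) \<le> (\<integral>\<^sup>+y. ennreal (g k y) * e' \<partial>lborel)"
    proof (rule nn_integral_mono)
      fix y
      show "ennreal (g k y) * \<omega> (- y) \<le> ennreal (g k y) * e'"
      proof (cases "g k y = 0")
        case False
        then have "norm (- y) < d" using supp[of k y] elim by simp
        then show ?thesis by (intro mult_left_mono d') auto
      qed simp
    qed
    also have "\<dots> = e'" using g(2) by (simp add: nn_integral_multc)
    finally show ?case using e' by simp
  qed
qed simp

lemma convolve_L1_tendsto:
  fixes f :: "'a::euclidean_space \<Rightarrow> complex"
  assumes f: "integrable lborel f"
    and [measurable]: "\<And>k. g k \<in> borel_measurable borel"
    and g: "\<And>k x. g k x \<ge> 0" "\<And>k. (\<integral>\<^sup>+x. ennreal (g k x) \<partial>lborel) = 1"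
    and supp: "\<And>k x. g k x \<noteq> 0 \<Longrightarrow> norm x < r k" and r: "r \<longlonglongrightarrow> 0"
  shows "(\<lambda>k. \<integral>\<^sup>+x. ennreal (cmod (convolve f (g k) x - f x)) \<partial>lborel) \<longlonglongrightarrow> 0"
proof -
  have [measurable]: "f \<in> borel_measurable borel" using f by simp
  let ?w = "\<lambda>z. \<integral>\<^sup>+x. ennreal (cmod (f (x + z) - f x)) \<partial>lborel"
  have "?w z = ennreal (LINT x|lborel. cmod (f (x + z) - f x))" for z
    using integrable_lborel_shift[OF f, of z] f by (intro nn_integral_eq_integral) auto
  then have "(?w \<longlongrightarrow> 0) (at 0)"
    using tendsto_ennrealI[OF L1_translation[OF f]] by simp
  from kernel_average_tendsto_0[OF this _ assms(2) g supp r]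
  have "(\<lambda>k. \<integral>\<^sup>+y. ennreal (g k y) * ?w (- y) \<partial>lborel) \<longlonglongrightarrow> 0" by simp
  then show ?thesis
    by (rule tendsto_sandwich[OF _ _ tendsto_const, rotated -1])
       (use convolve_L1_diff[OF _ assms(2) g] in auto)
qed

lemma convolve_L2_tendsto:
  fixes f :: "'a::euclidean_space \<Rightarrow> complex"
  assumes [measurable]: "f \<in> borel_measurable borel" and f: "integrable lborel (\<lambda>x. (cmod (f x))\<^sup>2)"
    and [measurable]: "\<And>k. g k \<in> borel_measurable borel"
    and g: "\<And>k x. g k x \<ge> 0" "\<And>k. (\<integral>\<^sup>+x. ennreal (g k x) \<partial>lborel) = 1"
    and supp: "\<And>k x. g k x \<noteq> 0 \<Longrightarrow> norm x < r k" and r: "r \<longlonglongrightarrow> 0"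
  shows "(\<lambda>k. \<integral>\<^sup>+x. ennreal ((cmod (convolve f (g k) x - f x))\<^sup>2) \<partial>lborel) \<longlonglongrightarrow> 0"
proof -
  let ?w = "\<lambda>z. \<integral>\<^sup>+x. ennreal ((cmod (f (x + z) - f x))\<^sup>2) \<partial>lborel"
  from kernel_average_tendsto_0[OF L2_translation[OF assms(1) f] _ assms(3) g supp r]
  have "(\<lambda>k. \<integral>\<^sup>+y. ennreal (g k y) * ?w (- y) \<partial>lborel) \<longlonglongrightarrow> 0" by simp
  then show ?thesis
    by (rule tendsto_sandwich[OF _ _ tendsto_const, rotated -1])
       (use convolve_L2_diff[OF assms(1,3) g] in auto)
qed


section \<open>Compactly supported smooth functions and mollification\<close>

definition cc_smooth :: "('a::euclidean_space \<Rightarrow> 'b::real_normed_vector) \<Rightarrow> bool" where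
  "cc_smooth f \<longleftrightarrow> smooth f \<and> compact (closure {x. f x \<noteq> 0})"

lemma test_functions_iff:
  "\<phi> \<in> test_functions \<Omega> \<longleftrightarrow> cc_smooth \<phi> \<and> closure {x. \<phi> x \<noteq> 0} \<subseteq> \<Omega>"
  by (simp add: test_functions_def cc_smooth_def)

lemma test_functions_UNIV: "\<phi> \<in> test_functions UNIV \<longleftrightarrow> cc_smooth \<phi>"
  by (simp add: test_functions_iff)

lemma cc_smooth_smooth: "cc_smooth f \<Longrightarrow> smooth f"
  by (simp add: cc_smooth_def)

lemma cc_smooth_has_derivative: "cc_smooth f \<Longrightarrow> (f has_derivative frechet_derivative f (at x)) (at x)"
  by (simp add: cc_smooth_def smooth_has_derivative)

lemma cc_smooth_subset:
  assumes "smooth f" "cc_smooth g" "\<And>x. f x \<noteq> 0 \<Longrightarrow> g x \<noteq> 0"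
  shows "cc_smooth f"
proof -
  have "closure {x. f x \<noteq> 0} \<subseteq> closure {x. g x \<noteq> 0}"
    using assms(3) by (intro closure_mono) auto
  then show ?thesis
    using assms unfolding cc_smooth_def by (metis closed_closure compact_Int_closed inf.absorb_iff2)
qed

lemma cc_smooth_compact:
  assumes "smooth f" "compact K" "\<And>x. f x \<noteq> 0 \<Longrightarrow> x \<in> K"
  shows "cc_smooth f" "closure {x. f x \<noteq> 0} \<subseteq> K"
proof -
  show *: "closure {x. f x \<noteq> 0} \<subseteq> K"
    using assms by (intro closure_minimal compact_imp_closed) auto
  show "cc_smooth f"
    using assms * unfolding cc_smooth_def by (metis closed_closure compact_Int_closed inf.absorb_iff2)
qed

lemma frechet_derivative_outside_support:
  assumes "x \<notin> closure {x. f x \<noteq> 0}"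
  shows "frechet_derivative f (at x) v = 0"
proof -
  have "((\<lambda>x. 0) has_derivative (\<lambda>v. 0)) (at x)" by simp
  then have "(f has_derivative (\<lambda>v. 0)) (at x)"
    by (rule has_derivative_transform_within_open[where s="- closure {x. f x \<noteq> 0}"])
       (use assms closure_subset[of "{x. f x \<noteq> 0}"] in auto)
  then show ?thesis using frechet_derivative_at by metis
qed

lemma support_frechet_derivative:
  "closure {x. frechet_derivative f (at x) v \<noteq> 0} \<subseteq> closure {x. f x \<noteq> 0}"
  using frechet_derivative_outside_support[of _ f v] by (intro closure_minimal) auto

lemma cc_smooth_derivative:
  assumes "cc_smooth f" shows "cc_smooth (\<lambda>x. frechet_derivative f (at x) v)"
  using assms frechet_derivative_outside_support[of _ f v]
  by (intro cc_smooth_compact(1)[where K="closure {x. f x \<noteq> 0}"])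
     (auto simp: cc_smooth_def smooth_frechet_derivative)

lemma test_functions_derivative:
  assumes "f \<in> test_functions \<Omega>" shows "(\<lambda>x. frechet_derivative f (at x) v) \<in> test_functions \<Omega>"
  using assms cc_smooth_derivative support_frechet_derivative[of f v] by (auto simp: test_functions_iff)

lemma cc_smooth_bounded:
  assumes "cc_smooth f" obtains B where "B > 0" "\<And>x. norm (f x) \<le> B"
proof -
  have "compact (f ` closure {x. f x \<noteq> 0})"
    using assms by (intro compact_continuous_image smooth_continuous) (auto simp: cc_smooth_def)
  then obtain B where B: "\<And>y. y \<in> f ` closure {x. f x \<noteq> 0} \<Longrightarrow> norm y \<le> B"
    using compact_imp_bounded bounded_iff by metis
  have "norm (f x) \<le> \<bar>B\<bar> + 1" for x
  proof (cases "f x = 0")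
    case False
    then have "norm (f x) \<le> B" using closure_subset[of "{x. f x \<noteq> 0}"] by (intro B) auto
    then show ?thesis by simp
  qed simp
  then show ?thesis using that[of "\<bar>B\<bar> + 1"] by auto
qed

lemma cc_smooth_derivative_bounded:
  fixes f :: "'a::euclidean_space \<Rightarrow> 'b::real_normed_vector"
  assumes "cc_smooth f"
  obtains L where "L > 0" "\<And>x v. norm (frechet_derivative f (at x) v) \<le> L * norm v"
proof -
  have "\<exists>B. B > 0 \<and> (\<forall>x. norm (frechet_derivative f (at x) b) \<le> B)" for b
    using cc_smooth_bounded[OF cc_smooth_derivative[OF assms, of b]] by metis
  then obtain B where B: "\<And>b. B b > 0" "\<And>b x. norm (frechet_derivative f (at x) b) \<le> B b"
    by metis
  have "norm (frechet_derivative f (at x) v) \<le> (\<Sum>b\<in>Basis. B b) * norm v" for x v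
  proof -
    have lin: "linear (frechet_derivative f (at x))"
      using cc_smooth_has_derivative[OF assms] has_derivative_linear by blast
    have "frechet_derivative f (at x) v = (\<Sum>b\<in>Basis. (v \<bullet> b) *\<^sub>R frechet_derivative f (at x) b)"
      by (subst (1) euclidean_representation[symmetric]) (simp only: linear_sum[OF lin] linear_cmul[OF lin])
    also have "norm \<dots> \<le> (\<Sum>b\<in>Basis. B b * norm v)"
    proof (rule sum_norm_le)
      fix b :: 'a assume "b \<in> Basis"
      then show "norm ((v \<bullet> b) *\<^sub>R frechet_derivative f (at x) b) \<le> B b * norm v"
        using B(1)[of b] B(2)[of x b] Basis_le_norm[of b v]
        by (simp add: mult.commute[of "B b"] mult_mono)
    qed
    finally show ?thesis by (simp add: sum_distrib_right)
  qed
  moreover have "(\<Sum>b\<in>(Basis::'a set). B b) > 0" using B(1) by (intro sum_pos) auto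
  ultimately show ?thesis using that by blast
qed

lemma cc_smooth_lipschitz:
  fixes f :: "'a::euclidean_space \<Rightarrow> 'b::real_normed_vector"
  assumes "\<And>x. (f has_derivative D x) (at x)" "\<And>x v. norm (D x v) \<le> L * norm v"
  shows "norm (f y - f x) \<le> L * norm (y - x)"
  by (rule differentiable_bound[of UNIV f D]) (use assms onorm_bound in \<open>auto intro: onorm_le\<close>)

lemma cc_smooth_measurable [measurable_dest]:
  fixes f :: "'a::euclidean_space \<Rightarrow> 'b::real_normed_vector"
  shows "cc_smooth f \<Longrightarrow> f \<in> borel_measurable borel"
  by (intro borel_measurable_continuous_onI smooth_continuous cc_smooth_smooth)

lemma cc_smooth_integrable:
  fixes f :: "'a::euclidean_space \<Rightarrow> 'b::{banach, second_countable_topology}"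
  assumes "cc_smooth f" shows "integrable lborel f"
proof -
  let ?K = "closure {x. f x \<noteq> 0}"
  obtain B where B: "B > 0" "\<And>x. norm (f x) \<le> B" using cc_smooth_bounded[OF assms] by blast
  have K: "compact ?K" using assms by (simp add: cc_smooth_def)
  have "integrable lborel (\<lambda>x. B * indicator ?K x :: real)"
    using emeasure_compact_finite[OF K] by (simp add: integrable_indicator_iff)
  then show ?thesis
  proof (rule Bochner_Integration.integrable_bound)
    show "AE x in lborel. norm (f x) \<le> norm (B * indicator ?K x :: real)"
      using B closure_subset[of "{x. f x \<noteq> 0}"] by (intro AE_I2) (auto simp: indicator_def)
  qed (use cc_smooth_measurable[OF assms] in simp)
qed

lemma cc_smooth_bilinear1:
  assumes "bounded_bilinear B" "cc_smooth f" "smooth g" shows "cc_smooth (\<lambda>x. B (f x) (g x))"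
  by (rule cc_smooth_subset[OF smooth_bilinear[OF assms(1)], of _ _ f])
     (use assms bounded_bilinear.zero_left[OF assms(1)] in \<open>auto simp: cc_smooth_def\<close>)

lemma cc_smooth_bilinear2:
  assumes "bounded_bilinear B" "smooth f" "cc_smooth g" shows "cc_smooth (\<lambda>x. B (f x) (g x))"
  by (rule cc_smooth_subset[OF smooth_bilinear[OF assms(1)], of _ _ g])
     (use assms bounded_bilinear.zero_right[OF assms(1)] in \<open>auto simp: cc_smooth_def\<close>)

lemma cc_smooth_linear_compose:
  assumes "bounded_linear L" "cc_smooth f" shows "cc_smooth (\<lambda>x. L (f x))"
  by (rule cc_smooth_subset[OF smooth_linear_compose[OF assms(1)], of _ f])
     (use assms linear_0[OF bounded_linear.linear[OF assms(1)]] in \<open>auto simp: cc_smooth_def\<close>)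

lemma cc_smooth_add:
  assumes "cc_smooth f" "cc_smooth g" shows "cc_smooth (\<lambda>x. f x + g x)"
proof (rule cc_smooth_compact(1)[where K="closure {x. f x \<noteq> 0} \<union> closure {x. g x \<noteq> 0}"])
  fix x assume "f x + g x \<noteq> 0"
  then have "f x \<noteq> 0 \<or> g x \<noteq> 0" by auto
  then show "x \<in> closure {x. f x \<noteq> 0} \<union> closure {x. g x \<noteq> 0}"
    using closure_subset[of "{x. f x \<noteq> 0}"] closure_subset[of "{x. g x \<noteq> 0}"] by blast
qed (use assms in \<open>auto simp: cc_smooth_def smooth_add\<close>)

lemma cc_smooth_diff:
  assumes "cc_smooth f" "cc_smooth g" shows "cc_smooth (\<lambda>x. f x - g x)"
  using cc_smooth_add[OF assms(1) cc_smooth_linear_compose[OF bounded_linear_minus[OF bounded_linear_ident] assms(2)]]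
  by simp

lemma cc_smooth_reflect:
  assumes "cc_smooth f" shows "cc_smooth (\<lambda>x. f (a - x))"
proof (rule cc_smooth_compact(1))
  show "compact ((\<lambda>x. a - x) ` closure {x. f x \<noteq> 0})"
    using assms by (intro compact_continuous_image continuous_intros) (auto simp: cc_smooth_def)
  show "x \<in> (\<lambda>x. a - x) ` closure {x. f x \<noteq> 0}" if "f (a - x) \<noteq> 0" for x
    using that closure_subset[of "{x. f x \<noteq> 0}"] by (intro image_eqI[of _ _ "a - x"]) auto
qed (use assms smooth_shift in \<open>auto simp: cc_smooth_def\<close>)

text \<open>With the variable moved into \<open>g\<close>, differentiation and testing act on the
  smooth factor alone.\<close>

lemma convolve_swap:
  fixes f :: "'a::euclidean_space \<Rightarrow> complex"
  assumes [measurable]: "f \<in> borel_measurable borel" "g \<in> borel_measurable borel"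
  shows "convolve f g x = (LINT y|lborel. g (x - y) *\<^sub>R f y)"
  unfolding convolve_def
  by (subst integral_lborel_reflect[symmetric, of _ x]) auto

lemma integrable_bounded_mult:
  fixes f :: "'a::euclidean_space \<Rightarrow> 'b::{banach, second_countable_topology}" and g :: "'a \<Rightarrow> real"
  assumes "integrable lborel f" "g \<in> borel_measurable borel" "\<And>y. \<bar>g y\<bar> \<le> B"
  shows "integrable lborel (\<lambda>y. g y *\<^sub>R f y)"
proof (rule Bochner_Integration.integrable_bound[of _ "\<lambda>y. B *\<^sub>R f y"])
  show "AE x in lborel. norm (g x *\<^sub>R f x) \<le> norm (B *\<^sub>R f x)"
    using assms(3) order_trans[OF assms(3) abs_ge_self] by (intro AE_I2) (simp add: mult_right_mono)
qed (use assms in auto)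

text \<open>Differentiation under the integral: the normalised remainder of \<open>g\<close> tends
  to 0 pointwise and is at most 2 L, one L from the Lipschitz bound and one from the derivative, so
  dominated convergence applies with majorant 2 L |f|.\<close>

lemma convolve_has_derivative:
  fixes f :: "'a::euclidean_space \<Rightarrow> complex" and g :: "'a \<Rightarrow> real"
  assumes f: "integrable lborel f" and g: "cc_smooth g"
  shows "(convolve f g has_derivative (\<lambda>v. convolve f (\<lambda>y. frechet_derivative g (at y) v) x)) (at x)"
proof -
  let ?D = "\<lambda>y. frechet_derivative g (at y)"
  have [measurable]: "f \<in> borel_measurable borel" "g \<in> borel_measurable borel"
    using f g by (auto intro: cc_smooth_measurable)
  have [measurable]: "(\<lambda>y. ?D y v) \<in> borel_measurable borel" for v
    by (rule cc_smooth_measurable[OF cc_smooth_derivative[OF g]])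
  obtain L where L: "L > 0" "\<And>x v. norm (?D x v) \<le> L * norm v"
    using cc_smooth_derivative_bounded[OF g] by blast
  obtain B where B: "B > 0" "\<And>x. norm (g x) \<le> B"
    using cc_smooth_bounded[OF g] by blast
  have ig: "integrable lborel (\<lambda>y. g (z - y) *\<^sub>R f y)" for z
    by (rule integrable_bounded_mult[OF f, of _ B]) (use B in auto)
  have iD: "integrable lborel (\<lambda>y. ?D (z - y) v *\<^sub>R f y)" for z v
    by (rule integrable_bounded_mult[OF f, of _ "L * norm v"]) (use L in auto)
  have lin: "linear (?D y)" for y
    using cc_smooth_has_derivative[OF g] has_derivative_linear by blast
  have swD: "convolve f (\<lambda>y. ?D y v) x = (LINT y|lborel. ?D (x - y) v *\<^sub>R f y)" for v
    by (rule convolve_swap) auto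
  have "linear (\<lambda>v. convolve f (\<lambda>y. ?D y v) x)"
  proof (rule linearI)
    show "convolve f (\<lambda>y. ?D y (v + w)) x = convolve f (\<lambda>y. ?D y v) x + convolve f (\<lambda>y. ?D y w) x" for v w
      unfolding swD by (simp add: linear_add[OF lin] scaleR_add_left iD)
    show "convolve f (\<lambda>y. ?D y (c *\<^sub>R v)) x = c *\<^sub>R convolve f (\<lambda>y. ?D y v) x" for c v
      unfolding swD by (simp add: linear_cmul[OF lin] scaleR_scaleR[symmetric] del: scaleR_scaleR)
  qed
  then have bl: "bounded_linear (\<lambda>v. convolve f (\<lambda>y. ?D y v) x)"
    by (simp add: linear_conv_bounded_linear)
  have "((\<lambda>h. norm (convolve f g (x + h) - convolve f g x - convolve f (\<lambda>y. ?D y h) x) / norm h) \<longlongrightarrow> 0) (at 0)"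
    unfolding tendsto_at_iff_sequentially o_def
  proof (intro allI impI)
    fix h :: "nat \<Rightarrow> 'a" assume h0: "\<forall>i. h i \<in> UNIV - {0}" and h: "h \<longlonglongrightarrow> 0"
    define R where "R k y = (g (x - y + h k) - g (x - y) - ?D (x - y) (h k)) / norm (h k)" for k y
    have [measurable]: "R k \<in> borel_measurable borel" for k
      unfolding R_def by measurable
    have Rb: "\<bar>R k y\<bar> \<le> 2 * L" for k y
    proof -
      have "\<bar>g (x - y + h k) - g (x - y)\<bar> \<le> L * norm (h k)"
        using cc_smooth_lipschitz[of g ?D L "x - y + h k" "x - y"] L cc_smooth_has_derivative[OF g] by simp
      moreover have "\<bar>?D (x - y) (h k)\<bar> \<le> L * norm (h k)" using L(2)[of "x - y" "h k"] by simp
      ultimately have "\<bar>g (x - y + h k) - g (x - y) - ?D (x - y) (h k)\<bar> \<le> 2 * L * norm (h k)" by linarith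
      then show ?thesis using h0 unfolding R_def by (simp add: divide_le_eq)
    qed
    have "(\<lambda>k. LINT y|lborel. R k y *\<^sub>R f y) \<longlonglongrightarrow> (LINT y|(lborel::'a measure). 0)"
    proof (rule integral_dominated_convergence[where w="\<lambda>y. 2 * L * norm (f y)"])
      show "AE y in lborel. (\<lambda>k. R k y *\<^sub>R f y) \<longlonglongrightarrow> 0"
      proof (intro AE_I2)
        fix y
        have "((\<lambda>h. norm (g (x - y + h) - g (x - y) - ?D (x - y) h) / norm h) \<longlongrightarrow> 0) (at 0)"
          using cc_smooth_has_derivative[OF g, of "x - y"] has_derivative_at by blast
        then have "(\<lambda>k. norm (g (x - y + h k) - g (x - y) - ?D (x - y) (h k)) / norm (h k)) \<longlonglongrightarrow> 0"
          using h0 h unfolding tendsto_at_iff_sequentially o_def by blast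
        then have "(\<lambda>k. \<bar>R k y\<bar>) \<longlonglongrightarrow> 0" by (simp add: R_def abs_divide)
        then have "(\<lambda>k. R k y) \<longlonglongrightarrow> 0" by (rule tendsto_rabs_zero_cancel)
        then show "(\<lambda>k. R k y *\<^sub>R f y) \<longlonglongrightarrow> 0" using tendsto_scaleR[OF _ tendsto_const] by fastforce
      qed
      show "AE y in lborel. norm (R k y *\<^sub>R f y) \<le> 2 * L * norm (f y)" for k
        using Rb by (intro AE_I2) (simp add: mult_right_mono)
    qed (use f L in auto)
    moreover have "norm (convolve f g (x + h k) - convolve f g x - convolve f (\<lambda>y. ?D y (h k)) x) / norm (h k)
       = norm (LINT y|lborel. R k y *\<^sub>R f y)" for k
    proof -
      have "(LINT y|lborel. R k y *\<^sub>R f y) = (LINT y|lborel. inverse (norm (h k)) *\<^sub>R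
         (g (x + h k - y) *\<^sub>R f y - g (x - y) *\<^sub>R f y - ?D (x - y) (h k) *\<^sub>R f y))"
      proof (rule Bochner_Integration.integral_cong[OF refl])
        fix y
        have "x + h k - y = x - y + h k" by simp
        then show "R k y *\<^sub>R f y = inverse (norm (h k)) *\<^sub>R
            (g (x + h k - y) *\<^sub>R f y - g (x - y) *\<^sub>R f y - ?D (x - y) (h k) *\<^sub>R f y)"
          by (simp only: R_def scaleR_diff_left[symmetric] scaleR_scaleR divide_inverse mult.commute)
      qed
      also have "\<dots> = inverse (norm (h k)) *\<^sub>R
         (convolve f g (x + h k) - convolve f g x - convolve f (\<lambda>y. ?D y (h k)) x)"
        using ig iD by (simp add: swD convolve_swap)
      finally show ?thesis by (simp add: divide_inverse mult.commute)
    qed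
    ultimately show "(\<lambda>k. norm (convolve f g (x + h k) - convolve f g x - convolve f (\<lambda>y. ?D y (h k)) x) / norm (h k)) \<longlonglongrightarrow> 0"
      using tendsto_norm_zero by simp
  qed
  then show ?thesis using bl by (simp add: has_derivative_at)
qed

text \<open>Every directional derivative of the convolution is again a convolution of
  \<open>f\<close>, with a derivative of \<open>g\<close>; induction on the order with
  \<open>g\<close> arbitrary.\<close>

lemma smooth_convolve:
  fixes f :: "'a::euclidean_space \<Rightarrow> complex"
  assumes f: "integrable lborel f" and g: "cc_smooth g"
  shows "smooth (convolve f g)"
proof -
  have "times_differentiable k (convolve f g)" for k
    using g
  proof (induction k arbitrary: g)
    case 0
    have "convolve f g differentiable (at x)" for x
      using convolve_has_derivative[OF f 0] differentiable_def by blast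
    then show ?case
      by (simp add: continuous_at_imp_continuous_on differentiable_imp_continuous_within)
  next
    case (Suc k)
    from times_differentiable_cong_has_derivative[OF convolve_has_derivative[OF f Suc.prems]]
    show ?case using Suc.IH[OF cc_smooth_derivative[OF Suc.prems]] by blast
  qed
  then show ?thesis by (simp add: smooth_def)
qed

lemma convolve_nonzero:
  assumes "convolve f g x \<noteq> 0"
  obtains y where "f (x - y) \<noteq> 0" "g y \<noteq> 0"
proof -
  have "\<not> (\<forall>y. g y *\<^sub>R f (x - y) = 0)"
  proof
    assume "\<forall>y. g y *\<^sub>R f (x - y) = 0"
    then have "convolve f g x = (LINT y|(lborel::'a measure). 0)" unfolding convolve_def by (simp only:)
    then show False using assms by simp
  qed
  then show ?thesis using that by auto
qed

section \<open>Mollifiers and smooth cut-offs\<close>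

lemma mollifier_exists:
  obtains g :: "nat \<Rightarrow> 'a::euclidean_space \<Rightarrow> real"
  where "\<And>k. cc_smooth (g k)" "\<And>k x. g k x \<ge> 0" "\<And>k. (\<integral>\<^sup>+x. ennreal (g k x) \<partial>lborel) = 1"
    "\<And>k x. g k x \<noteq> 0 \<Longrightarrow> norm x < inverse (real (Suc k))"
proof -
  have "\<exists>g::'a \<Rightarrow> real. cc_smooth g \<and> (\<forall>x. g x \<ge> 0) \<and> (\<integral>\<^sup>+x. ennreal (g x) \<partial>lborel) = 1 \<and>
     (\<forall>x. g x \<noteq> 0 \<longrightarrow> norm x < r)" if r: "r > 0" for r
  proof -
    obtain b :: "'a \<Rightarrow> real" where b: "smooth b" "\<And>x. b x \<ge> 0" "\<And>x. b x \<noteq> 0 \<longleftrightarrow> norm x < r"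
      using smooth_bump_exists[OF r] by blast
    have cb: "cc_smooth b"
      by (rule cc_smooth_compact(1)[OF b(1) compact_cball[of 0 r]]) (use b(3) in auto)
    have [measurable]: "b \<in> borel_measurable borel" by (rule cc_smooth_measurable[OF cb])
    define c where "c = (LINT x|lborel. b x)"
    have ib: "integrable lborel b" by (rule cc_smooth_integrable[OF cb])
    have nb: "(\<integral>\<^sup>+x. ennreal (b x) \<partial>lborel) = ennreal c"
      unfolding c_def by (rule nn_integral_eq_integral[OF ib]) (use b in auto)
    \<comment> \<open>Otherwise the bump would vanish almost everywhere, although it is nonzero on a
      ball of positive measure.\<close>
    have "c > 0"
    proof (rule ccontr)
      assume "\<not> c > 0"
      then have "AE x in lborel. b x \<le> 0"
        using nb by (simp add: nn_integral_0_iff_AE ennreal_neg ennreal_eq_0_iff)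
      then have "AE x in lborel. b x = 0"
        by (rule AE_mp) (use b(2) in \<open>auto intro!: AE_I2 antisym\<close>)
      then have "emeasure lborel (ball (0::'a) r) = 0"
      proof -
        have "ball (0::'a) r = {x \<in> space lborel. b x \<noteq> 0}" by (simp only: b(3)) (simp add: ball_def)
        then show ?thesis
          using emeasure_eq_0_AE[of "\<lambda>x. b x \<noteq> 0" lborel] \<open>AE x in lborel. b x = 0\<close> by simp
      qed
      then show False using r emeasure_ball[of r "0::'a"] unit_ball_vol_pos[of "real DIM('a)"]
        by (simp add: emeasure_lborel_ball_finite)
    qed
    have "(\<integral>\<^sup>+x. ennreal (b x / c) \<partial>lborel) = (\<integral>\<^sup>+x. ennreal (inverse c) * ennreal (b x) \<partial>lborel)"
      using \<open>c > 0\<close> b(2) by (intro nn_integral_cong) (simp add: ennreal_mult[symmetric] field_simps)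
    also have "\<dots> = 1"
      using \<open>c > 0\<close> by (simp add: nn_integral_cmult nb ennreal_mult[symmetric])
    finally have "(\<integral>\<^sup>+x. ennreal (b x / c) \<partial>lborel) = 1" .
    moreover have "cc_smooth (\<lambda>x. b x / c)"
      by (rule cc_smooth_linear_compose[OF bounded_linear_divide cb])
    ultimately show ?thesis using b \<open>c > 0\<close> by (intro exI[of _ "\<lambda>x. b x / c"]) auto
  qed
  then have "\<forall>k. \<exists>g::'a \<Rightarrow> real. cc_smooth g \<and> (\<forall>x. g x \<ge> 0) \<and> (\<integral>\<^sup>+x. ennreal (g x) \<partial>lborel) = 1 \<and>
     (\<forall>x. g x \<noteq> 0 \<longrightarrow> norm x < inverse (real (Suc k)))" by simp
  then obtain g :: "nat \<Rightarrow> 'a \<Rightarrow> real" where "\<And>k. cc_smooth (g k) \<and> (\<forall>x. g k x \<ge> 0) \<and>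
     (\<integral>\<^sup>+x. ennreal (g k x) \<partial>lborel) = 1 \<and> (\<forall>x. g k x \<noteq> 0 \<longrightarrow> norm x < inverse (real (Suc k)))"
    by metis
  then show ?thesis using that[of g] by blast
qed

lemma compact_neighbourhood: "compact K \<Longrightarrow> compact (\<Union>x\<in>K. cball x (r::real))"
  for K :: "'a::euclidean_space set"
proof -
  assume K: "compact K"
  have "(\<Union>x\<in>K. cball x r) = {x + y |x y. x \<in> K \<and> y \<in> cball 0 r}"
    by (force simp: dist_norm norm_minus_commute intro: exI[of _ "_ - _"])
  then show ?thesis using compact_sums[OF K compact_cball[of 0 r]] by simp
qed

text \<open>Mollify the indicator of the \<delta>/2-neighbourhood of K with a kernel of radius below
  \<delta>/4. The result is 1 on the \<delta>/4-neighbourhood V and supported in the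
  \<delta>-neighbourhood. The open set V is part of the conclusion so that the derivative of the
  cut-off vanishes on K as well.\<close>

lemma smooth_cutoff_exists:
  fixes K \<Omega> :: "'a::euclidean_space set"
  assumes "compact K" "open \<Omega>" "K \<subseteq> \<Omega>"
  obtains e V where "cc_smooth e" "closure {x. e x \<noteq> (0::real)} \<subseteq> \<Omega>" "\<And>x. 0 \<le> e x" "\<And>x. e x \<le> 1"
    "open V" "K \<subseteq> V" "V \<subseteq> \<Omega>" "\<And>x. x \<in> V \<Longrightarrow> e x = 1"
proof -
  obtain \<delta> where \<delta>: "\<delta> > 0" "(\<Union>x\<in>K. cball x \<delta>) \<subseteq> \<Omega>"
    using compact_subset_open_imp_cball_epsilon_subset[OF assms] by blast
  obtain g :: "nat \<Rightarrow> 'a \<Rightarrow> real" where g: "\<And>k. cc_smooth (g k)" "\<And>k x. g k x \<ge> 0"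
    "\<And>k. (\<integral>\<^sup>+x. ennreal (g k x) \<partial>lborel) = 1" "\<And>k x. g k x \<noteq> 0 \<Longrightarrow> norm x < inverse (real (Suc k))"
    using mollifier_exists by blast
  obtain k where k: "inverse (real (Suc k)) < \<delta> / 4" using reals_Archimedean[of "\<delta> / 4"] \<delta>(1) by auto
  define S where "S = (\<Union>x\<in>K. cball x (\<delta> / 2))"
  define V where "V = (\<Union>x\<in>K. ball x (\<delta> / 4))"
  have S: "compact S" unfolding S_def by (rule compact_neighbourhood[OF assms(1)])
  have [measurable]: "S \<in> sets borel" "g k \<in> borel_measurable borel"
    using S compact_imp_closed borel_closed cc_smooth_measurable[OF g(1)] by auto
  have gk: "integrable lborel (g k)" "(LINT y|lborel. g k y) = 1"
    using g(2,3) by (auto simp: integrable_iff_bounded integral_eq_nn_integral)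
  let ?f = "\<lambda>x. complex_of_real (indicator S x)"
  define e where "e x = Re (convolve ?f (g k) x)" for x
  have e_eq: "e x = (LINT y|lborel. g k y * indicator S (x - y))" for x
  proof -
    have "integrable lborel (\<lambda>y. g k y *\<^sub>R ?f (x - y))"
      by (rule Bochner_Integration.integrable_bound[OF gk(1)]) (auto simp: indicator_def)
    then show ?thesis unfolding e_def convolve_def by (subst integral_Re[symmetric]) auto
  qed
  have ie: "integrable lborel (\<lambda>y. g k y * indicator S (x - y))" for x
    by (rule Bochner_Integration.integrable_bound[OF gk(1)]) (auto simp: indicator_def)
  have "integrable lborel (indicator S :: 'a \<Rightarrow> real)"
    using emeasure_compact_finite[OF S] by (simp add: integrable_indicator_iff)
  then have "integrable lborel ?f" by simp
  then have "smooth e"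
    using smooth_linear_compose[OF bounded_linear_Re smooth_convolve[OF _ g(1)]] unfolding e_def by blast
  moreover have "x \<in> (\<Union>x\<in>K. cball x \<delta>)" if "e x \<noteq> 0" for x
  proof -
    have "convolve ?f (g k) x \<noteq> 0" using that by (auto simp: e_def)
    then obtain y where y: "?f (x - y) \<noteq> 0" "g k y \<noteq> 0" using convolve_nonzero by blast
    then obtain z where "z \<in> K" "dist z (x - y) \<le> \<delta> / 2"
      by (auto simp: S_def indicator_def split: if_splits)
    moreover have "dist (x - y) x < \<delta> / 4" using g(4)[OF y(2)] k by (simp add: dist_norm)
    ultimately have "dist z x \<le> \<delta>"
      using dist_triangle[of z x "x - y"] \<delta>(1) by linarith
    then show ?thesis using \<open>z \<in> K\<close> by auto
  qed
  ultimately have e1: "cc_smooth e" "closure {x. e x \<noteq> 0} \<subseteq> (\<Union>x\<in>K. cball x \<delta>)"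
    using cc_smooth_compact[OF _ compact_neighbourhood[OF assms(1)]] by blast+
  show ?thesis
  proof (rule that[of e V])
    show "0 \<le> e x" for x unfolding e_eq using g(2) by (intro integral_nonneg_AE) auto
    show "e x \<le> 1" for x
      unfolding e_eq gk(2)[symmetric] using g(2) ie gk(1)
      by (intro integral_mono) (auto simp: indicator_def)
    show "e x = 1" if xV: "x \<in> V" for x
    proof -
      have "g k y * indicator S (x - y) = g k y" for y
      proof (cases "g k y = 0")
        case False
        obtain z where z: "z \<in> K" "dist z x < \<delta> / 4" using xV by (auto simp: V_def dist_commute)
        have "dist x (x - y) < \<delta> / 4" using g(4)[OF False] k by (simp add: dist_norm)
        then have "dist z (x - y) \<le> \<delta> / 2" using z dist_triangle[of z "x - y" x] by linarith
        then have "x - y \<in> S" using z(1) by (auto simp: S_def)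
        then show ?thesis by simp
      qed simp
      then show ?thesis unfolding e_eq using gk(2) by (simp only:)
    qed
    show "K \<subseteq> V" unfolding V_def using \<delta>(1) by auto
    show "V \<subseteq> \<Omega>" using \<delta> unfolding V_def by fastforce
  qed (use e1 \<delta>(2) in \<open>auto simp: V_def\<close>)
qed


section \<open>Friedrichs' lemma and the du Bois-Reymond lemma\<close>

text \<open>The function y -> g (x - y) is the test function that turns a convolution into a weak
  pairing; the reflection produces the sign.\<close>

lemma partial_complex_of_real:
  assumes "cc_smooth g"
  shows "partial i (\<lambda>y. complex_of_real (g (x - y))) y = - complex_of_real (frechet_derivative g (at (x - y)) (axis i 1))"
proof -
  have "((\<lambda>y. x - y) has_derivative (\<lambda>v. - v)) (at y)"
    using has_derivative_diff[OF has_derivative_const has_derivative_ident] by simp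
  from has_derivative_compose[OF this cc_smooth_has_derivative[OF assms]]
  have "((\<lambda>y. g (x - y)) has_derivative (\<lambda>v. frechet_derivative g (at (x - y)) (- v))) (at y)" .
  from bounded_linear.has_derivative[OF bounded_linear_of_real this]
  have "((\<lambda>y. complex_of_real (g (x - y))) has_derivative
     (\<lambda>v. complex_of_real (frechet_derivative g (at (x - y)) (- v)))) (at y)" .
  from frechet_derivative_at[OF this]
  have "partial i (\<lambda>y. complex_of_real (g (x - y))) y = complex_of_real (frechet_derivative g (at (x - y)) (- axis i 1))"
    unfolding partial_def by metis
  moreover have "linear (frechet_derivative g (at (x - y)))"
    using cc_smooth_has_derivative[OF assms] has_derivative_linear by blast
  ultimately show ?thesis by (simp add: linear_neg)
qed

text \<open>Mollification commutes with weak differentiation: the derivative first falls on the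
  kernel, which is then used as a test function to move it to \<open>f\<close>.\<close>

lemma partial_convolve:
  fixes f G :: "real ^ 'n \<Rightarrow> complex"
  assumes f: "integrable lborel f" and [measurable]: "G \<in> borel_measurable borel" and g: "cc_smooth g"
    and weak: "\<And>\<phi>. \<phi> \<in> test_functions UNIV \<Longrightarrow>
      (LINT x|lborel. f x * partial i \<phi> x) = - (LINT x|lborel. G x * \<phi> x)"
  shows "partial i (convolve f g) x = convolve G g x"
proof -
  have [measurable]: "f \<in> borel_measurable borel" "g \<in> borel_measurable borel"
    "(\<lambda>y. frechet_derivative g (at y) (axis i 1)) \<in> borel_measurable borel"
    using f cc_smooth_measurable[OF g] cc_smooth_measurable[OF cc_smooth_derivative[OF g]] by auto
  have "partial i (convolve f g) x = convolve f (\<lambda>y. frechet_derivative g (at y) (axis i 1)) x"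
    unfolding partial_def using frechet_derivative_at[OF convolve_has_derivative[OF f g]] by metis
  also have "\<dots> = (LINT y|lborel. frechet_derivative g (at (x - y)) (axis i 1) *\<^sub>R f y)"
    by (rule convolve_swap) auto
  also have "\<dots> = - (LINT y|lborel. f y * partial i (\<lambda>y. complex_of_real (g (x - y))) y)"
    unfolding partial_complex_of_real[OF g] by (simp add: scaleR_conv_of_real mult.commute)
  also have "\<dots> = (LINT y|lborel. G y * complex_of_real (g (x - y)))"
    by (subst weak) (auto simp: test_functions_UNIV intro!: cc_smooth_linear_compose[OF bounded_linear_of_real]
        cc_smooth_reflect g)
  also have "\<dots> = convolve G g x"
    by (subst convolve_swap) (auto simp: scaleR_conv_of_real mult.commute)
  finally show ?thesis .
qed

text \<open>On the compact set |f| <= 1 + |f|^2.\<close>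

lemma integrable_of_square:
  fixes f :: "'a::euclidean_space \<Rightarrow> complex"
  assumes [measurable]: "f \<in> borel_measurable borel" and f2: "integrable lborel (\<lambda>x. (cmod (f x))\<^sup>2)"
    and K: "compact K" "\<And>x. x \<notin> K \<Longrightarrow> f x = 0"
  shows "integrable lborel f"
proof (rule Bochner_Integration.integrable_bound[of _ "\<lambda>x. indicator K x + (cmod (f x))\<^sup>2"])
  show "integrable lborel (\<lambda>x. indicator K x + (cmod (f x))\<^sup>2)"
    using emeasure_compact_finite[OF K(1)] borel_compact[OF K(1)] f2 by (simp add: integrable_indicator_iff)
  have "cmod (f x) \<le> 1 + (cmod (f x))\<^sup>2" for x
    using sum_squares_bound[of "cmod (f x)" 1] norm_ge_zero[of "f x"] by (simp add: power2_eq_square del: norm_ge_zero)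
  then show "AE x in lborel. norm (f x) \<le> norm (indicator K x + (cmod (f x))\<^sup>2 :: real)"
    using K(2) by (intro AE_I2) (auto simp: indicator_def)
qed simp

text \<open>Since mollification commutes with the weak derivatives, the mollified functions converge
  together with their gradients in L^2. A compactly supported f stays supported in \<Omega> for
  small kernels, so the approximants are test functions on \<Omega>.\<close>

lemma friedrichs:
  fixes f :: "real ^ 'n \<Rightarrow> complex" and G :: "'n \<Rightarrow> real ^ 'n \<Rightarrow> complex"
  assumes [measurable]: "f \<in> borel_measurable borel" "\<And>i. G i \<in> borel_measurable borel"
    and f2: "integrable lborel (\<lambda>x. (cmod (f x))\<^sup>2)" and G2: "\<And>i. integrable lborel (\<lambda>x. (cmod (G i x))\<^sup>2)"
    and K: "compact K" "K \<subseteq> \<Omega>" "open \<Omega>" "\<And>x. x \<notin> K \<Longrightarrow> f x = 0"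
    and weak: "\<And>i \<phi>. \<phi> \<in> test_functions UNIV \<Longrightarrow>
      (LINT x|lborel. f x * partial i \<phi> x) = - (LINT x|lborel. G i x * \<phi> x)"
  obtains \<psi> where "\<And>k::nat. \<psi> k \<in> test_functions \<Omega>"
    "(\<lambda>k. \<integral>\<^sup>+x. ennreal ((cmod (\<psi> k x - f x))\<^sup>2) \<partial>lborel) \<longlonglongrightarrow> 0"
    "\<And>i. (\<lambda>k. \<integral>\<^sup>+x. ennreal ((cmod (partial i (\<psi> k) x - G i x))\<^sup>2) \<partial>lborel) \<longlonglongrightarrow> 0"
proof -
  have f: "integrable lborel f"
    by (rule integrable_of_square[OF _ f2 K(1,4)]) auto
  obtain \<delta> where \<delta>: "\<delta> > 0" "(\<Union>x\<in>K. cball x \<delta>) \<subseteq> \<Omega>"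
    using compact_subset_open_imp_cball_epsilon_subset[OF K(1,3,2)] by blast
  obtain g :: "nat \<Rightarrow> real ^ 'n \<Rightarrow> real" where g: "\<And>k. cc_smooth (g k)" "\<And>k x. g k x \<ge> 0"
    "\<And>k. (\<integral>\<^sup>+x. ennreal (g k x) \<partial>lborel) = 1" "\<And>k x. g k x \<noteq> 0 \<Longrightarrow> norm x < inverse (real (Suc k))"
    using mollifier_exists by blast
  \<comment> \<open>The first N kernels are skipped; the others move the support by less than
    \<delta>, hence within \<Omega>.\<close>
  obtain N where N: "inverse (real (Suc N)) < \<delta>" using reals_Archimedean[OF \<delta>(1)] by auto
  define h where "h k = g (k + N)" for k
  have h: "\<And>k. cc_smooth (h k)" "\<And>k x. h k x \<ge> 0" "\<And>k. (\<integral>\<^sup>+x. ennreal (h k x) \<partial>lborel) = 1"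
    "\<And>k x. h k x \<noteq> 0 \<Longrightarrow> norm x < inverse (real (Suc (k + N)))"
    unfolding h_def using g by blast+
  have [measurable]: "\<And>k. h k \<in> borel_measurable borel" by (rule cc_smooth_measurable[OF h(1)])
  have r: "(\<lambda>k. inverse (real (Suc (k + N)))) \<longlonglongrightarrow> 0"
    using LIMSEQ_ignore_initial_segment[OF LIMSEQ_inverse_real_of_nat, of N] by simp
  define \<psi> where "\<psi> k = convolve f (h k)" for k
  have "\<psi> k \<in> test_functions \<Omega>" for k
  proof -
    have "x \<in> (\<Union>x\<in>K. cball x \<delta>)" if nz: "\<psi> k x \<noteq> 0" for x
    proof -
      obtain y where y: "f (x - y) \<noteq> 0" "h k y \<noteq> 0" using convolve_nonzero nz unfolding \<psi>_def by blast
      have "norm y < inverse (real (Suc (k + N)))" using h(4)[OF y(2)] .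
      also have "\<dots> \<le> inverse (real (Suc N))" by (intro le_imp_inverse_le) auto
      finally have "norm y \<le> \<delta>" using N by linarith
      moreover have "x - y \<in> K" using y(1) K(4) by blast
      ultimately show ?thesis by (intro UN_I[of "x - y"]) (auto simp: dist_norm)
    qed
    moreover have "smooth (\<psi> k)" unfolding \<psi>_def by (rule smooth_convolve[OF f h(1)])
    ultimately show ?thesis
      using cc_smooth_compact[OF _ compact_neighbourhood[OF K(1), of \<delta>], of "\<psi> k"] \<delta>(2)
      by (auto simp: test_functions_iff)
  qed
  moreover have "(\<lambda>k. \<integral>\<^sup>+x. ennreal ((cmod (\<psi> k x - f x))\<^sup>2) \<partial>lborel) \<longlonglongrightarrow> 0"
    unfolding \<psi>_def by (rule convolve_L2_tendsto[OF _ f2 _ h(2,3,4) r]) auto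
  moreover have "(\<lambda>k. \<integral>\<^sup>+x. ennreal ((cmod (partial i (\<psi> k) x - G i x))\<^sup>2) \<partial>lborel) \<longlonglongrightarrow> 0" for i
  proof -
    have "partial i (\<psi> k) x = convolve (G i) (h k) x" for k x
      unfolding \<psi>_def by (rule partial_convolve[OF f _ h(1) weak]) auto
    moreover have "(\<lambda>k. \<integral>\<^sup>+x. ennreal ((cmod (convolve (G i) (h k) x - G i x))\<^sup>2) \<partial>lborel) \<longlonglongrightarrow> 0"
      by (rule convolve_L2_tendsto[OF _ G2 _ h(2,3,4) r]) auto
    ultimately show ?thesis by simp
  qed
  ultimately show ?thesis using that by blast
qed

lemma completion_ex_borel_complex:
  fixes f :: "'a::euclidean_space \<Rightarrow> complex"
  assumes "f \<in> borel_measurable lebesgue"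
  obtains g where "g \<in> borel_measurable borel" "AE x in lebesgue. f x = g x" "AE x in lborel. f x = g x"
proof -
  have "(\<lambda>x. Re (f x)) \<in> borel_measurable lebesgue" "(\<lambda>x. Im (f x)) \<in> borel_measurable lebesgue"
    using assms by simp_all
  then obtain a b where ab: "a \<in> borel_measurable lborel" "AE x in lborel. Re (f x) = a x"
    "b \<in> borel_measurable lborel" "AE x in lborel. Im (f x) = b x"
    using completion_ex_borel_measurable_real[of "\<lambda>x. Re (f x)" lborel]
      completion_ex_borel_measurable_real[of "\<lambda>x. Im (f x)" lborel] by blast
  let ?g = "\<lambda>x. Complex (a x) (b x)"
  have "?g = (\<lambda>x. complex_of_real (a x) + \<i> * complex_of_real (b x))"
    by (simp add: Complex_eq)
  then have g: "?g \<in> borel_measurable borel" using ab by simp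
  have ae: "AE x in lborel. f x = ?g x" using ab(2,4) by eventually_elim (simp add: complex_eq_iff)
  moreover have "AE x in lebesgue. f x = ?g x" using ae AE_completion by blast
  ultimately show ?thesis using g that by blast
qed

section \<open>The fundamental lemma of the calculus of variations\<close>

text \<open>A locally integrable function that annihilates all test functions vanishes: its product with a
  cut-off is the $L^1$ limit of its mollifications, which vanish identically.\<close>

lemma du_Bois_Reymond_cutoff:
  fixes f :: "real ^ 'n \<Rightarrow> complex"
  assumes [measurable]: "f \<in> borel_measurable borel" and f: "integrable lborel (\<lambda>x. e x *\<^sub>R f x)" and e: "cc_smooth e"
    and supp: "closure {x. e x \<noteq> (0::real)} \<subseteq> \<Omega>"
    and weak: "\<And>\<phi>. \<phi> \<in> test_functions \<Omega> \<Longrightarrow> (LINT x|lborel. f x * \<phi> x) = 0"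
  shows "AE x in lborel. e x *\<^sub>R f x = 0"
proof -
  let ?F = "\<lambda>x. e x *\<^sub>R f x"
  have [measurable]: "e \<in> borel_measurable borel" by (rule cc_smooth_measurable[OF e])
  obtain g :: "nat \<Rightarrow> real ^ 'n \<Rightarrow> real" where g: "\<And>k. cc_smooth (g k)" "\<And>k x. g k x \<ge> 0"
    "\<And>k. (\<integral>\<^sup>+x. ennreal (g k x) \<partial>lborel) = 1" "\<And>k x. g k x \<noteq> 0 \<Longrightarrow> norm x < inverse (real (Suc k))"
    using mollifier_exists by blast
  have [measurable]: "\<And>k. g k \<in> borel_measurable borel" by (rule cc_smooth_measurable[OF g(1)])
  have "convolve ?F (g k) x = 0" for k x
  proof -
    have "convolve ?F (g k) x = (LINT y|lborel. g k (x - y) *\<^sub>R ?F y)"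
      by (rule convolve_swap) auto
    also have "\<dots> = (LINT y|lborel. f y * complex_of_real (e y * g k (x - y)))"
      by (rule Bochner_Integration.integral_cong) (auto simp: scaleR_conv_of_real)
    also have "\<dots> = 0"
    proof (rule weak)
      have "cc_smooth (\<lambda>y. e y * g k (x - y))"
        by (rule cc_smooth_bilinear1[OF bounded_bilinear_mult e])
           (rule cc_smooth_smooth[OF cc_smooth_reflect[OF g(1)]])
      then have "cc_smooth (\<lambda>y. complex_of_real (e y * g k (x - y)))"
        by (rule cc_smooth_linear_compose[OF bounded_linear_of_real])
      moreover have "closure {y. complex_of_real (e y * g k (x - y)) \<noteq> 0} \<subseteq> closure {y. e y \<noteq> 0}"
        by (intro closure_mono) auto
      ultimately show "(\<lambda>y. complex_of_real (e y * g k (x - y))) \<in> test_functions \<Omega>"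
        using supp by (auto simp: test_functions_iff)
    qed
    finally show ?thesis .
  qed
  then have "(\<integral>\<^sup>+x. ennreal (cmod (convolve ?F (g k) x - ?F x)) \<partial>lborel) = (\<integral>\<^sup>+x. ennreal (cmod (?F x)) \<partial>lborel)" for k
    by simp
  with convolve_L1_tendsto[OF f _ g(2,3,4) LIMSEQ_inverse_real_of_nat]
  have "(\<lambda>k::nat. \<integral>\<^sup>+x. ennreal (cmod (?F x)) \<partial>lborel) \<longlonglongrightarrow> 0" by simp
  then have "(\<integral>\<^sup>+x. ennreal (cmod (?F x)) \<partial>lborel) = 0" by (simp add: LIMSEQ_const_iff)
  then have "AE x in lborel. ennreal (cmod (?F x)) = 0" by (subst (asm) nn_integral_0_iff_AE) auto
  then show ?thesis by eventually_elim (simp only: ennreal_eq_0_iff norm_le_zero_iff)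
qed

text \<open>Cut-offs give every point of \<Omega> a neighbourhood on which f vanishes almost
  everywhere. By Lindelof countably many such sets suffice, so the exceptional null sets add up to a
  null set.\<close>

lemma du_Bois_Reymond:
  fixes f :: "real ^ 'n \<Rightarrow> complex"
  assumes [measurable]: "f \<in> borel_measurable borel" and \<Omega>: "open \<Omega>"
    and loc: "\<And>K. compact K \<Longrightarrow> K \<subseteq> \<Omega> \<Longrightarrow> set_integrable lborel K f"
    and weak: "\<And>\<phi>. \<phi> \<in> test_functions \<Omega> \<Longrightarrow> (LINT x|lborel. f x * \<phi> x) = 0"
  shows "AE x in lborel. x \<in> \<Omega> \<longrightarrow> f x = 0"
proof -
  have ball: "\<exists>D. open D \<and> x \<in> D \<and> (AE y in lborel. y \<in> D \<longrightarrow> f y = 0)" if "x \<in> \<Omega>" for x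
  proof -
    obtain e V where e: "cc_smooth e" "closure {x. e x \<noteq> (0::real)} \<subseteq> \<Omega>" "\<And>x. 0 \<le> e x" "\<And>x. e x \<le> 1"
      "open V" "{x} \<subseteq> V" "V \<subseteq> \<Omega>" "\<And>x. x \<in> V \<Longrightarrow> e x = 1"
      using smooth_cutoff_exists[of "{x}" \<Omega>] \<Omega> \<open>x \<in> \<Omega>\<close> by auto
    have [measurable]: "e \<in> borel_measurable borel" by (rule cc_smooth_measurable[OF e(1)])
    let ?K = "closure {x. e x \<noteq> 0}"
    have K: "compact ?K" using e(1) by (simp add: cc_smooth_def)
    have ef: "integrable lborel (\<lambda>x. e x *\<^sub>R f x)"
    proof (rule Bochner_Integration.integrable_bound)
      show "integrable lborel (\<lambda>x. indicator ?K x *\<^sub>R f x)"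
        using loc[OF K e(2)] by (simp add: set_integrable_def)
      have "e x \<noteq> 0 \<Longrightarrow> x \<in> ?K" for x using closure_subset[of "{x. e x \<noteq> 0}"] by auto
      then have "\<bar>e x\<bar> \<le> indicator ?K x" for x
        using e(3)[of x] e(4)[of x] by (cases "e x = 0") auto
      then show "AE x in lborel. norm (e x *\<^sub>R f x) \<le> norm (indicator ?K x *\<^sub>R f x)"
        by (intro AE_I2) (simp add: mult_right_mono)
    qed simp
    have "AE x in lborel. e x *\<^sub>R f x = 0"
      by (rule du_Bois_Reymond_cutoff[OF _ ef e(1,2) weak]) auto
    then have "AE y in lborel. y \<in> V \<longrightarrow> f y = 0"
      by eventually_elim (use e(8) in auto)
    then show ?thesis using e(5,6) by auto
  qed
  define \<D> where "\<D> = {D. open D \<and> (AE y in lborel. y \<in> D \<longrightarrow> f y = 0)}"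
  obtain \<F> where \<F>: "\<F> \<subseteq> \<D>" "countable \<F>" "\<Union>\<F> = \<Union>\<D>"
    using Lindelof[of \<D>] unfolding \<D>_def by blast
  have "AE y in lborel. \<forall>D\<in>\<F>. y \<in> D \<longrightarrow> f y = 0"
    using \<F>(1) by (subst AE_ball_countable[OF \<F>(2)]) (auto simp: \<D>_def)
  then show ?thesis
  proof eventually_elim
    case (elim y)
    show ?case
    proof
      assume "y \<in> \<Omega>"
      then have "y \<in> \<Union>\<D>" using ball[of y] unfolding \<D>_def by blast
      then show "f y = 0" using elim \<F>(3) by blast
    qed
  qed
qed


section \<open>Translations and gradients\<close>

lemma FTC_abs_le:
  fixes F F' :: "real \<Rightarrow> real"
  assumes "a \<le> b" "\<And>t. DERIV F t :> F' t" "\<And>t. isCont F' t"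
  shows "ennreal \<bar>F b - F a\<bar> \<le> (\<integral>\<^sup>+t. ennreal \<bar>F' t\<bar> * indicator {a..b} t \<partial>lborel)"
proof -
  have h: "has_bochner_integral lborel (\<lambda>t. F' t * indicator {a..b} t) (F b - F a)"
    by (rule has_bochner_integral_FTC_Icc_real) (use assms in auto)
  then have "ennreal (norm (F b - F a)) \<le> (\<integral>\<^sup>+t. ennreal (norm (F' t * indicator {a..b} t)) \<partial>lborel)"
    using integral_norm_bound_ennreal[of lborel "\<lambda>t. F' t * indicator {a..b} t"]
    by (simp add: has_bochner_integral_iff)
  also have "\<dots> = (\<integral>\<^sup>+t. ennreal \<bar>F' t\<bar> * indicator {a..b} t \<partial>lborel)"
    by (intro nn_integral_cong) (auto simp: indicator_def)
  finally show ?thesis by simp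
qed

lemma DERIV_along_line:
  fixes f :: "'a::euclidean_space \<Rightarrow> real"
  assumes "\<And>x. (f has_derivative D x) (at x)"
  shows "((\<lambda>t. f (x + t *\<^sub>R y)) has_field_derivative D (x + t *\<^sub>R y) y) (at t)"
proof -
  have "((\<lambda>t. x + t *\<^sub>R y) has_derivative (\<lambda>h. h *\<^sub>R y)) (at t)"
    by (auto intro!: derivative_eq_intros)
  from has_derivative_compose[OF this assms]
  have "((\<lambda>t. f (x + t *\<^sub>R y)) has_derivative (\<lambda>h. D (x + t *\<^sub>R y) (h *\<^sub>R y))) (at t)" .
  moreover have "D z (h *\<^sub>R y) = D z y * h" for z h
    using has_derivative_linear[OF assms] by (simp add: linear_cmul)
  ultimately show ?thesis by (simp add: has_field_derivative_def)
qed

text \<open>Fundamental theorem of calculus along the segment from x to x + y, then Tonelli: for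
  each fixed t the shifted integral of the derivative is the unshifted one.\<close>

lemma L1_translation_gradient:
  fixes f :: "'a::euclidean_space \<Rightarrow> real"
  assumes f: "\<And>x. (f has_derivative D x) (at x)" and cont: "continuous_on UNIV (\<lambda>x. D x y)"
  shows "(\<integral>\<^sup>+x. ennreal \<bar>f (x + y) - f x\<bar> \<partial>lborel) \<le> (\<integral>\<^sup>+x. ennreal \<bar>D x y\<bar> \<partial>lborel)"
proof -
  have [measurable]: "(\<lambda>x. D x y) \<in> borel_measurable borel"
    by (rule borel_measurable_continuous_onI[OF cont])
  have "continuous_on UNIV (\<lambda>t. D (x + t *\<^sub>R y) y)" for x
    by (rule continuous_on_compose2[OF cont]) (intro continuous_intros, simp)
  then have "isCont (\<lambda>t. D (x + t *\<^sub>R y) y) t" for x t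
    by (simp add: continuous_on_eq_continuous_at)
  then have "ennreal \<bar>f (x + y) - f x\<bar> \<le> (\<integral>\<^sup>+t. ennreal \<bar>D (x + t *\<^sub>R y) y\<bar> * indicator {0..1} t \<partial>lborel)" for x
    using FTC_abs_le[of 0 1 "\<lambda>t. f (x + t *\<^sub>R y)" "\<lambda>t. D (x + t *\<^sub>R y) y"] DERIV_along_line[OF f]
    by simp
  then have "(\<integral>\<^sup>+x. ennreal \<bar>f (x + y) - f x\<bar> \<partial>lborel)
    \<le> (\<integral>\<^sup>+x. (\<integral>\<^sup>+t. ennreal \<bar>D (x + t *\<^sub>R y) y\<bar> * indicator {0..1} t \<partial>lborel) \<partial>lborel)"
    by (intro nn_integral_mono)
  also have "\<dots> = (\<integral>\<^sup>+t. (\<integral>\<^sup>+x. ennreal \<bar>D (x + t *\<^sub>R y) y\<bar> * indicator {0..1} t \<partial>lborel) \<partial>(lborel::real measure))"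
    by (rule lborel_pair.Fubini') measurable
  also have "\<dots> = (\<integral>\<^sup>+t. (\<integral>\<^sup>+x. ennreal \<bar>D x y\<bar> \<partial>lborel) * indicator {0..1} t \<partial>(lborel::real measure))"
  proof (rule nn_integral_cong)
    fix t :: real
    have "(\<integral>\<^sup>+x. ennreal \<bar>D (x + t *\<^sub>R y) y\<bar> \<partial>lborel) = (\<integral>\<^sup>+x. ennreal \<bar>D x y\<bar> \<partial>lborel)"
      by (rule nn_integral_lborel_shift[of "\<lambda>x. ennreal \<bar>D x y\<bar>"]) simp
    then show "(\<integral>\<^sup>+x. ennreal \<bar>D (x + t *\<^sub>R y) y\<bar> * indicator {0..1} t \<partial>lborel)
       = (\<integral>\<^sup>+x. ennreal \<bar>D x y\<bar> \<partial>lborel) * indicator {0..1} t"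
      by (subst nn_integral_multc) auto
  qed
  also have "\<dots> = (\<integral>\<^sup>+x. ennreal \<bar>D x y\<bar> \<partial>lborel)"
    by (subst nn_integral_cmult_indicator) auto
  finally show ?thesis .
qed

text \<open>A Poincare inequality by averaging over translations. As f lives on E, f(x) <= 1_E(x)
  f(x + y) + |f(x + y) - f(x)|. Integrating over x and over y in B bounds |B| times the integral of
  f by |E| times that integral plus |B| D. Since 2 |E| <= |B| and the integral is finite, the first
  term is absorbed.\<close>

lemma Faber_Krahn_L1:
  fixes f :: "'a::euclidean_space \<Rightarrow> real"
  assumes [measurable]: "f \<in> borel_measurable borel" "E \<in> sets borel" "B \<in> sets borel"
    and f: "\<And>x. f x \<ge> 0" "\<And>x. x \<notin> E \<Longrightarrow> f x = 0" "(\<integral>\<^sup>+x. ennreal (f x) \<partial>lborel) < \<infinity>"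
    and B: "0 < emeasure lborel B" "emeasure lborel B < \<infinity>" "2 * emeasure lborel E \<le> emeasure lborel B"
    and D: "\<And>y. y \<in> B \<Longrightarrow> (\<integral>\<^sup>+x. ennreal \<bar>f (x + y) - f x\<bar> \<partial>lborel) \<le> D"
  shows "(\<integral>\<^sup>+x. ennreal (f x) \<partial>lborel) \<le> 2 * D"
proof -
  let ?I = "\<integral>\<^sup>+x. ennreal (f x) \<partial>lborel"
  \<comment> \<open>The restriction to y in \<open>B\<close> is dropped in the first term, so that
    its integral over all y is the full integral of \<open>f\<close> by translation
    invariance.\<close>
  have y: "?I * indicator B y \<le> (\<integral>\<^sup>+x. indicator E x * ennreal (f (x + y)) \<partial>lborel) + D * indicator B y" for y
  proof (cases "y \<in> B")
    case True
    have "?I \<le> (\<integral>\<^sup>+x. indicator E x * ennreal (f (x + y)) + ennreal \<bar>f (x + y) - f x\<bar> \<partial>lborel)"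
    proof (rule nn_integral_mono)
      fix x
      show "ennreal (f x) \<le> indicator E x * ennreal (f (x + y)) + ennreal \<bar>f (x + y) - f x\<bar>"
      proof (cases "x \<in> E")
        case True
        have "f x \<le> f (x + y) + \<bar>f (x + y) - f x\<bar>" by linarith
        then have "ennreal (f x) \<le> ennreal (f (x + y) + \<bar>f (x + y) - f x\<bar>)" by (rule ennreal_leI)
        then show ?thesis using True f(1)[of "x + y"] by simp
      qed (use f(2) in simp)
    qed
    also have "\<dots> = (\<integral>\<^sup>+x. indicator E x * ennreal (f (x + y)) \<partial>lborel) + (\<integral>\<^sup>+x. ennreal \<bar>f (x + y) - f x\<bar> \<partial>lborel)"
      by (rule nn_integral_add) auto
    also have "\<dots> \<le> (\<integral>\<^sup>+x. indicator E x * ennreal (f (x + y)) \<partial>lborel) + D"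
      by (intro add_left_mono D True)
    finally show ?thesis using True by simp
  qed simp
  have "?I * emeasure lborel B = (\<integral>\<^sup>+y. ?I * indicator B y \<partial>lborel)"
    by (subst nn_integral_cmult_indicator) auto
  also have "\<dots> \<le> (\<integral>\<^sup>+y. (\<integral>\<^sup>+x. indicator E x * ennreal (f (x + y)) \<partial>lborel) + D * indicator B y \<partial>lborel)"
    by (intro nn_integral_mono y)
  also have "\<dots> = (\<integral>\<^sup>+y. (\<integral>\<^sup>+x. indicator E x * ennreal (f (x + y)) \<partial>lborel) \<partial>lborel) + D * emeasure lborel B"
    by (subst nn_integral_add) (auto simp: nn_integral_cmult_indicator)
  also have "(\<integral>\<^sup>+y. (\<integral>\<^sup>+x. indicator E x * ennreal (f (x + y)) \<partial>lborel) \<partial>lborel) =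
      (\<integral>\<^sup>+x. (\<integral>\<^sup>+y. indicator E x * ennreal (f (x + y)) \<partial>lborel) \<partial>lborel)"
    by (rule lborel_pair.Fubini') measurable
  also have "\<dots> = (\<integral>\<^sup>+x. ?I * indicator E x \<partial>lborel)"
  proof (rule nn_integral_cong)
    fix x
    have "(\<integral>\<^sup>+y. ennreal (f (y + x)) \<partial>lborel) = ?I"
      by (rule nn_integral_lborel_shift[of "\<lambda>x. ennreal (f x)"]) simp
    then show "(\<integral>\<^sup>+y. indicator E x * ennreal (f (x + y)) \<partial>lborel) = ?I * indicator E x"
      by (simp add: nn_integral_cmult add.commute mult.commute)
  qed
  also have "\<dots> = ?I * emeasure lborel E"
    by (subst nn_integral_cmult_indicator) auto
  finally have main: "?I * emeasure lborel B \<le> ?I * emeasure lborel E + D * emeasure lborel B" .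
  show ?thesis
  proof (cases "D = \<infinity>")
    case False
    have "emeasure lborel E < \<infinity>"
    proof -
      have "emeasure lborel E \<le> 2 * emeasure lborel E" by (simp add: mult_2)
      then show ?thesis using B(2,3) by (meson order.strict_trans1)
    qed
    then obtain i e b d where r: "?I = ennreal i" "emeasure lborel E = ennreal e" "emeasure lborel B = ennreal b" "D = ennreal d"
      "i \<ge> 0" "e \<ge> 0" "b \<ge> 0" "d \<ge> 0"
      using f(3) B(2) False by (metis ennreal_cases infinity_ennreal_def less_irrefl)
    have "b > 0" using B(1) r by (simp add: ennreal_less_zero_iff)
    have "2 * e \<le> b" using B(3) r by (simp add: ennreal_mult[symmetric] ennreal_numeral[symmetric] del: ennreal_numeral)
    have "i * b \<le> i * e + d * b" using main r by (simp add: ennreal_mult[symmetric] ennreal_plus[symmetric] del: ennreal_plus)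
    moreover have "i * (2 * e) \<le> i * b" using \<open>2 * e \<le> b\<close> r(5) by (rule mult_left_mono)
    ultimately have "i * b \<le> (2 * d) * b" by (simp add: algebra_simps)
    then have "i \<le> 2 * d" using \<open>b > 0\<close> by simp
    then show ?thesis unfolding r(1,4) using r(8)
      by (simp add: ennreal_mult[symmetric] ennreal_numeral[symmetric] del: ennreal_numeral)
  qed (simp add: ennreal_mult_eq_top_iff)
qed

section \<open>Sobolev's inequality with a weight in $L^{d/2}$\<close>

text \<open>The squared L^2 norm, with values in \<open>ennreal\<close> so that estimates can be
  chained without integrability side conditions.\<close>

definition sq_norm :: "('a::euclidean_space \<Rightarrow> complex) \<Rightarrow> ennreal" where
  "sq_norm f = (\<integral>\<^sup>+x. ennreal ((cmod (f x))\<^sup>2) \<partial>lborel)"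

definition grad_sq :: "(real ^ 'n \<Rightarrow> complex) \<Rightarrow> real ^ 'n \<Rightarrow> real" where
  "grad_sq u x = (\<Sum>i\<in>UNIV. (cmod (partial i u x))\<^sup>2)"

lemma grad_sq_nonneg [simp]: "grad_sq u x \<ge> 0"
  by (simp add: grad_sq_def sum_nonneg)

lemma partial_cc_smooth: "cc_smooth u \<Longrightarrow> cc_smooth (partial i u)"
  unfolding partial_def by (rule cc_smooth_derivative)

lemma grad_sq_measurable:
  "cc_smooth u \<Longrightarrow> grad_sq u \<in> borel_measurable borel"
  unfolding grad_sq_def using cc_smooth_measurable[OF partial_cc_smooth] by measurable

lemma nn_integral_grad_sq:
  assumes "cc_smooth u"
  shows "(\<integral>\<^sup>+x. ennreal (grad_sq u x) \<partial>lborel) = (\<Sum>i\<in>UNIV. sq_norm (partial i u))"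
proof -
  have [measurable]: "partial i u \<in> borel_measurable borel" for i
    by (rule cc_smooth_measurable[OF partial_cc_smooth[OF assms]])
  have "(\<integral>\<^sup>+x. ennreal (grad_sq u x) \<partial>lborel) = (\<integral>\<^sup>+x. (\<Sum>i\<in>UNIV. ennreal ((cmod (partial i u x))\<^sup>2)) \<partial>lborel)"
    by (simp add: grad_sq_def)
  also have "\<dots> = (\<Sum>i\<in>UNIV. sq_norm (partial i u))"
    unfolding sq_norm_def by (rule nn_integral_sum) auto
  finally show ?thesis .
qed

text \<open>Cauchy-Schwarz over the coordinates.\<close>

lemma cmod_frechet_derivative_le:
  fixes u :: "real ^ 'n \<Rightarrow> complex"
  assumes "smooth u"
  shows "cmod (frechet_derivative u (at x) v) \<le> norm v * sqrt (grad_sq u x)"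
proof -
  have lin: "linear (frechet_derivative u (at x))"
    using smooth_has_derivative[OF assms] has_derivative_linear by blast
  have v: "v = (\<Sum>i\<in>UNIV. (v $ i) *\<^sub>R axis i 1)"
    using basis_expansion[of v] by (simp add: scalar_mult_eq_scaleR)
  have "frechet_derivative u (at x) v = (\<Sum>i\<in>UNIV. (v $ i) *\<^sub>R partial i u x)"
    by (subst v) (simp only: linear_sum[OF lin] linear_cmul[OF lin] partial_def)
  also have "cmod \<dots> \<le> (\<Sum>i\<in>UNIV. \<bar>v $ i\<bar> * \<bar>cmod (partial i u x)\<bar>)"
    by (rule order_trans[OF norm_sum]) simp
  also have "\<dots> \<le> L2_set (($) v) UNIV * L2_set (\<lambda>i. cmod (partial i u x)) UNIV"
    by (rule L2_set_mult_ineq)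
  finally show ?thesis by (simp add: norm_vec_def L2_set_def grad_sq_def)
qed

lemma norm_sq_has_derivative:
  fixes u :: "'a::euclidean_space \<Rightarrow> complex"
  assumes "smooth u"
  shows "((\<lambda>x. (cmod (u x))\<^sup>2) has_derivative (\<lambda>v. 2 * (u x \<bullet> frechet_derivative u (at x) v))) (at x)"
proof -
  have "((\<lambda>x. u x \<bullet> u x) has_derivative (\<lambda>v. u x \<bullet> frechet_derivative u (at x) v + frechet_derivative u (at x) v \<bullet> u x)) (at x)"
    by (intro has_derivative_inner smooth_has_derivative[OF assms])
  then show ?thesis by (simp add: power2_norm_eq_inner inner_commute)
qed

lemma cc_smooth_norm_sq:
  fixes u :: "'a::euclidean_space \<Rightarrow> complex"
  shows "cc_smooth u \<Longrightarrow> cc_smooth (\<lambda>x. (cmod (u x))\<^sup>2)"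
  unfolding power2_norm_eq_inner
  by (rule cc_smooth_bilinear1[OF bounded_bilinear_inner]) (auto simp: cc_smooth_smooth)

section \<open>Truncation between the levels s and 2 s\<close>

text \<open>A continuously differentiable step from 0 on $(-\infty,1]$ to 1 on $[2,\infty)$.\<close>

definition step :: "real \<Rightarrow> real" where
  "step t = 1 - (max 0 (1 - (max 0 (t - 1))\<^sup>2))\<^sup>2"

definition step' :: "real \<Rightarrow> real" where
  "step' t = 4 * max 0 (1 - (max 0 (t - 1))\<^sup>2) * max 0 (t - 1)"

text \<open>\<open>step\<close> is made of two nested squared positive parts; the square is what
  keeps the derivative continuous across 0.\<close>

lemma DERIV_max0_sq: "((\<lambda>t. (max 0 t)\<^sup>2) has_field_derivative 2 * max 0 t) (at (t::real))"
proof -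
  consider "t > 0" | "t < 0" | "t = 0" by linarith
  then show ?thesis
  proof cases
    case 1
    have "((\<lambda>t. t\<^sup>2) has_field_derivative 2 * max 0 t) (at t)"
      using 1 by (auto intro!: derivative_eq_intros)
    then show ?thesis
      by (rule has_field_derivative_transform_within_open[where S="{0<..}"]) (use 1 in auto)
  next
    case 2
    have "((\<lambda>t. 0) has_field_derivative 2 * max 0 t) (at t)"
      using 2 by auto
    then show ?thesis
      by (rule has_field_derivative_transform_within_open[where S="{..<0}"]) (use 2 in auto)
  next
    case 3
    have "((\<lambda>h. (max 0 h)\<^sup>2 / h) \<longlongrightarrow> 0) (at (0::real))"
    proof (rule Lim_null_comparison)
      show "\<forall>\<^sub>F h in at 0. norm ((max 0 h)\<^sup>2 / h) \<le> \<bar>h\<bar>"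
        by (intro always_eventually) (auto simp: max_def power2_eq_square)
      show "((\<lambda>h::real. \<bar>h\<bar>) \<longlongrightarrow> 0) (at 0)"
        by (rule tendsto_rabs_zero) (rule tendsto_ident_at)
    qed
    then show ?thesis unfolding 3 has_field_derivative_iff by simp
  qed
qed

lemma DERIV_step: "(step has_field_derivative step' t) (at t)"
proof -
  have "((\<lambda>t. 1 - (max 0 (t - 1))\<^sup>2) has_field_derivative 0 - 2 * max 0 (t - 1) * (1 - 0)) (at t)" for t :: real
    by (intro DERIV_diff DERIV_const DERIV_chain2[OF DERIV_max0_sq] DERIV_ident)
  from DERIV_diff[OF DERIV_const[of 1] DERIV_chain2[OF DERIV_max0_sq this]]
  show ?thesis unfolding step_def step'_def by (simp add: algebra_simps)
qed

lemma step_bounds: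
  "0 \<le> step t" "step t \<le> 1" "t \<le> 1 \<Longrightarrow> step t = 0" "t \<ge> 2 \<Longrightarrow> step t = 1"
  "\<bar>step' t\<bar> \<le> 4" "t \<le> 1 \<or> t \<ge> 2 \<Longrightarrow> step' t = 0" "isCont step' t"
proof -
  have m: "0 \<le> max 0 (1 - (max 0 (t - 1))\<^sup>2)" "max 0 (1 - (max 0 (t - 1))\<^sup>2) \<le> 1" by auto
  then have "(max 0 (1 - (max 0 (t - 1))\<^sup>2))\<^sup>2 \<le> 1\<^sup>2" by (intro power_mono)
  then show "0 \<le> step t" "step t \<le> 1" by (simp_all add: step_def)
  show "t \<le> 1 \<Longrightarrow> step t = 0" by (simp add: step_def)
  have t2: "t \<ge> 2 \<Longrightarrow> max 0 (1 - (max 0 (t - 1))\<^sup>2) = 0"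
    using power_mono[of 1 "t - 1" 2] by simp
  then show "t \<ge> 2 \<Longrightarrow> step t = 1" by (simp add: step_def)
  show z: "t \<le> 1 \<or> t \<ge> 2 \<Longrightarrow> step' t = 0" using t2 by (auto simp: step'_def)
  show "\<bar>step' t\<bar> \<le> 4"
  proof (cases "t \<le> 1 \<or> t \<ge> 2")
    case False
    then have "max 0 (1 - (max 0 (t - 1))\<^sup>2) * max 0 (t - 1) \<le> 1 * 1" using m by (intro mult_mono) auto
    then show ?thesis using m by (simp add: step'_def abs_mult)
  qed (use z in simp)
  show "isCont step' t" unfolding step'_def by (intro continuous_intros)
qed

lemma ennreal_le_sqrt: "x\<^sup>2 \<le> ennreal c \<Longrightarrow> c \<ge> 0 \<Longrightarrow> x \<le> ennreal (sqrt c)"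
proof (cases x)
  case (real r)
  assume "x\<^sup>2 \<le> ennreal c" "c \<ge> 0"
  then have "r\<^sup>2 \<le> c" using real by (simp add: ennreal_power)
  then have "r \<le> sqrt c" by (rule real_le_rsqrt)
  then show ?thesis using real by (simp add: ennreal_leI)
qed (simp add: power2_eq_square top_unique)


lemma level_set_measurable:
  fixes u :: "real ^ 'n \<Rightarrow> complex"
  assumes "cc_smooth u" "s \<ge> 0"
  shows "{x. s < (cmod (u x))\<^sup>2} \<in> sets borel" "emeasure lborel {x. s < (cmod (u x))\<^sup>2} < \<infinity>"
proof -
  have [measurable]: "u \<in> borel_measurable borel" by (rule cc_smooth_measurable[OF assms(1)])
  have "Measurable.pred borel (\<lambda>x. s < (cmod (u x))\<^sup>2)" by measurable
  then show *: "{x. s < (cmod (u x))\<^sup>2} \<in> sets borel" by (simp add: pred_def)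
  have K: "compact (closure {x. u x \<noteq> 0})" using assms(1) by (simp add: cc_smooth_def)
  have "{x. s < (cmod (u x))\<^sup>2} \<subseteq> closure {x. u x \<noteq> 0}"
    using closure_subset[of "{x. u x \<noteq> 0}"] assms(2) by auto
  then have "emeasure lborel {x. s < (cmod (u x))\<^sup>2} \<le> emeasure lborel (closure {x. u x \<noteq> 0})"
    by (intro emeasure_mono) auto
  then show "emeasure lborel {x. s < (cmod (u x))\<^sup>2} < \<infinity>"
    using emeasure_compact_finite[OF K] by (rule order.strict_trans1)
qed

lemma grad_sq_integrable:
  assumes "cc_smooth u" shows "integrable lborel (grad_sq u)"
proof -
  have "integrable lborel (\<lambda>x. \<Sum>i\<in>UNIV. (cmod (partial i u x))\<^sup>2)"
    by (intro Bochner_Integration.integrable_sum cc_smooth_integrable cc_smooth_norm_sq partial_cc_smooth assms)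
  then show ?thesis unfolding grad_sq_def by simp
qed

text \<open>The Faber-Krahn inequality applied to the truncation \<open>step (|u|\<^sup>2 / s)\<close>, which is supported
  in \<open>|u|\<^sup>2 > s\<close> and equals 1 on \<open>|u|\<^sup>2 > 2 s\<close>.\<close>

lemma truncation_estimate:
  fixes u :: "real ^ 'n \<Rightarrow> complex"
  assumes u: "cc_smooth u" and s: "s > 0" and r: "r > 0"
    and vol: "2 * measure lborel {x. s < (cmod (u x))\<^sup>2} \<le> measure lborel (ball (0 :: real ^ 'n) r)"
  shows "measure lborel {x. 2 * s < (cmod (u x))\<^sup>2} \<le>
    2 * (r * (8 / s) * sqrt (2 * s) * sqrt (measure lborel {x. s < (cmod (u x))\<^sup>2} *
      (LINT x|lborel. indicator {x. s < (cmod (u x))\<^sup>2 \<and> (cmod (u x))\<^sup>2 < 2 * s} x * grad_sq u x)))"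
proof -
  let ?q = "\<lambda>x. (cmod (u x))\<^sup>2"
  define E where "E = {x. s < ?q x}"
  define A where "A = {x. s < ?q x \<and> ?q x < 2 * s}"
  define m where "m = measure lborel E"
  define B where "B = (LINT x|lborel. indicator A x * grad_sq u x)"
  have [measurable]: "u \<in> borel_measurable borel" "grad_sq u \<in> borel_measurable borel"
    using cc_smooth_measurable[OF u] grad_sq_measurable[OF u] by auto
  have E[measurable]: "E \<in> sets borel" and Ef: "emeasure lborel E < \<infinity>"
    unfolding E_def using level_set_measurable[OF u, of s] s by auto
  have "Measurable.pred borel (\<lambda>x. s < ?q x \<and> ?q x < 2 * s)" by measurable
  then have A[measurable]: "A \<in> sets borel" by (simp add: A_def pred_def)
  have mE: "emeasure lborel E = ennreal m" unfolding m_def using Ef by (simp add: emeasure_eq_ennreal_measure)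
  have m0: "m \<ge> 0" by (simp add: m_def)
  have iB: "integrable lborel (\<lambda>x. indicator A x * grad_sq u x)"
    using integrable_real_mult_indicator[OF _ grad_sq_integrable[OF u], of A] by (simp add: mult.commute)
  have B0: "B \<ge> 0" unfolding B_def by (intro integral_nonneg_AE) auto
  have nB: "(\<integral>\<^sup>+x. ennreal (indicator A x * grad_sq u x) \<partial>lborel) = ennreal B"
    unfolding B_def by (rule nn_integral_eq_integral[OF iB]) auto
  define f where "f x = step (?q x / s)" for x
  define D where "D x v = 2 * (u x \<bullet> frechet_derivative u (at x) v) / s * step' (?q x / s)" for x v
  have fd: "(f has_derivative D x) (at x)" for x
  proof -
    have "((\<lambda>x. ?q x / s) has_derivative (\<lambda>v. 2 * (u x \<bullet> frechet_derivative u (at x) v) / s)) (at x)"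
      by (rule bounded_linear.has_derivative[OF bounded_linear_divide norm_sq_has_derivative[OF cc_smooth_smooth[OF u]]])
    from has_derivative_compose[OF this, of step "(*) (step' (?q x / s))"]
    show ?thesis using DERIV_step[of "?q x / s"] unfolding has_field_derivative_def f_def D_def
      by (simp add: mult.commute)
  qed
  have contu: "continuous_on UNIV u" "continuous_on UNIV (\<lambda>x. frechet_derivative u (at x) v)" for v
    using u smooth_continuous smooth_frechet_derivative cc_smooth_smooth by blast+
  have cD: "continuous_on UNIV (\<lambda>x. D x v)" for v
  proof -
    have "continuous_on UNIV step'" using step_bounds(7) by (simp add: continuous_on_eq_continuous_at)
    moreover have "continuous_on UNIV (\<lambda>x. ?q x / s)" using s by (intro continuous_intros contu) auto
    ultimately have "continuous_on UNIV (\<lambda>x. step' (?q x / s))" by (rule continuous_on_compose2) simp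
    then show ?thesis unfolding D_def using s by (intro continuous_intros contu) auto
  qed
  \<comment> \<open>The factor 8 / s collects 2 from differentiating |u|^2, 4 from the bound on
    \<open>step'\<close>, and 1 / s from the rescaling; on \<open>A\<close> the remaining factor |u|
    is at most sqrt (2 s).\<close>
  have D_le: "\<bar>D x y\<bar> \<le> r * (8 / s) * sqrt (2 * s) * (indicator A x * sqrt (grad_sq u x))" if "norm y \<le> r" for x y
  proof (cases "x \<in> A")
    case True
    have "cmod (u x) \<le> sqrt (2 * s)" using True by (intro real_le_rsqrt) (auto simp: A_def)
    moreover have "cmod (frechet_derivative u (at x) y) \<le> r * sqrt (grad_sq u x)"
      using cmod_frechet_derivative_le[OF cc_smooth_smooth[OF u], of x y] that
      by (meson mult_right_mono order_trans real_sqrt_ge_zero grad_sq_nonneg)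
    moreover have "\<bar>u x \<bullet> frechet_derivative u (at x) y\<bar> \<le> cmod (u x) * cmod (frechet_derivative u (at x) y)"
      by (rule Cauchy_Schwarz_ineq2)
    ultimately have "\<bar>u x \<bullet> frechet_derivative u (at x) y\<bar> \<le> sqrt (2 * s) * (r * sqrt (grad_sq u x))"
      by (meson mult_mono norm_ge_zero order_trans real_sqrt_ge_zero s less_imp_le mult_nonneg_nonneg zero_le_numeral)
    then have "2 * \<bar>u x \<bullet> frechet_derivative u (at x) y\<bar> / s * \<bar>step' (?q x / s)\<bar>
        \<le> 2 * (sqrt (2 * s) * (r * sqrt (grad_sq u x))) / s * 4"
      using s r step_bounds(5) by (intro mult_mono divide_right_mono mult_left_mono) auto
    then show ?thesis using True s by (simp add: D_def abs_mult field_simps)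
  next
    case False
    then have "?q x / s \<le> 1 \<or> ?q x / s \<ge> 2" using s by (auto simp: A_def field_simps)
    then have "step' (?q x / s) = 0" by (rule step_bounds(6))
    then show ?thesis using False by (simp add: D_def)
  qed
  \<comment> \<open>Cauchy-Schwarz on the shell \<open>A\<close>, whose measure is at most that of
    \<open>E\<close>.\<close>
  have "(\<integral>\<^sup>+x. indicator A x * ennreal (sqrt (grad_sq u x)) \<partial>lborel)\<^sup>2 \<le> ennreal (m * B)"
  proof -
    have "(\<integral>\<^sup>+x. indicator A x * ennreal (sqrt (grad_sq u x)) \<partial>lborel)
       = (\<integral>\<^sup>+x. indicator A x * ennreal (indicator A x * sqrt (grad_sq u x)) \<partial>lborel)"
      by (intro nn_integral_cong) (auto simp: indicator_def)
    also have "\<dots>\<^sup>2 \<le> (\<integral>\<^sup>+x. indicator A x ^ 2 \<partial>lborel) * (\<integral>\<^sup>+x. ennreal (indicator A x * sqrt (grad_sq u x)) ^ 2 \<partial>lborel)"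
      by (rule Cauchy_Schwarz_nn_integral) measurable
    also have "(\<integral>\<^sup>+x. indicator A x ^ 2 \<partial>lborel) = emeasure lborel A"
    proof -
      have "(\<integral>\<^sup>+x. indicator A x ^ 2 \<partial>lborel) = (\<integral>\<^sup>+x. indicator A x \<partial>lborel)"
        by (intro nn_integral_cong) (auto simp: indicator_def)
      then show ?thesis by simp
    qed
    also have "(\<integral>\<^sup>+x. ennreal (indicator A x * sqrt (grad_sq u x)) ^ 2 \<partial>lborel) = ennreal B"
      unfolding nB[symmetric] by (intro nn_integral_cong) (auto simp: indicator_def ennreal_power)
    also have "emeasure lborel A * ennreal B \<le> ennreal m * ennreal B"
      unfolding mE[symmetric] by (intro mult_right_mono emeasure_mono) (auto simp: A_def E_def)
    finally show ?thesis using m0 B0 by (simp add: ennreal_mult)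
  qed
  then have sq: "(\<integral>\<^sup>+x. indicator A x * ennreal (sqrt (grad_sq u x)) \<partial>lborel) \<le> ennreal (sqrt (m * B))"
    using m0 B0 by (intro ennreal_le_sqrt) auto
  let ?c = "r * (8 / s) * sqrt (2 * s)"
  have c0: "?c \<ge> 0" using r s by simp
  have mod: "(\<integral>\<^sup>+x. ennreal \<bar>f (x + y) - f x\<bar> \<partial>lborel) \<le> ennreal (?c * sqrt (m * B))" if y: "y \<in> ball 0 r" for y
  proof -
    have "(\<integral>\<^sup>+x. ennreal \<bar>f (x + y) - f x\<bar> \<partial>lborel) \<le> (\<integral>\<^sup>+x. ennreal \<bar>D x y\<bar> \<partial>lborel)"
      by (rule L1_translation_gradient[OF fd cD])
    also have "\<dots> \<le> (\<integral>\<^sup>+x. ennreal ?c * (indicator A x * ennreal (sqrt (grad_sq u x))) \<partial>lborel)"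
    proof (rule nn_integral_mono)
      fix x
      have "ennreal \<bar>D x y\<bar> \<le> ennreal (?c * (indicator A x * sqrt (grad_sq u x)))"
        using y by (intro ennreal_leI D_le) simp
      also have "\<dots> = ennreal ?c * (indicator A x * ennreal (sqrt (grad_sq u x)))"
        using c0 by (subst ennreal_mult) (auto simp: indicator_def)
      finally show "ennreal \<bar>D x y\<bar> \<le> ennreal ?c * (indicator A x * ennreal (sqrt (grad_sq u x)))" .
    qed
    also have "\<dots> = ennreal ?c * (\<integral>\<^sup>+x. indicator A x * ennreal (sqrt (grad_sq u x)) \<partial>lborel)"
      by (rule nn_integral_cmult) measurable
    also have "\<dots> \<le> ennreal ?c * ennreal (sqrt (m * B))" by (intro mult_left_mono sq) simp
    also have "\<dots> = ennreal (?c * sqrt (m * B))"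
      by (rule ennreal_mult[symmetric]) (use c0 m0 B0 in auto)
    finally show ?thesis .
  qed
  have f01: "f x \<ge> 0" "f x \<le> 1" for x by (auto simp: f_def step_bounds)
  have f0: "f x = 0" if "x \<notin> E" for x
    using that s unfolding f_def by (intro step_bounds(3)) (simp add: E_def)
  have fle: "ennreal (f x) \<le> indicator E x" for x using f01[of x] f0[of x] by (auto simp: indicator_def)
  have [measurable]: "f \<in> borel_measurable borel"
    by (intro borel_measurable_continuous_onI continuous_at_imp_continuous_on ballI)
       (use fd has_derivative_continuous in blast)
  have If: "(\<integral>\<^sup>+x. ennreal (f x) \<partial>lborel) < \<infinity>"
  proof -
    have "(\<integral>\<^sup>+x. ennreal (f x) \<partial>lborel) \<le> (\<integral>\<^sup>+x. indicator E x \<partial>lborel)" by (intro nn_integral_mono fle)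
    also have "\<dots> < \<infinity>" using Ef by simp
    finally show ?thesis .
  qed
  have "(\<integral>\<^sup>+x. ennreal (f x) \<partial>lborel) \<le> 2 * ennreal (?c * sqrt (m * B))"
  proof (rule Faber_Krahn_L1[where B="ball 0 r" and E=E])
    have b: "emeasure lborel (ball (0::real^'n) r) = ennreal (measure lborel (ball (0::real^'n) r))"
      using emeasure_lborel_ball_finite[of "0::real^'n" r] by (simp add: emeasure_eq_ennreal_measure)
    show "2 * emeasure lborel E \<le> emeasure lborel (ball (0::real^'n) r)"
      unfolding b mE using vol m0 unfolding m_def E_def
      by (simp add: ennreal_mult[symmetric] ennreal_numeral[symmetric] del: ennreal_numeral)
    show "0 < emeasure lborel (ball (0::real^'n) r)"
      using r emeasure_ball[of r "0::real^'n"] unit_ball_vol_pos[of "real DIM(real^'n)"] by simp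
  qed (use f01 f0 If mod emeasure_lborel_ball_finite in auto)
  moreover have "ennreal (measure lborel {x. 2 * s < ?q x}) \<le> (\<integral>\<^sup>+x. ennreal (f x) \<partial>lborel)"
  proof -
    have M: "{x. 2 * s < ?q x} \<in> sets borel" "emeasure lborel {x. 2 * s < ?q x} < \<infinity>"
      using level_set_measurable[OF u, of "2 * s"] s by auto
    then have "ennreal (measure lborel {x. 2 * s < ?q x}) = (\<integral>\<^sup>+x. indicator {x. 2 * s < ?q x} x \<partial>lborel)"
      by (simp add: emeasure_eq_ennreal_measure)
    also have "\<dots> \<le> (\<integral>\<^sup>+x. ennreal (f x) \<partial>lborel)"
    proof (rule nn_integral_mono)
      fix x
      have "2 * s < ?q x \<Longrightarrow> f x = 1" unfolding f_def using s by (intro step_bounds(4)) (simp add: field_simps)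
      then show "indicator {x. 2 * s < ?q x} x \<le> ennreal (f x)" by (auto simp: indicator_def)
    qed
    finally show ?thesis .
  qed
  moreover have cp: "0 \<le> ?c * sqrt (m * B)"
    by (rule mult_nonneg_nonneg[OF c0]) (use m0 B0 in simp)
  ultimately have "ennreal (measure lborel {x. 2 * s < ?q x}) \<le> 2 * ennreal (?c * sqrt (m * B))"
    using order_trans by blast
  also have "\<dots> = ennreal (2 * (?c * sqrt (m * B)))"
    by (rule ennreal_mult[of 2 "?c * sqrt (m * B)", symmetric, unfolded ennreal_numeral]) (use cp in simp_all)
  finally have "measure lborel {x. 2 * s < ?q x} \<le> 2 * (?c * sqrt (m * B))"
    using cp by (subst (asm) ennreal_le_iff) simp_all
  then show ?thesis unfolding m_def B_def E_def A_def .
qed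

text \<open>The radius in \<open>truncation_estimate\<close> is chosen so that the ball has exactly
  twice the measure m of {|u|^2 > s}. Then r^2 is a multiple of m^(2/n), which together with the
  factor m from Cauchy-Schwarz gives the power 1 + 2/n. The number 512 is 4 * 8^2 * 2.\<close>

lemma truncation_step:
  obtains C :: real where "C > 0"
    "\<And>(u :: real ^ 'n \<Rightarrow> complex) s. cc_smooth u \<Longrightarrow> s > 0 \<Longrightarrow>
      s * (measure lborel {x. 2 * s < (cmod (u x))\<^sup>2})\<^sup>2 \<le>
      C * measure lborel {x. s < (cmod (u x))\<^sup>2} powr (1 + 2 / real CARD('n)) *
      (LINT x|lborel. indicator {x. s < (cmod (u x))\<^sup>2 \<and> (cmod (u x))\<^sup>2 < 2 * s} x * grad_sq u x)"
proof -
  let ?n = "real CARD('n)"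
  define \<omega> where "\<omega> = unit_ball_vol ?n"
  have \<omega>: "\<omega> > 0" unfolding \<omega>_def by (rule unit_ball_vol_pos) simp
  have n: "?n > 0" by simp
  define C where "C = 512 * (2 / \<omega>) powr (2 / ?n)"
  have "s * (measure lborel {x. 2 * s < (cmod (u x))\<^sup>2})\<^sup>2 \<le>
      C * measure lborel {x. s < (cmod (u x))\<^sup>2} powr (1 + 2 / ?n) *
      (LINT x|lborel. indicator {x. s < (cmod (u x))\<^sup>2 \<and> (cmod (u x))\<^sup>2 < 2 * s} x * grad_sq u x)"
    if u: "cc_smooth u" and s: "s > 0" for u :: "real ^ 'n \<Rightarrow> complex" and s
  proof -
    let ?m = "measure lborel {x. s < (cmod (u x))\<^sup>2}" and ?m2 = "measure lborel {x. 2 * s < (cmod (u x))\<^sup>2}"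
    let ?B = "LINT x|lborel. indicator {x. s < (cmod (u x))\<^sup>2 \<and> (cmod (u x))\<^sup>2 < 2 * s} x * grad_sq u x"
    have B0: "?B \<ge> 0" by (intro integral_nonneg_AE) auto
    have mono: "?m2 \<le> ?m"
      using level_set_measurable[OF u, of s] level_set_measurable[OF u, of "2 * s"] s
      by (intro measure_mono_fmeasurable) (auto simp: fmeasurable_def)
    show ?thesis
    proof (cases "?m = 0")
      case True
      then have "?m2 = 0" using mono measure_nonneg[of lborel "{x. 2 * s < (cmod (u x))\<^sup>2}"] by linarith
      then show ?thesis using True by simp
    next
      case False
      then have m: "?m > 0" by (simp add: zero_less_measure_iff)
      define r where "r = (2 * ?m / \<omega>) powr (1 / ?n)"
      have r: "r > 0" unfolding r_def using m \<omega> by simp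
      have "r ^ CARD('n) = (2 * ?m / \<omega>)"
        using m \<omega> n unfolding r_def by (subst powr_realpow[symmetric]) (auto simp: powr_powr)
      then have "measure lborel (ball (0 :: real ^ 'n) r) = 2 * ?m"
        using r \<omega> content_ball[of r "0 :: real ^ 'n"] by (simp add: \<omega>_def[symmetric])
      then have est: "?m2 \<le> 2 * (r * (8 / s) * sqrt (2 * s) * sqrt (?m * ?B))"
        by (intro truncation_estimate[OF u s r]) simp
      have "?m2\<^sup>2 \<le> (2 * (r * (8 / s) * sqrt (2 * s) * sqrt (?m * ?B)))\<^sup>2"
        using est by (intro power_mono) auto
      also have "\<dots> = 4 * (r\<^sup>2 * (8 / s)\<^sup>2 * (2 * s) * (?m * ?B))"
      proof -
        have "(sqrt (2 * s))\<^sup>2 = 2 * s" "(sqrt (?m * ?B))\<^sup>2 = ?m * ?B" using s m B0 by auto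
        then show ?thesis by (simp only: power_mult_distrib) simp
      qed
      finally have "s * ?m2\<^sup>2 \<le> s * (4 * (r\<^sup>2 * (8 / s)\<^sup>2 * (2 * s) * (?m * ?B)))"
        using s by (intro mult_left_mono) auto
      also have "\<dots> = 512 * r\<^sup>2 * ?m * ?B"
        using s by (simp add: power2_eq_square field_simps)
      also have "r\<^sup>2 = (2 / \<omega>) powr (2 / ?n) * ?m powr (2 / ?n)"
      proof -
        have "r\<^sup>2 = (2 * ?m / \<omega>) powr (2 / ?n)"
          using r unfolding r_def by (subst powr_numeral[symmetric]) (auto simp: powr_powr)
        also have "2 * ?m / \<omega> = (2 / \<omega>) * ?m" by simp
        finally show ?thesis using m \<omega> by (simp only: powr_mult)
      qed
      also have "512 * ((2 / \<omega>) powr (2 / ?n) * ?m powr (2 / ?n)) * ?m * ?B = C * ?m powr (1 + 2 / ?n) * ?B"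
        using m by (simp add: C_def powr_add)
      finally show ?thesis .
    qed
  qed
  moreover have "C > 0" using \<omega> by (simp add: C_def)
  ultimately show ?thesis using that by blast
qed

text \<open>With \<theta> = 1 - 2/n, positive since n >= 3, write m and m2 for the measures at the
  levels s and 2 s. Either m2^\<theta> <= m^\<theta> / 4, and the quantity s m^\<theta> is at least
  halved at the next level; or m <= k m2 with k = 4^(1/\<theta>), and \<open>truncation_step\<close>
  can be divided by m2^(1 + 2/n), leaving m2^\<theta> because 2 = \<theta> + (1 + 2/n).\<close>

lemma truncation_recursion:
  assumes n: "CARD('n) \<ge> 3"
  obtains C :: real where "C > 0"
    "\<And>(u :: real ^ 'n \<Rightarrow> complex) s. cc_smooth u \<Longrightarrow> s > 0 \<Longrightarrow>
      (2 * s) * measure lborel {x. 2 * s < (cmod (u x))\<^sup>2} powr (1 - 2 / real CARD('n)) \<le>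
      s * measure lborel {x. s < (cmod (u x))\<^sup>2} powr (1 - 2 / real CARD('n)) / 2 +
      C * (LINT x|lborel. indicator {x. s < (cmod (u x))\<^sup>2 \<and> (cmod (u x))\<^sup>2 < 2 * s} x * grad_sq u x)"
proof -
  let ?n = "real CARD('n)"
  define \<theta> where "\<theta> = 1 - 2 / ?n"
  have \<theta>: "\<theta> > 0" using n by (simp add: \<theta>_def field_simps)
  obtain C where C: "C > 0" "\<And>(u :: real ^ 'n \<Rightarrow> complex) s. cc_smooth u \<Longrightarrow> s > 0 \<Longrightarrow>
      s * (measure lborel {x. 2 * s < (cmod (u x))\<^sup>2})\<^sup>2 \<le>
      C * measure lborel {x. s < (cmod (u x))\<^sup>2} powr (1 + 2 / ?n) *
      (LINT x|lborel. indicator {x. s < (cmod (u x))\<^sup>2 \<and> (cmod (u x))\<^sup>2 < 2 * s} x * grad_sq u x)"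
    using truncation_step[where 'n='n] by blast
  define k where "k = 4 powr (1 / \<theta>)"
  define C' where "C' = 2 * C * k powr (1 + 2 / ?n)"
  have k: "k > 0" by (simp add: k_def)
  have "(2 * s) * measure lborel {x. 2 * s < (cmod (u x))\<^sup>2} powr \<theta> \<le>
      s * measure lborel {x. s < (cmod (u x))\<^sup>2} powr \<theta> / 2 +
      C' * (LINT x|lborel. indicator {x. s < (cmod (u x))\<^sup>2 \<and> (cmod (u x))\<^sup>2 < 2 * s} x * grad_sq u x)"
    if u: "cc_smooth u" and s: "s > 0" for u :: "real ^ 'n \<Rightarrow> complex" and s
  proof -
    define m where "m = measure lborel {x. s < (cmod (u x))\<^sup>2}"
    define m2 where "m2 = measure lborel {x. 2 * s < (cmod (u x))\<^sup>2}"
    define B where "B = (LINT x|lborel. indicator {x. s < (cmod (u x))\<^sup>2 \<and> (cmod (u x))\<^sup>2 < 2 * s} x * grad_sq u x)"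
    have B0: "B \<ge> 0" unfolding B_def by (intro integral_nonneg_AE) auto
    have m0: "m \<ge> 0" "m2 \<ge> 0" by (auto simp: m_def m2_def)
    have st: "s * m2\<^sup>2 \<le> C * m powr (1 + 2 / ?n) * B" unfolding m_def m2_def B_def by (rule C(2)[OF u s])
    have C'0: "C' > 0" using C(1) k by (simp add: C'_def)
    have "2 * s * m2 powr \<theta> \<le> s * m powr \<theta> / 2 + C' * B"
    proof (cases "m2 powr \<theta> \<le> m powr \<theta> / 4")
      case True
      then have "2 * s * m2 powr \<theta> \<le> 2 * s * (m powr \<theta> / 4)" using s by (intro mult_left_mono) auto
      moreover have "C' * B \<ge> 0" using C'0 B0 by simp
      ultimately show ?thesis by simp
    next
      case False
      have m2: "m2 > 0" using False m0 by (cases "m2 = 0") auto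
      have "m powr \<theta> < 4 * m2 powr \<theta>" using False by simp
      also have "\<dots> = (k * m2) powr \<theta>"
        using \<theta> m2 k by (simp add: powr_mult k_def powr_powr)
      finally have "m \<le> k * m2" using \<theta> m0 k m2 powr_mono2[of \<theta> "k * m2" m] by (meson less_imp_le linorder_not_le not_less mult_nonneg_nonneg)
      then have "m powr (1 + 2 / ?n) \<le> (k * m2) powr (1 + 2 / ?n)" using m0 by (intro powr_mono2) auto
      also have "\<dots> = k powr (1 + 2 / ?n) * m2 powr (1 + 2 / ?n)" using k m2 by (simp add: powr_mult)
      finally have "C * m powr (1 + 2 / ?n) * B \<le> C * (k powr (1 + 2 / ?n) * m2 powr (1 + 2 / ?n)) * B"
        using C(1) B0 by (intro mult_right_mono mult_left_mono) auto
      with st have "s * m2\<^sup>2 \<le> C * k powr (1 + 2 / ?n) * B * m2 powr (1 + 2 / ?n)" by (simp add: algebra_simps)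
      moreover have "m2\<^sup>2 = m2 powr \<theta> * m2 powr (1 + 2 / ?n)"
        using m2 by (simp add: powr_add[symmetric] \<theta>_def powr_numeral)
      ultimately have "(s * m2 powr \<theta>) * m2 powr (1 + 2 / ?n) \<le> (C * k powr (1 + 2 / ?n) * B) * m2 powr (1 + 2 / ?n)"
        by (simp add: algebra_simps)
      then have "s * m2 powr \<theta> \<le> C * k powr (1 + 2 / ?n) * B"
        using m2 by (simp add: mult_le_cancel_right)
      moreover have "s * m powr \<theta> / 2 \<ge> 0" using s by simp
      ultimately show ?thesis by (simp add: C'_def)
    qed
    then show ?thesis by (simp add: m_def m2_def B_def)
  qed
  moreover have "C' > 0" using C(1) k by (simp add: C'_def)
  ultimately show ?thesis using that[of C'] unfolding \<theta>_def by blast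
qed


section \<open>Dyadic summation over the level sets\<close>

text \<open>Where V <= t use t, elsewhere V <= t^(1 - p) V^p. The threshold t = (M/m)^(1/p), with m
  the measure of E, makes both contributions equal, whence the constant 2 in this form of Hoelder's
  inequality.\<close>

lemma Hoelder_on_set:
  fixes V :: "'a::euclidean_space \<Rightarrow> real"
  assumes [measurable]: "V \<in> borel_measurable borel" "E \<in> sets borel" and V: "\<And>x. V x \<ge> 0"
    and p: "p > 1" and M: "M > 0" "(\<integral>\<^sup>+x. ennreal (V x powr p) \<partial>lborel) \<le> ennreal M"
    and E: "emeasure lborel E < \<infinity>"
  shows "(\<integral>\<^sup>+x. indicator E x * ennreal (V x) \<partial>lborel) \<le> ennreal (2 * M powr (1 / p) * measure lborel E powr (1 - 1 / p))"
proof (cases "measure lborel E = 0")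
  case True
  then have "emeasure lborel E = 0" using E by (simp add: emeasure_eq_ennreal_measure)
  then have "AE x in lborel. x \<notin> E" by (intro AE_not_in) (simp add: null_sets_def)
  then have "(\<integral>\<^sup>+x. indicator E x * ennreal (V x) \<partial>lborel) = 0"
    by (subst nn_integral_0_iff_AE) (auto elim!: eventually_mono)
  then show ?thesis by simp
next
  case False
  define m where "m = measure lborel E"
  have m: "m > 0" using False by (simp add: m_def zero_less_measure_iff)
  have mE: "emeasure lborel E = ennreal m" using E by (simp add: emeasure_eq_ennreal_measure m_def)
  define t where "t = (M / m) powr (1 / p)"
  have t: "t > 0" using M m by (simp add: t_def)
  have "indicator E x * ennreal (V x) \<le> ennreal t * indicator E x + ennreal (t powr (1 - p)) * ennreal (V x powr p)" for x
  proof (cases "V x \<le> t")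
    case True
    then show ?thesis by (auto simp: indicator_def intro: add_increasing2 ennreal_leI)
  next
    case False
    then have "V x powr (1 - p) \<le> t powr (1 - p)" using t p by (intro powr_mono2') auto
    then have "V x powr (1 - p) * V x powr p \<le> t powr (1 - p) * V x powr p" by (rule mult_right_mono) simp
    moreover have "V x powr (1 - p) * V x powr p = V x" using False t by (simp add: powr_add[symmetric])
    ultimately have "ennreal (V x) \<le> ennreal (t powr (1 - p) * V x powr p)" by (intro ennreal_leI) simp
    then have "ennreal (V x) \<le> ennreal (t powr (1 - p)) * ennreal (V x powr p)" by (simp add: ennreal_mult)
    then show ?thesis by (auto simp: indicator_def intro: add_increasing)
  qed
  then have "(\<integral>\<^sup>+x. indicator E x * ennreal (V x) \<partial>lborel) \<le>
     (\<integral>\<^sup>+x. ennreal t * indicator E x + ennreal (t powr (1 - p)) * ennreal (V x powr p) \<partial>lborel)"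
    by (intro nn_integral_mono)
  also have "\<dots> = ennreal t * ennreal m + ennreal (t powr (1 - p)) * (\<integral>\<^sup>+x. ennreal (V x powr p) \<partial>lborel)"
    by (simp add: nn_integral_add nn_integral_cmult nn_integral_cmult_indicator mE)
  also have "\<dots> \<le> ennreal t * ennreal m + ennreal (t powr (1 - p)) * ennreal M"
    by (intro add_left_mono mult_left_mono M(2)) simp
  also have "\<dots> = ennreal (t * m + t powr (1 - p) * M)"
    using t m M by (simp add: ennreal_mult ennreal_plus)
  also have "t * m = M powr (1 / p) * m powr (1 - 1 / p)"
    using M m p by (simp add: t_def powr_divide powr_diff)
  also have "t powr (1 - p) * M = M powr (1 / p) * m powr (1 - 1 / p)"
  proof -
    have "t powr (1 - p) = (M / m) powr (1 / p - 1)" using p by (simp add: t_def powr_powr field_simps)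
    also have "\<dots> = M powr (1 / p - 1) * m powr (1 - 1 / p)"
      using M m by (simp add: powr_divide powr_diff field_simps)
    finally show ?thesis using M by (simp add: powr_diff)
  qed
  finally show ?thesis by (simp add: m_def mult.assoc)
qed

text \<open>The shells are disjoint, so the sum is at most 1. The sharper bound by an indicator
  records that the new shell lies above all earlier ones, which the induction requires.\<close>

lemma dyadic_indicator_sum:
  fixes q \<delta> :: real
  assumes "\<delta> > 0"
  shows "(\<Sum>k<N. indicator {\<delta> * 2 ^ k<..<\<delta> * 2 ^ Suc k} q) \<le> (indicator {..<\<delta> * 2 ^ N} q :: real)"
proof (induction N)
  case (Suc N)
  show ?case
  proof (cases "q < \<delta> * 2 ^ N")
    case True
    moreover have "\<delta> * 2 ^ N \<le> \<delta> * 2 ^ Suc N" using assms by simp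
    ultimately show ?thesis using Suc by (auto simp: indicator_def)
  next
    case False
    then show ?thesis using Suc by (auto simp: indicator_def)
  qed
qed simp

text \<open>A discrete layer-cake formula: because the levels double, the last level below q already
  contributes at least q.\<close>

lemma dyadic_decomposition:
  fixes q \<delta> :: real
  assumes "\<delta> > 0" "q \<ge> 0"
  shows "q \<le> \<delta> * 2 ^ N \<Longrightarrow> q \<le> \<delta> * indicator {0<..} q + (\<Sum>k<N. 2 * (\<delta> * 2 ^ k) * indicator {\<delta> * 2 ^ k<..} q)"
proof (induction N)
  case 0
  then show ?case using assms by (auto simp: indicator_def)
next
  case (Suc N)
  show ?case
  proof (cases "q \<le> \<delta> * 2 ^ N")
    case True
    then show ?thesis using Suc.IH assms by (simp add: add_increasing2)
  next
    case False
    have "0 \<le> \<delta> * indicator {0<..} q + (\<Sum>k<N. 2 * (\<delta> * 2 ^ k) * indicator {\<delta> * 2 ^ k<..} q)"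
      using assms by (intro add_nonneg_nonneg sum_nonneg) auto
    then show ?thesis using False Suc.prems by simp
  qed
qed

text \<open>The extra term \<open>a N\<close> on the left is exactly what the halved term of the
  next step consumes.\<close>

lemma sum_of_halving_recursion:
  fixes a b :: "nat \<Rightarrow> real"
  assumes "\<And>k. a (Suc k) \<le> a k / 2 + b k"
  shows "(\<Sum>k\<le>N. a k) + a N \<le> 2 * a 0 + 2 * (\<Sum>k<N. b k)"
proof (induction N)
  case (Suc N)
  then show ?case using assms[of N] by simp
qed simp

text \<open>Maz'ya's truncation method. The dyadic decomposition of |u|^2 and Hoelder on each
  superlevel set reduce the claim to the sum of s_k m(s_k)^\<theta> over the levels s_k = \<delta>
  2^k. By \<open>truncation_recursion\<close> and \<open>sum_of_halving_recursion\<close> this sum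
  is controlled by its first term and by the gradient energy over the disjoint shells. Boundedness
  of u makes the number of levels finite.\<close>

lemma weighted_Sobolev:
  assumes n: "CARD('n) \<ge> 3"
  obtains C :: real where "C > 0"
    "\<And>(V :: real ^ 'n \<Rightarrow> real) M u. V \<in> borel_measurable borel \<Longrightarrow> (\<And>x. V x \<ge> 0) \<Longrightarrow> M > 0 \<Longrightarrow>
      (\<integral>\<^sup>+x. ennreal (V x powr (real CARD('n) / 2)) \<partial>lborel) \<le> ennreal M \<Longrightarrow> cc_smooth u \<Longrightarrow>
      (\<integral>\<^sup>+x. ennreal (V x * (cmod (u x))\<^sup>2) \<partial>lborel) \<le> ennreal (C * M powr (2 / real CARD('n)) * (LINT x|lborel. grad_sq u x))"
proof -
  let ?n = "real CARD('n)"
  define p where "p = ?n / 2"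
  define \<theta> where "\<theta> = 1 - 2 / ?n"
  have p: "p > 1" "1 / p = 2 / ?n" "1 - 1 / p = \<theta>" using n by (auto simp: p_def \<theta>_def)
  have \<theta>: "\<theta> > 0" using n by (simp add: \<theta>_def field_simps)
  obtain C where C: "C > 0" "\<And>(u :: real ^ 'n \<Rightarrow> complex) s. cc_smooth u \<Longrightarrow> s > 0 \<Longrightarrow>
      (2 * s) * measure lborel {x. 2 * s < (cmod (u x))\<^sup>2} powr \<theta> \<le>
      s * measure lborel {x. s < (cmod (u x))\<^sup>2} powr \<theta> / 2 +
      C * (LINT x|lborel. indicator {x. s < (cmod (u x))\<^sup>2 \<and> (cmod (u x))\<^sup>2 < 2 * s} x * grad_sq u x)"
    using truncation_recursion[OF n] unfolding \<theta>_def by blast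
  have "(\<integral>\<^sup>+x. ennreal (V x * (cmod (u x))\<^sup>2) \<partial>lborel) \<le> ennreal (8 * C * M powr (2 / ?n) * (LINT x|lborel. grad_sq u x))"
    if [measurable]: "V \<in> borel_measurable borel" and V: "\<And>x. V x \<ge> 0" and M: "M > 0"
      and VM: "(\<integral>\<^sup>+x. ennreal (V x powr (?n / 2)) \<partial>lborel) \<le> ennreal M" and u: "cc_smooth u"
    for V :: "real ^ 'n \<Rightarrow> real" and M u
  proof -
    let ?q = "\<lambda>x. (cmod (u x))\<^sup>2"
    define E where "E s = {x. s < ?q x}" for s
    define A where "A s = {x. s < ?q x \<and> ?q x < 2 * s}" for s
    define m where "m s = measure lborel (E s)" for s
    define K where "K = M powr (2 / ?n)"
    define G where "G = (LINT x|lborel. grad_sq u x)"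
    have K0: "K \<ge> 0" by (simp add: K_def)
    have G0: "G \<ge> 0" unfolding G_def by (intro integral_nonneg_AE) auto
    have [measurable]: "u \<in> borel_measurable borel" "grad_sq u \<in> borel_measurable borel"
      using cc_smooth_measurable[OF u] grad_sq_measurable[OF u] by auto
    have E: "E s \<in> sets borel" "emeasure lborel (E s) < \<infinity>" if "s \<ge> 0" for s
      unfolding E_def using level_set_measurable[OF u that] by auto
    have "Measurable.pred borel (\<lambda>x. s < ?q x \<and> ?q x < 2 * s)" for s by measurable
    then have A[measurable]: "A s \<in> sets borel" for s by (simp add: A_def pred_def)
    have Ho: "(\<integral>\<^sup>+x. indicator (E s) x * ennreal (V x) \<partial>lborel) \<le> ennreal (2 * K * m s powr \<theta>)" if "s \<ge> 0" for s
      using Hoelder_on_set[OF _ E(1)[OF that] V p(1) M _ E(2)[OF that]] VM p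
      unfolding K_def m_def by (simp add: p_def)
    have "\<exists>B. \<forall>x. ?q x \<le> B"
    proof -
      obtain B where "\<And>x. cmod (u x) \<le> B" using cc_smooth_bounded[OF u] by blast
      then show ?thesis by (intro exI[of _ "B\<^sup>2"] allI power_mono) auto
    qed
    then obtain b where b: "\<And>x. ?q x \<le> b" by blast
    \<comment> \<open>The lowest level \<delta> leaves an error proportional to \<delta>: 2 K from
      the part of |u|^2 below \<delta> and 8 K from the first term of the recursion.\<close>
    have est: "(\<integral>\<^sup>+x. ennreal (V x * ?q x) \<partial>lborel) \<le> ennreal (\<delta> * (10 * K * m 0 powr \<theta>) + 8 * C * K * G)"
      if \<delta>: "\<delta> > 0" for \<delta>
    proof -
      obtain N where N: "b / \<delta> < 2 ^ N" using real_arch_pow[of 2 "b / \<delta>"] by auto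
      have qN: "?q x \<le> \<delta> * 2 ^ N" for x using N \<delta> b[of x] by (simp add: field_simps)
      define s where "s k = \<delta> * 2 ^ k" for k :: nat
      have s: "s k > 0" "s (Suc k) = 2 * s k" "s 0 = \<delta>" for k using \<delta> by (auto simp: s_def)
      have B: "(\<Sum>k<N. LINT x|lborel. indicator (A (s k)) x * grad_sq u x) \<le> G"
      proof -
        have ii: "integrable lborel (\<lambda>x. indicator (A (s k)) x * grad_sq u x)" for k
          using integrable_real_mult_indicator[OF _ grad_sq_integrable[OF u], of "A (s k)"] by (simp add: mult.commute)
        have "(\<Sum>k<N. LINT x|lborel. indicator (A (s k)) x * grad_sq u x) =
            (LINT x|lborel. (\<Sum>k<N. indicator (A (s k)) x * grad_sq u x))"
          by (rule Bochner_Integration.integral_sum[symmetric]) (rule ii)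
        also have "\<dots> \<le> G" unfolding G_def
        proof (rule integral_mono)
          fix x
          have "(\<Sum>k<N. indicator (A (s k)) x) = (\<Sum>k<N. indicator {\<delta> * 2 ^ k<..<\<delta> * 2 ^ Suc k} (?q x) :: real)"
            by (intro sum.cong) (auto simp: indicator_def A_def s_def)
          also have "\<dots> \<le> 1" by (rule order_trans[OF dyadic_indicator_sum[OF \<delta>]]) (simp add: indicator_def)
          finally have "(\<Sum>k<N. indicator (A (s k)) x) * grad_sq u x \<le> 1 * grad_sq u x"
            by (rule mult_right_mono) simp
          then show "(\<Sum>k<N. indicator (A (s k)) x * grad_sq u x) \<le> grad_sq u x"
            by (simp add: sum_distrib_right)
        qed (rule Bochner_Integration.integrable_sum, rule ii, rule grad_sq_integrable[OF u])
        finally show ?thesis .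
      qed
      define c where "c k = s k * m (s k) powr \<theta>" for k
      have c0: "c k \<ge> 0" for k using s(1)[of k] by (simp add: c_def)
      have "c (Suc k) \<le> c k / 2 + C * (LINT x|lborel. indicator (A (s k)) x * grad_sq u x)" for k
        using C(2)[OF u s(1)[of k]] unfolding c_def s(2) m_def E_def A_def by simp
      from sum_of_halving_recursion[of c, OF this, of N]
      have "(\<Sum>k<N. c k) \<le> 2 * c 0 + 2 * (\<Sum>k<N. C * (LINT x|lborel. indicator (A (s k)) x * grad_sq u x))"
        using c0[of N] by (simp add: lessThan_Suc_atMost[symmetric])
      also have "\<dots> \<le> 2 * c 0 + 2 * (C * G)"
        using B C(1) by (simp add: sum_distrib_left[symmetric])
      also have "c 0 \<le> \<delta> * m 0 powr \<theta>"
      proof -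
        have "m \<delta> \<le> m 0" unfolding m_def using E[of \<delta>] E[of 0] \<delta>
          by (intro measure_mono_fmeasurable) (auto simp: fmeasurable_def E_def)
        then have "m \<delta> powr \<theta> \<le> m 0 powr \<theta>" using \<theta> by (intro powr_mono2) (auto simp: m_def)
        then show ?thesis using \<delta> by (simp add: c_def s)
      qed
      finally have sumc: "(\<Sum>k<N. c k) \<le> 2 * (\<delta> * m 0 powr \<theta>) + 2 * (C * G)" by simp
      have EM[measurable]: "E 0 \<in> sets borel" "E (s k) \<in> sets borel" for k
        using E(1)[of 0] E(1)[of "s k"] s(1)[of k] by auto
      have "(\<integral>\<^sup>+x. ennreal (V x * ?q x) \<partial>lborel) \<le> (\<integral>\<^sup>+x. ennreal \<delta> * (indicator (E 0) x * ennreal (V x)) +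
          (\<Sum>k<N. ennreal (2 * s k) * (indicator (E (s k)) x * ennreal (V x))) \<partial>lborel)"
      proof (rule nn_integral_mono)
        fix x
        have "?q x \<le> \<delta> * indicator {0<..} (?q x) + (\<Sum>k<N. 2 * (\<delta> * 2 ^ k) * indicator {\<delta> * 2 ^ k<..} (?q x))"
          using dyadic_decomposition[OF \<delta> _ qN] by simp
        also have "\<dots> = \<delta> * indicator (E 0) x + (\<Sum>k<N. 2 * s k * indicator (E (s k)) x)"
          by (simp add: E_def s_def indicator_def)
        finally have "V x * ?q x \<le> V x * (\<delta> * indicator (E 0) x + (\<Sum>k<N. 2 * s k * indicator (E (s k)) x))"
          by (rule mult_left_mono[OF _ V])
        also have "\<dots> = \<delta> * (indicator (E 0) x * V x) + (\<Sum>k<N. 2 * s k * (indicator (E (s k)) x * V x))"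
          by (simp add: algebra_simps sum_distrib_left)
        finally have "ennreal (V x * ?q x) \<le> ennreal (\<delta> * (indicator (E 0) x * V x) + (\<Sum>k<N. 2 * s k * (indicator (E (s k)) x * V x)))"
          by (rule ennreal_leI)
        also have "\<dots> = ennreal \<delta> * (indicator (E 0) x * ennreal (V x)) + (\<Sum>k<N. ennreal (2 * s k) * (indicator (E (s k)) x * ennreal (V x)))"
        proof -
          have i: "ennreal (a * (indicator S x * V x)) = ennreal a * (indicator S x * ennreal (V x))" if "a \<ge> 0" for a S
            using that V[of x] by (cases "x \<in> S") (simp_all add: ennreal_mult)
          have "ennreal (\<Sum>k<N. 2 * s k * (indicator (E (s k)) x * V x)) = (\<Sum>k<N. ennreal (2 * s k * (indicator (E (s k)) x * V x)))"
            using V s(1) by (intro sum_ennreal[symmetric] mult_nonneg_nonneg) (auto intro: less_imp_le)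
          also have "\<dots> = (\<Sum>k<N. ennreal (2 * s k) * (indicator (E (s k)) x * ennreal (V x)))"
            using s(1) by (intro sum.cong i) (auto intro: less_imp_le)
          finally have "ennreal (\<Sum>k<N. 2 * s k * (indicator (E (s k)) x * V x)) = (\<Sum>k<N. ennreal (2 * s k) * (indicator (E (s k)) x * ennreal (V x)))" .
          moreover have "0 \<le> (\<Sum>k<N. 2 * s k * (indicator (E (s k)) x * V x))"
            using V s(1) by (intro sum_nonneg mult_nonneg_nonneg) (auto intro: less_imp_le)
          ultimately show ?thesis using \<delta> V[of x] i[of \<delta> "E 0"] by (subst ennreal_plus) auto
        qed
        finally show "ennreal (V x * ?q x) \<le> ennreal \<delta> * (indicator (E 0) x * ennreal (V x)) +
           (\<Sum>k<N. ennreal (2 * s k) * (indicator (E (s k)) x * ennreal (V x)))" .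
      qed
      also have "\<dots> = ennreal \<delta> * (\<integral>\<^sup>+x. indicator (E 0) x * ennreal (V x) \<partial>lborel) +
          (\<Sum>k<N. ennreal (2 * s k) * (\<integral>\<^sup>+x. indicator (E (s k)) x * ennreal (V x) \<partial>lborel))"
        by (simp add: nn_integral_add nn_integral_sum nn_integral_cmult)
      also have "\<dots> \<le> ennreal \<delta> * ennreal (2 * K * m 0 powr \<theta>) + (\<Sum>k<N. ennreal (2 * s k) * ennreal (2 * K * m (s k) powr \<theta>))"
        by (intro add_mono sum_mono mult_left_mono Ho) (auto intro: less_imp_le s)
      also have "\<dots> = ennreal (\<delta> * (2 * K * m 0 powr \<theta>) + (\<Sum>k<N. 2 * s k * (2 * K * m (s k) powr \<theta>)))"
      proof -
        have "(\<Sum>k<N. ennreal (2 * s k) * ennreal (2 * K * m (s k) powr \<theta>)) = (\<Sum>k<N. ennreal (2 * s k * (2 * K * m (s k) powr \<theta>)))"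
          by (intro sum.cong refl ennreal_mult[symmetric]) (use K0 s(1) in \<open>auto intro: less_imp_le\<close>)
        also have "\<dots> = ennreal (\<Sum>k<N. 2 * s k * (2 * K * m (s k) powr \<theta>))"
          using K0 s(1) by (intro sum_ennreal mult_nonneg_nonneg) (auto intro: less_imp_le)
        finally have *: "(\<Sum>k<N. ennreal (2 * s k) * ennreal (2 * K * m (s k) powr \<theta>)) = ennreal (\<Sum>k<N. 2 * s k * (2 * K * m (s k) powr \<theta>))" .
        have "0 \<le> (\<Sum>k<N. 2 * s k * (2 * K * m (s k) powr \<theta>))"
          using K0 s(1) by (intro sum_nonneg mult_nonneg_nonneg) (auto intro: less_imp_le)
        moreover have "ennreal \<delta> * ennreal (2 * K * m 0 powr \<theta>) = ennreal (\<delta> * (2 * K * m 0 powr \<theta>))"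
          using K0 \<delta> by (intro ennreal_mult[symmetric]) auto
        ultimately show ?thesis unfolding * using K0 \<delta> by (subst ennreal_plus) auto
      qed
      also have "\<dots> \<le> ennreal (\<delta> * (10 * K * m 0 powr \<theta>) + 8 * C * K * G)"
      proof (rule ennreal_leI)
        have "(\<Sum>k<N. 2 * s k * (2 * K * m (s k) powr \<theta>)) = 4 * K * (\<Sum>k<N. c k)"
          by (simp add: c_def sum_distrib_left algebra_simps)
        also have "\<dots> \<le> 4 * K * (2 * (\<delta> * m 0 powr \<theta>) + 2 * (C * G))"
          using K0 by (intro mult_left_mono sumc) auto
        finally show "\<delta> * (2 * K * m 0 powr \<theta>) + (\<Sum>k<N. 2 * s k * (2 * K * m (s k) powr \<theta>)) \<le> \<delta> * (10 * K * m 0 powr \<theta>) + 8 * C * K * G"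
          by (simp add: algebra_simps)
      qed
      finally show ?thesis .
    qed
    \<comment> \<open>Letting \<delta> tend to 0 removes the measure of the support of u, leaving a
      constant independent of u.\<close>
    let ?a = "10 * K * m 0 powr \<theta>"
    have "((\<lambda>\<delta>. ennreal (\<delta> * ?a + 8 * C * K * G)) \<longlongrightarrow> ennreal (0 * ?a + 8 * C * K * G)) (at_right 0)"
      by (intro tendsto_ennrealI tendsto_add tendsto_mult_right tendsto_const tendsto_ident_at)
    then have "(\<integral>\<^sup>+x. ennreal (V x * ?q x) \<partial>lborel) \<le> ennreal (0 * ?a + 8 * C * K * G)"
      by (rule tendsto_lowerbound) (use est in \<open>auto simp: eventually_at_filter\<close>)
    then show ?thesis by (simp add: K_def G_def)
  qed
  then show ?thesis using that[of "8 * C"] C(1) by auto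
qed

text \<open>Cut |R| at height k. The part above k has arbitrarily small L^{n/2} norm by dominated
  convergence, and k is taken so large that \<open>weighted_Sobolev\<close> costs at most \<epsilon>
  times the energy; M is the solution of C M^(2/n) = \<epsilon>. The part below k costs k times the
  L^2 term.\<close>

lemma potential_form_bound:
  fixes R :: "real ^ 'n \<Rightarrow> real"
  assumes n: "CARD('n) \<ge> 3" and [measurable]: "R \<in> borel_measurable borel"
    and R: "integrable lborel (\<lambda>x. \<bar>R x\<bar> powr (real CARD('n) / 2))" and \<epsilon>: "\<epsilon> > 0"
  obtains C where "C \<ge> 0" "\<And>u. cc_smooth u \<Longrightarrow> (\<integral>\<^sup>+x. ennreal (\<bar>R x\<bar> * (cmod (u x))\<^sup>2) \<partial>lborel) \<le>
    ennreal \<epsilon> * (\<Sum>i\<in>UNIV. sq_norm (partial i u)) + ennreal C * sq_norm u"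
proof -
  let ?n = "real CARD('n)"
  obtain C where C: "C > 0" "\<And>(V :: real ^ 'n \<Rightarrow> real) M u. V \<in> borel_measurable borel \<Longrightarrow> (\<And>x. V x \<ge> 0) \<Longrightarrow> M > 0 \<Longrightarrow>
      (\<integral>\<^sup>+x. ennreal (V x powr (?n / 2)) \<partial>lborel) \<le> ennreal M \<Longrightarrow> cc_smooth u \<Longrightarrow>
      (\<integral>\<^sup>+x. ennreal (V x * (cmod (u x))\<^sup>2) \<partial>lborel) \<le> ennreal (C * M powr (2 / ?n) * (LINT x|lborel. grad_sq u x))"
    using weighted_Sobolev[OF n] by blast
  define M where "M = (\<epsilon> / C) powr (?n / 2)"
  have M: "M > 0" "C * M powr (2 / ?n) = \<epsilon>" using \<epsilon> C(1) by (auto simp: M_def powr_powr)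
  define V where "V k x = \<bar>R x\<bar> * indicator {real k<..} \<bar>R x\<bar>" for k x
  have [measurable]: "V k \<in> borel_measurable borel" for k unfolding V_def by measurable
  have "(\<lambda>k. LINT x|lborel. V k x powr (?n / 2)) \<longlonglongrightarrow> (LINT x|(lborel :: (real ^ 'n) measure). 0)"
  proof (rule integral_dominated_convergence[OF _ _ R])
    show "AE x in lborel. (\<lambda>k. V k x powr (?n / 2)) \<longlonglongrightarrow> 0"
    proof (intro AE_I2 tendsto_eventually)
      fix x
      obtain k0 where "\<bar>R x\<bar> < real k0" using reals_Archimedean2 by blast
      then show "\<forall>\<^sub>F k in sequentially. V k x powr (?n / 2) = 0"
        by (intro eventually_sequentiallyI[of k0]) (auto simp: V_def)
    qed
    show "AE x in lborel. norm (V k x powr (?n / 2)) \<le> \<bar>R x\<bar> powr (?n / 2)" for k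
      by (intro AE_I2) (auto simp: V_def indicator_def)
  qed auto
  then have "(\<lambda>k. LINT x|lborel. V k x powr (?n / 2)) \<longlonglongrightarrow> 0" by simp
  from LIMSEQ_D[OF this M(1)] obtain k where k: "(LINT x|lborel. V k x powr (?n / 2)) < M" by fastforce
  have iV: "integrable lborel (\<lambda>x. V k x powr (?n / 2))"
    by (rule Bochner_Integration.integrable_bound[OF R]) (auto simp: V_def indicator_def)
  have "(\<integral>\<^sup>+x. ennreal (V k x powr (?n / 2)) \<partial>lborel) \<le> ennreal M"
    using k by (subst nn_integral_eq_integral[OF iV]) (auto intro: ennreal_leI)
  note CV = C(2)[OF _ _ M(1) this, unfolded M(2)]
  show ?thesis
  proof (rule that[of "real k"])
    fix u :: "real ^ 'n \<Rightarrow> complex" assume u: "cc_smooth u"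
    have [measurable]: "u \<in> borel_measurable borel" by (rule cc_smooth_measurable[OF u])
    have "(\<integral>\<^sup>+x. ennreal (\<bar>R x\<bar> * (cmod (u x))\<^sup>2) \<partial>lborel) \<le>
        (\<integral>\<^sup>+x. ennreal (V k x * (cmod (u x))\<^sup>2) + ennreal (real k) * ennreal ((cmod (u x))\<^sup>2) \<partial>lborel)"
    proof (rule nn_integral_mono)
      fix x
      have "\<bar>R x\<bar> \<le> V k x + real k" by (auto simp: V_def indicator_def)
      then have "\<bar>R x\<bar> * (cmod (u x))\<^sup>2 \<le> (V k x + real k) * (cmod (u x))\<^sup>2" by (rule mult_right_mono) simp
      then have "ennreal (\<bar>R x\<bar> * (cmod (u x))\<^sup>2) \<le> ennreal (V k x * (cmod (u x))\<^sup>2 + real k * (cmod (u x))\<^sup>2)"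
        by (intro ennreal_leI) (simp add: algebra_simps)
      also have "\<dots> = ennreal (V k x * (cmod (u x))\<^sup>2) + ennreal (real k) * ennreal ((cmod (u x))\<^sup>2)"
        by (subst ennreal_plus) (auto simp: V_def ennreal_mult)
      finally show "ennreal (\<bar>R x\<bar> * (cmod (u x))\<^sup>2) \<le> ennreal (V k x * (cmod (u x))\<^sup>2) + ennreal (real k) * ennreal ((cmod (u x))\<^sup>2)" .
    qed
    also have "\<dots> = (\<integral>\<^sup>+x. ennreal (V k x * (cmod (u x))\<^sup>2) \<partial>lborel) + ennreal (real k) * sq_norm u"
      by (simp add: nn_integral_add nn_integral_cmult sq_norm_def)
    also have "(\<integral>\<^sup>+x. ennreal (V k x * (cmod (u x))\<^sup>2) \<partial>lborel) \<le> ennreal (\<epsilon> * (LINT x|lborel. grad_sq u x))"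
      by (rule CV) (use u in \<open>auto simp: V_def\<close>)
    also have "\<dots> = ennreal \<epsilon> * (\<integral>\<^sup>+x. ennreal (grad_sq u x) \<partial>lborel)"
      using \<epsilon> by (subst nn_integral_eq_integral[OF grad_sq_integrable[OF u]]) (auto simp: ennreal_mult)
    finally show "(\<integral>\<^sup>+x. ennreal (\<bar>R x\<bar> * (cmod (u x))\<^sup>2) \<partial>lborel) \<le>
      ennreal \<epsilon> * (\<Sum>i\<in>UNIV. sq_norm (partial i u)) + ennreal (real k) * sq_norm u"
      unfolding nn_integral_grad_sq[OF u] by simp
  qed simp
qed


section \<open>Gaussians and uniqueness of the Fourier transform\<close>

text \<open>The standard normal density, written as a product so that its integrals reduce to the
  one-dimensional normal distribution.\<close>

definition gauss :: "'a::euclidean_space \<Rightarrow> real" where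
  "gauss x = (\<Prod>b\<in>Basis. std_normal_density (x \<bullet> b))"

lemma gauss_measurable [measurable]: "gauss \<in> borel_measurable borel"
  unfolding gauss_def by measurable

lemma gauss_nonneg [simp]: "gauss x \<ge> 0"
  by (simp add: gauss_def prod_nonneg)

lemma nn_integral_gauss: "(\<integral>\<^sup>+x. ennreal (gauss (x::'a::euclidean_space)) \<partial>lborel) = 1"
proof -
  have 1: "(\<integral>\<^sup>+x. ennreal (std_normal_density x) \<partial>lborel) = 1"
  proof -
    have "emeasure std_normal_distribution (space std_normal_distribution) = 1"
      by (rule prob_space.emeasure_space_1[OF prob_space_normal_density]) simp
    then show ?thesis by (simp add: emeasure_density)
  qed
  have "(\<integral>\<^sup>+x. ennreal (gauss (x::'a)) \<partial>lborel) = (\<integral>\<^sup>+x. (\<Prod>b\<in>Basis. ennreal (std_normal_density (x \<bullet> b))) \<partial>(lborel::'a measure))"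
    unfolding gauss_def by (simp add: prod_ennreal)
  also have "\<dots> = (\<Prod>b\<in>(Basis::'a set). (\<integral>\<^sup>+x. ennreal (std_normal_density x) \<partial>lborel))"
    by (rule nn_integral_lborel_prod) auto
  finally show ?thesis by (simp add: 1)
qed

lemma gauss_integrable: "integrable lborel (gauss :: 'a::euclidean_space \<Rightarrow> real)"
  by (rule integrableI_nonneg) (simp_all add: nn_integral_gauss)

lemma gauss_eq: "gauss (x::'a::euclidean_space) = (1 / sqrt (2 * pi)) ^ DIM('a) * exp (- (norm x)\<^sup>2 / 2)"
proof -
  have "(norm x)\<^sup>2 = (\<Sum>b\<in>Basis. (x \<bullet> b)\<^sup>2)"
    unfolding power2_norm_eq_inner by (subst euclidean_inner) (simp add: power2_eq_square)
  then have "exp (- (norm x)\<^sup>2 / 2) = (\<Prod>b\<in>Basis. exp (- (x \<bullet> b)\<^sup>2 / 2))"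
    by (simp add: exp_sum[symmetric] sum_negf sum_divide_distrib)
  then show ?thesis unfolding gauss_def std_normal_density_def prod.distrib prod_constant by (simp only:)
qed

text \<open>Fubini over the coordinates. The factors carry the parameter \<xi> \<bullet> b because
  they will contain the one-dimensional characters.\<close>

lemma integral_lborel_prod:
  fixes f :: "real \<Rightarrow> real \<Rightarrow> complex" and \<xi> :: "'a::euclidean_space"
  assumes "\<And>t. integrable lborel (f t)"
  shows "(LINT x|lborel. (\<Prod>b\<in>Basis. f (\<xi> \<bullet> b) (x \<bullet> b))) = (\<Prod>b\<in>Basis. LINT x|lborel. f (\<xi> \<bullet> b) x)"
proof -
  interpret product_sigma_finite "\<lambda>_::'a. lborel :: real measure" by standard
  have [measurable]: "f t \<in> borel_measurable borel" for t using assms[of t] by simp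
  have "(LINT x|lborel. (\<Prod>b\<in>Basis. f (\<xi> \<bullet> b) (x \<bullet> b))) =
     (LINT x|(\<Pi>\<^sub>M b\<in>(Basis::'a set). lborel). (\<Prod>b\<in>Basis. f (\<xi> \<bullet> b) (x b)))"
    by (subst lborel_eq, subst integral_distr) (auto intro!: Bochner_Integration.integral_cong prod.cong)
  also have "\<dots> = (\<Prod>b\<in>Basis. LINT x|lborel. f (\<xi> \<bullet> b) x)"
    by (rule product_integral_prod) (auto simp: assms)
  finally show ?thesis .
qed

text \<open>The character splits over the coordinates, and each factor is the characteristic
  function of the standard normal distribution.\<close>

lemma gauss_fourier: "(LINT z|lborel. gauss z *\<^sub>R cis (z \<bullet> \<xi>)) = complex_of_real (exp (- (norm \<xi>)\<^sup>2 / 2))"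
  for \<xi> :: "'a::euclidean_space"
proof -
  let ?f = "\<lambda>t x. std_normal_density x *\<^sub>R cis (x * t)"
  have int: "integrable lborel (?f t)" for t
  proof (rule Bochner_Integration.integrable_bound)
    show "integrable lborel std_normal_density" by simp
    have "?f t = (\<lambda>x. std_normal_density x *\<^sub>R exp (\<i> * complex_of_real (x * t)))" by (simp add: cis_conv_exp)
    also have "\<dots> \<in> borel_measurable lborel" by measurable
    finally show "?f t \<in> borel_measurable lborel" .
  qed auto
  have one: "(LINT x|lborel. ?f t x) = complex_of_real (exp (- t\<^sup>2 / 2))" for t
  proof -
    have "char std_normal_distribution t = (LINT x|lborel. std_normal_density x *\<^sub>R exp (\<i> * complex_of_real (t * x)))"
      unfolding char_def by (subst integral_density) auto
    then show ?thesis unfolding char_std_normal_distribution by (simp add: cis_conv_exp mult.commute)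
  qed
  have "(LINT z|lborel. gauss z *\<^sub>R cis (z \<bullet> \<xi>)) = (LINT z|lborel. (\<Prod>b\<in>Basis. ?f (\<xi> \<bullet> b) (z \<bullet> b)))"
  proof (rule Bochner_Integration.integral_cong[OF refl])
    fix z :: 'a
    have "cis (z \<bullet> \<xi>) = exp (\<Sum>b\<in>Basis. \<i> * complex_of_real ((z \<bullet> b) * (\<xi> \<bullet> b)))"
      by (subst euclidean_inner) (simp add: cis_conv_exp sum_distrib_left)
    also have "\<dots> = (\<Prod>b\<in>Basis. cis ((z \<bullet> b) * (\<xi> \<bullet> b)))"
      by (simp add: exp_sum cis_conv_exp)
    finally show "gauss z *\<^sub>R cis (z \<bullet> \<xi>) = (\<Prod>b\<in>Basis. ?f (\<xi> \<bullet> b) (z \<bullet> b))"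
      by (simp add: gauss_def scaleR_conv_of_real prod.distrib)
  qed
  also have "\<dots> = (\<Prod>b\<in>Basis. complex_of_real (exp (- (\<xi> \<bullet> b)\<^sup>2 / 2)))"
    by (subst integral_lborel_prod[OF int]) (simp only: one)
  also have "\<dots> = complex_of_real (exp (- (norm \<xi>)\<^sup>2 / 2))"
  proof -
    have "(norm \<xi>)\<^sup>2 = (\<Sum>b\<in>Basis. (\<xi> \<bullet> b)\<^sup>2)"
      unfolding power2_norm_eq_inner by (subst euclidean_inner) (simp add: power2_eq_square)
    then have "exp (- (norm \<xi>)\<^sup>2 / 2) = (\<Prod>b\<in>Basis. exp (- (\<xi> \<bullet> b)\<^sup>2 / 2))"
      by (simp add: exp_sum[symmetric] sum_negf sum_divide_distrib)
    then show ?thesis by simp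
  qed
  finally show ?thesis .
qed

text \<open>Since t <= exp (3 t^2 / 8), the factor |z| is paid for by widening the Gaussian: exp
  (-|z|^2/2 + 3 |z|^2/8) is the exponential of the Gaussian at z/2.\<close>

lemma gauss_first_moment: "(\<integral>\<^sup>+z. ennreal (gauss z * norm z) \<partial>(lborel::'a::euclidean_space measure)) < \<infinity>"
proof -
  define c where "c = (1 / sqrt (2 * pi)) ^ DIM('a)"
  have c: "c > 0" by (simp add: c_def)
  have t: "t \<le> exp (t\<^sup>2 * (3 / 8))" if "t \<ge> 0" for t :: real
  proof -
    have "t \<le> 1 + t\<^sup>2 * (3 / 8)"
      using zero_le_power2[of "t * 3 / 4 - 1"] that by (simp add: power2_eq_square algebra_simps)
    also have "\<dots> \<le> exp (t\<^sup>2 * (3 / 8))" by (rule exp_ge_add_one_self)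
    finally show ?thesis .
  qed
  have "gauss z * norm z \<le> gauss ((1 / 2) *\<^sub>R z)" for z :: 'a
  proof -
    have "gauss z * norm z \<le> gauss z * exp ((norm z)\<^sup>2 * (3 / 8))"
      by (intro mult_left_mono t) auto
    also have "\<dots> = c * exp (- (norm z)\<^sup>2 / 2 + (norm z)\<^sup>2 * (3 / 8))"
      unfolding gauss_eq c_def by (subst exp_add) simp
    also have "- (norm z)\<^sup>2 / 2 + (norm z)\<^sup>2 * (3 / 8) = - (norm ((1 / 2) *\<^sub>R z))\<^sup>2 / 2"
      by (simp add: power_mult_distrib field_simps power2_eq_square)
    finally show ?thesis by (simp only: gauss_eq c_def)
  qed
  then have "(\<integral>\<^sup>+z. ennreal (gauss z * norm z) \<partial>(lborel::'a measure)) \<le> (\<integral>\<^sup>+z. ennreal (gauss ((1 / 2) *\<^sub>R (z::'a))) \<partial>lborel)"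
    by (intro nn_integral_mono ennreal_leI)
  also have "\<dots> < \<infinity>"
  proof -
    have "1 = ennreal ((1 / 2) ^ DIM('a)) * (\<integral>\<^sup>+z. ennreal (gauss ((1 / 2) *\<^sub>R (z::'a))) \<partial>lborel)"
      using nn_integral_lborel_scale[of "\<lambda>x. ennreal (gauss (x::'a))" "1 / 2"] nn_integral_gauss[where 'a='a] by simp
    then have "(\<integral>\<^sup>+z. ennreal (gauss ((1 / 2) *\<^sub>R (z::'a))) \<partial>lborel) \<noteq> \<infinity>"
      by (metis ennreal_mult_eq_top_iff ennreal_eq_0_iff infinity_ennreal_def not_le one_neq_zero ennreal_1 ennreal_neq_top zero_less_divide_1_iff zero_less_numeral zero_less_power)
    then show ?thesis by (simp add: top.not_eq_extremum)
  qed
  finally show ?thesis .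
qed

section \<open>Injectivity of the Fourier transform on L^1\<close>

text \<open>If all Fourier coefficients of \<open>F\<close> vanish, so do its convolutions with Gaussians, because a
  Gaussian is itself a superposition of characters.\<close>

lemma fourier_unique:
  fixes F :: "'a::euclidean_space \<Rightarrow> complex"
  assumes F: "integrable lborel F" and z: "\<And>\<xi>. (LINT x|lborel. cis (- (x \<bullet> \<xi>)) * F x) = 0"
  shows "AE x in lborel. F x = 0"
proof -
  have [measurable]: "F \<in> borel_measurable borel" using F by simp
  have [measurable]: "(\<lambda>x::'a. cis (h x)) \<in> borel_measurable M" if "h \<in> borel_measurable M" for h and M
    unfolding cis_conv_exp using that by measurable
  have [measurable]: "(\<lambda>x. cis (h x)) \<in> borel_measurable M" if "h \<in> borel_measurable M" for h and M :: "('a \<times> 'a) measure"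
    unfolding cis_conv_exp using that by measurable
  define c where "c = (1 / sqrt (2 * pi)) ^ DIM('a)"
  define w where "w y = (\<integral>\<^sup>+x. ennreal (cmod (F (x + y) - F x)) \<partial>lborel)" for y
  have [measurable]: "w \<in> borel_measurable borel" unfolding w_def by measurable
  define h where "h k y = real (Suc k) ^ DIM('a) * gauss (real (Suc k) *\<^sub>R y)" for k :: nat and y :: 'a
  have h0: "h k y \<ge> 0" for k y by (simp add: h_def)
  have [measurable]: "h k \<in> borel_measurable borel" for k unfolding h_def by measurable
  have h1: "(\<integral>\<^sup>+y. ennreal (h k y) \<partial>lborel) = 1" for k
  proof -
    have "(\<integral>\<^sup>+y. ennreal (h k y) \<partial>lborel) = ennreal (real (Suc k) ^ DIM('a)) * (\<integral>\<^sup>+y. ennreal (gauss (real (Suc k) *\<^sub>R (y::'a))) \<partial>lborel)"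
      unfolding h_def by (subst nn_integral_cmult[symmetric]) (auto intro!: nn_integral_cong ennreal_mult)
    also have "\<dots> = 1" using nn_integral_lborel_scale[of "\<lambda>x. ennreal (gauss (x::'a))" "real (Suc k)"] nn_integral_gauss[where 'a='a] by simp
    finally show ?thesis .
  qed
  have conv0: "convolve F (h k) x = 0" for k x
  proof -
    let ?k = "real (Suc k)"
    \<comment> \<open>Up to the constant c the Gaussian is its own Fourier transform. Inserting this
      and exchanging the integrals leaves the Fourier coefficients of F, which vanish.\<close>
    have g: "complex_of_real (gauss (y::'a)) = complex_of_real c * (LINT \<xi>|lborel. gauss \<xi> *\<^sub>R cis (\<xi> \<bullet> y))" for y
      unfolding gauss_fourier by (simp add: gauss_eq c_def)
    have "convolve F (h k) x = (LINT y|lborel. h k (x - y) *\<^sub>R F y)"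
      by (rule convolve_swap) auto
    also have "\<dots> = (LINT y|lborel. complex_of_real (?k ^ DIM('a) * c) * (LINT \<xi>|lborel. gauss \<xi> *\<^sub>R cis (\<xi> \<bullet> (?k *\<^sub>R (x - y))) * F y))"
    proof (rule Bochner_Integration.integral_cong[OF refl])
      fix y
      have "h k (x - y) *\<^sub>R F y = complex_of_real (?k ^ DIM('a)) * complex_of_real (gauss (?k *\<^sub>R (x - y))) * F y"
        by (simp add: h_def scaleR_conv_of_real)
      also have "\<dots> = complex_of_real (?k ^ DIM('a) * c) * ((LINT \<xi>|lborel. gauss \<xi> *\<^sub>R cis (\<xi> \<bullet> (?k *\<^sub>R (x - y)))) * F y)"
        unfolding g by simp
      finally show "h k (x - y) *\<^sub>R F y = complex_of_real (?k ^ DIM('a) * c) * (LINT \<xi>|lborel. gauss \<xi> *\<^sub>R cis (\<xi> \<bullet> (?k *\<^sub>R (x - y))) * F y)"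
        by (simp only: integral_mult_left_zero)
    qed
    also have "\<dots> = complex_of_real (?k ^ DIM('a) * c) * (LINT y|lborel. LINT \<xi>|lborel. gauss \<xi> *\<^sub>R cis (\<xi> \<bullet> (?k *\<^sub>R (x - y))) * F y)"
      by simp
    also have "(LINT y|lborel. LINT \<xi>|lborel. gauss \<xi> *\<^sub>R cis (\<xi> \<bullet> (?k *\<^sub>R (x - y))) * F y) =
       (LINT \<xi>|lborel. LINT y|lborel. gauss \<xi> *\<^sub>R cis (\<xi> \<bullet> (?k *\<^sub>R (x - y))) * F y)"
    proof (rule lborel_pair.Fubini_integral)
      have "integrable (lborel \<Otimes>\<^sub>M lborel) (\<lambda>(\<xi>, y). gauss (\<xi>::'a) *\<^sub>R F y)"
        by (rule lborel_pair.Fubini_integrable) (simp_all add: gauss_integrable F)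
      then show "integrable (lborel \<Otimes>\<^sub>M lborel) (\<lambda>(\<xi>, y). gauss \<xi> *\<^sub>R cis (\<xi> \<bullet> (?k *\<^sub>R (x - y))) * F y)"
        by (rule Bochner_Integration.integrable_bound) (auto simp: norm_mult)
    qed
    also have "\<dots> = 0"
    proof -
      have "(LINT y|lborel. gauss \<xi> *\<^sub>R cis (\<xi> \<bullet> (?k *\<^sub>R (x - y))) * F y) = 0" for \<xi>
      proof -
        have "gauss \<xi> *\<^sub>R cis (\<xi> \<bullet> (?k *\<^sub>R (x - y))) * F y =
           gauss \<xi> *\<^sub>R cis (?k * (\<xi> \<bullet> x)) * (cis (- (y \<bullet> (?k *\<^sub>R \<xi>))) * F y)" for y
          by (simp add: cis_mult inner_diff_right inner_commute algebra_simps del: of_nat_Suc)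
        then show ?thesis by (simp only: integral_mult_right_zero z mult_zero_right)
      qed
      then show ?thesis by (simp only: integral_zero)
    qed
    finally show ?thesis by simp
  qed
  \<comment> \<open>As the convolution is zero, the L^1 norm of F is its distance from the
    convolution, hence at most an average of translation moduli; rescaling moves k from the kernel
    into the displacement.\<close>
  have le: "(\<integral>\<^sup>+x. ennreal (cmod (F x)) \<partial>lborel) \<le> (\<integral>\<^sup>+y. ennreal (gauss y) * w ((- 1 / real (Suc k)) *\<^sub>R y) \<partial>lborel)" for k
  proof -
    have "(\<integral>\<^sup>+x. ennreal (cmod (F x)) \<partial>lborel) \<le> (\<integral>\<^sup>+y. ennreal (h k y) * w (- y) \<partial>lborel)"
      using convolve_L1_diff[of F "h k"] h0 h1 conv0 by (simp add: w_def)
    also have "\<dots> = ennreal (real (Suc k) ^ DIM('a)) * (\<integral>\<^sup>+y. ennreal (gauss (real (Suc k) *\<^sub>R y)) * w ((- 1 / real (Suc k)) *\<^sub>R (real (Suc k) *\<^sub>R y)) \<partial>lborel)"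
      unfolding h_def by (subst nn_integral_cmult[symmetric]) (auto intro!: nn_integral_cong simp: ennreal_mult mult.assoc)
    also have "\<dots> = (\<integral>\<^sup>+y. ennreal (gauss y) * w ((- 1 / real (Suc k)) *\<^sub>R y) \<partial>lborel)"
      by (subst (2) nn_integral_lborel_scale[of _ "real (Suc k)"]) auto
    finally show ?thesis .
  qed
  have wl: "w y = ennreal (LINT x|lborel. cmod (F (x + y) - F x))" for y
    unfolding w_def using integrable_lborel_shift[OF F, of y] F by (intro nn_integral_eq_integral) auto
  define A where "A = (LINT x|lborel. cmod (F x))"
  have wA: "w y \<le> ennreal (2 * A)" for y
    using L1_modulus_approx[OF F, of "\<lambda>_. 0" y] unfolding wl A_def by (intro ennreal_leI) simp
  \<comment> \<open>These Gaussian kernels lack compact support, so dominated convergence with the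
    bound w <= 2 A takes the place of a support argument.\<close>
  have "(\<lambda>k. \<integral>\<^sup>+y. ennreal (gauss y) * w ((- 1 / real (Suc k)) *\<^sub>R y) \<partial>lborel) \<longlonglongrightarrow> (\<integral>\<^sup>+y. 0 \<partial>(lborel::'a measure))"
  proof (rule nn_integral_dominated_convergence[where w="\<lambda>y. ennreal (gauss y) * ennreal (2 * A)"])
    show "(\<integral>\<^sup>+y. ennreal (gauss (y::'a)) * ennreal (2 * A) \<partial>lborel) < \<infinity>"
      by (subst nn_integral_multc) (auto simp: nn_integral_gauss)
    show "AE y in lborel. (\<lambda>k. ennreal (gauss y) * w ((- 1 / real (Suc k)) *\<^sub>R y)) \<longlonglongrightarrow> 0"
    proof (rule AE_I2)
      fix y :: 'a
      have "(\<lambda>k. - 1 * inverse (real (Suc k))) \<longlonglongrightarrow> - 1 * 0" by (intro tendsto_mult_left LIMSEQ_inverse_real_of_nat)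
      then have "(\<lambda>k. (- 1 / real (Suc k)) *\<^sub>R y) \<longlonglongrightarrow> 0 *\<^sub>R y" by (intro tendsto_scaleR) (simp_all add: divide_inverse)
      then have "(\<lambda>k. (- 1 / real (Suc k)) *\<^sub>R y) \<longlonglongrightarrow> 0" by simp
      from L1_translation_sequentially[OF F this]
      have "(\<lambda>k. w ((- 1 / real (Suc k)) *\<^sub>R y)) \<longlonglongrightarrow> ennreal 0" unfolding wl by (rule tendsto_ennrealI)
      then have "(\<lambda>k. ennreal (gauss y) * w ((- 1 / real (Suc k)) *\<^sub>R y)) \<longlonglongrightarrow> ennreal (gauss y) * 0"
        by (intro ennreal_tendsto_cmult) auto
      then show "(\<lambda>k. ennreal (gauss y) * w ((- 1 / real (Suc k)) *\<^sub>R y)) \<longlonglongrightarrow> 0" by simp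
    qed
    show "AE y in lborel. ennreal (gauss y) * w ((- 1 / real (Suc k)) *\<^sub>R y) \<le> ennreal (gauss y) * ennreal (2 * A)" for k
      using wA by (intro AE_I2 mult_left_mono) auto
  qed auto
  from LIMSEQ_le_const[OF this] le
  have "(\<integral>\<^sup>+x. ennreal (cmod (F x)) \<partial>lborel) \<le> 0" by simp
  then have "(\<integral>\<^sup>+x. ennreal (cmod (F x)) \<partial>lborel) = 0" by simp
  then have "AE x in lborel. ennreal (cmod (F x)) = 0" by (subst (asm) nn_integral_0_iff_AE) auto
  then show ?thesis by eventually_elim (simp only: ennreal_eq_0_iff norm_le_zero_iff)
qed


section \<open>The fractional derivative\<close>

text \<open>$D^s f$ is constructed as the average of the differences $f - f(\cdot - h(p))$ against a weight
  $\kappa(p)\,dp$; its Fourier transform is then $\hat f(\xi)$ times the average of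
  $1 - e^{-i h(p)\cdot\xi}$.\<close>

lemma cis_measurable [measurable (raw)]:
  "h \<in> borel_measurable M \<Longrightarrow> (\<lambda>x. cis (h x)) \<in> borel_measurable M"
  unfolding cis_conv_exp by measurable

text \<open>\<open>?W\<close> is the norm of the integrand in L^1 of the product space, so Fubini
  gives both the L^1 bound and the exchange of integrals in the Fourier transform, where a
  translation by h becomes multiplication by a character.\<close>

lemma difference_average:
  fixes f :: "'a::euclidean_space \<Rightarrow> complex" and \<kappa> :: "'b::euclidean_space \<Rightarrow> real" and h :: "'b \<Rightarrow> 'a"
  assumes f: "integrable lborel f" and [measurable]: "\<kappa> \<in> borel_measurable borel" "h \<in> borel_measurable borel"
    and \<kappa>: "\<And>p. \<kappa> p \<ge> 0"
    and fin: "(\<integral>\<^sup>+p. ennreal (\<kappa> p) * (\<integral>\<^sup>+x. ennreal (cmod (f (x + (- h p)) - f x)) \<partial>lborel) \<partial>lborel) < \<infinity>" (is "?W < \<infinity>")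
  defines "F \<equiv> \<lambda>x. LINT p|lborel. \<kappa> p *\<^sub>R (f x - f (x - h p))"
  shows "integrable lborel F" "(\<integral>\<^sup>+x. ennreal (cmod (F x)) \<partial>lborel) \<le> ?W"
    "(LINT x|lborel. cis (- (x \<bullet> \<xi>)) * F x) =
       (LINT p|lborel. \<kappa> p *\<^sub>R (1 - cis (- (h p \<bullet> \<xi>)))) * (LINT x|lborel. cis (- (x \<bullet> \<xi>)) * f x)"
proof -
  have [measurable]: "f \<in> borel_measurable borel" using f by simp
  have W: "(\<integral>\<^sup>+x. (\<integral>\<^sup>+p. ennreal (norm (\<kappa> p *\<^sub>R (f x - f (x - h p)))) \<partial>lborel) \<partial>lborel) = ?W"
  proof -
    have "(\<integral>\<^sup>+x. (\<integral>\<^sup>+p. ennreal (norm (\<kappa> p *\<^sub>R (f x - f (x - h p)))) \<partial>lborel) \<partial>lborel) =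
       (\<integral>\<^sup>+p. (\<integral>\<^sup>+x. ennreal (norm (\<kappa> p *\<^sub>R (f x - f (x - h p)))) \<partial>lborel) \<partial>lborel)"
      by (rule lborel_pair.Fubini') measurable
    also have "\<dots> = ?W"
    proof (rule nn_integral_cong)
      fix p
      have "(\<integral>\<^sup>+x. ennreal (norm (\<kappa> p *\<^sub>R (f x - f (x - h p)))) \<partial>lborel) =
          (\<integral>\<^sup>+x. ennreal (\<kappa> p) * ennreal (cmod (f (x + (- h p)) - f x)) \<partial>lborel)"
        using \<kappa>[of p] by (intro nn_integral_cong) (simp add: ennreal_mult norm_minus_commute)
      then show "(\<integral>\<^sup>+x. ennreal (norm (\<kappa> p *\<^sub>R (f x - f (x - h p)))) \<partial>lborel) =
          ennreal (\<kappa> p) * (\<integral>\<^sup>+x. ennreal (cmod (f (x + (- h p)) - f x)) \<partial>lborel)"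
        by (simp add: nn_integral_cmult)
    qed
    finally show ?thesis .
  qed
  have int: "integrable (lborel \<Otimes>\<^sub>M lborel) (\<lambda>(x, p). \<kappa> p *\<^sub>R (f x - f (x - h p)))"
  proof (rule integrableI_bounded)
    have "(\<integral>\<^sup>+z. ennreal (norm (case z of (x, p) \<Rightarrow> \<kappa> p *\<^sub>R (f x - f (x - h p)))) \<partial>(lborel \<Otimes>\<^sub>M lborel)) = ?W"
      unfolding W[symmetric] by (subst lborel.nn_integral_fst[symmetric]) auto
    then show "(\<integral>\<^sup>+z. ennreal (norm (case z of (x, p) \<Rightarrow> \<kappa> p *\<^sub>R (f x - f (x - h p)))) \<partial>(lborel \<Otimes>\<^sub>M lborel)) < \<infinity>"
      using fin by simp
  qed measurable
  show F1: "integrable lborel F"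
    unfolding F_def using lborel_pair.integrable_fst'[OF int] by simp
  have "(\<integral>\<^sup>+x. ennreal (cmod (F x)) \<partial>lborel) \<le> (\<integral>\<^sup>+x. (\<integral>\<^sup>+p. ennreal (norm (\<kappa> p *\<^sub>R (f x - f (x - h p)))) \<partial>lborel) \<partial>lborel)"
  proof (rule nn_integral_mono)
    fix x
    show "ennreal (cmod (F x)) \<le> (\<integral>\<^sup>+p. ennreal (norm (\<kappa> p *\<^sub>R (f x - f (x - h p)))) \<partial>lborel)"
    proof (cases "integrable lborel (\<lambda>p. \<kappa> p *\<^sub>R (f x - f (x - h p)))")
      case True
      then show ?thesis unfolding F_def by (rule integral_norm_bound_ennreal)
    qed (simp add: F_def not_integrable_integral_eq)
  qed
  then show "(\<integral>\<^sup>+x. ennreal (cmod (F x)) \<partial>lborel) \<le> ?W" unfolding W .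
  let ?e = "\<lambda>x. cis (- (x \<bullet> \<xi>))"
  have ef: "integrable lborel (\<lambda>x. ?e x * f x)"
    by (rule Bochner_Integration.integrable_bound[OF f]) (auto simp: norm_mult)
  have "(LINT x|lborel. ?e x * F x) = (LINT x|lborel. LINT p|lborel. ?e x * (\<kappa> p *\<^sub>R (f x - f (x - h p))))"
    unfolding F_def by (simp only: integral_mult_right_zero)
  also have "\<dots> = (LINT p|lborel. LINT x|lborel. ?e x * (\<kappa> p *\<^sub>R (f x - f (x - h p))))"
  proof (rule lborel_pair.Fubini_integral[symmetric])
    show "integrable (lborel \<Otimes>\<^sub>M lborel) (\<lambda>(x, p). ?e x * (\<kappa> p *\<^sub>R (f x - f (x - h p))))"
      by (rule Bochner_Integration.integrable_bound[OF int]) (auto simp: norm_mult)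
  qed
  also have "\<dots> = (LINT p|lborel. \<kappa> p *\<^sub>R (1 - cis (- (h p \<bullet> \<xi>))) * (LINT x|lborel. ?e x * f x))"
  proof (rule Bochner_Integration.integral_cong[OF refl])
    fix p
    have sh: "integrable lborel (\<lambda>x. ?e (x + (- h p)) * f (x + (- h p)))"
      by (rule integrable_lborel_shift[OF ef])
    have "(LINT x|lborel. ?e x * (\<kappa> p *\<^sub>R (f x - f (x - h p)))) =
       (LINT x|lborel. \<kappa> p *\<^sub>R (?e x * f x - ?e (h p) * (?e (x + (- h p)) * f (x + (- h p)))))"
    proof (rule Bochner_Integration.integral_cong[OF refl])
      fix x
      have "?e x = ?e (h p) * ?e (x + (- h p))" by (simp add: cis_mult inner_add_left inner_diff_left)
      then show "?e x * (\<kappa> p *\<^sub>R (f x - f (x - h p))) =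
         \<kappa> p *\<^sub>R (?e x * f x - ?e (h p) * (?e (x + (- h p)) * f (x + (- h p))))"
        by (simp only: diff_conv_add_uminus[symmetric] mult.assoc[symmetric]) (simp add: algebra_simps)
    qed
    also have "\<dots> = \<kappa> p *\<^sub>R ((LINT x|lborel. ?e x * f x) - ?e (h p) * (LINT x|lborel. ?e (x + (- h p)) * f (x + (- h p))))"
      using ef sh by (subst integral_scaleR_right, subst Bochner_Integration.integral_diff)
        (simp_all only: integral_mult_right_zero integrable_mult_right)
    also have "(LINT x|lborel. ?e (x + (- h p)) * f (x + (- h p))) = (LINT x|lborel. ?e x * f x)"
      by (rule integral_lborel_shift) measurable
    finally show "(LINT x|lborel. ?e x * (\<kappa> p *\<^sub>R (f x - f (x - h p)))) =
        \<kappa> p *\<^sub>R (1 - cis (- (h p \<bullet> \<xi>))) * (LINT x|lborel. ?e x * f x)"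
      by (simp add: algebra_simps)
  qed
  finally show "(LINT x|lborel. ?e x * F x) = (LINT p|lborel. \<kappa> p *\<^sub>R (1 - cis (- (h p \<bullet> \<xi>)))) * (LINT x|lborel. ?e x * f x)"
    by (simp only: integral_mult_left_zero)
qed

section \<open>The weight that produces the symbol |xi|^s\<close>

text \<open>A density in (r, z) for the displacement r z. Up to a constant the image measure is the
  usual |y|^(-n-s) dy, but here z is Gaussian, so that integrating it out gives 1 - exp (-(r |xi|)^2
  / 2) in closed form and avoids spherical integrals.\<close>

definition frac_kernel :: "real \<Rightarrow> real \<times> 'a::euclidean_space \<Rightarrow> real" where
  "frac_kernel s p = (if fst p > 0 then fst p powr (- 1 - s) * gauss (snd p) else 0)"

lemma frac_kernel_measurable [measurable]: "frac_kernel s \<in> borel_measurable borel"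
proof -
  have "frac_kernel s \<in> borel_measurable (borel \<Otimes>\<^sub>M borel)"
    unfolding frac_kernel_def by measurable
  then show ?thesis by (simp add: borel_prod)
qed

lemma frac_kernel_nonneg [simp]: "frac_kernel s p \<ge> 0"
  by (simp add: frac_kernel_def)

lemma powr_head_integral:
  assumes "s < 1" "R > 0"
  shows "(\<integral>\<^sup>+r. ennreal (r powr (- s)) * indicator {0..R} r \<partial>lborel) = ennreal (R powr (1 - s) / (1 - s))"
  using nn_integral_has_integral_lebesgue'[OF _ has_integral_powr_from_0[of "- s" R]] assms
  by (simp add: add.commute)

lemma powr_tail_integral:
  assumes "s > 0" "R > 0"
  shows "(\<integral>\<^sup>+r. ennreal (r powr (- 1 - s)) * indicator {R..} r \<partial>lborel) = ennreal (R powr (- s) / s)"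
  using nn_integral_has_integral_lebesgue'[OF _ has_integral_powr_to_inf[of "- 1 - s" R]] assms
  by simp

text \<open>The weight integrates the modulus of continuity of a function of class $W^{1,1}$.\<close>

lemma frac_kernel_bound:
  fixes w :: "'a::euclidean_space \<Rightarrow> ennreal"
  assumes s: "0 < s" "s < 1" and R: "R > 0" and [measurable]: "w \<in> borel_measurable borel"
    and K: "\<And>y. w y \<le> ennreal (K * norm y)" "K \<ge> 0" and A: "\<And>y. w y \<le> A"
  shows "(\<integral>\<^sup>+p. ennreal (frac_kernel s p) * w (- (fst p *\<^sub>R snd p)) \<partial>lborel) \<le>
    ennreal (K * (R powr (1 - s) / (1 - s))) * (\<integral>\<^sup>+z. ennreal (gauss z * norm z) \<partial>(lborel::'a measure))
     + ennreal (R powr (- s) / s) * A"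
proof -
  let ?m = "\<integral>\<^sup>+z. ennreal (gauss z * norm z) \<partial>(lborel::'a measure)"
  let ?G = "\<lambda>r z::'a. ennreal (frac_kernel s (r, z)) * w (- (r *\<^sub>R z))"
  have [measurable]: "(\<lambda>(r, z::'a). frac_kernel s (r, z)) \<in> borel_measurable (borel \<Otimes>\<^sub>M borel)"
    unfolding frac_kernel_def by measurable
  have "(\<integral>\<^sup>+p. ennreal (frac_kernel s p) * w (- (fst p *\<^sub>R snd p)) \<partial>lborel) =
     (\<integral>\<^sup>+p. ennreal (frac_kernel s p) * w (- (fst p *\<^sub>R snd p)) \<partial>(lborel \<Otimes>\<^sub>M (lborel::'a measure)))"
    by (simp add: lborel_prod)
  also have "\<dots> = (\<integral>\<^sup>+r. (\<integral>\<^sup>+z. ?G r z \<partial>lborel) \<partial>lborel)"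
  proof -
    have "(\<lambda>p. ennreal (frac_kernel s p) * w (- (fst p *\<^sub>R snd p))) \<in> borel_measurable (lborel \<Otimes>\<^sub>M (lborel::'a measure))"
      unfolding frac_kernel_def by measurable
    from lborel.nn_integral_fst[OF this] show ?thesis by simp
  qed
  also have "\<dots> \<le> (\<integral>\<^sup>+r. (ennreal K * ?m) * (ennreal (r powr (- s)) * indicator {0..R} r)
      + A * (ennreal (r powr (- 1 - s)) * indicator {R..} r) \<partial>lborel)"
  proof (rule nn_integral_mono)
    fix r :: real
    \<comment> \<open>For r <= R the Lipschitz bound on \<open>w\<close> gains a factor r and leaves
      r^(-s), integrable at 0 since s < 1; beyond R the bound by \<open>A\<close> leaves r^(-1-s),
      integrable at infinity since s > 0.\<close>
    consider "r \<le> 0" | "0 < r" "r \<le> R" | "r > R" using R by linarith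
    then show "(\<integral>\<^sup>+z. ?G r z \<partial>lborel) \<le> (ennreal K * ?m) * (ennreal (r powr (- s)) * indicator {0..R} r)
      + A * (ennreal (r powr (- 1 - s)) * indicator {R..} r)"
    proof cases
      case 1
      then show ?thesis by (simp add: frac_kernel_def)
    next
      case 2
      have "(\<integral>\<^sup>+z. ?G r z \<partial>lborel) \<le> (\<integral>\<^sup>+z. (ennreal K * ennreal (r powr (- s))) * ennreal (gauss z * norm z) \<partial>(lborel::'a measure))"
      proof (rule nn_integral_mono)
        fix z :: 'a
        have "?G r z \<le> ennreal (r powr (- 1 - s) * gauss z) * ennreal (K * norm (- (r *\<^sub>R z)))"
          using 2 by (intro mult_mono K) (auto simp: frac_kernel_def)
        also have "\<dots> = ennreal (r powr (- 1 - s) * gauss z * (K * norm (- (r *\<^sub>R z))))"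
          using 2 K(2) by (intro ennreal_mult[symmetric]) auto
        also have "r powr (- 1 - s) * gauss z * (K * norm (- (r *\<^sub>R z))) = K * (r powr (- 1 - s) * r) * (gauss z * norm z)"
          using 2 by simp
        also have "r powr (- 1 - s) * r = r powr (- s)"
          using 2 powr_add[of r "- 1 - s" 1] by simp
        also have "ennreal (K * r powr (- s) * (gauss z * norm z)) = (ennreal K * ennreal (r powr (- s))) * ennreal (gauss z * norm z)"
          using K(2) by (simp add: ennreal_mult)
        finally show "?G r z \<le> (ennreal K * ennreal (r powr (- s))) * ennreal (gauss z * norm z)" .
      qed
      also have "\<dots> = (ennreal K * ennreal (r powr (- s))) * ?m"
        by (rule nn_integral_cmult) measurable
      also have "\<dots> = (ennreal K * ?m) * (ennreal (r powr (- s)) * indicator {0..R} r)"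
        using 2 by (simp add: ac_simps)
      finally show ?thesis by (simp add: add_increasing2)
    next
      case 3
      have "(\<integral>\<^sup>+z. ?G r z \<partial>lborel) \<le> (\<integral>\<^sup>+z. (ennreal (r powr (- 1 - s)) * A) * ennreal (gauss z) \<partial>(lborel::'a measure))"
      proof (rule nn_integral_mono)
        fix z :: 'a
        have "?G r z \<le> ennreal (r powr (- 1 - s) * gauss z) * A"
          using 3 R by (intro mult_mono A) (auto simp: frac_kernel_def)
        also have "\<dots> = (ennreal (r powr (- 1 - s)) * A) * ennreal (gauss z)"
          by (simp add: ennreal_mult ac_simps)
        finally show "?G r z \<le> (ennreal (r powr (- 1 - s)) * A) * ennreal (gauss z)" .
      qed
      also have "\<dots> = A * (ennreal (r powr (- 1 - s)) * indicator {R..} r)"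
        using 3 by (subst nn_integral_cmult) (auto simp: nn_integral_gauss ac_simps)
      finally show ?thesis by (simp add: add_increasing)
    qed
  qed
  also have "\<dots> = (ennreal K * ?m) * ennreal (R powr (1 - s) / (1 - s)) + A * ennreal (R powr (- s) / s)"
    using s R by (subst nn_integral_add) (simp_all add: nn_integral_cmult powr_head_integral powr_tail_integral)
  also have "\<dots> = ennreal (K * (R powr (1 - s) / (1 - s))) * ?m + ennreal (R powr (- s) / s) * A"
    using s K(2) by (subst ennreal_mult) (auto simp: ac_simps)
  finally show ?thesis .
qed


lemma cmod_one_minus_cis_le: "cmod (1 - cis t) \<le> \<bar>t\<bar>" "cmod (1 - cis t) \<le> 2"
proof -
  show "cmod (1 - cis t) \<le> \<bar>t\<bar>"
    using iexp_approx1[of t 0] by (simp add: cis_conv_exp norm_minus_commute)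
  show "cmod (1 - cis t) \<le> 2"
    using norm_triangle_ineq4[of 1 "cis t"] by simp
qed

text \<open>The radial integrand of the symbol once the Gaussian variable is integrated out, with a
  = |xi|.\<close>

definition frac_profile :: "real \<Rightarrow> real \<Rightarrow> real \<Rightarrow> real" where
  "frac_profile s a r = (if r > 0 then r powr (- 1 - s) * (1 - exp (- (r * a)\<^sup>2 / 2)) else 0)"

lemma frac_profile_nonneg: "frac_profile s a r \<ge> 0"
  by (simp add: frac_profile_def)

lemma frac_kernel_symbol_aux:
  fixes \<xi> :: "'a::euclidean_space"
  assumes s: "0 < s" "s < 1"
  shows "integrable lborel (frac_profile s (norm \<xi>))"
    "(LINT p|lborel. frac_kernel s p *\<^sub>R (1 - cis (- ((fst p *\<^sub>R snd p) \<bullet> \<xi>)))) =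
      complex_of_real (LINT r|lborel. frac_profile s (norm \<xi>) r)"
proof -
  let ?g = "\<lambda>p. frac_kernel s p *\<^sub>R (1 - cis (- ((fst p *\<^sub>R snd p) \<bullet> \<xi>)))"
  have gm: "?g \<in> borel_measurable (lborel \<Otimes>\<^sub>M lborel)"
    unfolding frac_kernel_def by measurable
  have int: "integrable (lborel \<Otimes>\<^sub>M lborel) ?g"
  proof (rule integrableI_bounded[OF gm])
    \<comment> \<open>This function has the same two bounds as a modulus of continuity, |xi| |y| and
      2, so \<open>frac_kernel_bound\<close> also yields integrability of the symbol.\<close>
    define w where "w y = ennreal (cmod (1 - cis (y \<bullet> \<xi>)))" for y :: 'a
    have "w y \<le> ennreal (norm \<xi> * norm y)" for y
      unfolding w_def using cmod_one_minus_cis_le(1)[of "y \<bullet> \<xi>"] Cauchy_Schwarz_ineq2[of y \<xi>]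
      by (intro ennreal_leI) (simp add: mult.commute)
    moreover have "w y \<le> ennreal 2" for y
      unfolding w_def by (intro ennreal_leI cmod_one_minus_cis_le)
    moreover have "w \<in> borel_measurable borel" unfolding w_def by measurable
    ultimately have "(\<integral>\<^sup>+p. ennreal (frac_kernel s p) * w (- (fst p *\<^sub>R snd p)) \<partial>lborel) \<le>
      ennreal (norm \<xi> * (1 powr (1 - s) / (1 - s))) * (\<integral>\<^sup>+z. ennreal (gauss z * norm z) \<partial>(lborel::'a measure))
       + ennreal (1 powr (- s) / s) * ennreal 2"
      by (intro frac_kernel_bound s) auto
    also have "\<dots> < \<infinity>"
      using gauss_first_moment[where 'a='a] by (simp add: ennreal_mult_less_top ennreal_mult_eq_top_iff)
    finally have "(\<integral>\<^sup>+p. ennreal (frac_kernel s p) * w (- (fst p *\<^sub>R snd p)) \<partial>lborel) < \<infinity>" .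
    moreover have "ennreal (norm (?g p)) = ennreal (frac_kernel s p) * w (- (fst p *\<^sub>R snd p))" for p
      by (simp add: w_def ennreal_mult)
    ultimately show "(\<integral>\<^sup>+p. ennreal (norm (?g p)) \<partial>(lborel \<Otimes>\<^sub>M lborel)) < \<infinity>"
      by (simp add: lborel_prod)
  qed
  have inner: "(LINT z|lborel. ?g (r, z)) = complex_of_real (frac_profile s (norm \<xi>) r)" for r
  proof (cases "r > 0")
    case True
    have gc: "integrable lborel (\<lambda>z. gauss z *\<^sub>R cis (z \<bullet> (- (r *\<^sub>R \<xi>))))"
      by (rule Bochner_Integration.integrable_bound[OF gauss_integrable]) auto
    have "(LINT z|lborel. ?g (r, z)) = (LINT z|lborel. r powr (- 1 - s) *\<^sub>R (gauss z *\<^sub>R 1 - gauss z *\<^sub>R cis (z \<bullet> (- (r *\<^sub>R \<xi>)))))"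
      using True by (intro Bochner_Integration.integral_cong) (auto simp: frac_kernel_def scaleR_diff_right)
    also have "\<dots> = r powr (- 1 - s) *\<^sub>R ((LINT z|lborel. gauss (z::'a) *\<^sub>R (1::complex)) - (LINT z|lborel. gauss z *\<^sub>R cis (z \<bullet> (- (r *\<^sub>R \<xi>)))))"
    proof -
      have "integrable lborel (\<lambda>z::'a. gauss z *\<^sub>R (1::complex))"
        by (rule integrable_scaleR_left) (rule gauss_integrable)
      from Bochner_Integration.integral_diff[OF this gc] show ?thesis by (simp only: integral_scaleR_right)
    qed
    also have "(LINT z|lborel. gauss (z::'a) *\<^sub>R (1::complex)) = 1"
      using nn_integral_gauss[where 'a='a] gauss_integrable[where 'a='a] by (simp add: integral_eq_nn_integral)
    also have "(LINT z|lborel. gauss z *\<^sub>R cis (z \<bullet> (- (r *\<^sub>R \<xi>)))) = complex_of_real (exp (- (norm (- (r *\<^sub>R \<xi>)))\<^sup>2 / 2))"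
      by (rule gauss_fourier)
    also have "norm (- (r *\<^sub>R \<xi>)) = r * norm \<xi>" using True by simp
    finally show ?thesis using True by (simp add: frac_profile_def scaleR_conv_of_real)
  qed (simp add: frac_kernel_def frac_profile_def)
  have "integrable lborel (\<lambda>r. LINT z|lborel. ?g (r, z))"
    by (rule lborel_pair.integrable_fst'[OF int])
  then have "integrable lborel (\<lambda>r. complex_of_real (frac_profile s (norm \<xi>) r))" by (simp only: inner)
  from integrable_Re[OF this] show "integrable lborel (frac_profile s (norm \<xi>))" by simp
  have "(LINT p|lborel. ?g p) = (LINT p|(lborel \<Otimes>\<^sub>M lborel). ?g p)" by (simp add: lborel_prod)
  also have "\<dots> = (LINT r|lborel. LINT z|lborel. ?g (r, z))"
    by (rule lborel_pair.integral_fst'[OF int, symmetric])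
  also have "\<dots> = complex_of_real (LINT r|lborel. frac_profile s (norm \<xi>) r)"
    by (simp only: inner integral_complex_of_real)
  finally show "(LINT p|lborel. ?g p) = complex_of_real (LINT r|lborel. frac_profile s (norm \<xi>) r)" .
qed

text \<open>Substituting r / a for r; this homogeneity is the origin of the power |xi|^s.\<close>

lemma frac_profile_scale:
  assumes s: "0 < s" and a: "a > 0"
  shows "(LINT r|lborel. frac_profile s a r) = a powr s * (LINT r|lborel. frac_profile s 1 r)"
proof -
  have "(LINT r|lborel. frac_profile s a r) = \<bar>inverse a\<bar> *\<^sub>R (LINT r|lborel. frac_profile s a (0 + inverse a * r))"
    by (rule lborel_integral_real_affine) (use a in simp)
  also have "(\<lambda>r. frac_profile s a (0 + inverse a * r)) = (\<lambda>r. a powr (1 + s) * frac_profile s 1 r)"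
  proof
    fix r
    show "frac_profile s a (0 + inverse a * r) = a powr (1 + s) * frac_profile s 1 r"
    proof (cases "r > 0")
      case True
      have "(inverse a * r) powr (- 1 - s) = a powr (1 + s) * r powr (- 1 - s)"
        using True a by (simp add: powr_mult powr_minus[symmetric] inverse_powr add.commute)
      then show ?thesis using True a by (simp add: frac_profile_def)
    qed (use a in \<open>simp add: frac_profile_def zero_less_mult_iff\<close>)
  qed
  also have "\<bar>inverse a\<bar> *\<^sub>R (LINT r|lborel. a powr (1 + s) * frac_profile s 1 r) = (inverse a * a powr (1 + s)) * (LINT r|lborel. frac_profile s 1 r)"
    using a by simp
  also have "inverse a * a powr (1 + s) = a powr s" using a by (simp add: powr_add)
  finally show ?thesis .
qed

lemma frac_kernel_symbol:
  fixes \<xi> :: "'a::euclidean_space"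
  assumes s: "0 < s" "s < 1"
  shows "(LINT r|lborel. frac_profile s 1 r) > 0"
    "(LINT p|lborel. frac_kernel s p *\<^sub>R (1 - cis (- ((fst p *\<^sub>R snd p) \<bullet> \<xi>)))) =
      complex_of_real (norm \<xi> powr s * (LINT r|lborel. frac_profile s 1 r))"
proof -
  \<comment> \<open>A unit vector is needed to read off integrability of the profile at a = 1 from
    the statement about frequencies.\<close>
  have "norm (SOME b::'a. b \<in> Basis) = 1" by (rule norm_Basis[OF SOME_Basis])
  then have int: "integrable lborel (frac_profile s 1)"
    using frac_kernel_symbol_aux(1)[OF s, of "SOME b::'a. b \<in> Basis"] by simp
  show "(LINT r|lborel. frac_profile s 1 r) > 0"
  proof (rule ccontr)
    assume "\<not> ?thesis"
    moreover have "(LINT r|lborel. frac_profile s 1 r) \<ge> 0"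
      by (intro integral_nonneg_AE AE_I2 frac_profile_nonneg)
    ultimately have "(LINT r|lborel. frac_profile s 1 r) = 0" by simp
    then have "AE r in lborel. frac_profile s 1 r = 0"
      using integral_nonneg_eq_0_iff_AE[OF int] frac_profile_nonneg by auto
    then have "AE r in lborel. r \<notin> {0<..<1::real}"
      by eventually_elim (auto simp: frac_profile_def)
    then have "emeasure lborel {r \<in> space lborel. r \<in> {0<..<1::real}} = 0"
      by (rule emeasure_eq_0_AE)
    moreover have "{r \<in> space lborel. r \<in> {0<..<1::real}} = {0<..<1}" by auto
    ultimately have "emeasure lborel {0<..<1::real} = 0" by (simp only:)
    then show False by simp
  qed
  show "(LINT p|lborel. frac_kernel s p *\<^sub>R (1 - cis (- ((fst p *\<^sub>R snd p) \<bullet> \<xi>)))) =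
      complex_of_real (norm \<xi> powr s * (LINT r|lborel. frac_profile s 1 r))"
  proof (cases "\<xi> = 0")
    case False
    then show ?thesis using frac_kernel_symbol_aux(2)[OF s, of \<xi>] frac_profile_scale[OF s(1), of "norm \<xi>"] by simp
  qed simp
qed

section \<open>Existence, uniqueness and bounds for D^s\<close>

text \<open>The bridge between the definitions, stated for the Lebesgue measure, and the
  computations, done with Borel functions so that product measures apply.\<close>

lemma integral_lebesgue_lborel:
  fixes f g :: "'a::euclidean_space \<Rightarrow> 'b::{banach, second_countable_topology}"
  assumes "f \<in> borel_measurable lebesgue" "g \<in> borel_measurable borel" "AE x in lebesgue. f x = g x"
  shows "(LINT x|lebesgue. f x) = (LINT x|lborel. g x)" "integrable lebesgue f \<longleftrightarrow> integrable lborel g"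
proof -
  have g: "g \<in> borel_measurable lborel" "g \<in> borel_measurable lebesgue" using assms(2) by (auto simp: measurable_completion)
  have "(LINT x|lebesgue. f x) = (LINT x|lebesgue. g x)"
    by (rule integral_cong_AE) (use assms g in auto)
  then show "(LINT x|lebesgue. f x) = (LINT x|lborel. g x)" using integral_completion[OF g(1)] by simp
  have "integrable lebesgue f \<longleftrightarrow> integrable lebesgue g"
    by (rule integrable_cong_AE) (use assms g in auto)
  then show "integrable lebesgue f \<longleftrightarrow> integrable lborel g" using integrable_completion[OF g(1)] by simp
qed

lemma fourier_lborel:
  fixes f g :: "real ^ 'n \<Rightarrow> complex"
  assumes "f \<in> borel_measurable lebesgue" and [measurable]: "g \<in> borel_measurable borel" and "AE x in lebesgue. f x = g x"
  shows "fourier f \<xi> = (LINT x|lborel. cis (- (x \<bullet> \<xi>)) * g x)"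
  unfolding fourier_def
proof (rule integral_lebesgue_lborel(1))
  have "(\<lambda>x. cis (- (x \<bullet> \<xi>))) \<in> borel_measurable lborel" by measurable
  then have "(\<lambda>x. cis (- (x \<bullet> \<xi>))) \<in> borel_measurable lebesgue" by (rule measurable_completion)
  then show "(\<lambda>x. cis (- (x \<bullet> \<xi>)) * f x) \<in> borel_measurable lebesgue" using assms(1) by (rule borel_measurable_times)
  show "AE x in lebesgue. cis (- (x \<bullet> \<xi>)) * f x = cis (- (x \<bullet> \<xi>)) * g x" using assms(3) by eventually_elim simp
qed measurable

text \<open>Injectivity of the Fourier transform. Consequently the choice made in
  \<open>frac_deriv\<close> does not affect its L^1 norm, and any explicit candidate may be
  estimated instead.\<close>

lemma is_frac_deriv_unique:
  fixes f :: "real ^ 'n \<Rightarrow> complex"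
  assumes F: "is_frac_deriv s f F" and G: "is_frac_deriv s f G"
  shows "AE x in lebesgue. F x = G x"
proof -
  have Fm: "F \<in> borel_measurable lebesgue" "G \<in> borel_measurable lebesgue"
    using F G by (auto simp: is_frac_deriv_def)
  obtain a where a: "a \<in> borel_measurable borel" "AE x in lebesgue. F x = a x"
    using completion_ex_borel_complex[OF Fm(1)] by blast
  obtain b where b: "b \<in> borel_measurable borel" "AE x in lebesgue. G x = b x"
    using completion_ex_borel_complex[OF Fm(2)] by blast
  have ia: "integrable lborel a" "integrable lborel b"
    using F G integral_lebesgue_lborel(2)[OF Fm(1) a] integral_lebesgue_lborel(2)[OF Fm(2) b]
    by (auto simp: is_frac_deriv_def)
  have "AE x in lborel. a x - b x = 0"
  proof (rule fourier_unique)
    show "integrable lborel (\<lambda>x. a x - b x)" using ia by simp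
    show "(LINT x|lborel. cis (- (x \<bullet> \<xi>)) * (a x - b x)) = 0" for \<xi>
    proof -
      have e: "integrable lborel (\<lambda>x. cis (- (x \<bullet> \<xi>)) * h x)" if "integrable lborel h" for h :: "real ^ 'n \<Rightarrow> complex"
      proof -
        have [measurable]: "h \<in> borel_measurable borel" using that by simp
        show ?thesis by (rule Bochner_Integration.integrable_bound[OF that]) (auto simp: norm_mult)
      qed
      have "(LINT x|lborel. cis (- (x \<bullet> \<xi>)) * (a x - b x)) = (LINT x|lborel. cis (- (x \<bullet> \<xi>)) * a x) - (LINT x|lborel. cis (- (x \<bullet> \<xi>)) * b x)"
        using e[OF ia(1)] e[OF ia(2)] by (simp add: right_diff_distrib)
      also have "\<dots> = fourier F \<xi> - fourier G \<xi>"
        using fourier_lborel[OF Fm(1) a] fourier_lborel[OF Fm(2) b] by simp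
      also have "\<dots> = 0" using F G by (simp add: is_frac_deriv_def)
      finally show ?thesis .
    qed
  qed
  then have "AE x in lebesgue. a x - b x = 0" by (rule AE_completion)
  then show ?thesis using a(2) b(2) by eventually_elim simp
qed

text \<open>The candidate is the difference average divided by \<Psi>, the value of its symbol on
  unit vectors, which turns the symbol into |xi|^s. The norm bound is
  \<open>frac_kernel_bound\<close> for the translation modulus of g: it is at most K |y| by
  assumption and at most twice the L^1 norm.\<close>

lemma frac_deriv_exists:
  fixes f g :: "real ^ 'n \<Rightarrow> complex"
  assumes s: "0 < s" "s < 1" and R: "R > 0"
    and f: "f \<in> borel_measurable lebesgue" and g: "integrable lborel g" and fg: "AE x in lebesgue. f x = g x"
    and K: "K \<ge> 0" "\<And>y. (\<integral>\<^sup>+x. ennreal (cmod (g (x + y) - g x)) \<partial>lborel) \<le> ennreal (K * norm y)"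
  obtains F where "is_frac_deriv s f F" "F \<in> borel_measurable borel"
    "(\<integral>\<^sup>+x. ennreal (cmod (F x)) \<partial>lborel) \<le> ennreal (1 / (LINT r|lborel. frac_profile s 1 r)) *
      (ennreal (K * (R powr (1 - s) / (1 - s))) * (\<integral>\<^sup>+z. ennreal (gauss z * norm z) \<partial>(lborel::(real ^ 'n) measure))
       + ennreal (R powr (- s) / s) * (2 * (\<integral>\<^sup>+x. ennreal (cmod (g x)) \<partial>lborel)))"
proof -
  have [measurable]: "g \<in> borel_measurable borel" using g by simp
  define \<Psi> where "\<Psi> = (LINT r|lborel. frac_profile s 1 r)"
  have \<Psi>: "\<Psi> > 0" unfolding \<Psi>_def by (rule frac_kernel_symbol(1)[OF s])
  define w where "w y = (\<integral>\<^sup>+x. ennreal (cmod (g (x + y) - g x)) \<partial>lborel)" for y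
  have [measurable]: "w \<in> borel_measurable borel" unfolding w_def by measurable
  let ?A = "2 * (\<integral>\<^sup>+x. ennreal (cmod (g x)) \<partial>lborel)"
  have wA: "w y \<le> ?A" for y
  proof -
    have "w y \<le> (\<integral>\<^sup>+x. ennreal (cmod (g (x + y))) + ennreal (cmod (g x)) \<partial>lborel)"
      unfolding w_def
    proof (rule nn_integral_mono)
      fix x
      have "ennreal (cmod (g (x + y) - g x)) \<le> ennreal (cmod (g (x + y)) + cmod (g x))"
        by (intro ennreal_leI norm_triangle_ineq4)
      then show "ennreal (cmod (g (x + y) - g x)) \<le> ennreal (cmod (g (x + y))) + ennreal (cmod (g x))" by simp
    qed
    also have "\<dots> = (\<integral>\<^sup>+x. ennreal (cmod (g (x + y))) \<partial>lborel) + (\<integral>\<^sup>+x. ennreal (cmod (g x)) \<partial>lborel)"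
      by (rule nn_integral_add) auto
    also have "(\<integral>\<^sup>+x. ennreal (cmod (g (x + y))) \<partial>lborel) = (\<integral>\<^sup>+x. ennreal (cmod (g x)) \<partial>lborel)"
      by (rule nn_integral_lborel_shift[of "\<lambda>x. ennreal (cmod (g x))"]) simp
    finally show ?thesis by (simp add: mult_2)
  qed
  let ?B = "ennreal (K * (R powr (1 - s) / (1 - s))) * (\<integral>\<^sup>+z. ennreal (gauss z * norm z) \<partial>(lborel::(real ^ 'n) measure))
       + ennreal (R powr (- s) / s) * ?A"
  have B: "(\<integral>\<^sup>+p. ennreal (frac_kernel s p) * w (- (fst p *\<^sub>R snd p)) \<partial>lborel) \<le> ?B"
    by (rule frac_kernel_bound[OF s R _ _ K(1) wA]) (use K(2) in \<open>auto simp: w_def\<close>)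
  have "?A < \<infinity>" using g by (simp add: integrable_iff_bounded ennreal_mult_less_top)
  then have "?B < \<infinity>"
    using gauss_first_moment[where 'a="real ^ 'n"] by (simp add: ennreal_mult_less_top ennreal_mult_eq_top_iff)
  with B have fin: "(\<integral>\<^sup>+p. ennreal (frac_kernel s p) * w (- (fst p *\<^sub>R snd p)) \<partial>lborel) < \<infinity>"
    by (rule order.strict_trans1)
  have hm: "(\<lambda>p::real \<times> (real ^ 'n). fst p *\<^sub>R snd p) \<in> borel_measurable borel"
  proof -
    have "(\<lambda>p::real \<times> (real ^ 'n). fst p *\<^sub>R snd p) \<in> borel_measurable (borel \<Otimes>\<^sub>M borel)" by measurable
    then show ?thesis by (simp add: borel_prod)
  qed
  define F0 where "F0 x = (LINT p|lborel. frac_kernel s p *\<^sub>R (g x - g (x - fst p *\<^sub>R snd p)))" for x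
  note D = difference_average[OF g frac_kernel_measurable hm frac_kernel_nonneg fin[unfolded w_def], folded F0_def w_def]
  have [measurable]: "F0 \<in> borel_measurable borel" using D(1) by simp
  define F where "F x = complex_of_real (1 / \<Psi>) * F0 x" for x
  have [measurable]: "F \<in> borel_measurable borel" unfolding F_def by measurable
  have iF: "integrable lborel F" unfolding F_def using D(1) by simp
  have Fl: "F \<in> borel_measurable lebesgue" by (simp add: measurable_completion)
  show ?thesis
  proof (rule that[of F])
    show "is_frac_deriv s f F"
      unfolding is_frac_deriv_def
    proof (intro conjI allI)
      show "integrable lebesgue F" using integral_lebesgue_lborel(2)[OF Fl, of F] iF by simp
      fix \<xi> :: "real ^ 'n"
      have "fourier F \<xi> = (LINT x|lborel. cis (- (x \<bullet> \<xi>)) * F x)"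
        by (rule fourier_lborel[OF Fl]) auto
      also have "\<dots> = complex_of_real (1 / \<Psi>) * (LINT x|lborel. cis (- (x \<bullet> \<xi>)) * F0 x)"
        unfolding F_def by (subst integral_mult_right_zero[symmetric]) (simp add: algebra_simps)
      also have "(LINT x|lborel. cis (- (x \<bullet> \<xi>)) * F0 x) = complex_of_real (norm \<xi> powr s * \<Psi>) * fourier f \<xi>"
        unfolding D(3) frac_kernel_symbol(2)[OF s] fourier_lborel[OF f _ fg, simplified] \<Psi>_def ..
      finally show "fourier F \<xi> = complex_of_real (frac_symbol s \<xi>) * fourier f \<xi>"
        using \<Psi> s by (simp add: frac_symbol_def)
    qed
    have "(\<integral>\<^sup>+x. ennreal (cmod (F x)) \<partial>lborel) = ennreal (1 / \<Psi>) * (\<integral>\<^sup>+x. ennreal (cmod (F0 x)) \<partial>lborel)"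
      using \<Psi> by (subst nn_integral_cmult[symmetric]) (auto intro!: nn_integral_cong simp: F_def norm_divide ennreal_mult[symmetric])
    also have "\<dots> \<le> ennreal (1 / \<Psi>) * ?B"
      by (intro mult_left_mono order_trans[OF D(2) B]) simp
    finally show "(\<integral>\<^sup>+x. ennreal (cmod (F x)) \<partial>lborel) \<le> ennreal (1 / (LINT r|lborel. frac_profile s 1 r)) * ?B"
      unfolding \<Psi>_def .
  qed simp
qed

text \<open>The coefficient of K in \<open>frac_deriv_exists\<close> is of order R^(1-s), so a small
  splitting radius makes it at most \<epsilon>, at the price of a large multiple of the L^1 norm.
  For s = 0 the operator is the identity.\<close>

lemma frac_deriv_bound:
  assumes s: "0 \<le> s" "s < 1" and \<epsilon>: "\<epsilon> > 0"
  obtains C where "C \<ge> 0" "\<And>(f :: real ^ 'n \<Rightarrow> complex) g K. f \<in> borel_measurable lebesgue \<Longrightarrow> integrable lborel g \<Longrightarrow>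
      AE x in lebesgue. f x = g x \<Longrightarrow> K \<ge> 0 \<Longrightarrow>
      (\<And>y. (\<integral>\<^sup>+x. ennreal (cmod (g (x + y) - g x)) \<partial>lborel) \<le> ennreal (K * norm y)) \<Longrightarrow>
      frac_deriv s f \<in> borel_measurable lebesgue \<and> (\<integral>\<^sup>+x. ennreal (cmod (frac_deriv s f x)) \<partial>lebesgue) \<le> ennreal (\<epsilon> * K) + ennreal C * (\<integral>\<^sup>+x. ennreal (cmod (g x)) \<partial>lborel)"
proof -
  have uniq: "frac_deriv s f \<in> borel_measurable lebesgue \<and> (\<integral>\<^sup>+x. ennreal (cmod (frac_deriv s f x)) \<partial>lebesgue) = (\<integral>\<^sup>+x. ennreal (cmod (F x)) \<partial>lebesgue)"
    if "is_frac_deriv s f F" for f F :: "real ^ 'n \<Rightarrow> complex"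
  proof -
    have d: "is_frac_deriv s f (frac_deriv s f)" unfolding frac_deriv_def using someI[of "is_frac_deriv s f", OF that] .
    from is_frac_deriv_unique[OF d that]
    have "AE x in lebesgue. ennreal (cmod (frac_deriv s f x)) = ennreal (cmod (F x))" by eventually_elim simp
    then have "(\<integral>\<^sup>+x. ennreal (cmod (frac_deriv s f x)) \<partial>lebesgue) = (\<integral>\<^sup>+x. ennreal (cmod (F x)) \<partial>lebesgue)"
      by (rule nn_integral_cong_AE)
    then show ?thesis using d unfolding is_frac_deriv_def by (auto dest: borel_measurable_integrable)
  qed
  have leb: "(\<integral>\<^sup>+x. ennreal (cmod (f x)) \<partial>lebesgue) = (\<integral>\<^sup>+x. ennreal (cmod (g x)) \<partial>lborel)"
    if "g \<in> borel_measurable borel" "AE x in lebesgue. f x = g x" for f g :: "real ^ 'n \<Rightarrow> complex"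
  proof -
    have "(\<integral>\<^sup>+x. ennreal (cmod (f x)) \<partial>lebesgue) = (\<integral>\<^sup>+x. ennreal (cmod (g x)) \<partial>lebesgue)"
      using that(2) by (intro nn_integral_cong_AE) (auto elim!: eventually_mono)
    then show ?thesis by (simp add: nn_integral_completion)
  qed
  show ?thesis
  proof (cases "s = 0")
    case True
    have "frac_deriv s f \<in> borel_measurable lebesgue \<and> (\<integral>\<^sup>+x. ennreal (cmod (frac_deriv s f x)) \<partial>lebesgue) \<le> ennreal (\<epsilon> * K) + ennreal 1 * (\<integral>\<^sup>+x. ennreal (cmod (g x)) \<partial>lborel)"
      if f: "f \<in> borel_measurable lebesgue" "integrable lborel g" "AE x in lebesgue. f x = g x"
      for f g :: "real ^ 'n \<Rightarrow> complex" and K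
    proof -
      have "is_frac_deriv s f f"
        using True integral_lebesgue_lborel(2)[OF f(1) _ f(3)] f(2) by (simp add: is_frac_deriv_def frac_symbol_def)
      from uniq[OF this] leb[OF _ f(3)] f(2) show ?thesis by (simp add: add_increasing)
    qed
    then show ?thesis using that[of 1] by simp
  next
    case False
    then have s': "0 < s" using s by simp
    define \<Psi> where "\<Psi> = (LINT r|lborel. frac_profile s 1 r)"
    have \<Psi>: "\<Psi> > 0" unfolding \<Psi>_def by (rule frac_kernel_symbol(1)[OF s' s(2)])
    define m where "m = enn2real (\<integral>\<^sup>+z. ennreal (gauss z * norm z) \<partial>(lborel::(real ^ 'n) measure))"
    have m: "m \<ge> 0" "(\<integral>\<^sup>+z. ennreal (gauss z * norm z) \<partial>(lborel::(real ^ 'n) measure)) = ennreal m"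
      unfolding m_def using gauss_first_moment[where 'a="real ^ 'n"] by auto
    \<comment> \<open>The solution of R^(1-s) / (1-s) = \<epsilon> \<Psi> / (m + 1); the denominator
      m + 1 stays positive even for m = 0 and leaves the harmless factor m / (m + 1).\<close>
    define R where "R = (\<epsilon> * \<Psi> * (1 - s) / (m + 1)) powr (1 / (1 - s))"
    have R0: "R > 0" unfolding R_def using \<epsilon> \<Psi> s m(1) by simp
    have "R powr (1 - s) = \<epsilon> * \<Psi> * (1 - s) / (m + 1)"
      unfolding R_def using \<epsilon> \<Psi> s m(1) by (simp add: powr_powr)
    then have R1: "R powr (1 - s) / (1 - s) = \<epsilon> * \<Psi> / (m + 1)" using s by simp
    define C where "C = 1 / \<Psi> * (R powr (- s) / s * 2)"
    have C0: "C \<ge> 0" unfolding C_def using \<Psi> s' by simp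
    have "frac_deriv s f \<in> borel_measurable lebesgue \<and> (\<integral>\<^sup>+x. ennreal (cmod (frac_deriv s f x)) \<partial>lebesgue) \<le> ennreal (\<epsilon> * K) + ennreal C * (\<integral>\<^sup>+x. ennreal (cmod (g x)) \<partial>lborel)"
      if f: "f \<in> borel_measurable lebesgue" "integrable lborel g" "AE x in lebesgue. f x = g x"
        and K: "K \<ge> 0" "\<And>y. (\<integral>\<^sup>+x. ennreal (cmod (g (x + y) - g x)) \<partial>lborel) \<le> ennreal (K * norm y)"
      for f g :: "real ^ 'n \<Rightarrow> complex" and K
    proof -
      let ?N = "\<integral>\<^sup>+x. ennreal (cmod (g x)) \<partial>lborel"
      obtain F where F: "is_frac_deriv s f F" "F \<in> borel_measurable borel"
        "(\<integral>\<^sup>+x. ennreal (cmod (F x)) \<partial>lborel) \<le> ennreal (1 / \<Psi>) *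
          (ennreal (K * (R powr (1 - s) / (1 - s))) * ennreal m + ennreal (R powr (- s) / s) * (2 * ?N))"
        using frac_deriv_exists[OF s' s(2) R0 f K] unfolding \<Psi>_def m(2)[symmetric] by blast
      have "(\<integral>\<^sup>+x. ennreal (cmod (frac_deriv s f x)) \<partial>lebesgue) = (\<integral>\<^sup>+x. ennreal (cmod (F x)) \<partial>lborel)"
        using uniq[OF F(1)] leb[OF F(2)] by simp
      also note F(3)
      also have "ennreal (1 / \<Psi>) * (ennreal (K * (R powr (1 - s) / (1 - s))) * ennreal m + ennreal (R powr (- s) / s) * (2 * ?N))
         = ennreal (1 / \<Psi> * (K * (\<epsilon> * \<Psi> / (m + 1)) * m)) + ennreal C * ?N"
      proof -
        have p: "0 \<le> K * (\<epsilon> * \<Psi> / (m + 1))" "0 \<le> 1 / \<Psi>" "0 \<le> R powr (- s) / s" using K \<epsilon> \<Psi> m(1) s' by auto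
        have "ennreal C = ennreal (1 / \<Psi>) * (ennreal (R powr (- s) / s) * 2)"
          unfolding C_def using p(2,3) by (simp only: ennreal_mult ennreal_numeral mult_nonneg_nonneg zero_le_numeral)
        moreover have "ennreal (1 / \<Psi> * (K * (\<epsilon> * \<Psi> / (m + 1)) * m)) = ennreal (1 / \<Psi>) * (ennreal (K * (\<epsilon> * \<Psi> / (m + 1))) * ennreal m)"
          using p m(1) by (simp only: ennreal_mult mult_nonneg_nonneg)
        ultimately show ?thesis unfolding R1 by (simp only: distrib_left mult.assoc)
      qed
      also have "\<dots> \<le> ennreal (\<epsilon> * K) + ennreal C * ?N"
      proof (intro add_right_mono ennreal_leI)
        have "1 / \<Psi> * (K * (\<epsilon> * \<Psi> / (m + 1)) * m) = \<epsilon> * K * (m / (m + 1))" using \<Psi> by simp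
        also have "\<dots> \<le> \<epsilon> * K * 1" using \<epsilon> K m(1) by (intro mult_left_mono) auto
        finally show "1 / \<Psi> * (K * (\<epsilon> * \<Psi> / (m + 1)) * m) \<le> \<epsilon> * K" by simp
      qed
      finally show ?thesis using uniq[OF F(1)] by blast
    qed
    then show ?thesis using that[OF C0] by blast
  qed
qed


section \<open>The trace inequality on a Lipschitz hypersurface\<close>

text \<open>Difference quotients in a fixed direction v are bounded by L |v|, and so is their
  limit.\<close>

lemma lipschitz_onorm_le:
  fixes h :: "'a::real_normed_vector \<Rightarrow> real"
  assumes L: "L-lipschitz_on UNIV h" and d: "h differentiable (at x)"
  shows "0 \<le> onorm (frechet_derivative h (at x))" "onorm (frechet_derivative h (at x)) \<le> L"
proof -
  let ?D = "frechet_derivative h (at x)"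
  have D: "(h has_derivative ?D) (at x)" using d frechet_derivative_works by blast
  show "0 \<le> onorm ?D" using has_derivative_bounded_linear[OF D] by (rule onorm_pos_le)
  show "onorm ?D \<le> L"
  proof (rule onorm_bound[OF lipschitz_on_nonneg[OF L]])
    fix v
    have "((\<lambda>t. x + t *\<^sub>R v) has_derivative (\<lambda>t. t *\<^sub>R v)) (at (0::real))"
      by (auto intro!: derivative_eq_intros)
    moreover have "(h has_derivative ?D) (at (x + 0 *\<^sub>R v))" using D by simp
    ultimately have "((\<lambda>t. h (x + t *\<^sub>R v)) has_derivative (\<lambda>t. ?D (t *\<^sub>R v))) (at 0)"
      by (rule has_derivative_compose)
    then have "((\<lambda>t. h (x + t *\<^sub>R v)) has_field_derivative ?D v) (at 0)"
    proof -
      have "?D (t *\<^sub>R v) = ?D v * t" for t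
        using has_derivative_linear[OF D] by (simp add: linear_cmul)
      then show ?thesis using \<open>((\<lambda>t. h (x + t *\<^sub>R v)) has_derivative (\<lambda>t. ?D (t *\<^sub>R v))) (at 0)\<close>
        by (simp add: has_field_derivative_def)
    qed
    then have "((\<lambda>t. (h (x + t *\<^sub>R v) - h x) / t) \<longlongrightarrow> ?D v) (at 0)"
      by (simp add: has_field_derivative_iff)
    then have "((\<lambda>t. \<bar>(h (x + t *\<^sub>R v) - h x) / t\<bar>) \<longlongrightarrow> \<bar>?D v\<bar>) (at 0)"
      by (rule tendsto_rabs)
    then show "norm (?D v) \<le> L * norm v"
      unfolding real_norm_def
    proof (rule tendsto_upperbound)
      show "\<forall>\<^sub>F t in at 0. \<bar>(h (x + t *\<^sub>R v) - h x) / t\<bar> \<le> L * norm v"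
        unfolding eventually_at_filter
      proof (intro always_eventually allI impI)
        fix t :: real assume "t \<noteq> 0"
        have "\<bar>h (x + t *\<^sub>R v) - h x\<bar> \<le> L * (\<bar>t\<bar> * norm v)"
          using lipschitz_onD[OF L, of "x + t *\<^sub>R v" x] by (simp add: dist_norm)
        then show "\<bar>(h (x + t *\<^sub>R v) - h x) / t\<bar> \<le> L * norm v"
          using \<open>t \<noteq> 0\<close> by (simp add: abs_divide divide_le_eq algebra_simps)
      qed
    qed simp
  qed
qed

text \<open>On U the surface measure is dominated by the image, under projection along e to the
  graph, of C times Lebesgue measure on the slab, where C = sqrt (1 + L^2) bounds the area density.
  The inequality on sets is an inequality of measures and so passes to integrals of
  functions.\<close>

lemma chart_integral_le:
  fixes \<Gamma> U :: "(real ^ 'n) set"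
  assumes chart: "lipschitz_chart e h" and U: "open U" and \<Gamma>: "\<Gamma> \<inter> U = {x \<in> U. x \<bullet> e = h x}"
    and \<sigma>: "is_surface_measure \<Gamma> \<sigma>"
  obtains C :: real where "C \<ge> 0" "\<And>f. f \<in> borel_measurable borel \<Longrightarrow> (\<And>x. x \<notin> U \<Longrightarrow> f x = 0) \<Longrightarrow>
    (\<integral>\<^sup>+x. f x \<partial>\<sigma>) \<le> ennreal C * (\<integral>\<^sup>+x. indicator {x. 0 \<le> x \<bullet> e \<and> x \<bullet> e \<le> 1} x * f (x + (h x - x \<bullet> e) *\<^sub>R e) \<partial>lborel)"
proof -
  obtain L where L: "L-lipschitz_on UNIV h" using chart by (auto simp: lipschitz_chart_def)
  have [measurable]: "h \<in> borel_measurable borel"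
    by (rule borel_measurable_continuous_onI[OF lipschitz_on_continuous_on[OF L]])
  let ?S = "{x. 0 \<le> x \<bullet> e \<and> x \<bullet> e \<le> 1}" and ?P = "\<lambda>x. x + (h x - x \<bullet> e) *\<^sub>R e"
  define C where "C = sqrt (1 + L\<^sup>2)"
  have [measurable]: "?S \<in> sets borel"
  proof -
    have "Measurable.pred borel (\<lambda>x::real^'n. 0 \<le> x \<bullet> e \<and> x \<bullet> e \<le> 1)" by measurable
    then show ?thesis by (simp add: pred_def)
  qed
  have sets\<sigma>[measurable_cong]: "sets \<sigma> = sets borel" using \<sigma> by (simp add: is_surface_measure_def)
  have [measurable]: "U \<in> sets borel" using U by simp
  define N where "N = distr (density lborel (\<lambda>x. ennreal C * indicator ?S x)) borel ?P"
  define \<sigma>' where "\<sigma>' = density \<sigma> (indicator U)"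
  have N: "emeasure N A = (\<integral>\<^sup>+x. ennreal C * indicator ?S x * indicator A (?P x) \<partial>lborel)" if [measurable]: "A \<in> sets borel" for A
  proof -
    have "emeasure N A = (\<integral>\<^sup>+x. indicator A x \<partial>N)" using that by (simp add: N_def)
    also have "\<dots> = (\<integral>\<^sup>+x. ennreal C * indicator ?S x * indicator A (?P x) \<partial>lborel)"
      unfolding N_def by (subst nn_integral_distr) (auto simp: nn_integral_density)
    finally show ?thesis .
  qed
  have le: "emeasure \<sigma>' A \<le> emeasure N A" if A: "A \<in> sets borel" for A
  proof -
    have "emeasure \<sigma>' A = emeasure \<sigma> (U \<inter> A)"
      unfolding \<sigma>'_def using A by (simp add: emeasure_density indicator_inter_arith[symmetric] sets\<sigma>)
    also have "\<dots> = graph_area e h (U \<inter> A)"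
      using \<sigma>[unfolded is_surface_measure_def, THEN conjunct2, THEN conjunct2, rule_format, of e h U "U \<inter> A"]
        chart U \<Gamma> A by simp
    also have "\<dots> \<le> (\<integral>\<^sup>+x. ennreal C * indicator ?S x * indicator A (?P x) \<partial>lborel)"
      unfolding graph_area_def
    proof (rule nn_integral_mono)
      fix x
      show "ennreal (sqrt (1 + (onorm (frechet_derivative h (at x)))\<^sup>2)) *
          indicator {x. 0 \<le> x \<bullet> e \<and> x \<bullet> e \<le> 1 \<and> h differentiable at x \<and> ?P x \<in> U \<inter> A} x
          \<le> ennreal C * indicator ?S x * indicator A (?P x)"
      proof (cases "0 \<le> x \<bullet> e \<and> x \<bullet> e \<le> 1 \<and> h differentiable at x \<and> ?P x \<in> U \<inter> A")
        case True
        then have "sqrt (1 + (onorm (frechet_derivative h (at x)))\<^sup>2) \<le> C"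
          unfolding C_def using lipschitz_onorm_le[OF L, of x] by (simp add: power_mono)
        then show ?thesis using True by (simp add: ennreal_leI)
      qed simp
    qed
    finally show ?thesis using N[OF A] by simp
  qed
  have sN: "sets \<sigma>' = sets N" by (simp add: \<sigma>'_def N_def sets\<sigma>)
  have lem: "\<sigma>' \<le> N"
    using le sN by (subst le_measure) (auto simp: \<sigma>'_def sets\<sigma>)
  have "(\<integral>\<^sup>+x. f x \<partial>\<sigma>) \<le> ennreal C * (\<integral>\<^sup>+x. indicator ?S x * f (?P x) \<partial>lborel)"
    if f[measurable]: "f \<in> borel_measurable borel" and f0: "\<And>x. x \<notin> U \<Longrightarrow> f x = 0" for f
  proof -
    have "(\<integral>\<^sup>+x. f x \<partial>\<sigma>) = (\<integral>\<^sup>+x. indicator U x * f x \<partial>\<sigma>)"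
      using f0 by (intro nn_integral_cong) (auto simp: indicator_def)
    also have "\<dots> = (\<integral>\<^sup>+x. f x \<partial>\<sigma>')"
      unfolding \<sigma>'_def by (subst nn_integral_density) auto
    also have "\<dots> \<le> (\<integral>\<^sup>+x. f x \<partial>N)" by (rule nn_integral_mono_measure[OF sN lem])
    also have "\<dots> = (\<integral>\<^sup>+x. ennreal C * (indicator ?S x * f (?P x)) \<partial>lborel)"
      unfolding N_def by (subst nn_integral_distr) (auto simp: nn_integral_density mult.assoc)
    also have "\<dots> = ennreal C * (\<integral>\<^sup>+x. indicator ?S x * f (?P x) \<partial>lborel)"
      by (rule nn_integral_cmult) measurable
    finally show ?thesis .
  qed
  then show ?thesis using that[of C] by (simp add: C_def)
qed

text \<open>The integral of \<open>g\<close> over a graph is estimated by integrating \<open>Dg e\<close> along the lines in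
  direction \<open>e\<close>, each of which meets the graph once.\<close>

lemma slab_integral_le:
  fixes g :: "real ^ 'n \<Rightarrow> real"
  assumes g: "cc_smooth g" and g0: "\<And>x. g x \<ge> 0" and e: "norm e = 1" and [measurable]: "h \<in> borel_measurable borel"
  shows "(\<integral>\<^sup>+x. indicator {x. 0 \<le> x \<bullet> e \<and> x \<bullet> e \<le> 1} x * ennreal (g (x + (h x - x \<bullet> e) *\<^sub>R e)) \<partial>lborel)
    \<le> (\<integral>\<^sup>+x. ennreal \<bar>frechet_derivative g (at x) e\<bar> \<partial>lborel)"
proof -
  let ?S = "{x. 0 \<le> x \<bullet> e \<and> x \<bullet> e \<le> 1}"
  define F where "F x = ennreal \<bar>frechet_derivative g (at x) e\<bar>" for x
  have [measurable]: "F \<in> borel_measurable borel"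
    unfolding F_def using cc_smooth_measurable[OF cc_smooth_derivative[OF g]] by measurable
  have S[measurable]: "?S \<in> sets borel"
  proof -
    have "Measurable.pred borel (\<lambda>x::real^'n. 0 \<le> x \<bullet> e \<and> x \<bullet> e \<le> 1)" by measurable
    then show ?thesis by (simp add: pred_def)
  qed
  have ee: "e \<bullet> e = 1" using e by (simp add: norm_eq_sqrt_inner)
  have pt: "ennreal (g p) \<le> (\<integral>\<^sup>+t. F (p + t *\<^sub>R e) \<partial>lborel)" for p
  proof -
    obtain B where B: "B > 0" "\<And>x. g x \<noteq> 0 \<Longrightarrow> norm x \<le> B"
    proof -
      have "bounded (closure {x. g x \<noteq> 0})" using g by (simp add: cc_smooth_def compact_imp_bounded)
      then obtain B where B: "B > 0" "\<And>x. x \<in> closure {x. g x \<noteq> 0} \<Longrightarrow> norm x \<le> B" using bounded_pos by metis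
      then show ?thesis using that[OF B(1)] closure_subset[of "{x. g x \<noteq> 0}"] by blast
    qed
    \<comment> \<open>Far enough along the line for \<open>g\<close> to vanish, so
      \<open>g p\<close> is the integral of its directional derivative over the segment, up to
      sign.\<close>
    define T where "T = B + norm p + 1"
    have T: "T \<ge> 0" using B(1) by (simp add: T_def add_nonneg_nonneg less_imp_le)
    have "norm (p + T *\<^sub>R e) > B"
      using norm_triangle_ineq4[of "p + T *\<^sub>R e" p] e T by (simp add: T_def)
    then have gT: "g (p + T *\<^sub>R e) = 0" using B(2) not_less by blast
    have contD: "continuous_on UNIV (\<lambda>x. frechet_derivative g (at x) e)"
      by (rule smooth_continuous[OF cc_smooth_smooth[OF cc_smooth_derivative[OF g]]])
    have "continuous_on UNIV (\<lambda>t. frechet_derivative g (at (p + t *\<^sub>R e)) e)"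
      by (rule continuous_on_compose2[OF contD]) (intro continuous_intros, simp)
    then have "ennreal \<bar>g (p + T *\<^sub>R e) - g (p + 0 *\<^sub>R e)\<bar> \<le>
       (\<integral>\<^sup>+t. ennreal \<bar>frechet_derivative g (at (p + t *\<^sub>R e)) e\<bar> * indicator {0..T} t \<partial>lborel)"
      by (intro FTC_abs_le T DERIV_along_line cc_smooth_has_derivative g) (simp add: continuous_on_eq_continuous_at)
    also have "\<dots> \<le> (\<integral>\<^sup>+t. F (p + t *\<^sub>R e) \<partial>lborel)"
      by (intro nn_integral_mono) (auto simp: F_def indicator_def)
    finally show ?thesis using gT g0[of p] by simp
  qed
  have line: "(\<integral>\<^sup>+t. F (x + (h x - x \<bullet> e) *\<^sub>R e + t *\<^sub>R e) \<partial>lborel) = (\<integral>\<^sup>+t. F (x + t *\<^sub>R e) \<partial>lborel)" for x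
  proof -
    have eq: "x + (h x - x \<bullet> e) *\<^sub>R e + t *\<^sub>R e = x + (t + (h x - x \<bullet> e)) *\<^sub>R e" for t
      by (simp add: scaleR_add_left)
    show ?thesis
      unfolding eq by (rule nn_integral_lborel_shift[of "\<lambda>t. F (x + t *\<^sub>R e)"]) measurable
  qed
  have "(\<integral>\<^sup>+x. indicator ?S x * ennreal (g (x + (h x - x \<bullet> e) *\<^sub>R e)) \<partial>lborel)
     \<le> (\<integral>\<^sup>+x. indicator ?S x * (\<integral>\<^sup>+t. F (x + t *\<^sub>R e) \<partial>lborel) \<partial>lborel)"
  proof (rule nn_integral_mono, rule mult_left_mono)
    show "ennreal (g (x + (h x - x \<bullet> e) *\<^sub>R e)) \<le> (\<integral>\<^sup>+t. F (x + t *\<^sub>R e) \<partial>lborel)" for x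
      using pt[of "x + (h x - x \<bullet> e) *\<^sub>R e"] unfolding line .
  qed simp
  also have "\<dots> = (\<integral>\<^sup>+x. (\<integral>\<^sup>+t. indicator ?S x * F (x + t *\<^sub>R e) \<partial>lborel) \<partial>lborel)"
    by (intro nn_integral_cong nn_integral_cmult[symmetric]) measurable
  also have "\<dots> = (\<integral>\<^sup>+t. (\<integral>\<^sup>+x. indicator ?S x * F (x + t *\<^sub>R e) \<partial>lborel) \<partial>(lborel::real measure))"
    by (rule lborel_pair.Fubini') measurable
  \<comment> \<open>Taking x + t e as the new variable turns the slab condition into t lying in an
    interval of length one, whose integral over t is 1.\<close>
  also have "\<dots> = (\<integral>\<^sup>+t. (\<integral>\<^sup>+x. indicator {x \<bullet> e - 1..x \<bullet> e} t * F x \<partial>lborel) \<partial>(lborel::real measure))"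
  proof (rule nn_integral_cong)
    fix t :: real
    have "(\<integral>\<^sup>+x. indicator ?S x * F (x + t *\<^sub>R e) \<partial>lborel) = (\<integral>\<^sup>+x. indicator ?S ((x + t *\<^sub>R e) + (- t) *\<^sub>R e) * F (x + t *\<^sub>R e) \<partial>lborel)"
      by (simp add: algebra_simps)
    also have "\<dots> = (\<integral>\<^sup>+x. indicator ?S (x + (- t) *\<^sub>R e) * F x \<partial>lborel)"
      by (rule nn_integral_lborel_shift[of "\<lambda>x. indicator ?S (x + (- t) *\<^sub>R e) * F x"]) measurable
    also have "\<dots> = (\<integral>\<^sup>+x. indicator {x \<bullet> e - 1..x \<bullet> e} t * F x \<partial>lborel)"
      by (intro nn_integral_cong) (auto simp: indicator_def inner_add_left inner_diff_left ee)
    finally show "(\<integral>\<^sup>+x. indicator ?S x * F (x + t *\<^sub>R e) \<partial>lborel) = (\<integral>\<^sup>+x. indicator {x \<bullet> e - 1..x \<bullet> e} t * F x \<partial>lborel)" .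
  qed
  also have "\<dots> = (\<integral>\<^sup>+x. (\<integral>\<^sup>+t. indicator {x \<bullet> e - 1..x \<bullet> e} t * F x \<partial>(lborel::real measure)) \<partial>lborel)"
  proof (rule lborel_pair.Fubini')
    have "(\<lambda>(x, t). indicator {x \<bullet> e - 1..x \<bullet> e} t * F x) = (\<lambda>(x, t::real). (if x \<bullet> e - 1 \<le> t \<and> t \<le> x \<bullet> e then 1 else 0) * F x)"
      by (auto simp: indicator_def fun_eq_iff)
    also have "\<dots> \<in> borel_measurable (lborel \<Otimes>\<^sub>M lborel)" by measurable
    finally show "(\<lambda>(x, t::real). indicator {x \<bullet> e - 1..x \<bullet> e} t * F x) \<in> borel_measurable (lborel \<Otimes>\<^sub>M lborel)" .
  qed
  also have "\<dots> = (\<integral>\<^sup>+x. F x \<partial>lborel)"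
    by (intro nn_integral_cong) (simp add: nn_integral_multc)
  finally show ?thesis unfolding F_def .
qed

section \<open>Cut-offs, squared norms and the trace inequality\<close>

lemma partial_scaleR:
  fixes u :: "real ^ 'n \<Rightarrow> complex"
  assumes "smooth e" "smooth u"
  shows "partial i (\<lambda>x. e x *\<^sub>R u x) x = e x *\<^sub>R partial i u x + frechet_derivative e (at x) (axis i 1) *\<^sub>R u x"
  unfolding partial_def
  using frechet_derivative_at[OF has_derivative_scaleR[OF smooth_has_derivative[OF assms(1)] smooth_has_derivative[OF assms(2)]], symmetric]
  by simp

lemma cmod_add_squared_le: "(cmod (a + b))\<^sup>2 \<le> 2 * (cmod a)\<^sup>2 + 2 * (cmod b)\<^sup>2"
proof -
  have "(cmod (a + b))\<^sup>2 \<le> (cmod a + cmod b)\<^sup>2" by (intro power_mono norm_triangle_ineq) simp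
  also have "\<dots> \<le> 2 * (cmod a)\<^sup>2 + 2 * (cmod b)\<^sup>2"
    using sum_squares_bound[of "cmod a" "cmod b"] by (simp add: power2_sum)
  finally show ?thesis .
qed

lemma sq_norm_add_le:
  assumes [measurable]: "a \<in> borel_measurable borel" "b \<in> borel_measurable borel"
  shows "sq_norm (\<lambda>x. a x + b x) \<le> 2 * sq_norm a + 2 * sq_norm b"
proof -
  have "sq_norm (\<lambda>x. a x + b x) \<le> (\<integral>\<^sup>+x. 2 * ennreal ((cmod (a x))\<^sup>2) + 2 * ennreal ((cmod (b x))\<^sup>2) \<partial>lborel)"
    unfolding sq_norm_def
  proof (rule nn_integral_mono)
    fix x
    have "ennreal ((cmod (a x + b x))\<^sup>2) \<le> ennreal (2 * (cmod (a x))\<^sup>2 + 2 * (cmod (b x))\<^sup>2)"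
      by (intro ennreal_leI cmod_add_squared_le)
    then show "ennreal ((cmod (a x + b x))\<^sup>2) \<le> 2 * ennreal ((cmod (a x))\<^sup>2) + 2 * ennreal ((cmod (b x))\<^sup>2)"
      by (simp add: ennreal_mult)
  qed
  also have "\<dots> = 2 * sq_norm a + 2 * sq_norm b"
    unfolding sq_norm_def by (simp add: nn_integral_add nn_integral_cmult)
  finally show ?thesis .
qed

lemma sq_norm_scaleR_le:
  assumes [measurable]: "u \<in> borel_measurable borel" and "\<And>x. \<bar>e x\<bar> \<le> B"
  shows "sq_norm (\<lambda>x. e x *\<^sub>R u x) \<le> ennreal (B\<^sup>2) * sq_norm u"
proof -
  have "sq_norm (\<lambda>x. e x *\<^sub>R u x) \<le> (\<integral>\<^sup>+x. ennreal (B\<^sup>2) * ennreal ((cmod (u x))\<^sup>2) \<partial>lborel)"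
    unfolding sq_norm_def
  proof (rule nn_integral_mono)
    fix x
    have "(e x)\<^sup>2 \<le> B\<^sup>2" using power_mono[OF assms(2)[of x], of 2] by simp
    then have "(cmod (e x *\<^sub>R u x))\<^sup>2 \<le> B\<^sup>2 * (cmod (u x))\<^sup>2"
      by (simp add: power_mult_distrib mult_right_mono)
    then show "ennreal ((cmod (e x *\<^sub>R u x))\<^sup>2) \<le> ennreal (B\<^sup>2) * ennreal ((cmod (u x))\<^sup>2)"
      by (simp add: ennreal_mult[symmetric] ennreal_leI)
  qed
  also have "\<dots> = ennreal (B\<^sup>2) * sq_norm u" unfolding sq_norm_def by (rule nn_integral_cmult) measurable
  finally show ?thesis .
qed

lemma sq_norm_partial_scaleR_le:
  fixes u :: "real ^ 'n \<Rightarrow> complex"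
  assumes e: "smooth e" "\<And>x. \<bar>e x\<bar> \<le> B" "\<And>x v. \<bar>frechet_derivative e (at x) v\<bar> \<le> L * norm v" and u: "cc_smooth u"
  shows "sq_norm (partial i (\<lambda>x. e x *\<^sub>R u x)) \<le> 2 * ennreal (B\<^sup>2) * sq_norm (partial i u) + 2 * ennreal (L\<^sup>2) * sq_norm u"
proof -
  have [measurable]: "u \<in> borel_measurable borel" "partial i u \<in> borel_measurable borel"
    "e \<in> borel_measurable borel" "(\<lambda>x. frechet_derivative e (at x) (axis i 1)) \<in> borel_measurable borel"
    using cc_smooth_measurable[OF u] cc_smooth_measurable[OF partial_cc_smooth[OF u]]
      borel_measurable_continuous_onI[OF smooth_continuous[OF e(1)]]
      borel_measurable_continuous_onI[OF smooth_continuous[OF smooth_frechet_derivative[OF e(1)]]] by auto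
  have "sq_norm (partial i (\<lambda>x. e x *\<^sub>R u x)) = sq_norm (\<lambda>x. e x *\<^sub>R partial i u x + frechet_derivative e (at x) (axis i 1) *\<^sub>R u x)"
  proof -
    have "partial i (\<lambda>x. e x *\<^sub>R u x) = (\<lambda>x. e x *\<^sub>R partial i u x + frechet_derivative e (at x) (axis i 1) *\<^sub>R u x)"
      by (rule ext, rule partial_scaleR[OF e(1) cc_smooth_smooth[OF u]])
    then show ?thesis by (simp only:)
  qed
  also have "\<dots> \<le> 2 * sq_norm (\<lambda>x. e x *\<^sub>R partial i u x) + 2 * sq_norm (\<lambda>x. frechet_derivative e (at x) (axis i 1) *\<^sub>R u x)"
    by (rule sq_norm_add_le) measurable
  also have "\<dots> \<le> 2 * (ennreal (B\<^sup>2) * sq_norm (partial i u)) + 2 * (ennreal (L\<^sup>2) * sq_norm u)"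
    using e(3)[of _ "axis i 1"] by (intro add_mono mult_left_mono sq_norm_scaleR_le e(2)) auto
  finally show ?thesis by (simp add: mult.assoc)
qed

text \<open>Apply the slab estimate to |z u|^2 with a cut-off z in the chart, and Young's inequality
  2 |v| |grad v| <= \<eta> |grad v|^2 + |v|^2 / \<eta>. The neighbourhood V is fixed before
  \<epsilon>, so that a finite cover can be chosen independently of \<epsilon>.\<close>

lemma chart_form_bound:
  fixes \<Gamma> U :: "(real ^ 'n) set"
  assumes chart: "lipschitz_chart e h" and U: "open U" and \<Gamma>: "\<Gamma> \<inter> U = {x \<in> U. x \<bullet> e = h x}"
    and \<sigma>: "is_surface_measure \<Gamma> \<sigma>" and p: "p \<in> U"
  obtains V where "open V" "p \<in> V"
    "\<And>\<epsilon>. \<epsilon> > 0 \<Longrightarrow> \<exists>C\<ge>0. \<forall>u. cc_smooth u \<longrightarrow> (\<integral>\<^sup>+x. indicator V x * ennreal ((cmod (u x))\<^sup>2) \<partial>\<sigma>) \<le>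
      ennreal \<epsilon> * (\<Sum>i\<in>UNIV. sq_norm (partial i u)) + ennreal C * sq_norm u"
proof -
  obtain z V where z: "cc_smooth z" "closure {x. z x \<noteq> (0::real)} \<subseteq> U" "\<And>x. 0 \<le> z x" "\<And>x. z x \<le> 1"
    "open V" "{p} \<subseteq> V" "V \<subseteq> U" "\<And>x. x \<in> V \<Longrightarrow> z x = 1"
    using smooth_cutoff_exists[of "{p}" U] U p by auto
  obtain L where L: "L > 0" "\<And>x v. norm (frechet_derivative z (at x) v) \<le> L * norm v"
    using cc_smooth_derivative_bounded[OF z(1)] by blast
  obtain Q where Q: "Q \<ge> 0" "\<And>f. f \<in> borel_measurable borel \<Longrightarrow> (\<And>x. x \<notin> U \<Longrightarrow> f x = 0) \<Longrightarrow>
    (\<integral>\<^sup>+x. f x \<partial>\<sigma>) \<le> ennreal Q * (\<integral>\<^sup>+x. indicator {x. 0 \<le> x \<bullet> e \<and> x \<bullet> e \<le> 1} x * f (x + (h x - x \<bullet> e) *\<^sub>R e) \<partial>lborel)"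
    using chart_integral_le[OF chart U \<Gamma> \<sigma>] by blast
  have ne: "norm e = 1" using chart by (simp add: lipschitz_chart_def)
  obtain L' where "L'-lipschitz_on UNIV h" using chart by (auto simp: lipschitz_chart_def)
  then have [measurable]: "h \<in> borel_measurable borel"
    by (intro borel_measurable_continuous_onI lipschitz_on_continuous_on)
  have "\<exists>C\<ge>0. \<forall>u. cc_smooth u \<longrightarrow> (\<integral>\<^sup>+x. indicator V x * ennreal ((cmod (u x))\<^sup>2) \<partial>\<sigma>) \<le>
      ennreal \<epsilon> * (\<Sum>i\<in>UNIV. sq_norm (partial i u)) + ennreal C * sq_norm u" if \<epsilon>: "\<epsilon> > 0" for \<epsilon>
  proof -
    \<comment> \<open>Q comes from the chart and 2 from the product rule for z u, so the gradient
      coefficient Q \<eta> 2 is at most \<epsilon>.\<close>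
    define \<eta> where "\<eta> = \<epsilon> / (2 * (Q + 1))"
    have \<eta>: "\<eta> > 0" "Q * \<eta> * 2 \<le> \<epsilon>" using \<epsilon> Q(1) by (auto simp: \<eta>_def field_simps)
    define C where "C = Q * \<eta> * (2 * L\<^sup>2 * real CARD('n)) + Q * (1 / \<eta>)"
    have C0: "C \<ge> 0" using Q(1) \<eta>(1) by (simp add: C_def)
    have "(\<integral>\<^sup>+x. indicator V x * ennreal ((cmod (u x))\<^sup>2) \<partial>\<sigma>) \<le>
      ennreal \<epsilon> * (\<Sum>i\<in>UNIV. sq_norm (partial i u)) + ennreal C * sq_norm u" if u: "cc_smooth u" for u
    proof -
      define v where "v x = z x *\<^sub>R u x" for x
      have v: "cc_smooth v" unfolding v_def
        by (rule cc_smooth_bilinear1[OF bounded_bilinear_scaleR z(1) cc_smooth_smooth[OF u]])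
      define g where "g x = (cmod (v x))\<^sup>2" for x
      have g: "cc_smooth g" unfolding g_def by (rule cc_smooth_norm_sq[OF v])
      have [measurable]: "g \<in> borel_measurable borel" "v \<in> borel_measurable borel" "u \<in> borel_measurable borel"
        "grad_sq v \<in> borel_measurable borel"
        using cc_smooth_measurable[OF g] cc_smooth_measurable[OF v] cc_smooth_measurable[OF u] grad_sq_measurable[OF v] by auto
      have gU: "g x = 0" if "x \<notin> U" for x
        using that z(2) closure_subset[of "{x. z x \<noteq> 0}"] by (auto simp: g_def v_def)
      have "(\<integral>\<^sup>+x. indicator V x * ennreal ((cmod (u x))\<^sup>2) \<partial>\<sigma>) \<le> (\<integral>\<^sup>+x. ennreal (g x) \<partial>\<sigma>)"
        using z(8) by (intro nn_integral_mono) (auto simp: indicator_def g_def v_def)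
      also have "\<dots> \<le> ennreal Q * (\<integral>\<^sup>+x. indicator {x. 0 \<le> x \<bullet> e \<and> x \<bullet> e \<le> 1} x * ennreal (g (x + (h x - x \<bullet> e) *\<^sub>R e)) \<partial>lborel)"
        by (rule Q(2)) (auto simp: gU)
      also have "\<dots> \<le> ennreal Q * (\<integral>\<^sup>+x. ennreal \<bar>frechet_derivative g (at x) e\<bar> \<partial>lborel)"
        by (intro mult_left_mono slab_integral_le g ne) (auto simp: g_def)
      also have "\<dots> \<le> ennreal Q * (\<integral>\<^sup>+x. ennreal \<eta> * ennreal (grad_sq v x) + ennreal (1 / \<eta>) * ennreal ((cmod (v x))\<^sup>2) \<partial>lborel)"
      proof (intro mult_left_mono nn_integral_mono)
        fix x
        have "frechet_derivative g (at x) e = 2 * (v x \<bullet> frechet_derivative v (at x) e)"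
          using frechet_derivative_at[OF norm_sq_has_derivative[OF cc_smooth_smooth[OF v], of x], symmetric] unfolding g_def by simp
        then have "\<bar>frechet_derivative g (at x) e\<bar> \<le> 2 * (cmod (v x) * cmod (frechet_derivative v (at x) e))"
          using Cauchy_Schwarz_ineq2[of "v x" "frechet_derivative v (at x) e"] by (simp add: abs_mult)
        also have "\<dots> \<le> 2 * (cmod (v x) * sqrt (grad_sq v x))"
          using cmod_frechet_derivative_le[OF cc_smooth_smooth[OF v], of x e] ne by (intro mult_left_mono) auto
        also have "\<dots> = 2 * (cmod (v x) / sqrt \<eta>) * (sqrt \<eta> * sqrt (grad_sq v x))" using \<eta>(1) by simp
        also have "\<dots> \<le> (cmod (v x) / sqrt \<eta>)\<^sup>2 + (sqrt \<eta> * sqrt (grad_sq v x))\<^sup>2"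
          by (rule sum_squares_bound)
        also have "\<dots> = \<eta> * grad_sq v x + (1 / \<eta>) * (cmod (v x))\<^sup>2"
          using \<eta>(1) by (simp add: power_divide power_mult_distrib)
        finally have "ennreal \<bar>frechet_derivative g (at x) e\<bar> \<le> ennreal (\<eta> * grad_sq v x + (1 / \<eta>) * (cmod (v x))\<^sup>2)"
          by (rule ennreal_leI)
        also have "\<dots> = ennreal \<eta> * ennreal (grad_sq v x) + ennreal (1 / \<eta>) * ennreal ((cmod (v x))\<^sup>2)"
          using \<eta>(1) by (subst ennreal_plus) (auto simp: ennreal_mult[symmetric])
        finally show "ennreal \<bar>frechet_derivative g (at x) e\<bar> \<le> ennreal \<eta> * ennreal (grad_sq v x) + ennreal (1 / \<eta>) * ennreal ((cmod (v x))\<^sup>2)" .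
      qed simp
      also have "\<dots> = ennreal Q * (ennreal \<eta> * (\<Sum>i\<in>UNIV. sq_norm (partial i v)) + ennreal (1 / \<eta>) * sq_norm v)"
        by (simp add: nn_integral_add nn_integral_cmult nn_integral_grad_sq[OF v] sq_norm_def)
      also have "\<dots> \<le> ennreal Q * (ennreal \<eta> * (\<Sum>i\<in>UNIV. 2 * ennreal (1\<^sup>2) * sq_norm (partial i u) + 2 * ennreal (L\<^sup>2) * sq_norm u)
          + ennreal (1 / \<eta>) * (ennreal (1\<^sup>2) * sq_norm u))"
        unfolding v_def using z L u cc_smooth_smooth[OF z(1)]
        by (intro mult_left_mono add_mono sum_mono sq_norm_partial_scaleR_le sq_norm_scaleR_le) auto
      also have "\<dots> = ennreal (Q * \<eta> * 2) * (\<Sum>i\<in>UNIV. sq_norm (partial i u)) + ennreal C * sq_norm u"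
      proof -
        have "ennreal C = ennreal Q * ennreal \<eta> * (2 * ennreal (L\<^sup>2) * of_nat CARD('n)) + ennreal Q * ennreal (1 / \<eta>)"
        proof -
          have "ennreal C = ennreal (Q * \<eta> * (2 * L\<^sup>2 * real CARD('n))) + ennreal (Q * (1 / \<eta>))"
            unfolding C_def using Q(1) \<eta>(1) by (intro ennreal_plus) auto
          also have "ennreal (Q * (1 / \<eta>)) = ennreal Q * ennreal (1 / \<eta>)"
            using Q(1) \<eta>(1) by (intro ennreal_mult) auto
          also have "ennreal (Q * \<eta> * (2 * L\<^sup>2 * real CARD('n))) = ennreal Q * ennreal \<eta> * (2 * ennreal (L\<^sup>2) * of_nat CARD('n))"
            using Q(1) \<eta>(1) by (simp add: ennreal_mult ennreal_of_nat_eq_real_of_nat)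
          finally show ?thesis .
        qed
        moreover have "ennreal (Q * \<eta> * 2) = ennreal Q * ennreal \<eta> * 2" using Q(1) \<eta>(1) by (simp add: ennreal_mult)
        moreover have "(\<Sum>i\<in>(UNIV::'n set). 2 * ennreal (1\<^sup>2) * sq_norm (partial i u) + 2 * ennreal (L\<^sup>2) * sq_norm u)
           = 2 * (\<Sum>i\<in>UNIV. sq_norm (partial i u)) + of_nat CARD('n) * (2 * ennreal (L\<^sup>2) * sq_norm u)"
          by (simp add: sum.distrib sum_distrib_left)
        ultimately show ?thesis by (simp add: distrib_left distrib_right ac_simps)
      qed
      also have "\<dots> \<le> ennreal \<epsilon> * (\<Sum>i\<in>UNIV. sq_norm (partial i u)) + ennreal C * sq_norm u"
        by (intro add_right_mono mult_right_mono ennreal_leI \<eta>(2)) simp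
      finally show ?thesis .
    qed
    then show ?thesis using C0 by blast
  qed
  then show ?thesis using that[of V] z by blast
qed

text \<open>Compactness: finitely many chart neighbourhoods cover \<Gamma>, which carries all of
  \<sigma>, and \<epsilon> is shared among them.\<close>

lemma surface_form_bound:
  fixes \<Gamma> :: "(real ^ 'n) set"
  assumes \<Gamma>: "compact \<Gamma>" "lipschitz_hypersurface \<Gamma>" and \<sigma>: "is_surface_measure \<Gamma> \<sigma>" and \<epsilon>: "\<epsilon> > 0"
  obtains C where "C \<ge> 0" "\<And>u. cc_smooth u \<Longrightarrow> (\<integral>\<^sup>+x. ennreal ((cmod (u x))\<^sup>2) \<partial>\<sigma>) \<le>
    ennreal \<epsilon> * (\<Sum>i\<in>UNIV. sq_norm (partial i u)) + ennreal C * sq_norm u"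
proof -
  define bnd where "bnd V \<epsilon> C \<longleftrightarrow> C \<ge> 0 \<and> (\<forall>u. cc_smooth u \<longrightarrow>
      (\<integral>\<^sup>+x. indicator V x * ennreal ((cmod (u x))\<^sup>2) \<partial>\<sigma>) \<le>
      ennreal \<epsilon> * (\<Sum>i\<in>UNIV. sq_norm (partial i u)) + ennreal C * sq_norm u)" for V \<epsilon> C
  define good where "good V \<longleftrightarrow> open V \<and> (\<forall>\<epsilon>>0. \<exists>C. bnd V \<epsilon> C)" for V
  have "\<exists>V. good V \<and> p \<in> V" if p: "p \<in> \<Gamma>" for p
  proof -
    obtain e h U where c: "lipschitz_chart e h" "open U" "p \<in> U" "\<Gamma> \<inter> U = {x \<in> U. x \<bullet> e = h x}"
      using \<Gamma>(2) p unfolding lipschitz_hypersurface_def by blast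
    show ?thesis
    proof (rule chart_form_bound[OF c(1,2,4) \<sigma> c(3)])
      fix V assume V: "open V" "p \<in> V"
        "\<And>\<epsilon>. \<epsilon> > 0 \<Longrightarrow> \<exists>C\<ge>0. \<forall>u. cc_smooth u \<longrightarrow> (\<integral>\<^sup>+x. indicator V x * ennreal ((cmod (u x))\<^sup>2) \<partial>\<sigma>) \<le>
          ennreal \<epsilon> * (\<Sum>i\<in>UNIV. sq_norm (partial i u)) + ennreal C * sq_norm u"
      have "\<exists>C. bnd V \<epsilon> C" if "\<epsilon> > 0" for \<epsilon> unfolding bnd_def using V(3)[OF that] by blast
      then have "good V" unfolding good_def using V(1) by blast
      then show "\<exists>V. good V \<and> p \<in> V" using V(2) by blast
    qed
  qed
  then have cov: "\<Gamma> \<subseteq> \<Union>{V. good V}" by blast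
  have opn: "\<And>V. V \<in> {V. good V} \<Longrightarrow> open V" by (simp add: good_def)
  obtain D where D: "D \<subseteq> {V. good V}" "finite D" "\<Gamma> \<subseteq> \<Union>D"
    by (rule compactE[OF \<Gamma>(1) cov opn])
  define \<epsilon>' where "\<epsilon>' = \<epsilon> / (real (card D) + 1)"
  have \<epsilon>': "\<epsilon>' > 0" "real (card D) * \<epsilon>' \<le> \<epsilon>" using \<epsilon> by (auto simp: \<epsilon>'_def field_simps)
  have "\<forall>V\<in>D. \<exists>C. bnd V \<epsilon>' C"
    using D(1) \<epsilon>'(1) unfolding good_def by blast
  then obtain C where C0: "\<forall>V\<in>D. bnd V \<epsilon>' (C V)" by (rule bchoice[THEN exE])
  have C: "C V \<ge> 0" "\<And>u. cc_smooth u \<Longrightarrow>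
      (\<integral>\<^sup>+x. indicator V x * ennreal ((cmod (u x))\<^sup>2) \<partial>\<sigma>) \<le>
      ennreal \<epsilon>' * (\<Sum>i\<in>UNIV. sq_norm (partial i u)) + ennreal (C V) * sq_norm u" if "V \<in> D" for V
    using C0 that unfolding bnd_def by blast+
  have sets\<sigma>[measurable_cong]: "sets \<sigma> = sets borel" using \<sigma> by (simp add: is_surface_measure_def)
  have "AE x in \<sigma>. x \<in> \<Gamma>"
  proof (rule AE_I')
    show "- \<Gamma> \<in> null_sets \<sigma>"
      using \<sigma> \<Gamma>(1) by (auto simp: is_surface_measure_def null_sets_def compact_imp_closed intro!: borel_open)
  qed auto
  show ?thesis
  proof (rule that[of "\<Sum>V\<in>D. C V"])
    show "0 \<le> (\<Sum>V\<in>D. C V)" by (intro sum_nonneg C(1))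
    fix u :: "real ^ 'n \<Rightarrow> complex" assume u: "cc_smooth u"
    have [measurable]: "u \<in> borel_measurable borel" by (rule cc_smooth_measurable[OF u])
    have Vb[measurable]: "V \<in> sets borel" if "V \<in> D" for V using D(1) that by (auto simp: good_def)
    have "(\<integral>\<^sup>+x. ennreal ((cmod (u x))\<^sup>2) \<partial>\<sigma>) \<le> (\<integral>\<^sup>+x. (\<Sum>V\<in>D. indicator V x * ennreal ((cmod (u x))\<^sup>2)) \<partial>\<sigma>)"
    proof (rule nn_integral_mono_AE)
      show "AE x in \<sigma>. ennreal ((cmod (u x))\<^sup>2) \<le> (\<Sum>V\<in>D. indicator V x * ennreal ((cmod (u x))\<^sup>2))"
        using \<open>AE x in \<sigma>. x \<in> \<Gamma>\<close>
      proof eventually_elim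
        case (elim x)
        then obtain V where "V \<in> D" "x \<in> V" using D(3) by blast
        then have "indicator V x * ennreal ((cmod (u x))\<^sup>2) \<le> (\<Sum>V\<in>D. indicator V x * ennreal ((cmod (u x))\<^sup>2))"
          using D(2) by (intro member_le_sum) auto
        then show ?case using \<open>x \<in> V\<close> by simp
      qed
    qed
    also have "\<dots> = (\<Sum>V\<in>D. \<integral>\<^sup>+x. indicator V x * ennreal ((cmod (u x))\<^sup>2) \<partial>\<sigma>)"
      by (rule nn_integral_sum) (use Vb sets\<sigma> in \<open>auto intro!: borel_measurable_times_ennreal borel_measurable_indicator\<close>)
    also have "\<dots> \<le> (\<Sum>V\<in>D. ennreal \<epsilon>' * (\<Sum>i\<in>UNIV. sq_norm (partial i u)) + ennreal (C V) * sq_norm u)"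
      by (intro sum_mono C(2) u)
    also have "\<dots> = ennreal (real (card D) * \<epsilon>') * (\<Sum>i\<in>UNIV. sq_norm (partial i u)) + ennreal (\<Sum>V\<in>D. C V) * sq_norm u"
    proof -
      have "(\<Sum>V\<in>D. ennreal (C V)) = ennreal (\<Sum>V\<in>D. C V)" by (intro sum_ennreal C(1))
      then show ?thesis using \<epsilon>'(1)
        by (simp add: sum.distrib sum_distrib_right[symmetric] ennreal_mult ennreal_of_nat_eq_real_of_nat mult.assoc)
    qed
    also have "\<dots> \<le> ennreal \<epsilon> * (\<Sum>i\<in>UNIV. sq_norm (partial i u)) + ennreal (\<Sum>V\<in>D. C V) * sq_norm u"
      by (intro add_right_mono mult_right_mono ennreal_leI \<epsilon>'(2)) simp
    finally show "(\<integral>\<^sup>+x. ennreal ((cmod (u x))\<^sup>2) \<partial>\<sigma>) \<le>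
      ennreal \<epsilon> * (\<Sum>i\<in>UNIV. sq_norm (partial i u)) + ennreal (\<Sum>V\<in>D. C V) * sq_norm u" .
  qed
qed


section \<open>Borel representatives of functions in $H^1$\<close>

text \<open>Function-space elements are only Lebesgue measurable on W and arbitrary elsewhere.
  Convolutions, translations and Tonelli are applied to a Borel version extended by zero to the
  whole space.\<close>

definition rep :: "(real ^ 'n) set \<Rightarrow> (real ^ 'n \<Rightarrow> 'b::{banach, second_countable_topology}) \<Rightarrow> (real ^ 'n \<Rightarrow> 'b) \<Rightarrow> bool" where
  "rep W f g \<longleftrightarrow> f \<in> borel_measurable (lebesgue_on W) \<and> g \<in> borel_measurable borel \<and>
     (\<forall>x. x \<notin> W \<longrightarrow> g x = 0) \<and> (AE x in lebesgue. x \<in> W \<longrightarrow> f x = g x)"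

lemma rep_measurable: "rep W f g \<Longrightarrow> g \<in> borel_measurable borel"
  by (simp add: rep_def)

lemma rep_zero: "rep W f g \<Longrightarrow> x \<notin> W \<Longrightarrow> g x = 0"
  by (simp add: rep_def)

lemma open_space_lebesgue: "open W \<Longrightarrow> W \<inter> space lebesgue \<in> sets lebesgue"
  for W :: "(real ^ 'n) set"
  by auto

lemma rep_indicator:
  assumes W: "open W" and r: "rep W f g"
  shows "(\<lambda>x. indicator W x *\<^sub>R f x) \<in> borel_measurable lebesgue" "AE x in lebesgue. indicator W x *\<^sub>R f x = g x"
proof -
  have "f \<in> borel_measurable (restrict_space lebesgue W)" using r by (simp add: rep_def)
  then show "(\<lambda>x. indicator W x *\<^sub>R f x) \<in> borel_measurable lebesgue"
    using borel_measurable_restrict_space_iff[OF open_space_lebesgue[OF W], of f] by simp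
  have "AE x in lebesgue. x \<in> W \<longrightarrow> f x = g x" using r by (simp add: rep_def)
  then show "AE x in lebesgue. indicator W x *\<^sub>R f x = g x"
  proof eventually_elim
    case (elim x)
    then show ?case using rep_zero[OF r, of x] by (cases "x \<in> W") auto
  qed
qed

lemma rep_integral:
  assumes W: "open W" and r: "rep W f g"
  shows "(LINT x|lebesgue_on W. f x) = (LINT x|lborel. g x)"
    "integrable (lebesgue_on W) f \<longleftrightarrow> integrable lborel g"
proof -
  note i = rep_indicator[OF W r]
  have "(LINT x|lebesgue_on W. f x) = (LINT x|lebesgue. indicator W x *\<^sub>R f x)"
    by (rule integral_restrict_space[OF open_space_lebesgue[OF W]])
  then show "(LINT x|lebesgue_on W. f x) = (LINT x|lborel. g x)"
    using integral_lebesgue_lborel(1)[OF i(1) rep_measurable[OF r] i(2)] by simp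
  have "integrable (lebesgue_on W) f \<longleftrightarrow> integrable lebesgue (\<lambda>x. indicator W x *\<^sub>R f x)"
    by (rule integrable_restrict_space[OF open_space_lebesgue[OF W]])
  then show "integrable (lebesgue_on W) f \<longleftrightarrow> integrable lborel g"
    using integral_lebesgue_lborel(2)[OF i(1) rep_measurable[OF r] i(2)] by simp
qed

lemma rep_exists:
  fixes f :: "real ^ 'n \<Rightarrow> complex"
  assumes W: "open W" and f: "f \<in> borel_measurable (lebesgue_on W)"
  obtains g where "rep W f g"
proof -
  have "(\<lambda>x. indicator W x *\<^sub>R f x) \<in> borel_measurable lebesgue"
    using f borel_measurable_restrict_space_iff[OF open_space_lebesgue[OF W], of f] by simp
  then obtain g where g: "g \<in> borel_measurable borel" "AE x in lebesgue. indicator W x *\<^sub>R f x = g x"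
    using completion_ex_borel_complex by blast
  have "rep W f (\<lambda>x. indicator W x *\<^sub>R g x)"
    unfolding rep_def
  proof (intro conjI)
    show "(\<lambda>x. indicator W x *\<^sub>R g x) \<in> borel_measurable borel" using g(1) W by auto
    show "AE x in lebesgue. x \<in> W \<longrightarrow> f x = indicator W x *\<^sub>R g x"
      using g(2) by eventually_elim auto
  qed (use f in auto)
  then show ?thesis using that by blast
qed

lemma borel_measurable_lebesgue_on:
  "f \<in> borel_measurable borel \<Longrightarrow> f \<in> borel_measurable (lebesgue_on W)"
  for f :: "real ^ 'n \<Rightarrow> 'b::topological_space"
  by (intro measurable_restrict_space1 measurable_completion) simp

lemma rep_mult_borel:
  fixes f g \<phi> :: "real ^ 'n \<Rightarrow> complex"
  assumes r: "rep W f g" and \<phi>: "\<phi> \<in> borel_measurable borel"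
  shows "rep W (\<lambda>x. f x * \<phi> x) (\<lambda>x. g x * \<phi> x)"
  unfolding rep_def
proof (intro conjI)
  show "(\<lambda>x. f x * \<phi> x) \<in> borel_measurable (lebesgue_on W)"
    using r borel_measurable_lebesgue_on[OF \<phi>] by (auto simp: rep_def)
  have "AE x in lebesgue. x \<in> W \<longrightarrow> f x = g x" using r by (simp add: rep_def)
  then show "AE x in lebesgue. x \<in> W \<longrightarrow> f x * \<phi> x = g x * \<phi> x" by eventually_elim auto
qed (use r \<phi> in \<open>auto simp: rep_def\<close>)

lemma rep_mult:
  fixes f g f' g' :: "real ^ 'n \<Rightarrow> complex"
  assumes r: "rep W f g" "rep W f' g'"
  shows "rep W (\<lambda>x. f x * f' x) (\<lambda>x. g x * g' x)"
  unfolding rep_def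
proof (intro conjI)
  have "AE x in lebesgue. x \<in> W \<longrightarrow> f x = g x" "AE x in lebesgue. x \<in> W \<longrightarrow> f' x = g' x"
    using r by (auto simp: rep_def)
  then show "AE x in lebesgue. x \<in> W \<longrightarrow> f x * f' x = g x * g' x" by eventually_elim auto
qed (use r in \<open>auto simp: rep_def\<close>)

lemma rep_diff:
  fixes f g f' g' :: "real ^ 'n \<Rightarrow> complex"
  assumes r: "rep W f g" "rep W f' g'"
  shows "rep W (\<lambda>x. f x - f' x) (\<lambda>x. g x - g' x)"
  unfolding rep_def
proof (intro conjI)
  have "AE x in lebesgue. x \<in> W \<longrightarrow> f x = g x" "AE x in lebesgue. x \<in> W \<longrightarrow> f' x = g' x"
    using r by (auto simp: rep_def)
  then show "AE x in lebesgue. x \<in> W \<longrightarrow> f x - f' x = g x - g' x" by eventually_elim auto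
qed (use r in \<open>auto simp: rep_def\<close>)

lemma rep_norm_sq:
  fixes f g :: "real ^ 'n \<Rightarrow> complex"
  assumes r: "rep W f g"
  shows "rep W (\<lambda>x. (cmod (f x))\<^sup>2) (\<lambda>x. (cmod (g x))\<^sup>2)"
  unfolding rep_def
proof (intro conjI)
  have "AE x in lebesgue. x \<in> W \<longrightarrow> f x = g x" using r by (simp add: rep_def)
  then show "AE x in lebesgue. x \<in> W \<longrightarrow> (cmod (f x))\<^sup>2 = (cmod (g x))\<^sup>2" by eventually_elim auto
qed (use r in \<open>auto simp: rep_def\<close>)

lemma rep_restrict:
  assumes W: "open W" "W \<subseteq> \<Omega>" and r: "rep \<Omega> f g"
  shows "rep W f (\<lambda>x. indicator W x *\<^sub>R g x)"
  unfolding rep_def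
proof (intro conjI)
  have "f \<in> borel_measurable (restrict_space lebesgue \<Omega>)" using r by (simp add: rep_def)
  then show "f \<in> borel_measurable (lebesgue_on W)" by (rule measurable_restrict_mono[OF _ W(2)])
  show "(\<lambda>x. indicator W x *\<^sub>R g x) \<in> borel_measurable borel" using r W by (auto simp: rep_def)
  have "AE x in lebesgue. x \<in> \<Omega> \<longrightarrow> f x = g x" using r by (simp add: rep_def)
  then show "AE x in lebesgue. x \<in> W \<longrightarrow> f x = indicator W x *\<^sub>R g x"
    by eventually_elim (use W(2) in auto)
qed auto

lemma rep_borel:
  assumes W: "open W" and f: "f \<in> borel_measurable borel"
  shows "rep W f (\<lambda>x. indicator W x *\<^sub>R f x)"
  unfolding rep_def using W f borel_measurable_lebesgue_on[OF f] by auto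

lemma rep_sq_norm:
  fixes f g :: "real ^ 'n \<Rightarrow> complex"
  assumes W: "open W" and r: "rep W f g" and g: "integrable lborel (\<lambda>x. (cmod (g x))\<^sup>2)"
  shows "f \<in> L2_space W" "ennreal ((L2_norm W f)\<^sup>2) = sq_norm g"
proof -
  note i = rep_integral[OF W rep_norm_sq[OF r]]
  show "f \<in> L2_space W" using r i(2) g by (simp add: L2_space_def rep_def)
  have "(L2_norm W f)\<^sup>2 = (LINT x|lborel. (cmod (g x))\<^sup>2)"
    unfolding L2_norm_def i(1) by (rule real_sqrt_pow2) (auto intro: integral_nonneg_AE)
  then show "ennreal ((L2_norm W f)\<^sup>2) = sq_norm g"
    unfolding sq_norm_def by (subst nn_integral_eq_integral[OF g]) auto
qed

lemma L2_space_rep: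
  fixes f :: "real ^ 'n \<Rightarrow> complex"
  assumes W: "open W" and f: "f \<in> L2_space W"
  obtains g where "rep W f g" "integrable lborel (\<lambda>x. (cmod (g x))\<^sup>2)"
proof -
  obtain g where g: "rep W f g"
    using rep_exists[OF W, of f] f by (auto simp: L2_space_def)
  then show ?thesis
    using that[OF g] rep_integral(2)[OF W rep_norm_sq[OF g]] f by (simp add: L2_space_def)
qed

text \<open>Local integrability gives measurability on each compact set of an exhaustion of W, and
  the function on W is the pointwise limit.\<close>

lemma locally_integrable_measurable:
  fixes w :: "real ^ 'n \<Rightarrow> complex"
  assumes W: "open W" and w: "locally_integrable W w"
  shows "w \<in> borel_measurable (lebesgue_on W)"
proof -
  obtain C :: "nat \<Rightarrow> (real ^ 'n) set" where C: "\<And>n. compact (C n)" "\<And>n. C n \<subseteq> W" "\<And>n. C n \<subseteq> interior (C (Suc n))"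
    "\<Union> (range C) = W"
    using open_Union_compact_subsets[OF W] by metis
  have m: "(\<lambda>x. indicator (C n) x *\<^sub>R w x) \<in> borel_measurable lebesgue" for n
    using w C(1,2) by (auto simp: locally_integrable_def set_integrable_def intro: borel_measurable_integrable)
  have "(\<lambda>x. indicator W x *\<^sub>R w x) \<in> borel_measurable lebesgue"
  proof (rule borel_measurable_LIMSEQ_metric[OF m])
    fix x
    show "(\<lambda>n. indicator (C n) x *\<^sub>R w x) \<longlonglongrightarrow> indicator W x *\<^sub>R w x"
    proof (cases "x \<in> W")
      case True
      then obtain N where N: "x \<in> C N" using C(4) by auto
      have "x \<in> C n" if "n \<ge> N" for n
        using that by (induction rule: dec_induct) (use N C(3) interior_subset in blast)+
      then show ?thesis using True
        by (intro tendsto_eventually eventually_sequentiallyI[of N]) auto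
    next
      case False
      then have "x \<notin> C n" for n using C(2) by auto
      then show ?thesis using False by simp
    qed
  qed
  then show ?thesis
    using borel_measurable_restrict_space_iff[OF open_space_lebesgue[OF W], of w] by simp
qed

lemma rep_locally_integrable:
  fixes w b :: "real ^ 'n \<Rightarrow> complex"
  assumes W: "open W" and r: "rep W w b"
  shows "locally_integrable W w \<longleftrightarrow> (\<forall>K. compact K \<and> K \<subseteq> W \<longrightarrow> set_integrable lborel K b)"
proof -
  have "set_integrable lebesgue K w \<longleftrightarrow> set_integrable lborel K b" if K: "compact K" "K \<subseteq> W" for K
  proof -
    have [measurable]: "K \<in> sets borel" using K by (simp add: borel_compact)
    have "(\<lambda>x. indicator K x *\<^sub>R (indicator W x *\<^sub>R w x)) \<in> borel_measurable lebesgue"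
    proof (rule borel_measurable_scaleR[OF borel_measurable_indicator rep_indicator(1)[OF W r]])
      show "K \<in> sets lebesgue" by simp
    qed
    moreover have "(\<lambda>x. indicator K x *\<^sub>R (indicator W x *\<^sub>R w x)) = (\<lambda>x. indicator K x *\<^sub>R w x)"
      using K(2) by (intro ext) (auto split: split_indicator)
    ultimately have m: "(\<lambda>x. indicator K x *\<^sub>R w x) \<in> borel_measurable lebesgue" by simp
    have [measurable]: "b \<in> borel_measurable borel" by (rule rep_measurable[OF r])
    have "AE x in lebesgue. x \<in> W \<longrightarrow> w x = b x" using r by (simp add: rep_def)
    then have "AE x in lebesgue. indicator K x *\<^sub>R w x = indicator K x *\<^sub>R b x"
      by eventually_elim (use K(2) in \<open>auto simp: indicator_def\<close>)
    from integral_lebesgue_lborel(2)[OF m _ this] show ?thesis unfolding set_integrable_def by simp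
  qed
  then show ?thesis unfolding locally_integrable_def by blast
qed

lemma integrable_mult_test:
  fixes b \<phi> :: "real ^ 'n \<Rightarrow> complex"
  assumes [measurable]: "b \<in> borel_measurable borel" and b: "\<And>K. compact K \<Longrightarrow> K \<subseteq> W \<Longrightarrow> set_integrable lborel K b"
    and \<phi>: "\<phi> \<in> test_functions W"
  shows "integrable lborel (\<lambda>x. b x * \<phi> x)"
proof -
  let ?K = "closure {x. \<phi> x \<noteq> 0}"
  have c: "cc_smooth \<phi>" "?K \<subseteq> W" using \<phi> by (auto simp: test_functions_iff)
  have [measurable]: "\<phi> \<in> borel_measurable borel" by (rule cc_smooth_measurable[OF c(1)])
  obtain B where B: "B > 0" "\<And>x. norm (\<phi> x) \<le> B" using cc_smooth_bounded[OF c(1)] by blast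
  have "set_integrable lborel ?K b" using c by (intro b) (auto simp: cc_smooth_def)
  then have "integrable lborel (\<lambda>x. B *\<^sub>R (indicator ?K x *\<^sub>R b x))"
    unfolding set_integrable_def by (rule integrable_scaleR_right)
  then show ?thesis
  proof (rule Bochner_Integration.integrable_bound)
    show "AE x in lborel. norm (b x * \<phi> x) \<le> norm (B *\<^sub>R (indicator ?K x *\<^sub>R b x))"
    proof (rule AE_I2)
      fix x
      show "norm (b x * \<phi> x) \<le> norm (B *\<^sub>R (indicator ?K x *\<^sub>R b x))"
      proof (cases "\<phi> x = 0")
        case False
        then have "x \<in> ?K" using closure_subset[of "{x. \<phi> x \<noteq> 0}"] by auto
        then show ?thesis using B(1) B(2)[of x] by (simp add: norm_mult mult.commute[of B] mult_left_mono)
      qed simp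
    qed
  qed simp
qed

section \<open>Weak derivatives and their representatives\<close>

text \<open>By the du Bois-Reymond lemma two weak derivatives agree almost everywhere, so the one
  picked by \<open>weak_partial\<close> has the same Borel representative as any other.\<close>

lemma weak_partial_unique:
  fixes u :: "real ^ 'n \<Rightarrow> complex"
  assumes W: "open W" and w: "is_weak_partial W i u w" and b: "is_weak_partial W i u b'" "rep W b' b"
  shows "rep W w b"
proof -
  have wm: "w \<in> borel_measurable (lebesgue_on W)"
    using w locally_integrable_measurable[OF W] by (auto simp: is_weak_partial_def)
  obtain a where a: "rep W w a" using rep_exists[OF W wm] by blast
  have [measurable]: "a \<in> borel_measurable borel" "b \<in> borel_measurable borel"
    using rep_measurable[OF a] rep_measurable[OF b(2)] by auto
  have la: "set_integrable lborel K a" and lb: "set_integrable lborel K b" if "compact K" "K \<subseteq> W" for K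
    using w b(1) that rep_locally_integrable[OF W a] rep_locally_integrable[OF W b(2)]
    by (auto simp: is_weak_partial_def)
  have "AE x in lborel. x \<in> W \<longrightarrow> a x - b x = 0"
  proof (rule du_Bois_Reymond[OF _ W])
    show "set_integrable lborel K (\<lambda>x. a x - b x)" if "compact K" "K \<subseteq> W" for K
      using la[OF that] lb[OF that] by (simp add: set_integrable_def scaleR_diff_right)
    show "(LINT x|lborel. (a x - b x) * \<phi> x) = 0" if \<phi>: "\<phi> \<in> test_functions W" for \<phi>
    proof -
      have [measurable]: "\<phi> \<in> borel_measurable borel"
        using \<phi> cc_smooth_measurable by (auto simp: test_functions_iff)
      have "(LINT x|lborel. (a x - b x) * \<phi> x) = (LINT x|lborel. a x * \<phi> x) - (LINT x|lborel. b x * \<phi> x)"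
        using integrable_mult_test[OF _ la \<phi>] integrable_mult_test[OF _ lb \<phi>]
        by (simp add: left_diff_distrib)
      also have "\<dots> = (LINT x|lebesgue_on W. w x * \<phi> x) - (LINT x|lebesgue_on W. b' x * \<phi> x)"
        using rep_integral(1)[OF W rep_mult_borel[OF a]] rep_integral(1)[OF W rep_mult_borel[OF b(2)]] by simp
      also have "\<dots> = 0" using w b(1) \<phi> unfolding is_weak_partial_def by (metis diff_self minus_equation_iff)
      finally show ?thesis .
    qed
  qed simp
  then have "AE x in lebesgue. x \<in> W \<longrightarrow> a x - b x = 0" by (rule AE_completion)
  moreover have "AE x in lebesgue. x \<in> W \<longrightarrow> w x = a x" using a by (simp add: rep_def)
  ultimately have "AE x in lebesgue. x \<in> W \<longrightarrow> w x = b x" by eventually_elim auto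
  then show ?thesis using wm b(2) by (simp add: rep_def)
qed

text \<open>Bundles Borel versions of a function and of its chosen weak derivatives, so that every
  later norm and integral is one of Borel functions on the whole space.\<close>

definition H1_rep :: "(real ^ 'n) set \<Rightarrow> (real ^ 'n \<Rightarrow> complex) \<Rightarrow> (real ^ 'n \<Rightarrow> complex) \<Rightarrow> ('n \<Rightarrow> real ^ 'n \<Rightarrow> complex) \<Rightarrow> bool" where
  "H1_rep W u u0 w \<longleftrightarrow> rep W u u0 \<and> integrable lborel (\<lambda>x. (cmod (u0 x))\<^sup>2) \<and>
     (\<forall>i. rep W (weak_partial W i u) (w i) \<and> integrable lborel (\<lambda>x. (cmod (w i x))\<^sup>2) \<and>
       (\<forall>\<phi>\<in>test_functions W. (LINT x|lborel. u0 x * partial i \<phi> x) = - (LINT x|lborel. w i x * \<phi> x)))"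

lemma set_integrable_of_square:
  fixes f :: "'a::euclidean_space \<Rightarrow> complex"
  assumes [measurable]: "f \<in> borel_measurable borel" and f2: "integrable lborel (\<lambda>x. (cmod (f x))\<^sup>2)" and K: "compact K"
  shows "set_integrable lborel K f"
  unfolding set_integrable_def
proof (rule integrable_of_square[OF _ _ K])
  have [measurable]: "K \<in> sets borel" using K by (simp add: borel_compact)
  show "(\<lambda>x. indicator K x *\<^sub>R f x) \<in> borel_measurable borel" by measurable
  show "integrable lborel (\<lambda>x. (cmod (indicator K x *\<^sub>R f x))\<^sup>2)"
    by (rule Bochner_Integration.integrable_bound[OF f2]) (auto simp: indicator_def)
qed auto

text \<open>Because weak derivatives are unique, any square integrable candidates \<open>w\<close>
  that satisfy the integral identity represent the chosen derivatives.\<close>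

lemma H1_repI:
  fixes u u0 :: "real ^ 'n \<Rightarrow> complex"
  assumes W: "open W" and u: "rep W u u0" "integrable lborel (\<lambda>x. (cmod (u0 x))\<^sup>2)"
    and w: "\<And>i. w i \<in> borel_measurable borel" "\<And>i x. x \<notin> W \<Longrightarrow> w i x = 0" "\<And>i. integrable lborel (\<lambda>x. (cmod (w i x))\<^sup>2)"
    and weak: "\<And>i \<phi>. \<phi> \<in> test_functions W \<Longrightarrow> (LINT x|lborel. u0 x * partial i \<phi> x) = - (LINT x|lborel. w i x * \<phi> x)"
  shows "u \<in> H1 W" "H1_rep W u u0 w"
proof -
  have rw: "rep W (w i) (w i)" for i
    unfolding rep_def using w borel_measurable_lebesgue_on[OF w(1)] by auto
  have wp: "is_weak_partial W i u (w i)" for i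
    unfolding is_weak_partial_def
  proof (intro conjI ballI)
    show "locally_integrable W u"
      unfolding rep_locally_integrable[OF W u(1)] using set_integrable_of_square[OF rep_measurable[OF u(1)] u(2)] by blast
    show "locally_integrable W (w i)"
      unfolding rep_locally_integrable[OF W rw] using set_integrable_of_square[OF w(1,3)] by blast
    fix \<phi> :: "real ^ 'n \<Rightarrow> complex" assume \<phi>: "\<phi> \<in> test_functions W"
    then have c: "cc_smooth \<phi>" by (simp add: test_functions_iff)
    show "(LINT x|lebesgue_on W. u x * partial i \<phi> x) = - (LINT x|lebesgue_on W. w i x * \<phi> x)"
      using weak[OF \<phi>] rep_integral(1)[OF W rep_mult_borel[OF u(1) cc_smooth_measurable[OF partial_cc_smooth[OF c]]]]
        rep_integral(1)[OF W rep_mult_borel[OF rw cc_smooth_measurable[OF c]]] by simp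
  qed
  then have "is_weak_partial W i u (weak_partial W i u)" for i
    unfolding weak_partial_def using someI[of "is_weak_partial W i u"] by blast
  then have "rep W (weak_partial W i u) (w i)" for i
    using weak_partial_unique[OF W _ wp rw] by blast
  then show "H1_rep W u u0 w" unfolding H1_rep_def using u w weak by blast
  show "u \<in> H1 W"
    unfolding H1_def using rep_sq_norm(1)[OF W u] rep_sq_norm(1)[OF W rw w(3)] wp by blast
qed

lemma H1_rep_exists:
  fixes u :: "real ^ 'n \<Rightarrow> complex"
  assumes W: "open W" and u: "u \<in> H1 W"
  obtains u0 w where "H1_rep W u u0 w"
proof -
  have u2: "u \<in> L2_space W" using u by (simp add: H1_def)
  obtain u0 where u0: "rep W u u0" "integrable lborel (\<lambda>x. (cmod (u0 x))\<^sup>2)"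
    using L2_space_rep[OF W u2] by blast
  have "\<forall>i. \<exists>w. w \<in> L2_space W \<and> is_weak_partial W i u w" using u by (auto simp: H1_def)
  then obtain v where v: "\<And>i. v i \<in> L2_space W" "\<And>i. is_weak_partial W i u (v i)" by metis
  have "\<forall>i. \<exists>g. rep W (v i) g \<and> integrable lborel (\<lambda>x. (cmod (g x))\<^sup>2)"
    using L2_space_rep[OF W v(1)] by blast
  then obtain w where w: "\<And>i. rep W (v i) (w i)" "\<And>i. integrable lborel (\<lambda>x. (cmod (w i x))\<^sup>2)" by metis
  have "H1_rep W u u0 w"
  proof (rule H1_repI(2)[OF W u0 rep_measurable[OF w(1)] rep_zero[OF w(1)] w(2)])
    fix i and \<phi> :: "real ^ 'n \<Rightarrow> complex" assume \<phi>: "\<phi> \<in> test_functions W"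
    then have c: "cc_smooth \<phi>" by (simp add: test_functions_iff)
    show "(LINT x|lborel. u0 x * partial i \<phi> x) = - (LINT x|lborel. w i x * \<phi> x)"
      using v(2)[of i] \<phi> rep_integral(1)[OF W rep_mult_borel[OF u0(1) cc_smooth_measurable[OF partial_cc_smooth[OF c]]]]
        rep_integral(1)[OF W rep_mult_borel[OF w(1) cc_smooth_measurable[OF c]]]
      unfolding is_weak_partial_def by auto
  qed
  then show ?thesis using that by blast
qed

lemma H1_rep_norm:
  assumes W: "open W" and r: "H1_rep W u u0 w"
  shows "ennreal ((H1_norm W u)\<^sup>2) = sq_norm u0 + (\<Sum>i\<in>UNIV. sq_norm (w i))"
proof -
  have "(H1_norm W u)\<^sup>2 = (L2_norm W u)\<^sup>2 + (\<Sum>i\<in>UNIV. (L2_norm W (weak_partial W i u))\<^sup>2)"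
    unfolding H1_norm_def by (rule real_sqrt_pow2) (simp add: sum_nonneg)
  moreover have "(\<Sum>i\<in>UNIV. ennreal ((L2_norm W (weak_partial W i u))\<^sup>2)) = ennreal (\<Sum>i\<in>UNIV. (L2_norm W (weak_partial W i u))\<^sup>2)"
    by (rule sum_ennreal) simp
  ultimately have "ennreal ((H1_norm W u)\<^sup>2) = ennreal ((L2_norm W u)\<^sup>2) + (\<Sum>i\<in>UNIV. ennreal ((L2_norm W (weak_partial W i u))\<^sup>2))"
    by (simp add: sum_nonneg)
  also have "\<dots> = sq_norm u0 + (\<Sum>i\<in>UNIV. sq_norm (w i))"
  proof -
    have "ennreal ((L2_norm W u)\<^sup>2) = sq_norm u0"
      using r rep_sq_norm(2)[OF W] unfolding H1_rep_def by blast
    moreover have "ennreal ((L2_norm W (weak_partial W i u))\<^sup>2) = sq_norm (w i)" for i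
      using r rep_sq_norm(2)[OF W] unfolding H1_rep_def by blast
    ultimately show ?thesis by (simp only:)
  qed
  finally show ?thesis .
qed

lemma test_functions_mono: "\<phi> \<in> test_functions W \<Longrightarrow> W \<subseteq> \<Omega> \<Longrightarrow> \<phi> \<in> test_functions \<Omega>"
  by (auto simp: test_functions_iff)

lemma test_functions_outside: "\<phi> \<in> test_functions W \<Longrightarrow> x \<notin> W \<Longrightarrow> \<phi> x = 0"
  using closure_subset[of "{x. \<phi> x \<noteq> 0}"] by (auto simp: test_functions_iff)

lemma test_functions_partial: "\<phi> \<in> test_functions W \<Longrightarrow> partial i \<phi> \<in> test_functions W"
  unfolding partial_def by (rule test_functions_derivative)

lemma integrable_indicator_norm_sq:
  fixes f :: "real ^ 'n \<Rightarrow> complex"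
  assumes "W \<in> sets borel" "integrable lborel (\<lambda>x. (cmod (f x))\<^sup>2)" "f \<in> borel_measurable borel"
  shows "integrable lborel (\<lambda>x. (cmod (indicator W x *\<^sub>R f x))\<^sup>2)"
proof -
  have [measurable]: "W \<in> sets borel" "f \<in> borel_measurable borel" using assms by auto
  show ?thesis
    by (rule Bochner_Integration.integrable_bound[OF assms(2)]) (auto simp: indicator_def)
qed

text \<open>Test functions on W are test functions on \<Omega>; by uniqueness the derivatives chosen
  for W and for \<Omega> therefore agree on W. This links the norm on \<Omega>' with quantities on
  \<Omega>.\<close>

lemma H1_rep_restrict:
  assumes W: "open W" "W \<subseteq> \<Omega>" and r: "H1_rep \<Omega> u u0 w"
  shows "u \<in> H1 W" "H1_rep W u (\<lambda>x. indicator W x *\<^sub>R u0 x) (\<lambda>i x. indicator W x *\<^sub>R w i x)"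
proof -
  have u0: "rep \<Omega> u u0" "integrable lborel (\<lambda>x. (cmod (u0 x))\<^sup>2)"
    and w: "\<And>i. rep \<Omega> (weak_partial \<Omega> i u) (w i)" "\<And>i. integrable lborel (\<lambda>x. (cmod (w i x))\<^sup>2)"
    and weak: "\<And>i \<phi>. \<phi> \<in> test_functions \<Omega> \<Longrightarrow> (LINT x|lborel. u0 x * partial i \<phi> x) = - (LINT x|lborel. w i x * \<phi> x)"
    using r by (auto simp: H1_rep_def)
  have [measurable]: "W \<in> sets borel" using W by simp
  have m[measurable]: "u0 \<in> borel_measurable borel" "w i \<in> borel_measurable borel" for i
    using rep_measurable[OF u0(1)] rep_measurable[OF w(1)] by auto
  have wk: "(LINT x|lborel. indicator W x *\<^sub>R u0 x * partial i \<phi> x) = - (LINT x|lborel. indicator W x *\<^sub>R w i x * \<phi> x)"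
    if \<phi>: "\<phi> \<in> test_functions W" for i \<phi>
  proof -
    have "(\<lambda>x. indicator W x *\<^sub>R u0 x * partial i \<phi> x) = (\<lambda>x. u0 x * partial i \<phi> x)"
      using test_functions_outside[OF test_functions_partial[OF \<phi>]] by (auto simp: indicator_def fun_eq_iff)
    moreover have "(\<lambda>x. indicator W x *\<^sub>R w i x * \<phi> x) = (\<lambda>x. w i x * \<phi> x)"
      using test_functions_outside[OF \<phi>] by (auto simp: indicator_def fun_eq_iff)
    ultimately show ?thesis using weak[OF test_functions_mono[OF \<phi> W(2)]] by simp
  qed
  have wm: "(\<lambda>x. indicator W x *\<^sub>R w i x) \<in> borel_measurable borel" for i by measurable
  have wz: "indicator W x *\<^sub>R w i x = 0" if "x \<notin> W" for i x using that by simp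
  have ws: "integrable lborel (\<lambda>x. (cmod (indicator W x *\<^sub>R w i x))\<^sup>2)" for i
    by (rule integrable_indicator_norm_sq[OF _ w(2) m(2)]) simp
  have us: "integrable lborel (\<lambda>x. (cmod (indicator W x *\<^sub>R u0 x))\<^sup>2)"
    by (rule integrable_indicator_norm_sq[OF _ u0(2) m(1)]) simp
  note R = H1_repI[OF W(1) rep_restrict[OF W u0(1)] us wm wz ws wk]
  show "u \<in> H1 W" "H1_rep W u (\<lambda>x. indicator W x *\<^sub>R u0 x) (\<lambda>i x. indicator W x *\<^sub>R w i x)"
    by (rule R(1), simp_all) (rule R(2), simp_all)
qed

lemma H1_rep_diff:
  assumes W: "open W" and r: "H1_rep W u u0 w" "H1_rep W u' u0' w'"
  shows "H1_rep W (\<lambda>x. u x - u' x) (\<lambda>x. u0 x - u0' x) (\<lambda>i x. w i x - w' i x)"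
proof -
  have sq: "integrable lborel (\<lambda>x. (cmod (f x - g x))\<^sup>2)"
    if [measurable]: "f \<in> borel_measurable borel" "g \<in> borel_measurable borel" and
      i: "integrable lborel (\<lambda>x. (cmod (f x))\<^sup>2)" "integrable lborel (\<lambda>x. (cmod (g x))\<^sup>2)" for f g :: "real ^ 'a \<Rightarrow> complex"
  proof (rule Bochner_Integration.integrable_bound[of _ "\<lambda>x. 2 * (cmod (f x))\<^sup>2 + 2 * (cmod (g x))\<^sup>2"])
    show "AE x in lborel. norm ((cmod (f x - g x))\<^sup>2) \<le> norm (2 * (cmod (f x))\<^sup>2 + 2 * (cmod (g x))\<^sup>2)"
      using cmod_add_squared_le[of _ "- _"] by (intro AE_I2) (metis abs_of_nonneg add_nonneg_nonneg diff_conv_add_uminus mult_nonneg_nonneg norm_minus_cancel real_norm_def zero_le_numeral zero_le_power2)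
  qed (use i in auto)
  have u0: "rep W u u0" "integrable lborel (\<lambda>x. (cmod (u0 x))\<^sup>2)" "rep W u' u0'" "integrable lborel (\<lambda>x. (cmod (u0' x))\<^sup>2)"
    and w: "\<And>i. rep W (weak_partial W i u) (w i)" "\<And>i. integrable lborel (\<lambda>x. (cmod (w i x))\<^sup>2)"
      "\<And>i. rep W (weak_partial W i u') (w' i)" "\<And>i. integrable lborel (\<lambda>x. (cmod (w' i x))\<^sup>2)"
    and weak: "\<And>i \<phi>. \<phi> \<in> test_functions W \<Longrightarrow> (LINT x|lborel. u0 x * partial i \<phi> x) = - (LINT x|lborel. w i x * \<phi> x)"
     "\<And>i \<phi>. \<phi> \<in> test_functions W \<Longrightarrow> (LINT x|lborel. u0' x * partial i \<phi> x) = - (LINT x|lborel. w' i x * \<phi> x)"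
    using r by (auto simp: H1_rep_def)
  note m = rep_measurable[OF u0(1)] rep_measurable[OF u0(3)] rep_measurable[OF w(1)] rep_measurable[OF w(3)]
  have im: "integrable lborel (\<lambda>x. f x * \<phi> x)"
    if "f \<in> borel_measurable borel" "integrable lborel (\<lambda>x. (cmod (f x))\<^sup>2)" "\<phi> \<in> test_functions W" for f \<phi> :: "real ^ 'a \<Rightarrow> complex"
    using integrable_mult_test[OF that(1) set_integrable_of_square[OF that(1,2)] that(3)] by blast
  have wk: "(LINT x|lborel. (u0 x - u0' x) * partial i \<phi> x) = - (LINT x|lborel. (w i x - w' i x) * \<phi> x)"
    if \<phi>: "\<phi> \<in> test_functions W" for i \<phi>
    using im[OF m(1) u0(2) test_functions_partial[OF \<phi>, of i]] im[OF m(2) u0(4) test_functions_partial[OF \<phi>, of i]]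
      im[OF m(3) w(2) \<phi>] im[OF m(4) w(4) \<phi>] weak[OF \<phi>] by (simp add: left_diff_distrib)
  show "H1_rep W (\<lambda>x. u x - u' x) (\<lambda>x. u0 x - u0' x) (\<lambda>i x. w i x - w' i x)"
  proof (rule H1_repI(2)[OF W rep_diff[OF u0(1,3)]])
    show "integrable lborel (\<lambda>x. (cmod (u0 x - u0' x))\<^sup>2)" by (rule sq[OF m(1,2) u0(2,4)])
    show "integrable lborel (\<lambda>x. (cmod (w i x - w' i x))\<^sup>2)" for i by (rule sq[OF m(3,4) w(2,4)])
    show "w i x - w' i x = 0" if "x \<notin> W" for i x using rep_zero[OF w(1) that] rep_zero[OF w(3) that] by simp
    show "(\<lambda>x. w i x - w' i x) \<in> borel_measurable borel" for i using m(3,4) by simp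
  qed (rule wk)
qed


section \<open>Integration by parts and products with cut-offs\<close>

text \<open>Difference quotients integrate to zero by translation invariance and converge to the
  partial derivative; steps of length at most 1 keep them supported in the unit neighbourhood S of
  the support, where L is a majorant.\<close>

lemma integral_partial_zero:
  fixes g :: "real ^ 'n \<Rightarrow> complex"
  assumes g: "cc_smooth g"
  shows "(LINT x|lborel. partial i g x) = 0"
proof -
  let ?e = "axis i 1 :: real ^ 'n" and ?K = "closure {x. g x \<noteq> 0}"
  have [measurable]: "g \<in> borel_measurable borel" "partial i g \<in> borel_measurable borel"
    using cc_smooth_measurable[OF g] cc_smooth_measurable[OF partial_cc_smooth[OF g]] by auto
  obtain L where L: "L > 0" "\<And>x v. norm (frechet_derivative g (at x) v) \<le> L * norm v"
    using cc_smooth_derivative_bounded[OF g] by blast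
  define S where "S = (\<Union>x\<in>?K. cball x (1::real))"
  have S: "compact S" unfolding S_def using g by (intro compact_neighbourhood) (simp add: cc_smooth_def)
  have [measurable]: "S \<in> sets borel" using S by (simp add: borel_compact)
  define t where "t k = inverse (real (Suc k))" for k
  have t: "t k > 0" "t k \<le> 1" for k by (auto simp: t_def inverse_le_1_iff)
  have t0: "t \<longlonglongrightarrow> 0" unfolding t_def by (rule LIMSEQ_inverse_real_of_nat)
  define D where "D k x = (1 / t k) *\<^sub>R (g (x + t k *\<^sub>R ?e) - g x)" for k x
  have "(\<lambda>k. LINT x|lborel. D k x) \<longlonglongrightarrow> (LINT x|lborel. partial i g x)"
  proof (rule integral_dominated_convergence[where w="\<lambda>x. L * indicator S x"])
    show "integrable lborel (\<lambda>x. L * indicator S x :: real)"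
      using emeasure_compact_finite[OF S] by (simp add: integrable_indicator_iff)
    show "AE x in lborel. (\<lambda>k. D k x) \<longlonglongrightarrow> partial i g x"
    proof (rule AE_I2)
      fix x
      have A: "((\<lambda>h. norm (g (x + h) - g x - frechet_derivative g (at x) h) / norm h) \<longlongrightarrow> 0) (at 0)"
        using cc_smooth_has_derivative[OF g, of x] has_derivative_at by blast
      have "t k *\<^sub>R ?e \<noteq> 0" for k using t(1)[of k] by (simp add: axis_eq_0_iff)
      then have B: "\<forall>k. t k *\<^sub>R ?e \<in> UNIV - {0}" by blast
      have C: "(\<lambda>k. t k *\<^sub>R ?e) \<longlonglongrightarrow> 0" using tendsto_scaleR[OF t0 tendsto_const[of ?e]] by simp
      have "(\<lambda>k. norm (g (x + t k *\<^sub>R ?e) - g x - frechet_derivative g (at x) (t k *\<^sub>R ?e)) / norm (t k *\<^sub>R ?e)) \<longlonglongrightarrow> 0"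
        using A[unfolded tendsto_at_iff_sequentially, THEN spec, THEN mp, OF B, THEN mp, OF C] by (simp only: o_def)
      moreover have "norm (g (x + t k *\<^sub>R ?e) - g x - frechet_derivative g (at x) (t k *\<^sub>R ?e)) / norm (t k *\<^sub>R ?e)
          = norm (D k x - partial i g x)" for k
      proof -
        have "frechet_derivative g (at x) (t k *\<^sub>R ?e) = t k *\<^sub>R partial i g x"
          using has_derivative_linear[OF cc_smooth_has_derivative[OF g, of x]] by (simp add: linear_cmul partial_def)
        then have "D k x - partial i g x = (1 / t k) *\<^sub>R (g (x + t k *\<^sub>R ?e) - g x - frechet_derivative g (at x) (t k *\<^sub>R ?e))"
          using t(1)[of k] by (simp add: D_def scaleR_diff_right)
        then show ?thesis using t(1)[of k] by (simp add: divide_inverse mult.commute)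
      qed
      ultimately have "(\<lambda>k. norm (D k x - partial i g x)) \<longlonglongrightarrow> 0" by simp
      then show "(\<lambda>k. D k x) \<longlonglongrightarrow> partial i g x"
        using LIM_zero_iff tendsto_norm_zero_iff by blast
    qed
    show "AE x in lborel. norm (D k x) \<le> L * indicator S x" for k
    proof (rule AE_I2)
      fix x
      show "norm (D k x) \<le> L * indicator S x"
      proof (cases "x \<in> S")
        case True
        have "norm (g (x + t k *\<^sub>R ?e) - g x) \<le> L * norm (x + t k *\<^sub>R ?e - x)"
          by (rule cc_smooth_lipschitz[OF cc_smooth_has_derivative[OF g] L(2)])
        then have "norm (g (x + t k *\<^sub>R ?e) - g x) \<le> L * t k" using t(1)[of k] by simp
        then show ?thesis using True t(1)[of k] by (simp add: D_def divide_le_eq)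
      next
        case False
        have "g y = 0" if "dist y x \<le> 1" for y
        proof (rule ccontr)
          assume "g y \<noteq> 0"
          then have "y \<in> ?K" using closure_subset[of "{x. g x \<noteq> 0}"] by auto
          then have "x \<in> S" unfolding S_def using that by auto
          then show False using False by simp
        qed
        from this[of x] this[of "x + t k *\<^sub>R ?e"] show ?thesis
          using False t[of k] by (simp add: D_def dist_norm)
      qed
    qed
  qed (auto simp: D_def)
  moreover have "(LINT x|lborel. D k x) = 0" for k
  proof -
    have ig: "integrable lborel g" by (rule cc_smooth_integrable[OF g])
    have "(LINT x|lborel. D k x) = (1 / t k) *\<^sub>R ((LINT x|lborel. g (x + t k *\<^sub>R ?e)) - (LINT x|lborel. g x))"
      unfolding D_def using Bochner_Integration.integral_diff[OF integrable_lborel_shift[OF ig] ig]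
      by (simp only: integral_scaleR_right)
    then show ?thesis using integral_lborel_shift[of g "t k *\<^sub>R ?e"] by simp
  qed
  ultimately have "(\<lambda>k::nat. 0) \<longlonglongrightarrow> (LINT x|lborel. partial i g x)" by simp
  then show ?thesis by (simp add: LIMSEQ_const_iff)
qed

lemma partial_mult:
  fixes u v :: "real ^ 'n \<Rightarrow> complex"
  assumes "smooth u" "smooth v"
  shows "partial i (\<lambda>x. u x * v x) x = u x * partial i v x + partial i u x * v x"
  unfolding partial_def
  using frechet_derivative_at[OF has_derivative_mult[OF smooth_has_derivative[OF assms(1)] smooth_has_derivative[OF assms(2)]], symmetric]
  by simp

lemma integration_by_parts:
  fixes u \<phi> :: "real ^ 'n \<Rightarrow> complex"
  assumes u: "cc_smooth u" and \<phi>: "cc_smooth \<phi>"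
  shows "(LINT x|lborel. u x * partial i \<phi> x) = - (LINT x|lborel. partial i u x * \<phi> x)"
proof -
  have c: "cc_smooth (\<lambda>x. u x * \<phi> x)"
    by (rule cc_smooth_bilinear1[OF bounded_bilinear_mult u cc_smooth_smooth[OF \<phi>]])
  have i: "integrable lborel (\<lambda>x. u x * partial i \<phi> x)" "integrable lborel (\<lambda>x. partial i u x * \<phi> x)"
    by (rule cc_smooth_integrable[OF cc_smooth_bilinear1[OF bounded_bilinear_mult]],
        auto intro: u \<phi> partial_cc_smooth cc_smooth_smooth)+
  have "0 = (LINT x|lborel. u x * partial i \<phi> x + partial i u x * \<phi> x)"
    using integral_partial_zero[OF c, of i] partial_mult[OF cc_smooth_smooth[OF u] cc_smooth_smooth[OF \<phi>]] by simp
  then show ?thesis using i by (simp add: eq_neg_iff_add_eq_0)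
qed

lemma cc_smooth_sq_integrable:
  fixes u :: "'a::euclidean_space \<Rightarrow> complex"
  shows "cc_smooth u \<Longrightarrow> integrable lborel (\<lambda>x. (cmod (u x))\<^sup>2)"
  by (rule cc_smooth_integrable[OF cc_smooth_norm_sq])

lemma H1_rep_smooth:
  fixes v :: "real ^ 'n \<Rightarrow> complex"
  assumes W: "open W" and v: "cc_smooth v"
  shows "v \<in> H1 W" "H1_rep W v (\<lambda>x. indicator W x *\<^sub>R v x) (\<lambda>i x. indicator W x *\<^sub>R partial i v x)"
proof -
  note p = partial_cc_smooth[OF v]
  have [measurable]: "v \<in> borel_measurable borel" "partial i v \<in> borel_measurable borel" "W \<in> sets borel" for i
    using cc_smooth_measurable[OF v] cc_smooth_measurable[OF p] W by auto
  have weak: "(LINT x|lborel. v x * partial i \<phi> x) = - (LINT x|lborel. partial i v x * \<phi> x)" if "\<phi> \<in> test_functions UNIV" for i \<phi>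
    using that integration_by_parts[OF v] by (simp add: test_functions_UNIV)
  have "rep UNIV v v"
    unfolding rep_def by (intro conjI borel_measurable_lebesgue_on) auto
  from H1_repI[OF open_UNIV this cc_smooth_sq_integrable[OF v] _ _ cc_smooth_sq_integrable[OF p] weak]
  have "H1_rep UNIV v v (\<lambda>i. partial i v)" by simp
  from H1_rep_restrict[OF W subset_UNIV this]
  show "v \<in> H1 W" "H1_rep W v (\<lambda>x. indicator W x *\<^sub>R v x) (\<lambda>i x. indicator W x *\<^sub>R partial i v x)" .
qed

text \<open>Use e \<phi> as the test function and expand its derivative. Only e \<phi> must be
  supported in \<Omega>, so the lemma serves both for \<phi> supported in \<Omega> and for arbitrary
  \<phi> when e itself is supported there.\<close>

lemma weak_partial_mult:
  fixes u0 w :: "real ^ 'n \<Rightarrow> complex"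
  assumes u0: "u0 \<in> borel_measurable borel" "integrable lborel (\<lambda>x. (cmod (u0 x))\<^sup>2)"
    and w: "w \<in> borel_measurable borel" "integrable lborel (\<lambda>x. (cmod (w x))\<^sup>2)"
    and weak: "\<And>\<phi>. \<phi> \<in> test_functions \<Omega> \<Longrightarrow> (LINT x|lborel. u0 x * partial i \<phi> x) = - (LINT x|lborel. w x * \<phi> x)"
    and e: "cc_smooth (e :: real ^ 'n \<Rightarrow> real)" and \<phi>: "cc_smooth \<phi>" "closure {x. e x *\<^sub>R \<phi> x \<noteq> 0} \<subseteq> \<Omega>"
  shows "(LINT x|lborel. (e x *\<^sub>R u0 x) * partial i \<phi> x) =
    - (LINT x|lborel. (e x *\<^sub>R w x + frechet_derivative e (at x) (axis i 1) *\<^sub>R u0 x) * \<phi> x)"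
proof -
  let ?D = "\<lambda>x. frechet_derivative e (at x) (axis i 1)"
  have im: "integrable lborel (\<lambda>x. f x * \<psi> x)"
    if "f \<in> borel_measurable borel" "integrable lborel (\<lambda>x. (cmod (f x))\<^sup>2)" "cc_smooth \<psi>" for f \<psi> :: "real ^ 'n \<Rightarrow> complex"
    using integrable_mult_test[OF that(1) set_integrable_of_square[OF that(1,2)], of UNIV] that(3)
    by (simp add: test_functions_UNIV)
  have c: "cc_smooth (\<lambda>x. e x *\<^sub>R \<phi> x)" "cc_smooth (\<lambda>x. e x *\<^sub>R partial i \<phi> x)" "cc_smooth (\<lambda>x. ?D x *\<^sub>R \<phi> x)"
    using \<phi>(1) by (auto intro!: cc_smooth_bilinear1[OF bounded_bilinear_scaleR] e cc_smooth_derivative cc_smooth_smooth partial_cc_smooth)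
  have "(LINT x|lborel. u0 x * partial i (\<lambda>x. e x *\<^sub>R \<phi> x) x) = - (LINT x|lborel. w x * (e x *\<^sub>R \<phi> x))"
    by (rule weak) (use c \<phi> in \<open>simp add: test_functions_iff\<close>)
  also have "(LINT x|lborel. u0 x * partial i (\<lambda>x. e x *\<^sub>R \<phi> x) x) =
      (LINT x|lborel. u0 x * (e x *\<^sub>R partial i \<phi> x) + u0 x * (?D x *\<^sub>R \<phi> x))"
    unfolding partial_scaleR[OF cc_smooth_smooth[OF e] cc_smooth_smooth[OF \<phi>(1)]] by (simp add: distrib_left)
  also have "\<dots> = (LINT x|lborel. u0 x * (e x *\<^sub>R partial i \<phi> x)) + (LINT x|lborel. u0 x * (?D x *\<^sub>R \<phi> x))"
    by (rule Bochner_Integration.integral_add[OF im[OF u0 c(2)] im[OF u0 c(3)]])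
  finally have "(LINT x|lborel. u0 x * (e x *\<^sub>R partial i \<phi> x)) + (LINT x|lborel. u0 x * (?D x *\<^sub>R \<phi> x)) =
     - (LINT x|lborel. w x * (e x *\<^sub>R \<phi> x))" .
  then have "(LINT x|lborel. u0 x * (e x *\<^sub>R partial i \<phi> x)) =
     - ((LINT x|lborel. w x * (e x *\<^sub>R \<phi> x)) + (LINT x|lborel. u0 x * (?D x *\<^sub>R \<phi> x)))"
    by (simp only: eq_neg_iff_add_eq_0 add_ac)
  also have "(LINT x|lborel. w x * (e x *\<^sub>R \<phi> x)) + (LINT x|lborel. u0 x * (?D x *\<^sub>R \<phi> x)) =
     (LINT x|lborel. w x * (e x *\<^sub>R \<phi> x) + u0 x * (?D x *\<^sub>R \<phi> x))"
    by (rule Bochner_Integration.integral_add[OF im[OF w c(1)] im[OF u0 c(3)], symmetric])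
  also have "\<dots> = (LINT x|lborel. (e x *\<^sub>R w x + ?D x *\<^sub>R u0 x) * \<phi> x)"
    by (rule Bochner_Integration.integral_cong) (simp_all add: distrib_right)
  finally show ?thesis by simp
qed

lemma sq_integrable_iff: "f \<in> borel_measurable borel \<Longrightarrow> integrable lborel (\<lambda>x. (cmod (f x))\<^sup>2) \<longleftrightarrow> sq_norm f < \<infinity>"
  by (simp add: integrable_iff_bounded sq_norm_def)

lemma sq_norm_mono: "(\<And>x. cmod (f x) \<le> cmod (g x)) \<Longrightarrow> sq_norm f \<le> sq_norm g"
  unfolding sq_norm_def by (intro nn_integral_mono ennreal_leI power_mono) auto

lemma sq_norm_diff_le:
  assumes [measurable]: "a \<in> borel_measurable borel" "b \<in> borel_measurable borel"
  shows "sq_norm (\<lambda>x. a x - b x) \<le> 2 * sq_norm a + 2 * sq_norm b"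
  using sq_norm_add_le[of a "\<lambda>x. - b x"] by (simp add: sq_norm_def)

lemma mult_sq_integrable:
  fixes e :: "real ^ 'n \<Rightarrow> real"
  assumes e: "cc_smooth e" and u: "u \<in> borel_measurable borel" "integrable lborel (\<lambda>x. (cmod (u x))\<^sup>2)"
    and w: "w \<in> borel_measurable borel" "integrable lborel (\<lambda>x. (cmod (w x))\<^sup>2)"
  shows "(\<lambda>x. e x *\<^sub>R u x) \<in> borel_measurable borel" "integrable lborel (\<lambda>x. (cmod (e x *\<^sub>R u x))\<^sup>2)"
    "(\<lambda>x. e x *\<^sub>R w x + frechet_derivative e (at x) v *\<^sub>R u x) \<in> borel_measurable borel"
    "integrable lborel (\<lambda>x. (cmod (e x *\<^sub>R w x + frechet_derivative e (at x) v *\<^sub>R u x))\<^sup>2)"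
proof -
  note c = cc_smooth_derivative[OF e, of v]
  have [measurable]: "e \<in> borel_measurable borel" "(\<lambda>x. frechet_derivative e (at x) v) \<in> borel_measurable borel"
    "u \<in> borel_measurable borel" "w \<in> borel_measurable borel"
    using cc_smooth_measurable[OF e] cc_smooth_measurable[OF c] u w by auto
  have m: "sq_norm (\<lambda>x. a x *\<^sub>R f x) < \<infinity>" if "cc_smooth a" "f \<in> borel_measurable borel" "integrable lborel (\<lambda>x. (cmod (f x))\<^sup>2)"
    for a :: "real ^ 'n \<Rightarrow> real" and f
  proof -
    obtain B where B: "B > 0" "\<And>x. norm (a x) \<le> B" using cc_smooth_bounded[OF \<open>cc_smooth a\<close>] by blast
    have "sq_norm (\<lambda>x. a x *\<^sub>R f x) \<le> ennreal (B\<^sup>2) * sq_norm f"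
      using B(2) by (intro sq_norm_scaleR_le that) auto
    also have "\<dots> < \<infinity>" using that sq_integrable_iff[of f] by (simp add: ennreal_mult_less_top)
    finally show ?thesis .
  qed
  show eu: "(\<lambda>x. e x *\<^sub>R u x) \<in> borel_measurable borel" by measurable
  show "integrable lborel (\<lambda>x. (cmod (e x *\<^sub>R u x))\<^sup>2)" using m[OF e u] sq_integrable_iff[OF eu] by simp
  show g: "(\<lambda>x. e x *\<^sub>R w x + frechet_derivative e (at x) v *\<^sub>R u x) \<in> borel_measurable borel" by measurable
  have "sq_norm (\<lambda>x. e x *\<^sub>R w x + frechet_derivative e (at x) v *\<^sub>R u x) \<le> 2 * sq_norm (\<lambda>x. e x *\<^sub>R w x) + 2 * sq_norm (\<lambda>x. frechet_derivative e (at x) v *\<^sub>R u x)"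
    by (rule sq_norm_add_le) measurable
  also have "\<dots> < \<infinity>" using m[OF e w] m[OF c u] by (simp add: ennreal_mult_less_top)
  finally show "integrable lborel (\<lambda>x. (cmod (e x *\<^sub>R w x + frechet_derivative e (at x) v *\<^sub>R u x))\<^sup>2)"
    using sq_integrable_iff[OF g] by simp
qed

lemma H1_rep_mult:
  fixes e :: "real ^ 'n \<Rightarrow> real"
  assumes W: "open W" and r: "H1_rep W u u0 w" and e: "cc_smooth e"
  shows "(\<lambda>x. e x *\<^sub>R u x) \<in> H1 W" "H1_rep W (\<lambda>x. e x *\<^sub>R u x) (\<lambda>x. e x *\<^sub>R u0 x)
     (\<lambda>i x. e x *\<^sub>R w i x + frechet_derivative e (at x) (axis i 1) *\<^sub>R u0 x)"
proof -
  have u0: "rep W u u0" "integrable lborel (\<lambda>x. (cmod (u0 x))\<^sup>2)"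
    and w: "\<And>i. rep W (weak_partial W i u) (w i)" "\<And>i. integrable lborel (\<lambda>x. (cmod (w i x))\<^sup>2)"
    and weak: "\<And>i \<phi>. \<phi> \<in> test_functions W \<Longrightarrow> (LINT x|lborel. u0 x * partial i \<phi> x) = - (LINT x|lborel. w i x * \<phi> x)"
    using r by (auto simp: H1_rep_def)
  note M = mult_sq_integrable[OF e rep_measurable[OF u0(1)] u0(2) rep_measurable[OF w(1)] w(2)]
  have "rep W (\<lambda>x. u x * complex_of_real (e x)) (\<lambda>x. u0 x * complex_of_real (e x))"
    by (rule rep_mult_borel[OF u0(1)]) (use cc_smooth_measurable[OF e] in simp)
  then have ru: "rep W (\<lambda>x. e x *\<^sub>R u x) (\<lambda>x. e x *\<^sub>R u0 x)" by (simp add: scaleR_conv_of_real mult.commute)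
  have zero: "e x *\<^sub>R w i x + frechet_derivative e (at x) (axis i 1) *\<^sub>R u0 x = 0" if "x \<notin> W" for i x
    using rep_zero[OF w(1) that] rep_zero[OF u0(1) that] by simp
  have wk: "(LINT x|lborel. (e x *\<^sub>R u0 x) * partial i \<phi> x) =
    - (LINT x|lborel. (e x *\<^sub>R w i x + frechet_derivative e (at x) (axis i 1) *\<^sub>R u0 x) * \<phi> x)" if "\<phi> \<in> test_functions W" for i \<phi>
  proof (rule weak_partial_mult[OF rep_measurable[OF u0(1)] u0(2) rep_measurable[OF w(1)] w(2) weak e])
    have "closure {x. e x *\<^sub>R \<phi> x \<noteq> 0} \<subseteq> closure {x. \<phi> x \<noteq> 0}" by (intro closure_mono) auto
    then show "cc_smooth \<phi>" "closure {x. e x *\<^sub>R \<phi> x \<noteq> 0} \<subseteq> W"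
      using that by (auto simp: test_functions_iff)
  qed
  from H1_repI[OF W ru M(2,3) zero M(4) wk]
  show "(\<lambda>x. e x *\<^sub>R u x) \<in> H1 W" "H1_rep W (\<lambda>x. e x *\<^sub>R u x) (\<lambda>x. e x *\<^sub>R u0 x)
     (\<lambda>i x. e x *\<^sub>R w i x + frechet_derivative e (at x) (axis i 1) *\<^sub>R u0 x)" by auto
qed

lemma borel_measurable_cnj [measurable (raw)]:
  "f \<in> borel_measurable M \<Longrightarrow> (\<lambda>x. cnj (f x)) \<in> borel_measurable M"
  by (rule measurable_compose[of f M borel]) (auto intro!: borel_measurable_continuous_onI continuous_on_cnj continuous_on_id)

lemma partial_cnj:
  fixes \<phi> :: "real ^ 'n \<Rightarrow> complex"
  assumes "smooth \<phi>" shows "partial i (\<lambda>x. cnj (\<phi> x)) x = cnj (partial i \<phi> x)"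
  unfolding partial_def
  using frechet_derivative_at[OF bounded_linear.has_derivative[OF bounded_linear_cnj smooth_has_derivative[OF assms]], symmetric]
  by simp

lemma test_functions_cnj: "\<phi> \<in> test_functions W \<Longrightarrow> (\<lambda>x. cnj (\<phi> x)) \<in> test_functions W"
  using cc_smooth_linear_compose[OF bounded_linear_cnj, of \<phi>] by (simp add: test_functions_iff)

text \<open>The pairing is bilinear, so energies arise by testing with the conjugate of u;
  conjugating the test function moves conjugation through the weak identity.\<close>

lemma H1_rep_cnj:
  assumes W: "open W" and r: "H1_rep W u u0 w"
  shows "H1_rep W (\<lambda>x. cnj (u x)) (\<lambda>x. cnj (u0 x)) (\<lambda>i x. cnj (w i x))"
proof -
  have u0: "rep W u u0" "integrable lborel (\<lambda>x. (cmod (u0 x))\<^sup>2)"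
    and w: "\<And>i. rep W (weak_partial W i u) (w i)" "\<And>i. integrable lborel (\<lambda>x. (cmod (w i x))\<^sup>2)"
    and weak: "\<And>i \<phi>. \<phi> \<in> test_functions W \<Longrightarrow> (LINT x|lborel. u0 x * partial i \<phi> x) = - (LINT x|lborel. w i x * \<phi> x)"
    using r by (auto simp: H1_rep_def)
  have ru: "rep W (\<lambda>x. cnj (u x)) (\<lambda>x. cnj (u0 x))"
    unfolding rep_def
  proof (intro conjI)
    have "AE x in lebesgue. x \<in> W \<longrightarrow> u x = u0 x" using u0 by (simp add: rep_def)
    then show "AE x in lebesgue. x \<in> W \<longrightarrow> cnj (u x) = cnj (u0 x)" by eventually_elim auto
  qed (use u0(1) in \<open>auto simp: rep_def intro!: borel_measurable_cnj\<close>)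
  have wk: "(LINT x|lborel. cnj (u0 x) * partial i \<phi> x) = - (LINT x|lborel. cnj (w i x) * \<phi> x)" if \<phi>: "\<phi> \<in> test_functions W" for i \<phi>
  proof -
    have s: "smooth \<phi>" using \<phi> by (simp add: test_functions_def)
    have "(LINT x|lborel. u0 x * partial i (\<lambda>x. cnj (\<phi> x)) x) = - (LINT x|lborel. w i x * cnj (\<phi> x))"
      by (rule weak[OF test_functions_cnj[OF \<phi>]])
    then have "cnj (LINT x|lborel. u0 x * cnj (partial i \<phi> x)) = cnj (- (LINT x|lborel. w i x * cnj (\<phi> x)))"
      by (simp only: partial_cnj[OF s])
    then show ?thesis
      by (simp only: Bochner_Integration.integral_cnj[symmetric] complex_cnj_minus complex_cnj_mult complex_cnj_cnj)
  qed
  show ?thesis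
    by (rule H1_repI(2)[OF W ru]) (use u0 w wk rep_measurable[OF w(1)] rep_zero[OF w(1)] in \<open>auto intro!: borel_measurable_cnj\<close>)
qed

text \<open>The cut-off makes e u, extended by zero, weakly differentiable on the whole space, where
  it can be mollified by \<open>friedrichs\<close>.\<close>

lemma H1_localize:
  fixes e :: "real ^ 'n \<Rightarrow> real"
  assumes \<Omega>: "open \<Omega>" and r: "H1_rep \<Omega> u u0 w" and e: "cc_smooth e" "closure {x. e x \<noteq> 0} \<subseteq> \<Omega>"
  obtains \<psi> where "\<And>k::nat. \<psi> k \<in> test_functions \<Omega>" "(\<lambda>k. sq_norm (\<lambda>x. \<psi> k x - e x *\<^sub>R u0 x)) \<longlonglongrightarrow> 0"
    "\<And>i. (\<lambda>k. sq_norm (\<lambda>x. partial i (\<psi> k) x - (e x *\<^sub>R w i x + frechet_derivative e (at x) (axis i 1) *\<^sub>R u0 x))) \<longlonglongrightarrow> 0"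
proof -
  have u0: "rep \<Omega> u u0" "integrable lborel (\<lambda>x. (cmod (u0 x))\<^sup>2)"
    and w: "\<And>i. rep \<Omega> (weak_partial \<Omega> i u) (w i)" "\<And>i. integrable lborel (\<lambda>x. (cmod (w i x))\<^sup>2)"
    and weak: "\<And>i \<phi>. \<phi> \<in> test_functions \<Omega> \<Longrightarrow> (LINT x|lborel. u0 x * partial i \<phi> x) = - (LINT x|lborel. w i x * \<phi> x)"
    using r by (auto simp: H1_rep_def)
  note M = mult_sq_integrable[OF e(1) rep_measurable[OF u0(1)] u0(2) rep_measurable[OF w(1)] w(2)]
  have K: "compact (closure {x. e x \<noteq> 0})" using e by (simp add: cc_smooth_def)
  have z: "e x *\<^sub>R u0 x = 0" if "x \<notin> closure {x. e x \<noteq> 0}" for x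
    using that closure_subset[of "{x. e x \<noteq> 0}"] by auto
  have wk: "(LINT x|lborel. (e x *\<^sub>R u0 x) * partial i \<phi> x) =
    - (LINT x|lborel. (e x *\<^sub>R w i x + frechet_derivative e (at x) (axis i 1) *\<^sub>R u0 x) * \<phi> x)" if "\<phi> \<in> test_functions UNIV" for i \<phi>
  proof (rule weak_partial_mult[OF rep_measurable[OF u0(1)] u0(2) rep_measurable[OF w(1)] w(2) weak e(1)])
    have "closure {x. e x *\<^sub>R \<phi> x \<noteq> 0} \<subseteq> closure {x. e x \<noteq> 0}" by (intro closure_mono) auto
    then show "cc_smooth \<phi>" "closure {x. e x *\<^sub>R \<phi> x \<noteq> 0} \<subseteq> \<Omega>"
      using that e(2) by (auto simp: test_functions_iff)
  qed
  show ?thesis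
    by (rule friedrichs[OF M(1,3,2,4) K e(2) \<Omega> z wk, folded sq_norm_def];
        (assumption | (rule that; assumption)))
qed


section \<open>Existence and uniqueness of traces\<close>

lemma H1_norm_diff_eq:
  assumes W: "open W" "W \<subseteq> \<Omega>" and r: "H1_rep \<Omega> u u0 w" and v: "cc_smooth v"
  shows "ennreal ((H1_norm W (\<lambda>x. v x - u x))\<^sup>2) = sq_norm (\<lambda>x. indicator W x *\<^sub>R (v x - u0 x))
     + (\<Sum>i\<in>UNIV. sq_norm (\<lambda>x. indicator W x *\<^sub>R (partial i v x - w i x)))"
  using H1_rep_norm[OF W(1) H1_rep_diff[OF W(1) H1_rep_smooth(2)[OF W(1) v] H1_rep_restrict(2)[OF W r]]]
  by (simp only: scaleR_diff_right)

lemma H1_norm_nonneg: "H1_norm W f \<ge> 0"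
  unfolding H1_norm_def by (intro real_sqrt_ge_zero add_nonneg_nonneg sum_nonneg) auto

lemma H1_norm_tendsto_iff:
  "(\<lambda>k. H1_norm W (f k)) \<longlonglongrightarrow> 0 \<longleftrightarrow> (\<lambda>k. ennreal ((H1_norm W (f k))\<^sup>2)) \<longlonglongrightarrow> 0"
proof -
  have "(\<lambda>k. H1_norm W (f k)) \<longlonglongrightarrow> 0 \<longleftrightarrow> (\<lambda>k. (H1_norm W (f k))\<^sup>2) \<longlonglongrightarrow> 0"
  proof
    assume "(\<lambda>k. (H1_norm W (f k))\<^sup>2) \<longlonglongrightarrow> 0"
    from tendsto_real_sqrt[OF this] show "(\<lambda>k. H1_norm W (f k)) \<longlonglongrightarrow> 0"
      by (simp add: H1_norm_nonneg)
  next
    assume "(\<lambda>k. H1_norm W (f k)) \<longlonglongrightarrow> 0"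
    from tendsto_power[OF this, of 2] show "(\<lambda>k. (H1_norm W (f k))\<^sup>2) \<longlonglongrightarrow> 0" by simp
  qed
  then show ?thesis using ennreal_tendsto_0_iff[of "\<lambda>k. (H1_norm W (f k))\<^sup>2"] by simp
qed

lemma frechet_derivative_locally_const:
  assumes "open V" "x \<in> V" "\<And>y. y \<in> V \<Longrightarrow> e y = c"
  shows "frechet_derivative e (at x) v = 0"
proof -
  have "((\<lambda>y. c) has_derivative (\<lambda>v. 0)) (at x)" by simp
  then have "(e has_derivative (\<lambda>v. 0)) (at x)"
    by (rule has_derivative_transform_within_open[where s=V]) (use assms in auto)
  then show ?thesis using frechet_derivative_at by metis
qed

text \<open>Produces sets of the kind over which \<open>is_trace\<close> quantifies.\<close>

lemma compact_open_neighbourhood: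
  fixes S \<Omega> :: "'a::euclidean_space set"
  assumes "compact S" "open \<Omega>" "S \<subseteq> \<Omega>"
  obtains W where "open W" "bounded W" "S \<subseteq> W" "closure W \<subseteq> \<Omega>"
proof -
  obtain \<delta> where \<delta>: "\<delta> > 0" "(\<Union>x\<in>S. cball x \<delta>) \<subseteq> \<Omega>"
    using compact_subset_open_imp_cball_epsilon_subset[OF assms] by blast
  have c: "compact (\<Union>x\<in>S. cball x \<delta>)" by (rule compact_neighbourhood[OF assms(1)])
  have sub: "(\<Union>x\<in>S. ball x \<delta>) \<subseteq> (\<Union>x\<in>S. cball x \<delta>)" using ball_subset_cball by fastforce
  show ?thesis
  proof (rule that[of "\<Union>x\<in>S. ball x \<delta>"])
    show "bounded (\<Union>x\<in>S. ball x \<delta>)" using c sub bounded_subset compact_imp_bounded by blast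
    show "S \<subseteq> (\<Union>x\<in>S. ball x \<delta>)" using \<delta>(1) by auto
    show "closure (\<Union>x\<in>S. ball x \<delta>) \<subseteq> \<Omega>"
      using closure_minimal[OF sub compact_imp_closed[OF c]] \<delta>(2) by blast
  qed auto
qed

text \<open>The trace inequality on the support of a cut-off function.\<close>

lemma local_trace:
  fixes z :: "real ^ 'n \<Rightarrow> real"
  assumes Q: "Q \<ge> 0" "\<And>u. cc_smooth u \<Longrightarrow> (\<integral>\<^sup>+x. ennreal ((cmod (u x))\<^sup>2) \<partial>\<sigma>) \<le>
      ennreal Q * ((\<Sum>i\<in>UNIV. sq_norm (partial i u)) + sq_norm u)"
    and z: "cc_smooth z" "\<And>x. \<bar>z x\<bar> \<le> 1"
  obtains M where "M \<ge> 0" "\<And>d. cc_smooth d \<Longrightarrow> (\<integral>\<^sup>+x. ennreal ((cmod (z x *\<^sub>R d x))\<^sup>2) \<partial>\<sigma>) \<le>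
      ennreal M * (sq_norm (\<lambda>x. indicator (closure {x. z x \<noteq> 0}) x *\<^sub>R d x)
        + (\<Sum>i\<in>UNIV. sq_norm (\<lambda>x. indicator (closure {x. z x \<noteq> 0}) x *\<^sub>R partial i d x)))"
proof -
  let ?S = "closure {x. z x \<noteq> 0}"
  obtain L where L: "L > 0" "\<And>x v. norm (frechet_derivative z (at x) v) \<le> L * norm v"
    using cc_smooth_derivative_bounded[OF z(1)] by blast
  define m where "m = 2 + 2 * L\<^sup>2 * real CARD('n) + 1"
  have m: "m \<ge> 2" "m \<ge> 2 * L\<^sup>2 * real CARD('n) + 1" by (auto simp: m_def)
  have "(\<integral>\<^sup>+x. ennreal ((cmod (z x *\<^sub>R d x))\<^sup>2) \<partial>\<sigma>) \<le>
      ennreal (Q * m) * (sq_norm (\<lambda>x. indicator ?S x *\<^sub>R d x) + (\<Sum>i\<in>UNIV. sq_norm (\<lambda>x. indicator ?S x *\<^sub>R partial i d x)))"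
    if d: "cc_smooth d" for d
  proof -
    have [measurable]: "d \<in> borel_measurable borel" "partial i d \<in> borel_measurable borel"
      "z \<in> borel_measurable borel" "(\<lambda>x. frechet_derivative z (at x) v) \<in> borel_measurable borel" for i v
      using cc_smooth_measurable[OF d] cc_smooth_measurable[OF partial_cc_smooth[OF d]] cc_smooth_measurable[OF z(1)]
        cc_smooth_measurable[OF cc_smooth_derivative[OF z(1)]] by auto
    define a where "a x = indicator ?S x *\<^sub>R d x" for x
    define b where "b i x = indicator ?S x *\<^sub>R partial i d x" for i x
    have [measurable]: "a \<in> borel_measurable borel" "b i \<in> borel_measurable borel" for i
      unfolding a_def b_def by measurable
    have c: "cc_smooth (\<lambda>x. z x *\<^sub>R d x)"
      by (rule cc_smooth_bilinear1[OF bounded_bilinear_scaleR z(1) cc_smooth_smooth[OF d]])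
    have za: "z x *\<^sub>R d x = z x *\<^sub>R a x" for x
      unfolding a_def using closure_subset[of "{x. z x \<noteq> 0}"] by (cases "z x = 0") auto
    have s0: "sq_norm (\<lambda>x. z x *\<^sub>R d x) \<le> sq_norm a"
      unfolding za using sq_norm_scaleR_le[of a z 1] z(2) by simp
    have si: "sq_norm (partial i (\<lambda>x. z x *\<^sub>R d x)) \<le> 2 * sq_norm (b i) + 2 * (ennreal (L\<^sup>2) * sq_norm a)" for i
    proof -
      have "partial i (\<lambda>x. z x *\<^sub>R d x) x = z x *\<^sub>R b i x + frechet_derivative z (at x) (axis i 1) *\<^sub>R a x" for x
      proof -
        have "z x *\<^sub>R (indicator ?S x *\<^sub>R partial i d x) = z x *\<^sub>R partial i d x"
          using closure_subset[of "{x. z x \<noteq> 0}"] by (cases "z x = 0") auto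
        moreover have "frechet_derivative z (at x) (axis i 1) *\<^sub>R (indicator ?S x *\<^sub>R d x) = frechet_derivative z (at x) (axis i 1) *\<^sub>R d x"
          using frechet_derivative_outside_support[of x z "axis i 1"] by (cases "x \<in> ?S") simp_all
        ultimately show ?thesis
          unfolding partial_scaleR[OF cc_smooth_smooth[OF z(1)] cc_smooth_smooth[OF d]] a_def b_def by (simp only:)
      qed
      then have "sq_norm (partial i (\<lambda>x. z x *\<^sub>R d x)) = sq_norm (\<lambda>x. z x *\<^sub>R b i x + frechet_derivative z (at x) (axis i 1) *\<^sub>R a x)"
        by (simp add: sq_norm_def)
      also have "\<dots> \<le> 2 * sq_norm (\<lambda>x. z x *\<^sub>R b i x) + 2 * sq_norm (\<lambda>x. frechet_derivative z (at x) (axis i 1) *\<^sub>R a x)"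
        by (rule sq_norm_add_le) measurable
      also have "\<dots> \<le> 2 * (ennreal (1\<^sup>2) * sq_norm (b i)) + 2 * (ennreal (L\<^sup>2) * sq_norm a)"
        using L(2)[of _ "axis i 1"] z(2) by (intro add_mono mult_left_mono sq_norm_scaleR_le) auto
      finally show ?thesis by simp
    qed
    have "(\<integral>\<^sup>+x. ennreal ((cmod (z x *\<^sub>R d x))\<^sup>2) \<partial>\<sigma>) \<le>
        ennreal Q * ((\<Sum>i\<in>UNIV. sq_norm (partial i (\<lambda>x. z x *\<^sub>R d x))) + sq_norm (\<lambda>x. z x *\<^sub>R d x))"
      by (rule Q(2)[OF c])
    also have "\<dots> \<le> ennreal Q * ((\<Sum>i\<in>UNIV. 2 * sq_norm (b i) + 2 * (ennreal (L\<^sup>2) * sq_norm a)) + sq_norm a)"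
      by (intro mult_left_mono add_mono sum_mono si s0) simp
    also have "(\<Sum>i\<in>UNIV. 2 * sq_norm (b i) + 2 * (ennreal (L\<^sup>2) * sq_norm a)) + sq_norm a =
        ennreal 2 * (\<Sum>i\<in>UNIV. sq_norm (b i)) + ennreal (2 * L\<^sup>2 * real CARD('n) + 1) * sq_norm a"
    proof -
      have "ennreal (2 * L\<^sup>2 * real CARD('n) + 1) = 2 * ennreal (L\<^sup>2) * of_nat CARD('n) + 1"
        by (simp add: ennreal_mult ennreal_of_nat_eq_real_of_nat)
      then show ?thesis by (simp add: sum.distrib sum_distrib_left[symmetric] distrib_right distrib_left ac_simps)
    qed
    also have "ennreal Q * (ennreal 2 * (\<Sum>i\<in>UNIV. sq_norm (b i)) + ennreal (2 * L\<^sup>2 * real CARD('n) + 1) * sq_norm a)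
        \<le> ennreal Q * (ennreal m * (\<Sum>i\<in>UNIV. sq_norm (b i)) + ennreal m * sq_norm a)"
      by (intro mult_left_mono add_mono mult_right_mono ennreal_leI m) auto
    also have "\<dots> =
        ennreal (Q * m) * (sq_norm a + (\<Sum>i\<in>UNIV. sq_norm (b i)))"
      using Q(1) m(1) by (simp add: ennreal_mult distrib_left ac_simps)
    finally show ?thesis unfolding a_def b_def .
  qed
  moreover have "Q * m \<ge> 0" using Q(1) m(1) by simp
  ultimately show ?thesis using that by blast
qed

lemma nn_square_triangle:
  fixes f g h :: "'a \<Rightarrow> complex"
  assumes [measurable]: "W \<in> sets M" "f \<in> borel_measurable M" "g \<in> borel_measurable M" "h \<in> borel_measurable M"
  shows "(\<integral>\<^sup>+x\<in>W. ennreal ((cmod (f x - h x))\<^sup>2) \<partial>M) \<le>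
    2 * (\<integral>\<^sup>+x\<in>W. ennreal ((cmod (f x - g x))\<^sup>2) \<partial>M) + 2 * (\<integral>\<^sup>+x\<in>W. ennreal ((cmod (g x - h x))\<^sup>2) \<partial>M)"
proof -
  have "(\<integral>\<^sup>+x\<in>W. ennreal ((cmod (f x - h x))\<^sup>2) \<partial>M) \<le>
    (\<integral>\<^sup>+x. 2 * (ennreal ((cmod (f x - g x))\<^sup>2) * indicator W x) + 2 * (ennreal ((cmod (g x - h x))\<^sup>2) * indicator W x) \<partial>M)"
  proof (rule nn_integral_mono)
    fix x
    have "(cmod (f x - h x))\<^sup>2 \<le> 2 * (cmod (f x - g x))\<^sup>2 + 2 * (cmod (g x - h x))\<^sup>2"
      using cmod_add_squared_le[of "f x - g x" "g x - h x"] by simp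
    then have "ennreal ((cmod (f x - h x))\<^sup>2) \<le> ennreal (2 * (cmod (f x - g x))\<^sup>2 + 2 * (cmod (g x - h x))\<^sup>2)"
      by (rule ennreal_leI)
    then show "ennreal ((cmod (f x - h x))\<^sup>2) * indicator W x \<le>
       2 * (ennreal ((cmod (f x - g x))\<^sup>2) * indicator W x) + 2 * (ennreal ((cmod (g x - h x))\<^sup>2) * indicator W x)"
      by (cases "x \<in> W") (simp_all add: ennreal_mult)
  qed
  also have "\<dots> = 2 * (\<integral>\<^sup>+x\<in>W. ennreal ((cmod (f x - g x))\<^sup>2) \<partial>M) + 2 * (\<integral>\<^sup>+x\<in>W. ennreal ((cmod (g x - h x))\<^sup>2) \<partial>M)"
    by (simp add: nn_integral_add nn_integral_cmult)
  finally show ?thesis .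
qed

lemma tendsto_zero_bound:
  fixes f g :: "nat \<Rightarrow> ennreal"
  assumes "g \<longlonglongrightarrow> 0" "\<And>k. f k \<le> ennreal c * g k"
  shows "f \<longlonglongrightarrow> 0"
proof -
  have "(\<lambda>k. ennreal c * g k) \<longlonglongrightarrow> ennreal c * 0"
    by (rule ennreal_tendsto_cmult[OF _ assms(1)]) simp
  then have "(\<lambda>k. ennreal c * g k) \<longlonglongrightarrow> 0" by simp
  then show ?thesis by (rule tendsto_sandwich[OF _ _ tendsto_const, rotated -1]) (use assms(2) in auto)
qed

lemma sq_norm_restrict_diff_le:
  assumes [measurable]: "a \<in> borel_measurable borel" "b \<in> borel_measurable borel" "c \<in> borel_measurable borel" "S \<in> sets borel"
  shows "sq_norm (\<lambda>x. indicator S x *\<^sub>R (a x - b x)) \<le>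
    2 * sq_norm (\<lambda>x. indicator S x *\<^sub>R (a x - c x)) + 2 * sq_norm (\<lambda>x. indicator S x *\<^sub>R (b x - c x))"
proof -
  have "sq_norm (\<lambda>x. indicator S x *\<^sub>R (a x - c x) - indicator S x *\<^sub>R (b x - c x)) \<le>
    2 * sq_norm (\<lambda>x. indicator S x *\<^sub>R (a x - c x)) + 2 * sq_norm (\<lambda>x. indicator S x *\<^sub>R (b x - c x))"
    by (rule sq_norm_diff_le) measurable
  moreover have "indicator S x *\<^sub>R (a x - c x) - indicator S x *\<^sub>R (b x - c x) = indicator S x *\<^sub>R (a x - b x)" for x
    by (simp add: scaleR_diff_right)
  ultimately show ?thesis by (simp only:)
qed

lemma partial_diff:
  fixes u v :: "real ^ 'n \<Rightarrow> complex"
  assumes "smooth u" "smooth v"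
  shows "partial i (\<lambda>x. u x - v x) x = partial i u x - partial i v x"
  unfolding partial_def
  using frechet_derivative_at[OF has_derivative_diff[OF smooth_has_derivative[OF assms(1)] smooth_has_derivative[OF assms(2)]], symmetric]
  by simp

text \<open>The $L^2(\sigma)$ distance on \<open>W\<close> of two test functions is controlled by their $H^1$ distances
  from \<open>u\<close> on a compact neighbourhood of \<open>W\<close>.\<close>

lemma trace_difference:
  fixes W \<Omega> :: "(real ^ 'n) set"
  assumes Q: "Q \<ge> 0" "\<And>u. cc_smooth u \<Longrightarrow> (\<integral>\<^sup>+x. ennreal ((cmod (u x))\<^sup>2) \<partial>\<sigma>) \<le>
      ennreal Q * ((\<Sum>i\<in>UNIV. sq_norm (partial i u)) + sq_norm u)"
    and W: "bounded W" "closure W \<subseteq> \<Omega>" and \<Omega>: "open \<Omega>" and r: "H1_rep \<Omega> u u0 w"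
  obtains S M where "compact S" "W \<subseteq> S" "S \<subseteq> \<Omega>" "M \<ge> 0" "\<And>v v'. cc_smooth v \<Longrightarrow> cc_smooth v' \<Longrightarrow>
     (\<integral>\<^sup>+x\<in>W. ennreal ((cmod (v x - v' x))\<^sup>2) \<partial>\<sigma>) \<le> ennreal M *
       ((sq_norm (\<lambda>x. indicator S x *\<^sub>R (v x - u0 x)) + (\<Sum>i\<in>UNIV. sq_norm (\<lambda>x. indicator S x *\<^sub>R (partial i v x - w i x))))
      + (sq_norm (\<lambda>x. indicator S x *\<^sub>R (v' x - u0 x)) + (\<Sum>i\<in>UNIV. sq_norm (\<lambda>x. indicator S x *\<^sub>R (partial i v' x - w i x)))))"
proof -
  have cW: "compact (closure W)" using W(1) by (simp add: compact_closure)
  obtain z V where z: "cc_smooth z" "closure {x. z x \<noteq> (0::real)} \<subseteq> \<Omega>" "\<And>x. 0 \<le> z x" "\<And>x. z x \<le> 1"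
    "open V" "closure W \<subseteq> V" "V \<subseteq> \<Omega>" "\<And>x. x \<in> V \<Longrightarrow> z x = 1"
    using smooth_cutoff_exists[OF cW \<Omega> W(2)] by metis
  define S where "S = closure {x. z x \<noteq> 0}"
  have zabs: "\<bar>z x\<bar> \<le> 1" for x using z(3)[of x] z(4)[of x] by simp
  obtain M where M: "M \<ge> 0" "\<And>d. cc_smooth d \<Longrightarrow> (\<integral>\<^sup>+x. ennreal ((cmod (z x *\<^sub>R d x))\<^sup>2) \<partial>\<sigma>) \<le>
      ennreal M * (sq_norm (\<lambda>x. indicator S x *\<^sub>R d x) + (\<Sum>i\<in>UNIV. sq_norm (\<lambda>x. indicator S x *\<^sub>R partial i d x)))"
    by (rule local_trace[OF Q z(1) zabs, folded S_def]; (assumption | (rule that; assumption)))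
  have WS: "W \<subseteq> S"
  proof
    fix x assume "x \<in> W"
    then have "z x = 1" using closure_subset z(6,8) by blast
    then show "x \<in> S" unfolding S_def using closure_subset[of "{x. z x \<noteq> 0}"] by auto
  qed
  have S: "compact S" unfolding S_def using z(1) by (simp add: cc_smooth_def)
  have [measurable]: "S \<in> sets borel" using S by (simp add: borel_compact)
  have [measurable]: "u0 \<in> borel_measurable borel" "w i \<in> borel_measurable borel" for i
    using r rep_measurable unfolding H1_rep_def by blast+
  have "(\<integral>\<^sup>+x\<in>W. ennreal ((cmod (v x - v' x))\<^sup>2) \<partial>\<sigma>) \<le> ennreal (2 * M) *
       ((sq_norm (\<lambda>x. indicator S x *\<^sub>R (v x - u0 x)) + (\<Sum>i\<in>UNIV. sq_norm (\<lambda>x. indicator S x *\<^sub>R (partial i v x - w i x))))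
      + (sq_norm (\<lambda>x. indicator S x *\<^sub>R (v' x - u0 x)) + (\<Sum>i\<in>UNIV. sq_norm (\<lambda>x. indicator S x *\<^sub>R (partial i v' x - w i x)))))"
    if v: "cc_smooth v" "cc_smooth v'" for v v'
  proof -
    have [measurable]: "v \<in> borel_measurable borel" "v' \<in> borel_measurable borel"
      "partial i v \<in> borel_measurable borel" "partial i v' \<in> borel_measurable borel" for i
      using cc_smooth_measurable v partial_cc_smooth by blast+
    have "(\<integral>\<^sup>+x\<in>W. ennreal ((cmod (v x - v' x))\<^sup>2) \<partial>\<sigma>) \<le> (\<integral>\<^sup>+x. ennreal ((cmod (z x *\<^sub>R (v x - v' x)))\<^sup>2) \<partial>\<sigma>)"
    proof (rule nn_integral_mono)
      fix x
      show "ennreal ((cmod (v x - v' x))\<^sup>2) * indicator W x \<le> ennreal ((cmod (z x *\<^sub>R (v x - v' x)))\<^sup>2)"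
        using z(8)[of x] z(6) closure_subset[of W] by (cases "x \<in> W") auto
    qed
    also have "\<dots> \<le> ennreal M * (sq_norm (\<lambda>x. indicator S x *\<^sub>R (v x - v' x)) + (\<Sum>i\<in>UNIV. sq_norm (\<lambda>x. indicator S x *\<^sub>R partial i (\<lambda>x. v x - v' x) x)))"
      by (rule M(2)[OF cc_smooth_diff[OF v]])
    also have "(\<lambda>i. sq_norm (\<lambda>x. indicator S x *\<^sub>R partial i (\<lambda>x. v x - v' x) x)) = (\<lambda>i. sq_norm (\<lambda>x. indicator S x *\<^sub>R (partial i v x - partial i v' x)))"
      using partial_diff[OF cc_smooth_smooth[OF v(1)] cc_smooth_smooth[OF v(2)]] by simp
    also have "ennreal M * (sq_norm (\<lambda>x. indicator S x *\<^sub>R (v x - v' x)) + (\<Sum>i\<in>UNIV. sq_norm (\<lambda>x. indicator S x *\<^sub>R (partial i v x - partial i v' x)))) \<le>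
      ennreal M * ((2 * sq_norm (\<lambda>x. indicator S x *\<^sub>R (v x - u0 x)) + 2 * sq_norm (\<lambda>x. indicator S x *\<^sub>R (v' x - u0 x))) +
        (\<Sum>i\<in>UNIV. 2 * sq_norm (\<lambda>x. indicator S x *\<^sub>R (partial i v x - w i x)) + 2 * sq_norm (\<lambda>x. indicator S x *\<^sub>R (partial i v' x - w i x))))"
      by (intro mult_left_mono add_mono sum_mono sq_norm_restrict_diff_le) auto
    also have "\<dots> = ennreal (2 * M) *
       ((sq_norm (\<lambda>x. indicator S x *\<^sub>R (v x - u0 x)) + (\<Sum>i\<in>UNIV. sq_norm (\<lambda>x. indicator S x *\<^sub>R (partial i v x - w i x))))
      + (sq_norm (\<lambda>x. indicator S x *\<^sub>R (v' x - u0 x)) + (\<Sum>i\<in>UNIV. sq_norm (\<lambda>x. indicator S x *\<^sub>R (partial i v' x - w i x)))))"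
      using M(1) by (simp add: ennreal_mult sum.distrib sum_distrib_left[symmetric] distrib_left ac_simps)
    finally show ?thesis .
  qed
  then show ?thesis using that[of S "2 * M"] S WS z(2) M(1) unfolding S_def by auto
qed

text \<open>Both approximating sequences converge to u in H^1 on a neighbourhood of the compact set
  S from \<open>trace_difference\<close>, so their difference tends to 0 in L^2(\<sigma>) on W. Two
  triangle inequalities transfer this to the two candidate traces.\<close>

lemma is_trace_unique:
  fixes W \<Omega> :: "(real ^ 'n) set"
  assumes Q: "Q \<ge> 0" "\<And>u. cc_smooth u \<Longrightarrow> (\<integral>\<^sup>+x. ennreal ((cmod (u x))\<^sup>2) \<partial>\<sigma>) \<le>
      ennreal Q * ((\<Sum>i\<in>UNIV. sq_norm (partial i u)) + sq_norm u)"
    and \<sigma>[measurable_cong]: "sets \<sigma> = sets borel"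
    and W: "open W" "bounded W" "closure W \<subseteq> \<Omega>" and \<Omega>: "open \<Omega>" and r: "H1_rep \<Omega> u u0 w"
    and T: "is_trace \<Omega> \<sigma> u T" "is_trace \<Omega> \<sigma> u T'"
  shows "AE x in \<sigma>. x \<in> W \<longrightarrow> T x = T' x"
proof -
  obtain S M where S: "compact S" "W \<subseteq> S" "S \<subseteq> \<Omega>" "M \<ge> 0" and tr: "\<And>v v'. cc_smooth v \<Longrightarrow> cc_smooth v' \<Longrightarrow>
     (\<integral>\<^sup>+x\<in>W. ennreal ((cmod (v x - v' x))\<^sup>2) \<partial>\<sigma>) \<le> ennreal M *
       ((sq_norm (\<lambda>x. indicator S x *\<^sub>R (v x - u0 x)) + (\<Sum>i\<in>UNIV. sq_norm (\<lambda>x. indicator S x *\<^sub>R (partial i v x - w i x))))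
      + (sq_norm (\<lambda>x. indicator S x *\<^sub>R (v' x - u0 x)) + (\<Sum>i\<in>UNIV. sq_norm (\<lambda>x. indicator S x *\<^sub>R (partial i v' x - w i x)))))"
    by (rule trace_difference[OF Q W(2,3) \<Omega> r]; (assumption | (rule that; assumption)))
  \<comment> \<open>The trace inequality loses some room, so convergence in H^1 is used on a larger
    admissible set that contains \<open>S\<close>.\<close>
  obtain W' where W': "open W'" "bounded W'" "S \<subseteq> W'" "closure W' \<subseteq> \<Omega>"
    using compact_open_neighbourhood[OF S(1) \<Omega> S(3)] by blast
  have W'\<Omega>: "W' \<subseteq> \<Omega>" using W'(4) closure_subset by blast
  obtain v where v: "\<And>k::nat. v k \<in> test_functions UNIV" "\<And>W. open W \<Longrightarrow> bounded W \<Longrightarrow> closure W \<subseteq> \<Omega> \<Longrightarrow>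
      (\<lambda>k. H1_norm W (\<lambda>x. v k x - u x)) \<longlonglongrightarrow> 0 \<and> (\<lambda>k. \<integral>\<^sup>+x\<in>W. ennreal ((cmod (v k x - T x))\<^sup>2) \<partial>\<sigma>) \<longlonglongrightarrow> 0"
    using T(1) unfolding is_trace_def by blast
  obtain v' where v': "\<And>k::nat. v' k \<in> test_functions UNIV" "\<And>W. open W \<Longrightarrow> bounded W \<Longrightarrow> closure W \<subseteq> \<Omega> \<Longrightarrow>
      (\<lambda>k. H1_norm W (\<lambda>x. v' k x - u x)) \<longlonglongrightarrow> 0 \<and> (\<lambda>k. \<integral>\<^sup>+x\<in>W. ennreal ((cmod (v' k x - T' x))\<^sup>2) \<partial>\<sigma>) \<longlonglongrightarrow> 0"
    using T(2) unfolding is_trace_def by blast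
  have cv: "cc_smooth (v k)" "cc_smooth (v' k)" for k using v(1) v'(1) by (auto simp: test_functions_UNIV)
  have [measurable]: "T \<in> borel_measurable borel" "T' \<in> borel_measurable borel" "v k \<in> borel_measurable borel" "v' k \<in> borel_measurable borel" for k
    using T cc_smooth_measurable[OF cv(1)] cc_smooth_measurable[OF cv(2)] by (auto simp: is_trace_def)
  have [measurable]: "W \<in> sets borel" using W by simp
  have le: "sq_norm (\<lambda>x. indicator S x *\<^sub>R (f x - u0 x)) + (\<Sum>i\<in>UNIV. sq_norm (\<lambda>x. indicator S x *\<^sub>R (partial i f x - w i x)))
     \<le> ennreal ((H1_norm W' (\<lambda>x. f x - u x))\<^sup>2)" if "cc_smooth f" for f
    unfolding H1_norm_diff_eq[OF W'(1) W'\<Omega> r that] using W'(3)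
    by (intro add_mono sum_mono sq_norm_mono) (auto simp: indicator_def)
  have "(\<lambda>k. \<integral>\<^sup>+x\<in>W. ennreal ((cmod (v k x - v' k x))\<^sup>2) \<partial>\<sigma>) \<longlonglongrightarrow> 0"
  proof (rule tendsto_zero_bound)
    show "(\<lambda>k. ennreal ((H1_norm W' (\<lambda>x. v k x - u x))\<^sup>2) + ennreal ((H1_norm W' (\<lambda>x. v' k x - u x))\<^sup>2)) \<longlonglongrightarrow> 0"
      using tendsto_add[of "\<lambda>k. ennreal ((H1_norm W' (\<lambda>x. v k x - u x))\<^sup>2)" 0 sequentially "\<lambda>k. ennreal ((H1_norm W' (\<lambda>x. v' k x - u x))\<^sup>2)" 0]
        v(2)[OF W'(1,2,4)] v'(2)[OF W'(1,2,4)] by (simp add: H1_norm_tendsto_iff)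
    show "(\<integral>\<^sup>+x\<in>W. ennreal ((cmod (v k x - v' k x))\<^sup>2) \<partial>\<sigma>) \<le> ennreal M *
       (ennreal ((H1_norm W' (\<lambda>x. v k x - u x))\<^sup>2) + ennreal ((H1_norm W' (\<lambda>x. v' k x - u x))\<^sup>2))" for k
      by (rule order_trans[OF tr[OF cv]]) (intro mult_left_mono add_mono le cv, simp)
  qed
  note lim = this conjunct2[OF v(2)[OF W]] conjunct2[OF v'(2)[OF W]]
  have est: "(\<integral>\<^sup>+x\<in>W. ennreal ((cmod (T x - T' x))\<^sup>2) \<partial>\<sigma>) \<le> ennreal 4 *
     ((\<integral>\<^sup>+x\<in>W. ennreal ((cmod (v k x - v' k x))\<^sup>2) \<partial>\<sigma>) + (\<integral>\<^sup>+x\<in>W. ennreal ((cmod (v k x - T x))\<^sup>2) \<partial>\<sigma>)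
       + (\<integral>\<^sup>+x\<in>W. ennreal ((cmod (v' k x - T' x))\<^sup>2) \<partial>\<sigma>))" (is "?I \<le> _ * (?a + ?b + ?c)") for k
  proof -
    have "?I \<le> 2 * (\<integral>\<^sup>+x\<in>W. ennreal ((cmod (T x - v k x))\<^sup>2) \<partial>\<sigma>) + 2 * (\<integral>\<^sup>+x\<in>W. ennreal ((cmod (v k x - T' x))\<^sup>2) \<partial>\<sigma>)"
      by (rule nn_square_triangle) measurable
    also have "(\<integral>\<^sup>+x\<in>W. ennreal ((cmod (T x - v k x))\<^sup>2) \<partial>\<sigma>) = ?b" by (simp add: norm_minus_commute)
    also have "(\<integral>\<^sup>+x\<in>W. ennreal ((cmod (v k x - T' x))\<^sup>2) \<partial>\<sigma>) \<le> 2 * ?a + 2 * ?c"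
      by (rule nn_square_triangle) measurable
    finally have "?I \<le> 2 * ?b + 2 * (2 * ?a + 2 * ?c)" by (simp add: add_left_mono mult_left_mono)
    also have "\<dots> \<le> 4 * ?b + (4 * ?a + 4 * ?c)"
      by (intro add_mono mult_right_mono) (simp_all add: distrib_left mult.assoc[symmetric])
    also have "\<dots> = ennreal 4 * (?a + ?b + ?c)" by (simp add: distrib_left ac_simps)
    finally show ?thesis .
  qed
  have "(\<lambda>k::nat. \<integral>\<^sup>+x\<in>W. ennreal ((cmod (T x - T' x))\<^sup>2) \<partial>\<sigma>) \<longlonglongrightarrow> 0"
    by (rule tendsto_zero_bound[OF _ est]) (use tendsto_add[OF tendsto_add[OF lim(1,2)] lim(3)] in simp)
  then have "(\<integral>\<^sup>+x\<in>W. ennreal ((cmod (T x - T' x))\<^sup>2) \<partial>\<sigma>) = 0" by (simp add: LIMSEQ_const_iff)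
  then have "AE x in \<sigma>. ennreal ((cmod (T x - T' x))\<^sup>2) * indicator W x = 0"
    by (subst (asm) nn_integral_0_iff_AE) measurable
  then show ?thesis by eventually_elim (auto simp: indicator_def)
qed


section \<open>Construction of the trace\<close>

lemma convergent_geometric_increments:
  fixes a :: "nat \<Rightarrow> 'a::banach"
  assumes "\<And>n. n \<ge> N \<Longrightarrow> norm (a (Suc n) - a n) \<le> c * (1 / 2) ^ n"
  shows "convergent a"
proof -
  have "summable (\<lambda>n. a (Suc (n + N)) - a (n + N))"
  proof (rule summable_comparison_test')
    show "summable (\<lambda>n. c * (1 / 2) ^ N * (1 / 2) ^ n :: real)"
      by (intro summable_mult summable_geometric) simp
    show "norm (a (Suc (n + N)) - a (n + N)) \<le> c * (1 / 2) ^ N * (1 / 2) ^ n" if "n \<ge> 0" for n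
      using assms[of "n + N"] by (simp add: power_add mult.commute mult.left_commute)
  qed
  from summable_LIMSEQ[OF this]
  have "(\<lambda>m. \<Sum>n<m. a (Suc n + N) - a (n + N)) \<longlonglongrightarrow> (\<Sum>n. a (Suc (n + N)) - a (n + N))" by simp
  then have "(\<lambda>m. a (m + N) - a (0 + N)) \<longlonglongrightarrow> (\<Sum>n. a (Suc (n + N)) - a (n + N))"
    by (simp only: sum_lessThan_telescope[of "\<lambda>n. a (n + N)"])
  from tendsto_add[OF this tendsto_const[of "a (0 + N)"]]
  have "(\<lambda>m. a (m + N)) \<longlonglongrightarrow> (\<Sum>n. a (Suc (n + N)) - a (n + N)) + a (0 + N)" by simp
  from LIMSEQ_offset[OF this] show ?thesis by (rule convergentI)
qed

text \<open>Choose smooth v_n whose squared H^1 distance from u on the n-th compact set of an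
  exhaustion is O(16^-n). The trace inequality makes v_n Cauchy in L^2(\<sigma>) near every compact
  set, fast enough for pointwise convergence almost everywhere. The pointwise limit is a single
  Borel function for all W at once, and Fatou's lemma bounds its distance from v_n.\<close>

lemma is_trace_exists:
  fixes \<Omega> :: "(real ^ 'n) set"
  assumes Q: "Q \<ge> 0" "\<And>u. cc_smooth u \<Longrightarrow> (\<integral>\<^sup>+x. ennreal ((cmod (u x))\<^sup>2) \<partial>\<sigma>) \<le>
      ennreal Q * ((\<Sum>i\<in>UNIV. sq_norm (partial i u)) + sq_norm u)"
    and \<sigma>[measurable_cong]: "sets \<sigma> = sets borel"
    and \<Omega>: "open \<Omega>" and r: "H1_rep \<Omega> u u0 w"
  shows "\<exists>T. is_trace \<Omega> \<sigma> u T"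
proof -
  define c where "c = 1 + real CARD('n)"
  have c0: "c \<ge> 0" by (simp add: c_def)
  obtain C :: "nat \<Rightarrow> (real ^ 'n) set" where C: "\<And>n. compact (C n)" "\<And>n. C n \<subseteq> \<Omega>"
    "\<And>K. compact K \<Longrightarrow> K \<subseteq> \<Omega> \<Longrightarrow> \<exists>N. \<forall>n\<ge>N. K \<subseteq> C n"
    using open_Union_compact_subsets[OF \<Omega>] by metis
  \<comment> \<open>All subsets of \<open>C n\<close> are allowed because the estimate is used both
    for the set S of \<open>trace_difference\<close> and for W itself.\<close>
  define good where "good n v \<longleftrightarrow> cc_smooth v \<and> (\<forall>S. S \<subseteq> C n \<longrightarrow>
     sq_norm (\<lambda>x. indicator S x *\<^sub>R (v x - u0 x)) + (\<Sum>i\<in>UNIV. sq_norm (\<lambda>x. indicator S x *\<^sub>R (partial i v x - w i x)))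
       \<le> ennreal (c * (1 / 16) ^ n))" for n v
  have "\<exists>v. good n v" for n
  proof -
    obtain e V where e: "cc_smooth e" "closure {x. e x \<noteq> (0::real)} \<subseteq> \<Omega>" "\<And>x. 0 \<le> e x" "\<And>x. e x \<le> 1"
      "open V" "C n \<subseteq> V" "V \<subseteq> \<Omega>" "\<And>x. x \<in> V \<Longrightarrow> e x = 1"
      using smooth_cutoff_exists[OF C(1) \<Omega> C(2)] by metis
    let ?G = "\<lambda>i x. e x *\<^sub>R w i x + frechet_derivative e (at x) (axis i 1) *\<^sub>R u0 x"
    obtain \<psi> where \<psi>: "\<And>k::nat. \<psi> k \<in> test_functions \<Omega>" "(\<lambda>k. sq_norm (\<lambda>x. \<psi> k x - e x *\<^sub>R u0 x)) \<longlonglongrightarrow> 0"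
      "\<And>i. (\<lambda>k. sq_norm (\<lambda>x. partial i (\<psi> k) x - ?G i x)) \<longlonglongrightarrow> 0"
      by (rule H1_localize[OF \<Omega> r e(1,2)]; (rule that; assumption))
    have pos: "0 < ennreal ((1 / 16) ^ n)" by simp
    have "\<forall>\<^sub>F k in sequentially. sq_norm (\<lambda>x. \<psi> k x - e x *\<^sub>R u0 x) < ennreal ((1 / 16) ^ n)"
      by (rule order_tendstoD(2)[OF \<psi>(2) pos])
    moreover have "\<forall>\<^sub>F k in sequentially. \<forall>i\<in>UNIV. sq_norm (\<lambda>x. partial i (\<psi> k) x - ?G i x) < ennreal ((1 / 16) ^ n)"
      by (rule eventually_ball_finite) (auto intro: order_tendstoD(2)[OF \<psi>(3) pos])
    ultimately have "\<forall>\<^sub>F k in sequentially. sq_norm (\<lambda>x. \<psi> k x - e x *\<^sub>R u0 x) < ennreal ((1 / 16) ^ n)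
       \<and> (\<forall>i\<in>UNIV. sq_norm (\<lambda>x. partial i (\<psi> k) x - ?G i x) < ennreal ((1 / 16) ^ n))"
      by (rule eventually_conj)
    then obtain k where k: "sq_norm (\<lambda>x. \<psi> k x - e x *\<^sub>R u0 x) < ennreal ((1 / 16) ^ n)"
      "\<And>i. sq_norm (\<lambda>x. partial i (\<psi> k) x - ?G i x) < ennreal ((1 / 16) ^ n)"
      by (auto simp: eventually_sequentially)
    have "good n (\<psi> k)"
      unfolding good_def
    proof (intro conjI allI impI)
      show "cc_smooth (\<psi> k)" using \<psi>(1) by (simp add: test_functions_iff)
      fix S assume S: "S \<subseteq> C n"
      have e1: "e x = 1" "frechet_derivative e (at x) v = 0" if "x \<in> S" for x v
        using that S e(6,8) frechet_derivative_locally_const[OF e(5), of x e 1 v] by auto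
      have a: "sq_norm (\<lambda>x. indicator S x *\<^sub>R (\<psi> k x - u0 x)) \<le> sq_norm (\<lambda>x. \<psi> k x - e x *\<^sub>R u0 x)"
        by (rule sq_norm_mono) (auto simp: indicator_def e1)
      have b: "sq_norm (\<lambda>x. indicator S x *\<^sub>R (partial i (\<psi> k) x - w i x)) \<le> sq_norm (\<lambda>x. partial i (\<psi> k) x - ?G i x)" for i
        by (rule sq_norm_mono) (auto simp: indicator_def e1)
      have "sq_norm (\<lambda>x. indicator S x *\<^sub>R (\<psi> k x - u0 x)) + (\<Sum>i\<in>UNIV. sq_norm (\<lambda>x. indicator S x *\<^sub>R (partial i (\<psi> k) x - w i x)))
        \<le> ennreal ((1 / 16) ^ n) + (\<Sum>i\<in>(UNIV::'n set). ennreal ((1 / 16) ^ n))"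
        by (intro add_mono sum_mono order_trans[OF a] order_trans[OF b] less_imp_le k)
      also have "\<dots> = ennreal (c * (1 / 16) ^ n)"
        by (simp add: c_def ennreal_mult ennreal_of_nat_eq_real_of_nat[symmetric] distrib_right)
      finally show "sq_norm (\<lambda>x. indicator S x *\<^sub>R (\<psi> k x - u0 x)) + (\<Sum>i\<in>UNIV. sq_norm (\<lambda>x. indicator S x *\<^sub>R (partial i (\<psi> k) x - w i x)))
        \<le> ennreal (c * (1 / 16) ^ n)" .
    qed
    then show ?thesis by blast
  qed
  then obtain v where v: "\<And>n. good n (v n)" by metis
  have cv: "cc_smooth (v n)" for n using v by (simp add: good_def)
  have [measurable]: "v n \<in> borel_measurable borel" for n by (rule cc_smooth_measurable[OF cv])
  \<comment> \<open>Defined everywhere and Borel; it is the actual limit only where the sequence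
    converges, which below is shown to hold \<sigma>-almost everywhere on each W.\<close>
  define T where "T x = lim (\<lambda>n. v n x)" for x
  have [measurable]: "T \<in> borel_measurable borel" unfolding T_def by measurable
  have main: "(\<lambda>k. H1_norm W (\<lambda>x. v k x - u x)) \<longlonglongrightarrow> 0 \<and>
     (\<lambda>k. \<integral>\<^sup>+x\<in>W. ennreal ((cmod (v k x - T x))\<^sup>2) \<partial>\<sigma>) \<longlonglongrightarrow> 0"
    if W: "open W" "bounded W" "closure W \<subseteq> \<Omega>" for W
  proof -
    obtain S M where S: "compact S" "W \<subseteq> S" "S \<subseteq> \<Omega>" "M \<ge> 0" and tr: "\<And>v v'. cc_smooth v \<Longrightarrow> cc_smooth v' \<Longrightarrow>
     (\<integral>\<^sup>+x\<in>W. ennreal ((cmod (v x - v' x))\<^sup>2) \<partial>\<sigma>) \<le> ennreal M *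
       ((sq_norm (\<lambda>x. indicator S x *\<^sub>R (v x - u0 x)) + (\<Sum>i\<in>UNIV. sq_norm (\<lambda>x. indicator S x *\<^sub>R (partial i v x - w i x))))
      + (sq_norm (\<lambda>x. indicator S x *\<^sub>R (v' x - u0 x)) + (\<Sum>i\<in>UNIV. sq_norm (\<lambda>x. indicator S x *\<^sub>R (partial i v' x - w i x)))))"
      by (rule trace_difference[OF Q W(2,3) \<Omega> r]; (assumption | (rule that; assumption)))
    have [measurable]: "W \<in> sets borel" using W by simp
    have W\<Omega>: "W \<subseteq> \<Omega>" using S by blast
    obtain N where N: "\<And>n. n \<ge> N \<Longrightarrow> S \<subseteq> C n" using C(3)[OF S(1,3)] by blast
    define A where "A = M * c"
    have A0: "A \<ge> 0" using S(4) c0 by (simp add: A_def)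
    have d: "(\<integral>\<^sup>+x\<in>W. ennreal ((cmod (v n x - v j x))\<^sup>2) \<partial>\<sigma>) \<le> ennreal (2 * A * (1 / 16) ^ n)" if n: "n \<ge> N" "j \<ge> n" for n j
    proof -
      have "(\<integral>\<^sup>+x\<in>W. ennreal ((cmod (v n x - v j x))\<^sup>2) \<partial>\<sigma>) \<le> ennreal M * (ennreal (c * (1 / 16) ^ n) + ennreal (c * (1 / 16) ^ j))"
        using v[of n] v[of j] N[of n] N[of j] n unfolding good_def
        by (intro order_trans[OF tr[OF cv cv]] mult_left_mono add_mono) auto
      also have "\<dots> = ennreal (M * (c * (1 / 16) ^ n + c * (1 / 16) ^ j))"
        using S(4) c0 by (simp add: ennreal_mult)
      also have "\<dots> \<le> ennreal (2 * A * (1 / 16) ^ n)"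
      proof (rule ennreal_leI)
        have "(1 / 16 :: real) ^ j \<le> (1 / 16) ^ n" using n(2) by (intro power_decreasing) auto
        then have "A * (1 / 16) ^ j \<le> A * (1 / 16) ^ n" using A0 by (rule mult_left_mono)
        then show "M * (c * (1 / 16) ^ n + c * (1 / 16) ^ j) \<le> 2 * A * (1 / 16) ^ n"
          by (simp add: A_def algebra_simps)
      qed
      finally show ?thesis .
    qed
    have conv: "AE x in \<sigma>. x \<in> W \<longrightarrow> convergent (\<lambda>n. v n x)"
    proof -
      \<comment> \<open>The weight 4^n against 16^-n leaves a summable series of integrals;
        finiteness of the sum at x then bounds the increments by a multiple of 2^-n.\<close>
      define f where "f n x = ennreal (4 ^ (n + N)) * (ennreal ((cmod (v (n + N) x - v (Suc (n + N)) x))\<^sup>2) * indicator W x)" for n x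
      have [measurable]: "f n \<in> borel_measurable \<sigma>" for n unfolding f_def by measurable
      have "(\<integral>\<^sup>+x. f n x \<partial>\<sigma>) \<le> ennreal (2 * A * (1 / 4) ^ N * (1 / 4) ^ n)" for n
      proof -
        have "(\<integral>\<^sup>+x. f n x \<partial>\<sigma>) = ennreal (4 ^ (n + N)) * (\<integral>\<^sup>+x\<in>W. ennreal ((cmod (v (n + N) x - v (Suc (n + N)) x))\<^sup>2) \<partial>\<sigma>)"
          unfolding f_def by (rule nn_integral_cmult) measurable
        also have "\<dots> \<le> ennreal (4 ^ (n + N)) * ennreal (2 * A * (1 / 16) ^ (n + N))"
          by (intro mult_left_mono d) auto
        also have "\<dots> = ennreal (4 ^ (n + N) * (2 * A * (1 / 16) ^ (n + N)))"
          using A0 by (intro ennreal_mult[symmetric]) auto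
        also have "4 ^ (n + N) * (2 * A * (1 / 16) ^ (n + N)) = 2 * A * (4 * (1 / 16)) ^ (n + N)"
          by (simp only: power_mult_distrib ac_simps)
        also have "\<dots> = 2 * A * (1 / 4) ^ N * (1 / 4) ^ n" by (simp add: power_add ac_simps)
        finally show ?thesis .
      qed
      then have "(\<Sum>n. \<integral>\<^sup>+x. f n x \<partial>\<sigma>) \<le> (\<Sum>n. ennreal (2 * A * (1 / 4) ^ N * (1 / 4) ^ n))"
        by (intro suminf_le) auto
      moreover have "(\<Sum>n. ennreal (2 * A * (1 / 4) ^ N * (1 / 4) ^ n)) \<noteq> \<top>"
        using A0 by (intro ennreal_suminf_neq_top summable_mult summable_geometric) auto
      ultimately have "(\<integral>\<^sup>+x. (\<Sum>n. f n x) \<partial>\<sigma>) \<noteq> \<infinity>"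
        by (subst nn_integral_suminf) (auto simp: top_unique)
      then have "AE x in \<sigma>. (\<Sum>n. f n x) \<noteq> \<infinity>"
        by (intro nn_integral_noteq_infinite) auto
      then show ?thesis
      proof eventually_elim
        case (elim x)
        show ?case
        proof
          assume x: "x \<in> W"
          obtain s where s: "(\<Sum>n. f n x) = ennreal s" "s \<ge> 0" using elim by (cases "\<Sum>n. f n x") auto
          have "norm (v (Suc m) x - v m x) \<le> sqrt s * (1 / 2) ^ m" if m: "m \<ge> N" for m
          proof -
            have "f (m - N) x \<le> ennreal s"
              unfolding s(1)[symmetric] using sum_le_suminf[of "\<lambda>n. f n x" "{m - N}"] by (simp add: summableI)
            then have "ennreal (4 ^ m * (cmod (v m x - v (Suc m) x))\<^sup>2) \<le> ennreal s"
              using x m by (simp add: f_def ennreal_mult)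
            then have "4 ^ m * (cmod (v m x - v (Suc m) x))\<^sup>2 \<le> s" using s(2) by (simp only: ennreal_le_iff)
            then have "(2 ^ m * cmod (v m x - v (Suc m) x))\<^sup>2 \<le> s"
              by (simp add: power_mult_distrib power_even_eq[symmetric] power_mult[symmetric] mult.commute[of m 2] power_mult)
            then have "2 ^ m * cmod (v m x - v (Suc m) x) \<le> sqrt s" by (rule real_le_rsqrt)
            then show ?thesis by (simp add: norm_minus_commute power_divide field_simps)
          qed
          then show "convergent (\<lambda>n. v n x)" by (rule convergent_geometric_increments)
        qed
      qed
    qed
    have fatou: "(\<integral>\<^sup>+x\<in>W. ennreal ((cmod (v n x - T x))\<^sup>2) \<partial>\<sigma>) \<le> ennreal (2 * A * (1 / 16) ^ n)" if n: "n \<ge> N" for n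
    proof -
      have "(\<integral>\<^sup>+x\<in>W. ennreal ((cmod (v n x - T x))\<^sup>2) \<partial>\<sigma>) \<le>
         (\<integral>\<^sup>+x. liminf (\<lambda>j. ennreal ((cmod (v n x - v j x))\<^sup>2) * indicator W x) \<partial>\<sigma>)"
      proof (rule nn_integral_mono_AE)
        show "AE x in \<sigma>. ennreal ((cmod (v n x - T x))\<^sup>2) * indicator W x \<le> liminf (\<lambda>j. ennreal ((cmod (v n x - v j x))\<^sup>2) * indicator W x)"
          using conv
        proof eventually_elim
          case (elim x)
          show ?case
          proof (cases "x \<in> W")
            case True
            then have "(\<lambda>j. v j x) \<longlonglongrightarrow> T x" using elim by (simp add: T_def convergent_LIMSEQ_iff)
            then have "(\<lambda>j. ennreal ((cmod (v n x - v j x))\<^sup>2)) \<longlonglongrightarrow> ennreal ((cmod (v n x - T x))\<^sup>2)"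
              by (intro tendsto_ennrealI tendsto_power tendsto_norm tendsto_diff tendsto_const)
            from lim_imp_Liminf[OF sequentially_bot this] show ?thesis using True by simp
          qed simp
        qed
      qed
      also have "\<dots> \<le> liminf (\<lambda>j. \<integral>\<^sup>+x. ennreal ((cmod (v n x - v j x))\<^sup>2) * indicator W x \<partial>\<sigma>)"
        by (rule nn_integral_liminf) measurable
      also have "\<dots> \<le> limsup (\<lambda>j. \<integral>\<^sup>+x. ennreal ((cmod (v n x - v j x))\<^sup>2) * indicator W x \<partial>\<sigma>)"
        by (rule Liminf_le_Limsup) simp
      also have "\<dots> \<le> ennreal (2 * A * (1 / 16) ^ n)"
        by (rule Limsup_bounded) (use d[OF n] in \<open>auto intro: eventually_sequentiallyI[of n]\<close>)
      finally show ?thesis .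
    qed
    have g0: "(\<lambda>n. ennreal ((1 / 16) ^ n)) \<longlonglongrightarrow> 0"
      using tendsto_ennrealI[OF LIMSEQ_realpow_zero[of "1 / 16"]] by simp
    have "(\<lambda>k. ennreal ((H1_norm W (\<lambda>x. v (k + N) x - u x))\<^sup>2)) \<longlonglongrightarrow> 0"
    proof (rule tendsto_zero_bound[OF LIMSEQ_ignore_initial_segment[OF g0, of N]])
      fix k
      have "W \<subseteq> C (k + N)" using N[of "k + N"] S(2) by auto
      then have "ennreal ((H1_norm W (\<lambda>x. v (k + N) x - u x))\<^sup>2) \<le> ennreal (c * (1 / 16) ^ (k + N))"
        unfolding H1_norm_diff_eq[OF W(1) W\<Omega> r cv] using v[of "k + N"] unfolding good_def by blast
      then show "ennreal ((H1_norm W (\<lambda>x. v (k + N) x - u x))\<^sup>2) \<le> ennreal c * ennreal ((1 / 16) ^ (k + N))"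
        using c0 by (simp add: ennreal_mult)
    qed
    then have "(\<lambda>k. H1_norm W (\<lambda>x. v (k + N) x - u x)) \<longlonglongrightarrow> 0"
      using H1_norm_tendsto_iff[of W "\<lambda>k x. v (k + N) x - u x"] by blast
    from LIMSEQ_offset[OF this] have "(\<lambda>k. H1_norm W (\<lambda>x. v k x - u x)) \<longlonglongrightarrow> 0" .
    moreover have "(\<lambda>k. \<integral>\<^sup>+x\<in>W. ennreal ((cmod (v (k + N) x - T x))\<^sup>2) \<partial>\<sigma>) \<longlonglongrightarrow> 0"
    proof (rule tendsto_zero_bound[OF LIMSEQ_ignore_initial_segment[OF g0, of N]])
      show "(\<integral>\<^sup>+x\<in>W. ennreal ((cmod (v (k + N) x - T x))\<^sup>2) \<partial>\<sigma>) \<le> ennreal (2 * A) * ennreal ((1 / 16) ^ (k + N))" for k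
        using fatou[of "k + N"] A0 by (simp add: ennreal_mult)
    qed
    from LIMSEQ_offset[OF this] have "(\<lambda>k. \<integral>\<^sup>+x\<in>W. ennreal ((cmod (v k x - T x))\<^sup>2) \<partial>\<sigma>) \<longlonglongrightarrow> 0" .
    ultimately show ?thesis by blast
  qed
  show ?thesis
    unfolding is_trace_def
  proof (intro exI[of _ T] exI[of _ v] conjI allI impI)
    show "T \<in> borel_measurable borel" by simp
    show "v k \<in> test_functions UNIV" for k using cv by (simp add: test_functions_UNIV)
  qed (use main in blast)+
qed

lemma H1_rep_measurable:
  assumes "H1_rep W u u0 w"
  shows "u0 \<in> borel_measurable borel" "w i \<in> borel_measurable borel"
proof -
  have "rep W u u0" "rep W (weak_partial W i u) (w i)" using assms by (simp_all add: H1_rep_def)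
  then show "u0 \<in> borel_measurable borel" "w i \<in> borel_measurable borel" by (auto dest: rep_measurable)
qed

lemma sq_norm_combination_le:
  fixes a b :: "'a::euclidean_space \<Rightarrow> complex"
  assumes [measurable]: "a \<in> borel_measurable borel" "b \<in> borel_measurable borel" "W \<in> sets borel"
    "e \<in> borel_measurable borel" "d \<in> borel_measurable borel"
    and ed: "\<And>x. \<bar>e x\<bar> \<le> 1" "\<And>x. \<bar>d x\<bar> \<le> L"
  shows "sq_norm (\<lambda>x. indicator W x *\<^sub>R (e x *\<^sub>R a x + d x *\<^sub>R b x)) \<le>
    2 * sq_norm (\<lambda>x. indicator W x *\<^sub>R a x) + 2 * ennreal (L\<^sup>2) * sq_norm (\<lambda>x. indicator W x *\<^sub>R b x)"
proof -
  have "sq_norm (\<lambda>x. indicator W x *\<^sub>R (e x *\<^sub>R a x + d x *\<^sub>R b x)) =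
    sq_norm (\<lambda>x. e x *\<^sub>R (indicator W x *\<^sub>R a x) + d x *\<^sub>R (indicator W x *\<^sub>R b x))"
    by (simp add: scaleR_add_right mult.commute)
  also have "\<dots> \<le> 2 * sq_norm (\<lambda>x. e x *\<^sub>R (indicator W x *\<^sub>R a x)) + 2 * sq_norm (\<lambda>x. d x *\<^sub>R (indicator W x *\<^sub>R b x))"
    by (rule sq_norm_add_le) measurable
  also have "\<dots> \<le> 2 * (ennreal (1\<^sup>2) * sq_norm (\<lambda>x. indicator W x *\<^sub>R a x)) + 2 * (ennreal (L\<^sup>2) * sq_norm (\<lambda>x. indicator W x *\<^sub>R b x))"
    using ed by (intro add_mono mult_left_mono sq_norm_scaleR_le) auto
  finally show ?thesis by (simp add: mult.assoc)
qed

section \<open>Traces of cut-off functions\<close>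

text \<open>Multiplying and conjugating the approximants of u gives approximants of the new
  function. This identifies the trace of the test function in terms of the trace of u.\<close>

lemma is_trace_mult_cnj:
  fixes \<Omega> :: "(real ^ 'n) set"
  assumes \<sigma>[measurable_cong]: "sets \<sigma> = sets borel" and \<Omega>: "open \<Omega>" and r: "H1_rep \<Omega> u u0 w"
    and e: "cc_smooth (e :: real ^ 'n \<Rightarrow> real)" "\<And>x. \<bar>e x\<bar> \<le> 1" and T: "is_trace \<Omega> \<sigma> u T"
  shows "is_trace \<Omega> \<sigma> (\<lambda>x. e x *\<^sub>R cnj (u x)) (\<lambda>x. e x *\<^sub>R cnj (T x))"
proof -
  obtain v where v: "\<And>k::nat. v k \<in> test_functions UNIV" "\<And>W. open W \<Longrightarrow> bounded W \<Longrightarrow> closure W \<subseteq> \<Omega> \<Longrightarrow>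
      (\<lambda>k. H1_norm W (\<lambda>x. v k x - u x)) \<longlonglongrightarrow> 0 \<and> (\<lambda>k. \<integral>\<^sup>+x\<in>W. ennreal ((cmod (v k x - T x))\<^sup>2) \<partial>\<sigma>) \<longlonglongrightarrow> 0"
    using T unfolding is_trace_def by blast
  have cv: "cc_smooth (v k)" for k using v(1) by (simp add: test_functions_UNIV)
  have cc: "cc_smooth (\<lambda>x. cnj (v k x))" for k by (rule cc_smooth_linear_compose[OF bounded_linear_cnj cv])
  have cev: "cc_smooth (\<lambda>x. e x *\<^sub>R cnj (v k x))" for k
    by (rule cc_smooth_bilinear1[OF bounded_bilinear_scaleR e(1) cc_smooth_smooth[OF cc]])
  obtain L where L: "L > 0" "\<And>x v. norm (frechet_derivative e (at x) v) \<le> L * norm v"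
    using cc_smooth_derivative_bounded[OF e(1)] by blast
  have [measurable]: "T \<in> borel_measurable borel" "e \<in> borel_measurable borel"
    "u0 \<in> borel_measurable borel" "w i \<in> borel_measurable borel" "v k \<in> borel_measurable borel"
    "partial i (v k) \<in> borel_measurable borel"
    "(\<lambda>x. frechet_derivative e (at x) (axis i 1)) \<in> borel_measurable borel" for i k
    using T H1_rep_measurable[OF r] cc_smooth_measurable[OF e(1)] cc_smooth_measurable[OF cc_smooth_derivative[OF e(1)]]
      cc_smooth_measurable[OF cv] cc_smooth_measurable[OF partial_cc_smooth[OF cv]]
    by (simp_all add: is_trace_def)
  note rm = H1_rep_mult(2)[OF \<Omega> H1_rep_cnj[OF \<Omega> r] e(1)]
  define B where "B = 1 + (2 + 2 * L\<^sup>2) * real CARD('n)"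
  have B0: "B \<ge> 0" by (simp add: B_def)
  have "(\<lambda>k. H1_norm W (\<lambda>x. e x *\<^sub>R cnj (v k x) - e x *\<^sub>R cnj (u x))) \<longlonglongrightarrow> 0 \<and>
     (\<lambda>k. \<integral>\<^sup>+x\<in>W. ennreal ((cmod (e x *\<^sub>R cnj (v k x) - e x *\<^sub>R cnj (T x)))\<^sup>2) \<partial>\<sigma>) \<longlonglongrightarrow> 0"
    if W: "open W" "bounded W" "closure W \<subseteq> \<Omega>" for W
  proof
    have [measurable]: "W \<in> sets borel" using W by simp
    have W\<Omega>: "W \<subseteq> \<Omega>" using W(3) closure_subset by blast
    have "(\<lambda>k. ennreal ((H1_norm W (\<lambda>x. e x *\<^sub>R cnj (v k x) - e x *\<^sub>R cnj (u x)))\<^sup>2)) \<longlonglongrightarrow> 0"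
    proof (rule tendsto_zero_bound)
      show "(\<lambda>k. ennreal ((H1_norm W (\<lambda>x. v k x - u x))\<^sup>2)) \<longlonglongrightarrow> 0"
        using v(2)[OF W] H1_norm_tendsto_iff[of W "\<lambda>k x. v k x - u x"] by blast
      fix k
      define a where "a = sq_norm (\<lambda>x. indicator W x *\<^sub>R (v k x - u0 x))"
      define b where "b i = sq_norm (\<lambda>x. indicator W x *\<^sub>R (partial i (v k) x - w i x))" for i
      have cn: "sq_norm (\<lambda>x. indicator W x *\<^sub>R cnj (f x)) = sq_norm (\<lambda>x. indicator W x *\<^sub>R f x)" for f
        by (simp add: sq_norm_def)
      have 1: "sq_norm (\<lambda>x. indicator W x *\<^sub>R (e x *\<^sub>R cnj (v k x) - e x *\<^sub>R cnj (u0 x))) \<le> a"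
        unfolding a_def
      proof (rule sq_norm_mono)
        fix x
        have "cmod (e x *\<^sub>R cnj (v k x) - e x *\<^sub>R cnj (u0 x)) = \<bar>e x\<bar> * cmod (v k x - u0 x)"
          by (simp flip: scaleR_diff_right complex_cnj_diff)
        also have "\<dots> \<le> cmod (v k x - u0 x)" using e(2)[of x] by (simp add: mult_left_le_one_le)
        finally show "cmod (indicator W x *\<^sub>R (e x *\<^sub>R cnj (v k x) - e x *\<^sub>R cnj (u0 x))) \<le> cmod (indicator W x *\<^sub>R (v k x - u0 x))"
          by (simp add: mult_left_mono)
      qed
      have 2: "sq_norm (\<lambda>x. indicator W x *\<^sub>R (partial i (\<lambda>x. e x *\<^sub>R cnj (v k x)) x
          - (e x *\<^sub>R cnj (w i x) + frechet_derivative e (at x) (axis i 1) *\<^sub>R cnj (u0 x)))) \<le> 2 * b i + 2 * ennreal (L\<^sup>2) * a" for i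
      proof -
        have "partial i (\<lambda>x. e x *\<^sub>R cnj (v k x)) x - (e x *\<^sub>R cnj (w i x) + frechet_derivative e (at x) (axis i 1) *\<^sub>R cnj (u0 x))
          = e x *\<^sub>R cnj (partial i (v k) x - w i x) + frechet_derivative e (at x) (axis i 1) *\<^sub>R cnj (v k x - u0 x)" for x
          unfolding partial_scaleR[OF cc_smooth_smooth[OF e(1)] cc_smooth_smooth[OF cc]] partial_cnj[OF cc_smooth_smooth[OF cv]]
          by (simp add: algebra_simps)
        then have "sq_norm (\<lambda>x. indicator W x *\<^sub>R (partial i (\<lambda>x. e x *\<^sub>R cnj (v k x)) x
          - (e x *\<^sub>R cnj (w i x) + frechet_derivative e (at x) (axis i 1) *\<^sub>R cnj (u0 x)))) =
          sq_norm (\<lambda>x. indicator W x *\<^sub>R (e x *\<^sub>R cnj (partial i (v k) x - w i x) + frechet_derivative e (at x) (axis i 1) *\<^sub>R cnj (v k x - u0 x)))"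
          by (simp only:)
        also have "\<dots> \<le> 2 * sq_norm (\<lambda>x. indicator W x *\<^sub>R cnj (partial i (v k) x - w i x)) + 2 * ennreal (L\<^sup>2) * sq_norm (\<lambda>x. indicator W x *\<^sub>R cnj (v k x - u0 x))"
          by (rule sq_norm_combination_le) (use e(2) L(2)[of _ "axis i 1"] in auto)
        finally show ?thesis unfolding cn a_def b_def .
      qed
      have "ennreal ((H1_norm W (\<lambda>x. e x *\<^sub>R cnj (v k x) - e x *\<^sub>R cnj (u x)))\<^sup>2) \<le> a + (\<Sum>i\<in>UNIV. 2 * b i + 2 * ennreal (L\<^sup>2) * a)"
        unfolding H1_norm_diff_eq[OF W(1) W\<Omega> rm cev] by (intro add_mono sum_mono 1 2)
      also have "\<dots> \<le> ennreal B * (a + (\<Sum>i\<in>UNIV. b i))"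
      proof -
        have "a + (\<Sum>i\<in>UNIV. 2 * b i + 2 * ennreal (L\<^sup>2) * a) = ennreal 2 * (\<Sum>i\<in>UNIV. b i) + ennreal (1 + 2 * L\<^sup>2 * real CARD('n)) * a"
        proof -
          have "(\<Sum>i\<in>UNIV. 2 * b i + 2 * ennreal (L\<^sup>2) * a) = 2 * (\<Sum>i\<in>UNIV. b i) + of_nat CARD('n) * (2 * ennreal (L\<^sup>2) * a)"
            by (simp add: sum.distrib sum_distrib_left[symmetric])
          moreover have "ennreal (1 + 2 * L\<^sup>2 * real CARD('n)) = 1 + 2 * ennreal (L\<^sup>2) * of_nat CARD('n)"
            by (simp add: ennreal_mult ennreal_of_nat_eq_real_of_nat)
          ultimately show ?thesis by (simp add: distrib_left distrib_right ac_simps)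
        qed
        also have "\<dots> \<le> ennreal B * (\<Sum>i\<in>UNIV. b i) + ennreal B * a"
        proof (intro add_mono mult_right_mono ennreal_leI)
          have "1 \<le> real CARD('n)" by (simp add: Suc_leI)
          moreover have "0 \<le> L\<^sup>2 * real CARD('n)" by simp
          moreover have "B = 1 + 2 * real CARD('n) + 2 * (L\<^sup>2 * real CARD('n))" by (simp add: B_def algebra_simps)
          moreover have "2 * L\<^sup>2 * real CARD('n) = 2 * (L\<^sup>2 * real CARD('n))" by simp
          ultimately show "2 \<le> B" "1 + 2 * L\<^sup>2 * real CARD('n) \<le> B" by linarith+
        qed auto
        finally show ?thesis by (simp add: distrib_left add.commute)
      qed
      finally show "ennreal ((H1_norm W (\<lambda>x. e x *\<^sub>R cnj (v k x) - e x *\<^sub>R cnj (u x)))\<^sup>2) \<le> ennreal B * ennreal ((H1_norm W (\<lambda>x. v k x - u x))\<^sup>2)"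
        unfolding H1_norm_diff_eq[OF W(1) W\<Omega> r cv] a_def b_def .
    qed
    then show "(\<lambda>k. H1_norm W (\<lambda>x. e x *\<^sub>R cnj (v k x) - e x *\<^sub>R cnj (u x))) \<longlonglongrightarrow> 0"
      using H1_norm_tendsto_iff[of W "\<lambda>k x. e x *\<^sub>R cnj (v k x) - e x *\<^sub>R cnj (u x)"] by blast
    show "(\<lambda>k. \<integral>\<^sup>+x\<in>W. ennreal ((cmod (e x *\<^sub>R cnj (v k x) - e x *\<^sub>R cnj (T x)))\<^sup>2) \<partial>\<sigma>) \<longlonglongrightarrow> 0"
    proof (rule tendsto_zero_bound[OF conjunct2[OF v(2)[OF W]]])
      fix k
      have "(cmod (e x *\<^sub>R cnj (v k x) - e x *\<^sub>R cnj (T x)))\<^sup>2 \<le> (cmod (v k x - T x))\<^sup>2" for x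
      proof (rule power_mono)
        have "cmod (e x *\<^sub>R cnj (v k x) - e x *\<^sub>R cnj (T x)) = \<bar>e x\<bar> * cmod (v k x - T x)"
          by (simp flip: scaleR_diff_right complex_cnj_diff)
        also have "\<dots> \<le> cmod (v k x - T x)" using e(2)[of x] by (simp add: mult_left_le_one_le)
        finally show "cmod (e x *\<^sub>R cnj (v k x) - e x *\<^sub>R cnj (T x)) \<le> cmod (v k x - T x)" .
      qed simp
      then have "(\<integral>\<^sup>+x\<in>W. ennreal ((cmod (e x *\<^sub>R cnj (v k x) - e x *\<^sub>R cnj (T x)))\<^sup>2) \<partial>\<sigma>) \<le> (\<integral>\<^sup>+x\<in>W. ennreal ((cmod (v k x - T x))\<^sup>2) \<partial>\<sigma>)"
        by (intro nn_integral_mono mult_right_mono ennreal_leI) auto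
      then show "(\<integral>\<^sup>+x\<in>W. ennreal ((cmod (e x *\<^sub>R cnj (v k x) - e x *\<^sub>R cnj (T x)))\<^sup>2) \<partial>\<sigma>) \<le> ennreal 1 * (\<integral>\<^sup>+x\<in>W. ennreal ((cmod (v k x - T x))\<^sup>2) \<partial>\<sigma>)"
        by simp
    qed
  qed
  moreover have "(\<lambda>x. e x *\<^sub>R cnj (T x)) \<in> borel_measurable borel" by measurable
  ultimately show ?thesis
    unfolding is_trace_def using cev by (auto simp: test_functions_UNIV intro!: exI[of _ "\<lambda>k x. e x *\<^sub>R cnj (v k x)"])
qed

text \<open>Apply the smooth bound to e v_k, with v_k the approximants in the definition of the
  trace, and let k tend to infinity. The factor 4 is one 2 for replacing the trace by v_k on the
  surface and one 2 for returning from v_k to u in the energy.\<close>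

lemma trace_form_bound:
  fixes \<Omega> :: "(real ^ 'n) set"
  assumes \<epsilon>: "\<epsilon> \<ge> 0" "C \<ge> 0" "\<And>u. cc_smooth u \<Longrightarrow> (\<integral>\<^sup>+x. ennreal ((cmod (u x))\<^sup>2) \<partial>\<sigma>) \<le>
      ennreal \<epsilon> * (\<Sum>i\<in>UNIV. sq_norm (partial i u)) + ennreal C * sq_norm u"
    and \<sigma>[measurable_cong]: "sets \<sigma> = sets borel" and \<Omega>: "open \<Omega>" and r: "H1_rep \<Omega> u u0 w"
    and e: "cc_smooth (e :: real ^ 'n \<Rightarrow> real)" "\<And>x. \<bar>e x\<bar> \<le> 1" "closure {x. e x \<noteq> 0} \<subseteq> \<Omega>" and T: "is_trace \<Omega> \<sigma> u T"
  shows "(\<integral>\<^sup>+x. ennreal ((cmod (e x *\<^sub>R T x))\<^sup>2) \<partial>\<sigma>) \<le>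
    ennreal (4 * \<epsilon>) * (\<Sum>i\<in>UNIV. sq_norm (\<lambda>x. e x *\<^sub>R w i x + frechet_derivative e (at x) (axis i 1) *\<^sub>R u0 x))
      + ennreal (4 * C) * sq_norm (\<lambda>x. e x *\<^sub>R u0 x)"
proof -
  let ?G = "\<lambda>i x. e x *\<^sub>R w i x + frechet_derivative e (at x) (axis i 1) *\<^sub>R u0 x"
  have "compact (closure {x. e x \<noteq> 0})" using e(1) by (simp add: cc_smooth_def)
  then obtain W where W: "open W" "bounded W" "closure {x. e x \<noteq> 0} \<subseteq> W" "closure W \<subseteq> \<Omega>"
    using compact_open_neighbourhood[OF _ \<Omega> e(3)] by blast
  have W\<Omega>: "W \<subseteq> \<Omega>" using W(4) closure_subset by blast
  obtain v where v: "\<And>k::nat. v k \<in> test_functions UNIV" "\<And>W. open W \<Longrightarrow> bounded W \<Longrightarrow> closure W \<subseteq> \<Omega> \<Longrightarrow>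
      (\<lambda>k. H1_norm W (\<lambda>x. v k x - u x)) \<longlonglongrightarrow> 0 \<and> (\<lambda>k. \<integral>\<^sup>+x\<in>W. ennreal ((cmod (v k x - T x))\<^sup>2) \<partial>\<sigma>) \<longlonglongrightarrow> 0"
    using T unfolding is_trace_def by blast
  have cv: "cc_smooth (v k)" for k using v(1) by (simp add: test_functions_UNIV)
  have cev: "cc_smooth (\<lambda>x. e x *\<^sub>R v k x)" for k
    by (rule cc_smooth_bilinear1[OF bounded_bilinear_scaleR e(1) cc_smooth_smooth[OF cv]])
  obtain L where L: "L > 0" "\<And>x v. norm (frechet_derivative e (at x) v) \<le> L * norm v"
    using cc_smooth_derivative_bounded[OF e(1)] by blast
  have [measurable]: "T \<in> borel_measurable borel" "e \<in> borel_measurable borel"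
    "u0 \<in> borel_measurable borel" "w i \<in> borel_measurable borel" "v k \<in> borel_measurable borel"
    "partial i (v k) \<in> borel_measurable borel"
    "(\<lambda>x. frechet_derivative e (at x) (axis i 1)) \<in> borel_measurable borel" for i k
    using T H1_rep_measurable[OF r] cc_smooth_measurable[OF e(1)] cc_smooth_measurable[OF cc_smooth_derivative[OF e(1)]]
      cc_smooth_measurable[OF cv] cc_smooth_measurable[OF partial_cc_smooth[OF cv]]
    by (simp_all add: is_trace_def)
  have [measurable]: "W \<in> sets borel" using W by simp
  have eW: "e x = 0" "frechet_derivative e (at x) y = 0" if "x \<notin> W" for x y
    using that W(3) closure_subset[of "{x. e x \<noteq> 0}"] frechet_derivative_outside_support[of x e y] by auto
  define a where "a k = (\<integral>\<^sup>+x\<in>W. ennreal ((cmod (v k x - T x))\<^sup>2) \<partial>\<sigma>)" for k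
  define h where "h k = ennreal ((H1_norm W (\<lambda>x. v k x - u x))\<^sup>2)" for k
  have a0: "a \<longlonglongrightarrow> 0" and h0: "h \<longlonglongrightarrow> 0"
    unfolding a_def h_def using v(2)[OF W(1,2,4)] H1_norm_tendsto_iff[of W "\<lambda>k x. v k x - u x"] by blast+
  have hk: "sq_norm (\<lambda>x. indicator W x *\<^sub>R (v k x - u0 x)) \<le> h k" "sq_norm (\<lambda>x. indicator W x *\<^sub>R (partial i (v k) x - w i x)) \<le> h k" for i k
  proof -
    have h: "h k = sq_norm (\<lambda>x. indicator W x *\<^sub>R (v k x - u0 x)) + (\<Sum>i\<in>UNIV. sq_norm (\<lambda>x. indicator W x *\<^sub>R (partial i (v k) x - w i x)))"
      unfolding h_def by (rule H1_norm_diff_eq[OF W(1) W\<Omega> r cv])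
    show "sq_norm (\<lambda>x. indicator W x *\<^sub>R (v k x - u0 x)) \<le> h k" unfolding h by simp
    have "sq_norm (\<lambda>x. indicator W x *\<^sub>R (partial i (v k) x - w i x)) \<le> (\<Sum>i\<in>UNIV. sq_norm (\<lambda>x. indicator W x *\<^sub>R (partial i (v k) x - w i x)))"
      by (rule member_le_sum) auto
    then show "sq_norm (\<lambda>x. indicator W x *\<^sub>R (partial i (v k) x - w i x)) \<le> h k" unfolding h by (rule add_increasing[rotated]) simp
  qed
  have s0: "sq_norm (\<lambda>x. e x *\<^sub>R v k x) \<le> 2 * sq_norm (\<lambda>x. e x *\<^sub>R u0 x) + 2 * h k" for k
  proof -
    have "sq_norm (\<lambda>x. e x *\<^sub>R v k x) = sq_norm (\<lambda>x. e x *\<^sub>R u0 x + e x *\<^sub>R (v k x - u0 x))"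
      by (simp add: scaleR_diff_right)
    also have "\<dots> \<le> 2 * sq_norm (\<lambda>x. e x *\<^sub>R u0 x) + 2 * sq_norm (\<lambda>x. e x *\<^sub>R (v k x - u0 x))"
      by (rule sq_norm_add_le) measurable
    also have "sq_norm (\<lambda>x. e x *\<^sub>R (v k x - u0 x)) \<le> sq_norm (\<lambda>x. indicator W x *\<^sub>R (v k x - u0 x))"
      using e(2) eW(1) by (intro sq_norm_mono) (auto simp: indicator_def mult_left_le_one_le)
    also note hk(1)
    finally show ?thesis by (simp add: add_left_mono mult_left_mono)
  qed
  have si: "sq_norm (partial i (\<lambda>x. e x *\<^sub>R v k x)) \<le> 2 * sq_norm (?G i) + 2 * (2 * h k + 2 * ennreal (L\<^sup>2) * h k)" for i k
  proof -
    have "partial i (\<lambda>x. e x *\<^sub>R v k x) x = ?G i x + indicator W x *\<^sub>R (e x *\<^sub>R (partial i (v k) x - w i x)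
       + frechet_derivative e (at x) (axis i 1) *\<^sub>R (v k x - u0 x))" for x
      unfolding partial_scaleR[OF cc_smooth_smooth[OF e(1)] cc_smooth_smooth[OF cv]]
      using eW[of x] by (cases "x \<in> W") (simp_all add: algebra_simps)
    then have "sq_norm (partial i (\<lambda>x. e x *\<^sub>R v k x)) = sq_norm (\<lambda>x. ?G i x + indicator W x *\<^sub>R (e x *\<^sub>R (partial i (v k) x - w i x)
       + frechet_derivative e (at x) (axis i 1) *\<^sub>R (v k x - u0 x)))"
      unfolding sq_norm_def by (simp only:)
    also have "\<dots> \<le> 2 * sq_norm (?G i) + 2 * sq_norm (\<lambda>x. indicator W x *\<^sub>R (e x *\<^sub>R (partial i (v k) x - w i x)
       + frechet_derivative e (at x) (axis i 1) *\<^sub>R (v k x - u0 x)))"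
      by (rule sq_norm_add_le) measurable
    also have "\<dots> \<le> 2 * sq_norm (?G i) + 2 * (2 * sq_norm (\<lambda>x. indicator W x *\<^sub>R (partial i (v k) x - w i x))
        + 2 * ennreal (L\<^sup>2) * sq_norm (\<lambda>x. indicator W x *\<^sub>R (v k x - u0 x)))"
      by (intro add_left_mono mult_left_mono sq_norm_combination_le) (use e(2) L(2)[of _ "axis i 1"] in auto)
    also have "\<dots> \<le> 2 * sq_norm (?G i) + 2 * (2 * h k + 2 * ennreal (L\<^sup>2) * h k)"
      by (intro add_mono mult_left_mono hk order_refl) auto
    finally show ?thesis .
  qed
  let ?R = "ennreal (4 * \<epsilon>) * (\<Sum>i\<in>UNIV. sq_norm (?G i)) + ennreal (4 * C) * sq_norm (\<lambda>x. e x *\<^sub>R u0 x)"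
  define B where "B = 8 * \<epsilon> * real CARD('n) * (1 + L\<^sup>2) + 4 * C"
  have est: "(\<integral>\<^sup>+x. ennreal ((cmod (e x *\<^sub>R T x))\<^sup>2) \<partial>\<sigma>) \<le> ?R + (2 * a k + ennreal B * h k)" for k
  proof -
    have "(\<integral>\<^sup>+x. ennreal ((cmod (e x *\<^sub>R T x))\<^sup>2) \<partial>\<sigma>) \<le>
       (\<integral>\<^sup>+x. 2 * (ennreal ((cmod (v k x - T x))\<^sup>2) * indicator W x) + 2 * ennreal ((cmod (e x *\<^sub>R v k x))\<^sup>2) \<partial>\<sigma>)"
    proof (rule nn_integral_mono)
      fix x
      have "cmod (e x *\<^sub>R (T x - v k x)) \<le> indicator W x * cmod (v k x - T x)"
        using e(2)[of x] eW(1)[of x] by (cases "x \<in> W") (auto simp: mult_left_le_one_le norm_minus_commute)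
      then have "(cmod (e x *\<^sub>R (T x - v k x)))\<^sup>2 \<le> (indicator W x * cmod (v k x - T x))\<^sup>2" by (rule power_mono) simp
      moreover have "(cmod (e x *\<^sub>R T x))\<^sup>2 \<le> 2 * (cmod (e x *\<^sub>R (T x - v k x)))\<^sup>2 + 2 * (cmod (e x *\<^sub>R v k x))\<^sup>2"
        using cmod_add_squared_le[of "e x *\<^sub>R (T x - v k x)" "e x *\<^sub>R v k x"] by (simp only: scaleR_diff_right diff_add_cancel)
      ultimately have "ennreal ((cmod (e x *\<^sub>R T x))\<^sup>2) \<le> ennreal (2 * (indicator W x * cmod (v k x - T x))\<^sup>2 + 2 * (cmod (e x *\<^sub>R v k x))\<^sup>2)"
        by (intro ennreal_leI) linarith
      also have "\<dots> = 2 * (ennreal ((cmod (v k x - T x))\<^sup>2) * indicator W x) + 2 * ennreal ((cmod (e x *\<^sub>R v k x))\<^sup>2)"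
        by (cases "x \<in> W") (simp_all add: ennreal_mult)
      finally show "ennreal ((cmod (e x *\<^sub>R T x))\<^sup>2) \<le> 2 * (ennreal ((cmod (v k x - T x))\<^sup>2) * indicator W x) + 2 * ennreal ((cmod (e x *\<^sub>R v k x))\<^sup>2)" .
    qed
    also have "\<dots> = 2 * a k + 2 * (\<integral>\<^sup>+x. ennreal ((cmod (e x *\<^sub>R v k x))\<^sup>2) \<partial>\<sigma>)"
      unfolding a_def by (subst nn_integral_add) (measurable, simp add: nn_integral_cmult)
    also have "\<dots> \<le> 2 * a k + 2 * (ennreal \<epsilon> * (\<Sum>i\<in>UNIV. 2 * sq_norm (?G i) + 2 * (2 * h k + 2 * ennreal (L\<^sup>2) * h k))
        + ennreal C * (2 * sq_norm (\<lambda>x. e x *\<^sub>R u0 x) + 2 * h k))"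
      by (intro add_left_mono mult_left_mono order_trans[OF \<epsilon>(3)[OF cev]] add_mono sum_mono si s0) auto
    also have "\<dots> = ?R + (2 * a k + ennreal B * h k)"
    proof -
      have "ennreal B = 8 * ennreal \<epsilon> * of_nat CARD('n) * (1 + ennreal (L\<^sup>2)) + 4 * ennreal C"
        using \<epsilon>(1,2) by (simp add: B_def ennreal_mult ennreal_of_nat_eq_real_of_nat)
      moreover have "ennreal (4 * \<epsilon>) = 4 * ennreal \<epsilon>" "ennreal (4 * C) = 4 * ennreal C" using \<epsilon>(1,2) by (simp_all add: ennreal_mult)
      moreover have "(\<Sum>i\<in>(UNIV::'n set). 2 * sq_norm (?G i) + 2 * (2 * h k + 2 * ennreal (L\<^sup>2) * h k)) =
          2 * (\<Sum>i\<in>UNIV. sq_norm (?G i)) + of_nat CARD('n) * (4 * ((1 + ennreal (L\<^sup>2)) * h k))"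
      proof -
        have "(\<Sum>i\<in>(UNIV::'n set). 2 * sq_norm (?G i) + 2 * (2 * h k + 2 * ennreal (L\<^sup>2) * h k)) =
          2 * (\<Sum>i\<in>UNIV. sq_norm (?G i)) + of_nat CARD('n) * (2 * (2 * h k + 2 * ennreal (L\<^sup>2) * h k))"
          by (simp add: sum.distrib sum_distrib_left[symmetric])
        moreover have "2 * (2 * h k + 2 * ennreal (L\<^sup>2) * h k) = 4 * ((1 + ennreal (L\<^sup>2)) * h k)"
          by (simp add: distrib_left distrib_right mult.assoc[symmetric])
        ultimately show ?thesis by (simp only:)
      qed
      ultimately show ?thesis by (simp add: distrib_left distrib_right ac_simps)
    qed
    finally show ?thesis .
  qed
  have "(\<lambda>k. ?R + (2 * a k + ennreal B * h k)) \<longlonglongrightarrow> ?R + (2 * 0 + ennreal B * 0)"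
    by (intro tendsto_add tendsto_const ennreal_tendsto_cmult a0 h0) auto
  then have "(\<lambda>k. ?R + (2 * a k + ennreal B * h k)) \<longlonglongrightarrow> ?R" by simp
  from LIMSEQ_le_const[OF this] est show ?thesis by blast
qed


section \<open>Form bounds for localized functions\<close>

lemma ennreal_norm_integral_le:
  fixes f :: "'a \<Rightarrow> 'b::{banach, second_countable_topology}"
  shows "ennreal (norm (integral\<^sup>L M f)) \<le> (\<integral>\<^sup>+x. ennreal (norm (f x)) \<partial>M)"
  by (cases "integrable M f") (auto intro: integral_norm_bound_ennreal simp: not_integrable_integral_eq)

lemma AE_lborel_translate:
  assumes "AE x in lborel. P (x :: 'a::euclidean_space)"
  shows "AE x in lborel. P (x + y)"
proof -
  obtain N where N: "N \<in> null_sets lborel" "\<And>x. x \<notin> N \<Longrightarrow> P x"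
    by (rule AE_E3[OF assms], rule that) auto
  have "{x. x - (- y) \<in> N} \<in> null_sets lborel" by (rule null_sets_translation[OF N(1)])
  then show ?thesis by (rule AE_I') (use N(2) in fastforce)
qed

text \<open>Fatou's lemma needs pointwise convergence, which convergence in L^2 provides along a
  subsequence.\<close>

lemma sq_norm_tendsto_AE_subseq:
  fixes f :: "'a::euclidean_space \<Rightarrow> complex"
  assumes i: "\<And>k. integrable lborel (\<lambda>x. (cmod (\<psi> k x - f x))\<^sup>2)"
    and lim: "(\<lambda>k::nat. sq_norm (\<lambda>x. \<psi> k x - f x)) \<longlonglongrightarrow> 0"
  obtains r where "strict_mono r" "AE x in lborel. (\<lambda>k. \<psi> (r k) x) \<longlonglongrightarrow> f x"
proof -
  have eq: "sq_norm (\<lambda>x. \<psi> k x - f x) = ennreal (LINT x|lborel. norm ((cmod (\<psi> k x - f x))\<^sup>2))" for k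
    unfolding sq_norm_def by (subst nn_integral_eq_integral[OF i]) auto
  have "(\<lambda>k. LINT x|lborel. norm ((cmod (\<psi> k x - f x))\<^sup>2)) \<longlonglongrightarrow> 0"
    using lim unfolding eq by (subst (asm) ennreal_tendsto_0_iff) auto
  from tendsto_L1_AE_subseq[OF i this] obtain r :: "nat \<Rightarrow> nat"
    where r: "strict_mono r" "AE x in lborel. (\<lambda>n. (cmod (\<psi> (r n) x - f x))\<^sup>2) \<longlonglongrightarrow> 0" by blast
  have "AE x in lborel. (\<lambda>k. \<psi> (r k) x) \<longlonglongrightarrow> f x" using r(2)
  proof eventually_elim
    case (elim x)
    from tendsto_real_sqrt[OF elim] have "(\<lambda>n. cmod (\<psi> (r n) x - f x)) \<longlonglongrightarrow> 0" by simp
    from LIM_zero_cancel[OF tendsto_norm_zero_cancel[OF this]] show ?case .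
  qed
  then show ?thesis using that[OF r(1)] by blast
qed

lemma H1_rep_integrable:
  assumes "H1_rep W u u0 w"
  shows "integrable lborel (\<lambda>x. (cmod (u0 x))\<^sup>2)" "integrable lborel (\<lambda>x. (cmod (w i x))\<^sup>2)"
  using assms by (simp_all add: H1_rep_def)

text \<open>A lower semicontinuous functional which is bounded on test functions by the energy is
  bounded in the same way, up to a factor 2, on localized functions in $H^1$.\<close>

lemma H1_form_extension:
  fixes \<Omega> :: "(real ^ 'n) set" and N :: "(real ^ 'n \<Rightarrow> complex) \<Rightarrow> ennreal"
  assumes \<Omega>: "open \<Omega>" and r: "H1_rep \<Omega> u u0 w" and e: "cc_smooth (e :: real ^ 'n \<Rightarrow> real)" "closure {x. e x \<noteq> 0} \<subseteq> \<Omega>"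
    and AB: "A \<ge> 0" "B \<ge> 0" "\<And>v. cc_smooth v \<Longrightarrow> N v \<le> ennreal A * (\<Sum>i\<in>UNIV. sq_norm (partial i v)) + ennreal B * sq_norm v"
    and N: "\<And>\<psi>. (\<And>k::nat. cc_smooth (\<psi> k)) \<Longrightarrow> AE x in lborel. (\<lambda>k. \<psi> k x) \<longlonglongrightarrow> e x *\<^sub>R u0 x \<Longrightarrow>
      N (\<lambda>x. e x *\<^sub>R u0 x) \<le> liminf (\<lambda>k. N (\<psi> k))"
  shows "N (\<lambda>x. e x *\<^sub>R u0 x) \<le> ennreal (2 * A) * (\<Sum>i\<in>UNIV. sq_norm (\<lambda>x. e x *\<^sub>R w i x + frechet_derivative e (at x) (axis i 1) *\<^sub>R u0 x))
    + ennreal (2 * B) * sq_norm (\<lambda>x. e x *\<^sub>R u0 x)"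
proof -
  let ?f = "\<lambda>x. e x *\<^sub>R u0 x" and ?G = "\<lambda>i x. e x *\<^sub>R w i x + frechet_derivative e (at x) (axis i 1) *\<^sub>R u0 x"
  obtain \<psi> where \<psi>: "\<And>k::nat. \<psi> k \<in> test_functions \<Omega>" "(\<lambda>k. sq_norm (\<lambda>x. \<psi> k x - ?f x)) \<longlonglongrightarrow> 0"
    "\<And>i. (\<lambda>k. sq_norm (\<lambda>x. partial i (\<psi> k) x - ?G i x)) \<longlonglongrightarrow> 0"
    by (rule H1_localize[OF \<Omega> r e]; (rule that; assumption))
  have c: "cc_smooth (\<psi> k)" for k using \<psi>(1) by (simp add: test_functions_iff)
  note m = H1_rep_measurable[OF H1_rep_mult(2)[OF \<Omega> r e(1)]]
  have [measurable]: "\<psi> k \<in> borel_measurable borel" "partial i (\<psi> k) \<in> borel_measurable borel"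
    "?f \<in> borel_measurable borel" "?G i \<in> borel_measurable borel" for k i
    by (rule cc_smooth_measurable[OF c], rule cc_smooth_measurable[OF partial_cc_smooth[OF c]], rule m(1), rule m(2))
  have fin: "sq_norm ?f < \<infinity>" "sq_norm (\<psi> k) < \<infinity>" for k
    using H1_rep_integrable(1)[OF H1_rep_mult(2)[OF \<Omega> r e(1)]] cc_smooth_sq_integrable[OF c]
      sq_integrable_iff[of ?f] sq_integrable_iff[of "\<psi> k"] by simp_all
  have "sq_norm (\<lambda>x. \<psi> k x - ?f x) < \<infinity>" for k
  proof -
    have "sq_norm (\<lambda>x. \<psi> k x - ?f x) \<le> 2 * sq_norm (\<psi> k) + 2 * sq_norm ?f" by (rule sq_norm_diff_le) measurable
    also have "\<dots> < \<infinity>" using fin(1) fin(2)[of k] by (simp add: ennreal_mult_less_top)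
    finally show ?thesis .
  qed
  then have "integrable lborel (\<lambda>x. (cmod (\<psi> k x - ?f x))\<^sup>2)" for k
    by (subst sq_integrable_iff) auto
  then obtain \<rho> where \<rho>: "strict_mono \<rho>" "AE x in lborel. (\<lambda>k. \<psi> (\<rho> k) x) \<longlonglongrightarrow> ?f x"
    using sq_norm_tendsto_AE_subseq[OF _ \<psi>(2)] by metis
  define a where "a k = sq_norm (\<lambda>x. \<psi> (\<rho> k) x - ?f x)" for k
  define b where "b i k = sq_norm (\<lambda>x. partial i (\<psi> (\<rho> k)) x - ?G i x)" for i k
  have a0: "a \<longlonglongrightarrow> 0" unfolding a_def using LIMSEQ_subseq_LIMSEQ[OF \<psi>(2) \<rho>(1)] by (simp add: o_def)
  have b0: "b i \<longlonglongrightarrow> 0" for i unfolding b_def using LIMSEQ_subseq_LIMSEQ[OF \<psi>(3) \<rho>(1)] by (simp add: o_def)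
  let ?U = "\<lambda>k. ennreal A * (\<Sum>i\<in>UNIV. 2 * sq_norm (?G i) + 2 * b i k) + ennreal B * (2 * sq_norm ?f + 2 * a k)"
  have est: "N (\<psi> (\<rho> k)) \<le> ?U k" for k
  proof -
    have "sq_norm (\<psi> (\<rho> k)) = sq_norm (\<lambda>x. ?f x + (\<psi> (\<rho> k) x - ?f x))" by simp
    also have "\<dots> \<le> 2 * sq_norm ?f + 2 * a k" unfolding a_def by (rule sq_norm_add_le) measurable
    finally have 1: "sq_norm (\<psi> (\<rho> k)) \<le> 2 * sq_norm ?f + 2 * a k" .
    have 2: "sq_norm (partial i (\<psi> (\<rho> k))) \<le> 2 * sq_norm (?G i) + 2 * b i k" for i
    proof -
      have "sq_norm (partial i (\<psi> (\<rho> k))) = sq_norm (\<lambda>x. ?G i x + (partial i (\<psi> (\<rho> k)) x - ?G i x))" by simp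
      also have "\<dots> \<le> 2 * sq_norm (?G i) + 2 * b i k" unfolding b_def by (rule sq_norm_add_le) measurable
      finally show ?thesis .
    qed
    show ?thesis
      by (rule order_trans[OF AB(3)[OF c]]) (intro add_mono mult_left_mono sum_mono 1 2; simp)
  qed
  have "?U \<longlonglongrightarrow> ennreal A * (\<Sum>i\<in>UNIV. 2 * sq_norm (?G i) + 2 * 0) + ennreal B * (2 * sq_norm ?f + 2 * 0)"
    by (intro tendsto_add tendsto_sum ennreal_tendsto_cmult tendsto_const a0 b0) auto
  also have "ennreal A * (\<Sum>i\<in>UNIV. 2 * sq_norm (?G i) + 2 * 0) + ennreal B * (2 * sq_norm ?f + 2 * 0) =
     ennreal (2 * A) * (\<Sum>i\<in>UNIV. sq_norm (?G i)) + ennreal (2 * B) * sq_norm ?f"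
  proof -
    have "(\<Sum>i\<in>UNIV. 2 * sq_norm (?G i) + 2 * 0) = 2 * (\<Sum>i\<in>UNIV. sq_norm (?G i))" by (simp add: sum_distrib_left)
    moreover have "ennreal (2 * A) = ennreal A * 2" "ennreal (2 * B) = ennreal B * 2" using AB(1,2) by (simp_all add: ennreal_mult mult.commute)
    ultimately show ?thesis by (simp add: mult.assoc)
  qed
  finally have U: "?U \<longlonglongrightarrow> ennreal (2 * A) * (\<Sum>i\<in>UNIV. sq_norm (?G i)) + ennreal (2 * B) * sq_norm ?f" .
  have "N ?f \<le> liminf (\<lambda>k. N (\<psi> (\<rho> k)))" by (rule N[OF c \<rho>(2)])
  also have "\<dots> \<le> liminf ?U" by (rule Liminf_mono) (simp add: est)
  also have "\<dots> = ennreal (2 * A) * (\<Sum>i\<in>UNIV. sq_norm (?G i)) + ennreal (2 * B) * sq_norm ?f"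
    by (rule lim_imp_Liminf[OF _ U]) simp
  finally show ?thesis .
qed

text \<open>Fatou's lemma gives the lower semicontinuity required by
  \<open>H1_form_extension\<close>.\<close>

lemma localized_potential_bound:
  fixes \<Omega> :: "(real ^ 'n) set"
  assumes \<Omega>: "open \<Omega>" and r: "H1_rep \<Omega> u u0 w" and e: "cc_smooth (e :: real ^ 'n \<Rightarrow> real)" "closure {x. e x \<noteq> 0} \<subseteq> \<Omega>"
    and AB: "A \<ge> 0" "B \<ge> 0" "\<And>v. cc_smooth v \<Longrightarrow> (\<integral>\<^sup>+x. ennreal (\<bar>R x\<bar> * (cmod (v x))\<^sup>2) \<partial>lborel) \<le>
      ennreal A * (\<Sum>i\<in>UNIV. sq_norm (partial i v)) + ennreal B * sq_norm v"
    and [measurable]: "R \<in> borel_measurable borel"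
  shows "(\<integral>\<^sup>+x. ennreal (\<bar>R x\<bar> * (cmod (e x *\<^sub>R u0 x))\<^sup>2) \<partial>lborel) \<le>
    ennreal (2 * A) * (\<Sum>i\<in>UNIV. sq_norm (\<lambda>x. e x *\<^sub>R w i x + frechet_derivative e (at x) (axis i 1) *\<^sub>R u0 x))
    + ennreal (2 * B) * sq_norm (\<lambda>x. e x *\<^sub>R u0 x)"
proof (rule H1_form_extension[where N="\<lambda>v. \<integral>\<^sup>+x. ennreal (\<bar>R x\<bar> * (cmod (v x))\<^sup>2) \<partial>lborel", OF \<Omega> r e AB])
  fix \<psi> :: "nat \<Rightarrow> real ^ 'n \<Rightarrow> complex"
  assume c: "\<And>k. cc_smooth (\<psi> k)" and l: "AE x in lborel. (\<lambda>k. \<psi> k x) \<longlonglongrightarrow> e x *\<^sub>R u0 x"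
  have [measurable]: "\<psi> k \<in> borel_measurable borel" for k by (rule cc_smooth_measurable[OF c])
  have "(\<integral>\<^sup>+x. ennreal (\<bar>R x\<bar> * (cmod (e x *\<^sub>R u0 x))\<^sup>2) \<partial>lborel) \<le> (\<integral>\<^sup>+x. liminf (\<lambda>k. ennreal (\<bar>R x\<bar> * (cmod (\<psi> k x))\<^sup>2)) \<partial>lborel)"
  proof (rule nn_integral_mono_AE, use l in eventually_elim)
    fix x assume "(\<lambda>k. \<psi> k x) \<longlonglongrightarrow> e x *\<^sub>R u0 x"
    then have "(\<lambda>k. ennreal (\<bar>R x\<bar> * (cmod (\<psi> k x))\<^sup>2)) \<longlonglongrightarrow> ennreal (\<bar>R x\<bar> * (cmod (e x *\<^sub>R u0 x))\<^sup>2)"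
      by (intro tendsto_ennrealI tendsto_mult tendsto_const tendsto_power tendsto_norm)
    from lim_imp_Liminf[OF sequentially_bot this]
    show "ennreal (\<bar>R x\<bar> * (cmod (e x *\<^sub>R u0 x))\<^sup>2) \<le> liminf (\<lambda>k. ennreal (\<bar>R x\<bar> * (cmod (\<psi> k x))\<^sup>2))" by simp
  qed
  also have "\<dots> \<le> liminf (\<lambda>k. \<integral>\<^sup>+x. ennreal (\<bar>R x\<bar> * (cmod (\<psi> k x))\<^sup>2) \<partial>lborel)"
    by (rule nn_integral_liminf) measurable
  finally show "(\<integral>\<^sup>+x. ennreal (\<bar>R x\<bar> * (cmod (e x *\<^sub>R u0 x))\<^sup>2) \<partial>lborel) \<le>
    liminf (\<lambda>k. \<integral>\<^sup>+x. ennreal (\<bar>R x\<bar> * (cmod (\<psi> k x))\<^sup>2) \<partial>lborel)" .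
qed

text \<open>The derivative of |v|^2 is at most 2 |v| |grad v| |y| <= (|v|^2 + |grad v|^2) |y| in
  direction y, so |v|^2 is Lipschitz under translations in L^1.\<close>

lemma norm_sq_translation_le:
  fixes v :: "real ^ 'n \<Rightarrow> complex"
  assumes v: "cc_smooth v"
  shows "(\<integral>\<^sup>+x. ennreal \<bar>(cmod (v (x + y)))\<^sup>2 - (cmod (v x))\<^sup>2\<bar> \<partial>lborel) \<le>
    ennreal (norm y) * (\<Sum>i\<in>UNIV. sq_norm (partial i v)) + ennreal (norm y) * sq_norm v"
proof -
  note s = cc_smooth_smooth[OF v]
  have [measurable]: "v \<in> borel_measurable borel" "grad_sq v \<in> borel_measurable borel"
    using cc_smooth_measurable[OF v] grad_sq_measurable[OF v] by auto
  let ?D = "\<lambda>x z. 2 * (v x \<bullet> frechet_derivative v (at x) z)"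
  have "continuous_on UNIV (\<lambda>x. ?D x y)"
    by (intro continuous_on_mult continuous_on_const continuous_on_inner smooth_continuous s smooth_frechet_derivative)
  from L1_translation_gradient[OF norm_sq_has_derivative[OF s] this]
  have "(\<integral>\<^sup>+x. ennreal \<bar>(cmod (v (x + y)))\<^sup>2 - (cmod (v x))\<^sup>2\<bar> \<partial>lborel) \<le> (\<integral>\<^sup>+x. ennreal \<bar>?D x y\<bar> \<partial>lborel)" .
  also have "\<dots> \<le> (\<integral>\<^sup>+x. ennreal (norm y) * ennreal (grad_sq v x) + ennreal (norm y) * ennreal ((cmod (v x))\<^sup>2) \<partial>lborel)"
  proof (rule nn_integral_mono)
    fix x
    have "\<bar>?D x y\<bar> \<le> 2 * (cmod (v x) * cmod (frechet_derivative v (at x) y))"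
      using Cauchy_Schwarz_ineq2[of "v x" "frechet_derivative v (at x) y"] by (simp add: abs_mult)
    also have "\<dots> \<le> 2 * (cmod (v x) * (norm y * sqrt (grad_sq v x)))"
      using cmod_frechet_derivative_le[OF s, of x y] by (intro mult_left_mono) auto
    also have "\<dots> = norm y * (2 * (cmod (v x) * sqrt (grad_sq v x)))" by simp
    also have "\<dots> \<le> norm y * (grad_sq v x + (cmod (v x))\<^sup>2)"
      using sum_squares_bound[of "cmod (v x)" "sqrt (grad_sq v x)"] by (intro mult_left_mono) auto
    finally have "ennreal \<bar>?D x y\<bar> \<le> ennreal (norm y * (grad_sq v x + (cmod (v x))\<^sup>2))" by (rule ennreal_leI)
    then show "ennreal \<bar>?D x y\<bar> \<le> ennreal (norm y) * ennreal (grad_sq v x) + ennreal (norm y) * ennreal ((cmod (v x))\<^sup>2)"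
      by (simp add: ennreal_mult distrib_left)
  qed
  also have "\<dots> = ennreal (norm y) * (\<integral>\<^sup>+x. ennreal (grad_sq v x) \<partial>lborel) + ennreal (norm y) * sq_norm v"
    by (simp add: nn_integral_add nn_integral_cmult sq_norm_def)
  finally show ?thesis unfolding nn_integral_grad_sq[OF v] .
qed

text \<open>Fatou's lemma once more, with almost everywhere convergence used at x and at x +
  y.\<close>

lemma localized_translation_bound:
  fixes \<Omega> :: "(real ^ 'n) set"
  assumes \<Omega>: "open \<Omega>" and r: "H1_rep \<Omega> u u0 w" and e: "cc_smooth (e :: real ^ 'n \<Rightarrow> real)" "closure {x. e x \<noteq> 0} \<subseteq> \<Omega>"
  shows "(\<integral>\<^sup>+x. ennreal \<bar>(cmod (e (x + y) *\<^sub>R u0 (x + y)))\<^sup>2 - (cmod (e x *\<^sub>R u0 x))\<^sup>2\<bar> \<partial>lborel) \<le>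
    ennreal (2 * norm y) * (\<Sum>i\<in>UNIV. sq_norm (\<lambda>x. e x *\<^sub>R w i x + frechet_derivative e (at x) (axis i 1) *\<^sub>R u0 x))
    + ennreal (2 * norm y) * sq_norm (\<lambda>x. e x *\<^sub>R u0 x)"
proof (rule H1_form_extension[where N="\<lambda>v. \<integral>\<^sup>+x. ennreal \<bar>(cmod (v (x + y)))\<^sup>2 - (cmod (v x))\<^sup>2\<bar> \<partial>lborel", OF \<Omega> r e _ _ norm_sq_translation_le])
  fix \<psi> :: "nat \<Rightarrow> real ^ 'n \<Rightarrow> complex"
  assume c: "\<And>k. cc_smooth (\<psi> k)" and l: "AE x in lborel. (\<lambda>k. \<psi> k x) \<longlonglongrightarrow> e x *\<^sub>R u0 x"
  have [measurable]: "\<psi> k \<in> borel_measurable borel" for k by (rule cc_smooth_measurable[OF c])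
  have "(\<integral>\<^sup>+x. ennreal \<bar>(cmod (e (x + y) *\<^sub>R u0 (x + y)))\<^sup>2 - (cmod (e x *\<^sub>R u0 x))\<^sup>2\<bar> \<partial>lborel) \<le>
     (\<integral>\<^sup>+x. liminf (\<lambda>k. ennreal \<bar>(cmod (\<psi> k (x + y)))\<^sup>2 - (cmod (\<psi> k x))\<^sup>2\<bar>) \<partial>lborel)"
  proof (rule nn_integral_mono_AE, use l AE_lborel_translate[OF l, of y] in eventually_elim)
    fix x assume "(\<lambda>k. \<psi> k x) \<longlonglongrightarrow> e x *\<^sub>R u0 x" "(\<lambda>k. \<psi> k (x + y)) \<longlonglongrightarrow> e (x + y) *\<^sub>R u0 (x + y)"
    then have "(\<lambda>k. ennreal \<bar>(cmod (\<psi> k (x + y)))\<^sup>2 - (cmod (\<psi> k x))\<^sup>2\<bar>) \<longlonglongrightarrow>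
       ennreal \<bar>(cmod (e (x + y) *\<^sub>R u0 (x + y)))\<^sup>2 - (cmod (e x *\<^sub>R u0 x))\<^sup>2\<bar>"
      by (intro tendsto_ennrealI tendsto_rabs tendsto_diff tendsto_power tendsto_norm)
    from lim_imp_Liminf[OF sequentially_bot this]
    show "ennreal \<bar>(cmod (e (x + y) *\<^sub>R u0 (x + y)))\<^sup>2 - (cmod (e x *\<^sub>R u0 x))\<^sup>2\<bar> \<le>
      liminf (\<lambda>k. ennreal \<bar>(cmod (\<psi> k (x + y)))\<^sup>2 - (cmod (\<psi> k x))\<^sup>2\<bar>)" by simp
  qed
  also have "\<dots> \<le> liminf (\<lambda>k. \<integral>\<^sup>+x. ennreal \<bar>(cmod (\<psi> k (x + y)))\<^sup>2 - (cmod (\<psi> k x))\<^sup>2\<bar> \<partial>lborel)"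
    by (rule nn_integral_liminf) measurable
  finally show "(\<integral>\<^sup>+x. ennreal \<bar>(cmod (e (x + y) *\<^sub>R u0 (x + y)))\<^sup>2 - (cmod (e x *\<^sub>R u0 x))\<^sup>2\<bar> \<partial>lborel) \<le>
     liminf (\<lambda>k. \<integral>\<^sup>+x. ennreal \<bar>(cmod (\<psi> k (x + y)))\<^sup>2 - (cmod (\<psi> k x))\<^sup>2\<bar> \<partial>lborel)" .
qed auto

text \<open>The approximants from \<open>H1_localize\<close> are test functions on \<Omega>, which
  is what membership in \<open>H1_0\<close> demands.\<close>

lemma cutoff_test_H1_0:
  fixes \<Omega> :: "(real ^ 'n) set"
  assumes \<Omega>: "open \<Omega>" and r: "H1_rep \<Omega> u u0 w" and e: "cc_smooth (e :: real ^ 'n \<Rightarrow> real)" "closure {x. e x \<noteq> 0} \<subseteq> \<Omega>"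
  shows "(\<lambda>x. e x *\<^sub>R u x) \<in> H1_0 \<Omega>"
proof -
  let ?f = "\<lambda>x. e x *\<^sub>R u0 x" and ?G = "\<lambda>i x. e x *\<^sub>R w i x + frechet_derivative e (at x) (axis i 1) *\<^sub>R u0 x"
  obtain \<psi> where \<psi>: "\<And>k::nat. \<psi> k \<in> test_functions \<Omega>" "(\<lambda>k. sq_norm (\<lambda>x. \<psi> k x - ?f x)) \<longlonglongrightarrow> 0"
    "\<And>i. (\<lambda>k. sq_norm (\<lambda>x. partial i (\<psi> k) x - ?G i x)) \<longlonglongrightarrow> 0"
    by (rule H1_localize[OF \<Omega> r e]; (rule that; assumption))
  have c: "cc_smooth (\<psi> k)" for k using \<psi>(1) by (simp add: test_functions_iff)
  note R = H1_rep_mult[OF \<Omega> r e(1)]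
  have lim: "(\<lambda>k. sq_norm (\<lambda>x. \<psi> k x - ?f x) + (\<Sum>i\<in>UNIV. sq_norm (\<lambda>x. partial i (\<psi> k) x - ?G i x))) \<longlonglongrightarrow> 0 + (\<Sum>i\<in>(UNIV::'n set). 0)"
    by (intro tendsto_add tendsto_sum \<psi>(2,3))
  have "(\<lambda>k. ennreal ((H1_norm \<Omega> (\<lambda>x. \<psi> k x - e x *\<^sub>R u x))\<^sup>2)) \<longlonglongrightarrow> 0"
  proof (rule tendsto_zero_bound)
    show "(\<lambda>k. sq_norm (\<lambda>x. \<psi> k x - ?f x) + (\<Sum>i\<in>UNIV. sq_norm (\<lambda>x. partial i (\<psi> k) x - ?G i x))) \<longlonglongrightarrow> 0" using lim by simp
    fix k
    have "ennreal ((H1_norm \<Omega> (\<lambda>x. \<psi> k x - e x *\<^sub>R u x))\<^sup>2) \<le> sq_norm (\<lambda>x. \<psi> k x - ?f x) + (\<Sum>i\<in>UNIV. sq_norm (\<lambda>x. partial i (\<psi> k) x - ?G i x))"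
      unfolding H1_norm_diff_eq[OF \<Omega> subset_refl R(2) c]
      by (intro add_mono sum_mono sq_norm_mono) (auto simp: indicator_def)
    then show "ennreal ((H1_norm \<Omega> (\<lambda>x. \<psi> k x - e x *\<^sub>R u x))\<^sup>2) \<le> ennreal 1 *
      (sq_norm (\<lambda>x. \<psi> k x - ?f x) + (\<Sum>i\<in>UNIV. sq_norm (\<lambda>x. partial i (\<psi> k) x - ?G i x)))" by simp
  qed
  then have "(\<lambda>k. H1_norm \<Omega> (\<lambda>x. \<psi> k x - e x *\<^sub>R u x)) \<longlonglongrightarrow> 0"
    using H1_norm_tendsto_iff[of \<Omega> "\<lambda>k x. \<psi> k x - e x *\<^sub>R u x"] by blast
  then show ?thesis unfolding H1_0_def using R(1) \<psi>(1) by blast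
qed


section \<open>The potential as a form perturbation\<close>

text \<open>The squared L^2 norm of grad (e u), written out by the product rule in terms of
  representatives.\<close>

definition cut_energy :: "(real ^ 'n \<Rightarrow> real) \<Rightarrow> (real ^ 'n \<Rightarrow> complex) \<Rightarrow> ('n \<Rightarrow> real ^ 'n \<Rightarrow> complex) \<Rightarrow> ennreal" where
  "cut_energy e u0 w = (\<Sum>i\<in>UNIV. sq_norm (\<lambda>x. e x *\<^sub>R w i x + frechet_derivative e (at x) (axis i 1) *\<^sub>R u0 x))"

lemma cc_smooth_mult_real:
  fixes e f :: "'a::euclidean_space \<Rightarrow> real"
  assumes "cc_smooth e" "cc_smooth f"
  shows "cc_smooth (\<lambda>x. e x * f x)"
  by (rule cc_smooth_bilinear1[OF bounded_bilinear_mult assms(1) cc_smooth_smooth[OF assms(2)]])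

lemma closure_support_mult:
  fixes e f :: "'a::topological_space \<Rightarrow> real"
  shows "closure {x. f x \<noteq> 0} \<subseteq> \<Omega> \<Longrightarrow> closure {x. e x * f x \<noteq> 0} \<subseteq> \<Omega>"
  by (rule order_trans[OF closure_mono]) auto

lemma frechet_derivative_mult_real:
  fixes e f :: "'a::euclidean_space \<Rightarrow> real"
  assumes "smooth e" "smooth f"
  shows "frechet_derivative (\<lambda>x. e x * f x) (at x) v = e x * frechet_derivative f (at x) v + frechet_derivative e (at x) v * f x"
  using frechet_derivative_at[OF has_derivative_mult[OF smooth_has_derivative[OF assms(1)] smooth_has_derivative[OF assms(2)]], symmetric]
  by simp

lemma H1_rep_AE:
  assumes "H1_rep \<Omega> u u0 w"
  shows "AE x in lebesgue. x \<in> \<Omega> \<longrightarrow> u x = u0 x" "x \<notin> \<Omega> \<Longrightarrow> u0 x = 0"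
  using assms by (simp_all add: H1_rep_def rep_def)

text \<open>The product of u with the test function is |e u|^2, so the form bound applies to e u. It
  is invoked with \<epsilon>/2, because the extension from smooth functions doubles the
  constant.\<close>

lemma regular_term_bound:
  fixes \<Omega> :: "(real ^ 'n) set" and R e :: "real ^ 'n \<Rightarrow> real"
  assumes n: "CARD('n) \<ge> 3" and R: "R \<in> borel_measurable lebesgue" "integrable lebesgue (\<lambda>x. \<bar>R x\<bar> powr (real CARD('n) / 2))"
    and \<Omega>: "open \<Omega>" and e: "cc_smooth e" "closure {x. e x \<noteq> 0} \<subseteq> \<Omega>" and \<epsilon>: "\<epsilon> > 0"
  obtains C where "C \<ge> 0" "\<And>u u0 w. H1_rep \<Omega> u u0 w \<Longrightarrow>
    ennreal (cmod (LINT x|lebesgue_on \<Omega>. of_real (R x) * u x * ((e x)\<^sup>2 *\<^sub>R cnj (u x))))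
      \<le> ennreal \<epsilon> * cut_energy e u0 w + ennreal C * sq_norm (\<lambda>x. e x *\<^sub>R u0 x)"
proof -
  let ?p = "real CARD('n) / 2"
  obtain R' where R': "R' \<in> borel_measurable borel" "AE x in lborel. R x = R' x"
    using completion_ex_borel_measurable_real[OF R(1)] by auto
  have R'L: "AE x in lebesgue. R x = R' x" by (rule AE_completion[OF R'(2)])
  have "integrable lebesgue (\<lambda>x. \<bar>R x\<bar> powr ?p) \<longleftrightarrow> integrable lborel (\<lambda>x. \<bar>R' x\<bar> powr ?p)"
  proof (rule integral_lebesgue_lborel(2))
    show "(\<lambda>x. \<bar>R x\<bar> powr ?p) \<in> borel_measurable lebesgue" using R(2) by (rule borel_measurable_integrable)
    show "(\<lambda>x. \<bar>R' x\<bar> powr ?p) \<in> borel_measurable borel" using R'(1) by measurable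
    show "AE x in lebesgue. \<bar>R x\<bar> powr ?p = \<bar>R' x\<bar> powr ?p" using R'L by eventually_elim simp
  qed
  then have i: "integrable lborel (\<lambda>x. \<bar>R' x\<bar> powr ?p)" using R(2) by simp
  have \<epsilon>2: "\<epsilon> / 2 > 0" using \<epsilon> by simp
  obtain C where C: "C \<ge> 0" "\<And>v. cc_smooth v \<Longrightarrow> (\<integral>\<^sup>+x. ennreal (\<bar>R' x\<bar> * (cmod (v x))\<^sup>2) \<partial>lborel) \<le>
    ennreal (\<epsilon> / 2) * (\<Sum>i\<in>UNIV. sq_norm (partial i v)) + ennreal C * sq_norm v"
    by (rule potential_form_bound[OF n R'(1) i \<epsilon>2]; (rule that; assumption))
  have "ennreal (cmod (LINT x|lebesgue_on \<Omega>. of_real (R x) * u x * ((e x)\<^sup>2 *\<^sub>R cnj (u x))))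
      \<le> ennreal \<epsilon> * cut_energy e u0 w + ennreal (2 * C) * sq_norm (\<lambda>x. e x *\<^sub>R u0 x)" if r: "H1_rep \<Omega> u u0 w" for u u0 w
  proof -
    let ?h = "\<lambda>x. of_real (R x) * u x * ((e x)\<^sup>2 *\<^sub>R cnj (u x))"
    have "ennreal (cmod (LINT x|lebesgue_on \<Omega>. ?h x)) \<le> (\<integral>\<^sup>+x. ennreal (cmod (?h x)) \<partial>lebesgue_on \<Omega>)"
      by (rule ennreal_norm_integral_le)
    also have "\<dots> = (\<integral>\<^sup>+x. ennreal (cmod (?h x)) * indicator \<Omega> x \<partial>lebesgue)"
      by (rule nn_integral_restrict_space[OF open_space_lebesgue[OF \<Omega>]])
    also have "\<dots> = (\<integral>\<^sup>+x. ennreal (\<bar>R' x\<bar> * (cmod (e x *\<^sub>R u0 x))\<^sup>2) \<partial>lebesgue)"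
    proof (rule nn_integral_cong_AE, use R'L H1_rep_AE(1)[OF r] in eventually_elim)
      fix x assume x: "R x = R' x" "x \<in> \<Omega> \<longrightarrow> u x = u0 x"
      show "ennreal (cmod (?h x)) * indicator \<Omega> x = ennreal (\<bar>R' x\<bar> * (cmod (e x *\<^sub>R u0 x))\<^sup>2)"
        using x H1_rep_AE(2)[OF r, of x]
        by (cases "x \<in> \<Omega>") (simp_all add: norm_mult power_mult_distrib power2_eq_square[of "cmod _"] ac_simps)
    qed
    also have "\<dots> = (\<integral>\<^sup>+x. ennreal (\<bar>R' x\<bar> * (cmod (e x *\<^sub>R u0 x))\<^sup>2) \<partial>lborel)" by (rule nn_integral_completion)
    also have "\<dots> \<le> ennreal (2 * (\<epsilon> / 2)) * cut_energy e u0 w + ennreal (2 * C) * sq_norm (\<lambda>x. e x *\<^sub>R u0 x)"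
      unfolding cut_energy_def using \<epsilon> by (intro localized_potential_bound[OF \<Omega> r e _ C(1) C(2) R'(1)]) auto
    finally show ?thesis by simp
  qed
  then show ?thesis using C(1) by (intro that[of "2 * C"]) auto
qed

text \<open>The function under D^s is G = |\<eta> e u|^2, nonnegative, with L^1 norm ||\<eta> e
  u||^2 and translates that move in L^1 at a rate bounded by energy plus squared norm. Hence
  \<open>frac_deriv_bound\<close> makes the energy coefficient as small as desired, and the
  coefficient function g only costs its bound.\<close>

lemma frac_term_bound:
  fixes \<Omega> :: "(real ^ 'n) set" and g \<eta> e :: "real ^ 'n \<Rightarrow> real"
  assumes s: "0 \<le> s" "s < 1" and g: "AE x in lebesgue. \<bar>g x\<bar> \<le> M" and \<eta>: "cc_smooth \<eta>" "\<And>x. \<bar>\<eta> x\<bar> \<le> 1"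
    and \<Omega>: "open \<Omega>" and e: "cc_smooth e" "closure {x. e x \<noteq> 0} \<subseteq> \<Omega>" and \<epsilon>: "\<epsilon> > 0"
  obtains C where "C \<ge> 0" "\<And>u u0 w. H1_rep \<Omega> u u0 w \<Longrightarrow>
    ennreal (cmod (LINT x|lebesgue. of_real (g x) * frac_deriv s
       (\<lambda>y. if y \<in> \<Omega> then (of_real (\<eta> y) * u y) * (of_real (\<eta> y) * ((e y)\<^sup>2 *\<^sub>R cnj (u y))) else 0) x))
      \<le> ennreal \<epsilon> * cut_energy e u0 w + ennreal C * sq_norm (\<lambda>x. e x *\<^sub>R u0 x)"
proof -
  define M' where "M' = max M 1"
  have M': "M' > 0" "M \<le> M'" by (auto simp: M'_def)
  obtain L where L: "L > 0" "\<And>x v. norm (frechet_derivative \<eta> (at x) v) \<le> L * norm v"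
    using cc_smooth_derivative_bounded[OF \<eta>(1)] by blast
  \<comment> \<open>M' bounds the coefficient function; the 4 is 2 from
    \<open>localized_translation_bound\<close> times 2 from the product rule for the factor
    \<eta>.\<close>
  define \<delta> where "\<delta> = \<epsilon> / (4 * M')"
  have \<delta>: "\<delta> > 0" "M' * (4 * \<delta>) = \<epsilon>" using \<epsilon> M' by (auto simp: \<delta>_def)
  obtain C where C: "C \<ge> 0" "\<And>(f :: real ^ 'n \<Rightarrow> complex) g K. f \<in> borel_measurable lebesgue \<Longrightarrow> integrable lborel g \<Longrightarrow>
      AE x in lebesgue. f x = g x \<Longrightarrow> K \<ge> 0 \<Longrightarrow>
      (\<And>y. (\<integral>\<^sup>+x. ennreal (cmod (g (x + y) - g x)) \<partial>lborel) \<le> ennreal (K * norm y)) \<Longrightarrow>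
      frac_deriv s f \<in> borel_measurable lebesgue \<and>
      (\<integral>\<^sup>+x. ennreal (cmod (frac_deriv s f x)) \<partial>lebesgue) \<le> ennreal (\<delta> * K) + ennreal C * (\<integral>\<^sup>+x. ennreal (cmod (g x)) \<partial>lborel)"
    using frac_deriv_bound[OF s \<delta>(1), where 'n='n] by blast
  define C' where "C' = M' * (4 * \<delta>) * (L\<^sup>2 * real CARD('n)) + M' * (2 * \<delta>) + M' * C"
  have C': "C' \<ge> 0" unfolding C'_def using M'(1) \<delta>(1) C(1) by (intro add_nonneg_nonneg mult_nonneg_nonneg) auto
  let ?e = "\<lambda>x. \<eta> x * e x"
  have ce: "cc_smooth ?e" by (rule cc_smooth_mult_real[OF \<eta>(1) e(1)])
  have se: "closure {x. ?e x \<noteq> 0} \<subseteq> \<Omega>" by (rule closure_support_mult[OF e(2)])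
  have "ennreal (cmod (LINT x|lebesgue. of_real (g x) * frac_deriv s
       (\<lambda>y. if y \<in> \<Omega> then (of_real (\<eta> y) * u y) * (of_real (\<eta> y) * ((e y)\<^sup>2 *\<^sub>R cnj (u y))) else 0) x))
      \<le> ennreal \<epsilon> * cut_energy e u0 w + ennreal C' * sq_norm (\<lambda>x. e x *\<^sub>R u0 x)" if r: "H1_rep \<Omega> u u0 w" for u u0 w
  proof -
    define F where "F = (\<lambda>y. if y \<in> \<Omega> then (of_real (\<eta> y) * u y) * (of_real (\<eta> y) * ((e y)\<^sup>2 *\<^sub>R cnj (u y))) else 0)"
    let ?v = "\<lambda>x. ?e x *\<^sub>R u0 x"
    note R = H1_rep_mult(2)[OF \<Omega> r ce]
    note m = H1_rep_measurable[OF R] H1_rep_measurable[OF r] H1_rep_measurable[OF H1_rep_mult(2)[OF \<Omega> r e(1)]]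
    have [measurable]: "u0 \<in> borel_measurable borel" "w i \<in> borel_measurable borel" "\<eta> \<in> borel_measurable borel" "e \<in> borel_measurable borel"
      "(\<lambda>x. frechet_derivative \<eta> (at x) (axis i 1)) \<in> borel_measurable borel"
      "(\<lambda>x. frechet_derivative e (at x) (axis i 1)) \<in> borel_measurable borel" for i
      using m(3,4) cc_smooth_measurable[OF \<eta>(1)] cc_smooth_measurable[OF e(1)] cc_smooth_measurable[OF cc_smooth_derivative[OF \<eta>(1)]]
        cc_smooth_measurable[OF cc_smooth_derivative[OF e(1)]] by simp_all
    let ?q = "sq_norm (\<lambda>x. e x *\<^sub>R u0 x)"
    have q: "sq_norm ?v \<le> ?q"
    proof (rule sq_norm_mono)
      fix x
      have "\<bar>\<eta> x\<bar> * (\<bar>e x\<bar> * cmod (u0 x)) \<le> 1 * (\<bar>e x\<bar> * cmod (u0 x))" by (intro mult_right_mono \<eta>(2)) auto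
      then show "cmod (?v x) \<le> cmod (e x *\<^sub>R u0 x)" by (simp add: abs_mult mult.assoc)
    qed
    \<comment> \<open>The energy with the cut-off \<eta> e is brought back to the energy with
      \<open>e\<close> alone, since only the latter can be absorbed in the end.\<close>
    have S: "cut_energy ?e u0 w \<le> 2 * cut_energy e u0 w + 2 * ennreal (L\<^sup>2) * (of_nat CARD('n) * ?q)"
    proof -
      have "sq_norm (\<lambda>x. ?e x *\<^sub>R w i x + frechet_derivative ?e (at x) (axis i 1) *\<^sub>R u0 x) \<le>
        2 * sq_norm (\<lambda>x. e x *\<^sub>R w i x + frechet_derivative e (at x) (axis i 1) *\<^sub>R u0 x) + 2 * ennreal (L\<^sup>2) * ?q" for i
      proof -
        have "sq_norm (\<lambda>x. indicator UNIV x *\<^sub>R (\<eta> x *\<^sub>R (e x *\<^sub>R w i x + frechet_derivative e (at x) (axis i 1) *\<^sub>R u0 x)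
          + frechet_derivative \<eta> (at x) (axis i 1) *\<^sub>R (e x *\<^sub>R u0 x))) \<le>
          2 * sq_norm (\<lambda>x. indicator UNIV x *\<^sub>R (e x *\<^sub>R w i x + frechet_derivative e (at x) (axis i 1) *\<^sub>R u0 x))
          + 2 * ennreal (L\<^sup>2) * sq_norm (\<lambda>x. indicator UNIV x *\<^sub>R (e x *\<^sub>R u0 x))"
          by (rule sq_norm_combination_le) (use \<eta>(2) L(2)[of _ "axis i 1"] in auto)
        moreover have "indicator UNIV x *\<^sub>R (\<eta> x *\<^sub>R (e x *\<^sub>R w i x + frechet_derivative e (at x) (axis i 1) *\<^sub>R u0 x)
          + frechet_derivative \<eta> (at x) (axis i 1) *\<^sub>R (e x *\<^sub>R u0 x))
          = ?e x *\<^sub>R w i x + frechet_derivative ?e (at x) (axis i 1) *\<^sub>R u0 x" for x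
          unfolding frechet_derivative_mult_real[OF cc_smooth_smooth[OF \<eta>(1)] cc_smooth_smooth[OF e(1)]]
          by (simp add: algebra_simps)
        ultimately show ?thesis by simp
      qed
      then have "cut_energy ?e u0 w \<le> (\<Sum>i\<in>UNIV. 2 * sq_norm (\<lambda>x. e x *\<^sub>R w i x + frechet_derivative e (at x) (axis i 1) *\<^sub>R u0 x) + 2 * ennreal (L\<^sup>2) * ?q)"
        unfolding cut_energy_def by (rule sum_mono)
      also have "\<dots> = 2 * cut_energy e u0 w + of_nat CARD('n) * (2 * ennreal (L\<^sup>2) * ?q)"
        unfolding cut_energy_def by (simp add: sum.distrib sum_distrib_left[symmetric])
      also have "of_nat CARD('n) * (2 * ennreal (L\<^sup>2) * ?q) = 2 * ennreal (L\<^sup>2) * (of_nat CARD('n) * ?q)" by (simp only: ac_simps)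
      finally show ?thesis .
    qed
    define G where "G x = complex_of_real ((cmod (?v x))\<^sup>2)" for x
    have iv: "integrable lborel (\<lambda>x. (cmod (?v x))\<^sup>2)" by (rule H1_rep_integrable(1)[OF R])
    have iG: "integrable lborel G" unfolding G_def by (rule integrable_of_real[OF iv])
    have nG: "(\<integral>\<^sup>+x. ennreal (cmod (G x)) \<partial>lborel) = sq_norm ?v" unfolding G_def sq_norm_def norm_of_real by simp
    have "rep \<Omega> (\<lambda>y. (u y * ((e y)\<^sup>2 *\<^sub>R cnj (u y))) * of_real ((\<eta> y)\<^sup>2)) (\<lambda>y. (u0 y * ((e y)\<^sup>2 *\<^sub>R cnj (u0 y))) * of_real ((\<eta> y)\<^sup>2))"
    proof (rule rep_mult_borel[OF rep_mult])
      show "rep \<Omega> u u0" using r by (simp add: H1_rep_def)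
      have "rep \<Omega> (\<lambda>y. cnj (u y) * of_real ((e y)\<^sup>2)) (\<lambda>y. cnj (u0 y) * of_real ((e y)\<^sup>2))"
        by (rule rep_mult_borel) (use H1_rep_cnj[OF \<Omega> r] in \<open>simp_all add: H1_rep_def\<close>)
      then show "rep \<Omega> (\<lambda>y. (e y)\<^sup>2 *\<^sub>R cnj (u y)) (\<lambda>y. (e y)\<^sup>2 *\<^sub>R cnj (u0 y))" by (simp add: scaleR_conv_of_real mult.commute)
    qed simp
    note ri = rep_indicator[OF \<Omega> this]
    have "F = (\<lambda>y. indicator \<Omega> y *\<^sub>R ((u y * ((e y)\<^sup>2 *\<^sub>R cnj (u y))) * of_real ((\<eta> y)\<^sup>2)))"
      by (intro ext) (simp add: F_def power2_eq_square[of "\<eta> _"])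
    moreover have "(u0 y * ((e y)\<^sup>2 *\<^sub>R cnj (u0 y))) * of_real ((\<eta> y)\<^sup>2) = G y" for y
    proof -
      have "(u0 y * ((e y)\<^sup>2 *\<^sub>R cnj (u0 y))) * of_real ((\<eta> y)\<^sup>2) = of_real ((\<eta> y)\<^sup>2 * (e y)\<^sup>2) * (u0 y * cnj (u0 y))"
        by (simp add: scaleR_conv_of_real)
      also have "\<dots> = G y" unfolding complex_norm_square[symmetric] G_def by (simp add: power_mult_distrib norm_mult)
      finally show ?thesis .
    qed
    ultimately have F: "F \<in> borel_measurable lebesgue" "AE x in lebesgue. F x = G x" using ri by simp_all
    have Sfin: "cut_energy ?e u0 w < \<infinity>"
      unfolding cut_energy_def using sq_integrable_iff[OF m(2)] H1_rep_integrable(2)[OF R] by simp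
    have qfin: "sq_norm ?v < \<infinity>" using sq_integrable_iff[OF m(1)] iv by simp
    define K where "K = 2 * (enn2real (cut_energy ?e u0 w) + enn2real (sq_norm ?v))"
    have K: "K \<ge> 0" "ennreal K = 2 * (cut_energy ?e u0 w + sq_norm ?v)"
      using Sfin qfin by (simp_all add: K_def ennreal_mult distrib_left)
    have tr: "(\<integral>\<^sup>+x. ennreal (cmod (G (x + y) - G x)) \<partial>lborel) \<le> ennreal (K * norm y)" for y
    proof -
      have "cmod (G (x + y) - G x) = \<bar>(cmod (?v (x + y)))\<^sup>2 - (cmod (?v x))\<^sup>2\<bar>" for x
        unfolding G_def of_real_diff[symmetric] norm_of_real by simp
      then have "(\<integral>\<^sup>+x. ennreal (cmod (G (x + y) - G x)) \<partial>lborel) \<le> ennreal (2 * norm y) * cut_energy ?e u0 w + ennreal (2 * norm y) * sq_norm ?v"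
        unfolding cut_energy_def using localized_translation_bound[OF \<Omega> r ce se, of y] by simp
      also have "\<dots> = ennreal (K * norm y)"
        using K(1) by (simp add: ennreal_mult K(2) distrib_left distrib_right ac_simps)
      finally show ?thesis .
    qed
    note B = C(2)[OF F(1) iG F(2) K(1) tr]
    have [measurable]: "frac_deriv s F \<in> borel_measurable lebesgue" using B by blast
    have "ennreal (cmod (LINT x|lebesgue. of_real (g x) * frac_deriv s F x)) \<le> (\<integral>\<^sup>+x. ennreal (cmod (of_real (g x) * frac_deriv s F x)) \<partial>lebesgue)"
      by (rule ennreal_norm_integral_le)
    also have "\<dots> \<le> (\<integral>\<^sup>+x. ennreal M' * ennreal (cmod (frac_deriv s F x)) \<partial>lebesgue)"
    proof (rule nn_integral_mono_AE, use g in eventually_elim)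
      fix x assume "\<bar>g x\<bar> \<le> M"
      then have "ennreal (\<bar>g x\<bar> * cmod (frac_deriv s F x)) \<le> ennreal (M' * cmod (frac_deriv s F x))"
        using M' by (intro ennreal_leI mult_right_mono) auto
      then show "ennreal (cmod (of_real (g x) * frac_deriv s F x)) \<le> ennreal M' * ennreal (cmod (frac_deriv s F x))"
        using M' by (simp add: norm_mult ennreal_mult)
    qed
    also have "\<dots> = ennreal M' * (\<integral>\<^sup>+x. ennreal (cmod (frac_deriv s F x)) \<partial>lebesgue)"
      by (rule nn_integral_cmult) measurable
    also have "\<dots> \<le> ennreal M' * (ennreal (\<delta> * K) + ennreal C * sq_norm ?v)"
      by (rule mult_left_mono) (use B nG in simp_all)
    also have "ennreal (\<delta> * K) = ennreal \<delta> * (2 * (cut_energy ?e u0 w + sq_norm ?v))"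
      using \<delta>(1) K by (simp add: ennreal_mult)
    also have "ennreal M' * (ennreal \<delta> * (2 * (cut_energy ?e u0 w + sq_norm ?v)) + ennreal C * sq_norm ?v) \<le>
       ennreal M' * (ennreal \<delta> * (2 * ((2 * cut_energy e u0 w + 2 * ennreal (L\<^sup>2) * (of_nat CARD('n) * ?q)) + ?q)) + ennreal C * ?q)"
      by (intro mult_left_mono add_mono S q) auto
    also have "\<dots> = ennreal \<epsilon> * cut_energy e u0 w + ennreal C' * ?q"
    proof -
      have "ennreal \<epsilon> = ennreal M' * (4 * ennreal \<delta>)"
        unfolding \<delta>(2)[symmetric] using M' \<delta>(1) by (simp add: ennreal_mult)
      moreover have "ennreal C' = ennreal M' * (4 * ennreal \<delta>) * (ennreal (L\<^sup>2) * of_nat CARD('n)) + ennreal M' * (2 * ennreal \<delta>) + ennreal M' * ennreal C"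
        unfolding C'_def using M' \<delta>(1) C(1) by (simp add: ennreal_mult ennreal_of_nat_eq_real_of_nat)
      moreover have "2 * (2 * cut_energy e u0 w + 2 * ennreal (L\<^sup>2) * (of_nat CARD('n) * ?q) + ?q)
         = 4 * cut_energy e u0 w + 4 * (ennreal (L\<^sup>2) * (of_nat CARD('n) * ?q)) + 2 * ?q"
        by (simp add: distrib_left mult.assoc[symmetric])
      ultimately show ?thesis by (simp add: distrib_left distrib_right ac_simps)
    qed
    finally show ?thesis unfolding F_def .
  qed
  then show ?thesis using that[OF C'] by blast
qed


text \<open>The trace of the test function is \<open>(e x)\<^sup>2\<close> times the conjugate of
  the trace T of u, so the integrand has modulus |\<alpha>| |e T|^2 and
  \<open>trace_form_bound\<close> applies.\<close>

lemma surface_term_bound: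
  fixes \<Omega> \<Gamma> :: "(real ^ 'n) set" and \<alpha> e :: "real ^ 'n \<Rightarrow> real"
  assumes \<Gamma>: "compact \<Gamma>" "lipschitz_hypersurface \<Gamma>" and \<sigma>: "is_surface_measure \<Gamma> \<sigma>"
    and \<alpha>: "AE x in \<sigma>. \<bar>\<alpha> x\<bar> \<le> M"
    and \<Omega>: "open \<Omega>" and e: "cc_smooth e" "\<And>x. \<bar>e x\<bar> \<le> 1" "closure {x. e x \<noteq> 0} \<subseteq> \<Omega>" and \<epsilon>: "\<epsilon> > 0"
  obtains C where "C \<ge> 0" "\<And>u u0 w. H1_rep \<Omega> u u0 w \<Longrightarrow>
    ennreal (cmod (LINT x:(\<Gamma> \<inter> \<Omega>)|\<sigma>. of_real (\<alpha> x) * H1_trace \<Omega> \<sigma> u x * H1_trace \<Omega> \<sigma> (\<lambda>x. (e x)\<^sup>2 *\<^sub>R cnj (u x)) x))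
      \<le> ennreal \<epsilon> * cut_energy e u0 w + ennreal C * sq_norm (\<lambda>x. e x *\<^sub>R u0 x)"
proof -
  have s[measurable_cong]: "sets \<sigma> = sets borel" using \<sigma> by (simp add: is_surface_measure_def)
  define M' where "M' = max M 1"
  have M': "M' > 0" "M \<le> M'" by (auto simp: M'_def)
  \<comment> \<open>The 4 compensates the factor in \<open>trace_form_bound\<close>.\<close>
  define \<delta> where "\<delta> = \<epsilon> / (4 * M')"
  have \<delta>: "\<delta> > 0" "M' * (4 * \<delta>) = \<epsilon>" using \<epsilon> M' by (auto simp: \<delta>_def)
  obtain C where C: "C \<ge> 0" "\<And>u. cc_smooth u \<Longrightarrow> (\<integral>\<^sup>+x. ennreal ((cmod (u x))\<^sup>2) \<partial>\<sigma>) \<le>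
    ennreal \<delta> * (\<Sum>i\<in>UNIV. sq_norm (partial i u)) + ennreal C * sq_norm u"
    by (rule surface_form_bound[OF \<Gamma> \<sigma> \<delta>(1)]; (rule that; assumption))
  have Q0: "\<delta> + C \<ge> 0" using \<delta>(1) C(1) by simp
  have Q: "(\<integral>\<^sup>+x. ennreal ((cmod (u x))\<^sup>2) \<partial>\<sigma>) \<le> ennreal (\<delta> + C) * ((\<Sum>i\<in>UNIV. sq_norm (partial i u)) + sq_norm u)"
    if "cc_smooth u" for u
  proof -
    have "(\<integral>\<^sup>+x. ennreal ((cmod (u x))\<^sup>2) \<partial>\<sigma>) \<le> ennreal \<delta> * (\<Sum>i\<in>UNIV. sq_norm (partial i u)) + ennreal C * sq_norm u"
      by (rule C(2)[OF that])
    also have "\<dots> \<le> ennreal (\<delta> + C) * (\<Sum>i\<in>UNIV. sq_norm (partial i u)) + ennreal (\<delta> + C) * sq_norm u"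
      using \<delta>(1) C(1) by (intro add_mono mult_right_mono ennreal_leI) auto
    finally show ?thesis by (simp only: distrib_left)
  qed
  let ?e = "\<lambda>x. (e x)\<^sup>2"
  have ce: "cc_smooth ?e" unfolding power2_eq_square by (rule cc_smooth_mult_real[OF e(1) e(1)])
  have e1: "\<bar>?e x\<bar> \<le> 1" for x using e(2)[of x] by (simp add: abs_square_le_1)
  \<comment> \<open>Uniqueness of traces is available on bounded open sets with closure in \<Omega>;
    countably many of them cover \<Omega>.\<close>
  obtain K :: "nat \<Rightarrow> (real ^ 'n) set" where K: "\<And>n. compact (K n)" "\<And>n. K n \<subseteq> \<Omega>" "\<Union> (range K) = \<Omega>"
    using open_Union_compact_subsets[OF \<Omega>] by metis
  have "\<exists>W. open W \<and> bounded W \<and> K n \<subseteq> W \<and> closure W \<subseteq> \<Omega>" for n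
    using compact_open_neighbourhood[OF K(1) \<Omega> K(2)] by metis
  then obtain W where W: "\<And>n. open (W n)" "\<And>n. bounded (W n)" "\<And>n. K n \<subseteq> W n" "\<And>n. closure (W n) \<subseteq> \<Omega>" by metis
  have "ennreal (cmod (LINT x:(\<Gamma> \<inter> \<Omega>)|\<sigma>. of_real (\<alpha> x) * H1_trace \<Omega> \<sigma> u x * H1_trace \<Omega> \<sigma> (\<lambda>x. ?e x *\<^sub>R cnj (u x)) x))
      \<le> ennreal \<epsilon> * cut_energy e u0 w + ennreal (M' * (4 * C)) * sq_norm (\<lambda>x. e x *\<^sub>R u0 x)" if r: "H1_rep \<Omega> u u0 w" for u u0 w
  proof -
    let ?\<phi> = "\<lambda>x. ?e x *\<^sub>R cnj (u x)"
    let ?T = "H1_trace \<Omega> \<sigma> u" and ?T' = "H1_trace \<Omega> \<sigma> ?\<phi>"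
    have T: "is_trace \<Omega> \<sigma> u ?T"
      unfolding H1_trace_def by (rule someI_ex[OF is_trace_exists[OF Q0 Q s \<Omega> r]])
    have [measurable]: "?T \<in> borel_measurable borel" using T by (simp add: is_trace_def)
    have [measurable]: "e \<in> borel_measurable borel" by (rule cc_smooth_measurable[OF e(1)])
    note R = H1_rep_mult(2)[OF \<Omega> H1_rep_cnj[OF \<Omega> r] ce]
    note T2 = is_trace_mult_cnj[OF s \<Omega> r ce e1 T]
    have T': "is_trace \<Omega> \<sigma> ?\<phi> ?T'"
      unfolding H1_trace_def[of \<Omega> \<sigma> ?\<phi>] by (rule someI[of "is_trace \<Omega> \<sigma> ?\<phi>", OF T2])
    have "AE x in \<sigma>. x \<in> W n \<longrightarrow> ?T' x = ?e x *\<^sub>R cnj (?T x)" for n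
      by (rule is_trace_unique[OF Q0 Q s W(1,2,4) \<Omega> R T' T2])
    then have "AE x in \<sigma>. \<forall>n. x \<in> W n \<longrightarrow> ?T' x = ?e x *\<^sub>R cnj (?T x)" unfolding AE_all_countable by blast
    then have tr: "AE x in \<sigma>. x \<in> \<Omega> \<longrightarrow> ?T' x = ?e x *\<^sub>R cnj (?T x)"
    proof eventually_elim
      case (elim x)
      show ?case
      proof
        assume "x \<in> \<Omega>"
        then obtain n where "x \<in> K n" using K(3) by auto
        then show "?T' x = ?e x *\<^sub>R cnj (?T x)" using elim W(3)[of n] by auto
      qed
    qed
    have "ennreal (cmod (LINT x:(\<Gamma> \<inter> \<Omega>)|\<sigma>. of_real (\<alpha> x) * ?T x * ?T' x))
       \<le> (\<integral>\<^sup>+x. ennreal (cmod (indicator (\<Gamma> \<inter> \<Omega>) x *\<^sub>R (of_real (\<alpha> x) * ?T x * ?T' x))) \<partial>\<sigma>)"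
      unfolding set_lebesgue_integral_def by (rule ennreal_norm_integral_le)
    also have "\<dots> \<le> (\<integral>\<^sup>+x. ennreal M' * ennreal ((cmod (e x *\<^sub>R ?T x))\<^sup>2) \<partial>\<sigma>)"
    proof (rule nn_integral_mono_AE, use \<alpha> tr in eventually_elim)
      fix x assume x: "\<bar>\<alpha> x\<bar> \<le> M" "x \<in> \<Omega> \<longrightarrow> ?T' x = ?e x *\<^sub>R cnj (?T x)"
      show "ennreal (cmod (indicator (\<Gamma> \<inter> \<Omega>) x *\<^sub>R (of_real (\<alpha> x) * ?T x * ?T' x))) \<le> ennreal M' * ennreal ((cmod (e x *\<^sub>R ?T x))\<^sup>2)"
      proof (cases "x \<in> \<Gamma> \<inter> \<Omega>")
        case True
        then have "cmod (indicator (\<Gamma> \<inter> \<Omega>) x *\<^sub>R (of_real (\<alpha> x) * ?T x * ?T' x)) = \<bar>\<alpha> x\<bar> * (cmod (e x *\<^sub>R ?T x))\<^sup>2"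
          using x(2) by (simp add: norm_mult power_mult_distrib power2_eq_square[of "cmod _"] ac_simps)
        also have "\<dots> \<le> M' * (cmod (e x *\<^sub>R ?T x))\<^sup>2" using x(1) M'(2) by (intro mult_right_mono) auto
        finally have "ennreal (cmod (indicator (\<Gamma> \<inter> \<Omega>) x *\<^sub>R (of_real (\<alpha> x) * ?T x * ?T' x))) \<le> ennreal (M' * (cmod (e x *\<^sub>R ?T x))\<^sup>2)"
          by (rule ennreal_leI)
        then show ?thesis using M'(1) by (simp only: ennreal_mult less_imp_le zero_le_power2)
      qed simp
    qed
    also have "\<dots> = ennreal M' * (\<integral>\<^sup>+x. ennreal ((cmod (e x *\<^sub>R ?T x))\<^sup>2) \<partial>\<sigma>)"
      by (rule nn_integral_cmult) measurable
    also have "\<dots> \<le> ennreal M' * (ennreal (4 * \<delta>) * cut_energy e u0 w + ennreal (4 * C) * sq_norm (\<lambda>x. e x *\<^sub>R u0 x))"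
      unfolding cut_energy_def
      by (intro mult_left_mono trace_form_bound[OF less_imp_le[OF \<delta>(1)] C s \<Omega> r e T]) auto
    also have "\<dots> = ennreal \<epsilon> * cut_energy e u0 w + ennreal (M' * (4 * C)) * sq_norm (\<lambda>x. e x *\<^sub>R u0 x)"
    proof -
      have "ennreal \<epsilon> = ennreal M' * ennreal (4 * \<delta>)" "ennreal (M' * (4 * C)) = ennreal M' * ennreal (4 * C)"
        unfolding \<delta>(2)[symmetric] using M'(1) \<delta>(1) C(1) by (auto intro!: ennreal_mult)
      then show ?thesis by (simp only: distrib_left mult.assoc)
    qed
    finally show ?thesis .
  qed
  moreover have "M' * (4 * C) \<ge> 0" using M'(1) C(1) by simp
  ultimately show ?thesis using that by blast
qed

lemma pairing_bound:
  fixes \<Omega> :: "(real ^ 'n) set" and V :: "'n::finite potential" and e :: "real ^ 'n \<Rightarrow> real"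
  assumes n: "CARD('n) \<ge> 3" and V: "admissible V"
    and \<Omega>: "open \<Omega>" and e: "cc_smooth e" "\<And>x. \<bar>e x\<bar> \<le> 1" "closure {x. e x \<noteq> 0} \<subseteq> \<Omega>" and \<epsilon>: "\<epsilon> > 0"
  obtains C where "C \<ge> 0" "\<And>u u0 w. H1_rep \<Omega> u u0 w \<Longrightarrow>
    ennreal (cmod (pairing \<Omega> V u (\<lambda>x. (e x)\<^sup>2 *\<^sub>R cnj (u x))))
      \<le> ennreal \<epsilon> * cut_energy e u0 w + ennreal C * sq_norm (\<lambda>x. e x *\<^sub>R u0 x)"
proof -
  have \<epsilon>3: "\<epsilon> / 3 > 0" using \<epsilon> by simp
  obtain M1 M2 where M: "AE x in lebesgue. \<bar>frac_coeff V x\<bar> \<le> M1" "AE x in surf_measure V. \<bar>strength V x\<bar> \<le> M2"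
    using V unfolding admissible_def by blast
  have R: "regular V \<in> borel_measurable lebesgue" "integrable lebesgue (\<lambda>x. \<bar>regular V x\<bar> powr (real CARD('n) / 2))"
    and s: "0 \<le> exponent V" "exponent V < 1" and \<eta>: "cc_smooth (cutoff V)" "\<And>x. \<bar>cutoff V x\<bar> \<le> 1"
    and \<Gamma>: "compact (surface V)" "lipschitz_hypersurface (surface V)" "is_surface_measure (surface V) (surf_measure V)"
    using V by (simp_all add: admissible_def cc_smooth_def)
  obtain A where A: "A \<ge> 0" "\<And>u u0 w. H1_rep \<Omega> u u0 w \<Longrightarrow>
    ennreal (cmod (LINT x|lebesgue_on \<Omega>. of_real (regular V x) * u x * ((e x)\<^sup>2 *\<^sub>R cnj (u x))))
      \<le> ennreal (\<epsilon> / 3) * cut_energy e u0 w + ennreal A * sq_norm (\<lambda>x. e x *\<^sub>R u0 x)"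
    using regular_term_bound[OF n R \<Omega> e(1,3) \<epsilon>3] by blast
  obtain B where B: "B \<ge> 0" "\<And>u u0 w. H1_rep \<Omega> u u0 w \<Longrightarrow>
    ennreal (cmod (LINT x|lebesgue. of_real (frac_coeff V x) * frac_deriv (exponent V)
       (\<lambda>y. if y \<in> \<Omega> then (of_real (cutoff V y) * u y) * (of_real (cutoff V y) * ((e y)\<^sup>2 *\<^sub>R cnj (u y))) else 0) x))
      \<le> ennreal (\<epsilon> / 3) * cut_energy e u0 w + ennreal B * sq_norm (\<lambda>x. e x *\<^sub>R u0 x)"
    using frac_term_bound[OF s M(1) \<eta> \<Omega> e(1,3) \<epsilon>3] by blast
  obtain C where C: "C \<ge> 0" "\<And>u u0 w. H1_rep \<Omega> u u0 w \<Longrightarrow>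
    ennreal (cmod (LINT x:(surface V \<inter> \<Omega>)|surf_measure V. of_real (strength V x) * H1_trace \<Omega> (surf_measure V) u x *
        H1_trace \<Omega> (surf_measure V) (\<lambda>x. (e x)\<^sup>2 *\<^sub>R cnj (u x)) x))
      \<le> ennreal (\<epsilon> / 3) * cut_energy e u0 w + ennreal C * sq_norm (\<lambda>x. e x *\<^sub>R u0 x)"
    using surface_term_bound[OF \<Gamma> M(2) \<Omega> e \<epsilon>3] by blast
  have "ennreal (cmod (pairing \<Omega> V u (\<lambda>x. (e x)\<^sup>2 *\<^sub>R cnj (u x))))
      \<le> ennreal \<epsilon> * cut_energy e u0 w + ennreal (A + B + C) * sq_norm (\<lambda>x. e x *\<^sub>R u0 x)" if r: "H1_rep \<Omega> u u0 w" for u u0 w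
  proof -
    have tri: "ennreal (cmod (a + b + c)) \<le> ennreal (cmod a) + ennreal (cmod b) + ennreal (cmod c)" for a b c
    proof -
      have "cmod (a + b + c) \<le> cmod a + cmod b + cmod c" using norm_triangle_ineq[of "a + b" c] norm_triangle_ineq[of a b] by simp
      then have "ennreal (cmod (a + b + c)) \<le> ennreal (cmod a + cmod b + cmod c)" by (rule ennreal_leI)
      then show ?thesis by simp
    qed
    let ?E = "cut_energy e u0 w" and ?q = "sq_norm (\<lambda>x. e x *\<^sub>R u0 x)"
    have "ennreal (cmod (pairing \<Omega> V u (\<lambda>x. (e x)\<^sup>2 *\<^sub>R cnj (u x)))) \<le>
      (ennreal (\<epsilon> / 3) * ?E + ennreal A * ?q) + (ennreal (\<epsilon> / 3) * ?E + ennreal B * ?q) + (ennreal (\<epsilon> / 3) * ?E + ennreal C * ?q)"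
      unfolding pairing_def by (rule order_trans[OF tri]) (intro add_mono A(2) B(2) C(2) r)
    also have "\<dots> = ennreal (\<epsilon> / 3 + \<epsilon> / 3 + \<epsilon> / 3) * ?E + ennreal (A + B + C) * ?q"
    proof -
      have "ennreal (\<epsilon> / 3 + \<epsilon> / 3 + \<epsilon> / 3) = ennreal (\<epsilon> / 3) + ennreal (\<epsilon> / 3) + ennreal (\<epsilon> / 3)"
        "ennreal (A + B + C) = ennreal A + ennreal B + ennreal C" using \<epsilon> A(1) B(1) C(1) by (simp_all only: ennreal_plus add_nonneg_nonneg less_imp_le[OF \<epsilon>3])
      then show ?thesis by (simp only: distrib_left distrib_right ac_simps)
    qed
    also have "\<epsilon> / 3 + \<epsilon> / 3 + \<epsilon> / 3 = \<epsilon>" by simp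
    finally show ?thesis .
  qed
  moreover have "A + B + C \<ge> 0" using A(1) B(1) C(1) by simp
  ultimately show ?thesis using that by blast
qed

section \<open>Testing the equation and absorbing the gradient\<close>

text \<open>Testing the equation with \<open>e\<^sup>2 \<cdot> cnj u\<close> produces \<open>\<integral>|\<nabla>(e u)|\<^sup>2\<close> exactly, up to a term of
  order zero.\<close>

lemma Caccioppoli_estimate:
  fixes \<Omega> :: "(real ^ 'n) set" and e :: "real ^ 'n \<Rightarrow> real"
  assumes \<Omega>: "open \<Omega>" and r: "H1_rep \<Omega> u u0 w" and e: "cc_smooth e" "closure {x. e x \<noteq> 0} \<subseteq> \<Omega>"
    and sol: "weak_solution \<Omega> lam V u"
  shows "cut_energy e u0 w \<le> (\<Sum>i\<in>UNIV. sq_norm (\<lambda>x. frechet_derivative e (at x) (axis i 1) *\<^sub>R u0 x))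
    + ennreal \<bar>lam\<bar> * sq_norm (\<lambda>x. e x *\<^sub>R u0 x) + ennreal (cmod (pairing \<Omega> V u (\<lambda>x. (e x)\<^sup>2 *\<^sub>R cnj (u x))))"
proof -
  let ?e = "\<lambda>x. (e x)\<^sup>2" and ?D = "\<lambda>i x. frechet_derivative e (at x) (axis i 1)"
  let ?\<phi> = "\<lambda>x. ?e x *\<^sub>R cnj (u x)" and ?G = "\<lambda>i x. e x *\<^sub>R w i x + ?D i x *\<^sub>R u0 x"
  let ?P = "pairing \<Omega> V u ?\<phi>"
  have ce: "cc_smooth ?e" unfolding power2_eq_square by (rule cc_smooth_mult_real[OF e(1) e(1)])
  have se: "closure {x. ?e x \<noteq> 0} \<subseteq> \<Omega>" using e(2) by simp
  have De: "frechet_derivative ?e (at x) v = 2 * e x * frechet_derivative e (at x) v" for x v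
    unfolding power2_eq_square frechet_derivative_mult_real[OF cc_smooth_smooth[OF e(1)] cc_smooth_smooth[OF e(1)]] by simp
  note rc = H1_rep_cnj[OF \<Omega> r]
  note R = H1_rep_mult(2)[OF \<Omega> rc ce]
  define \<Phi> where "\<Phi> i x = ?e x *\<^sub>R cnj (w i x) + (2 * e x * ?D i x) *\<^sub>R cnj (u0 x)" for i x
  have R': "H1_rep \<Omega> ?\<phi> (\<lambda>x. ?e x *\<^sub>R cnj (u0 x)) \<Phi>" using R unfolding De \<Phi>_def .
  note m = H1_rep_measurable[OF r] H1_rep_measurable[OF R']
  have [measurable]: "u0 \<in> borel_measurable borel" "w i \<in> borel_measurable borel" "\<Phi> i \<in> borel_measurable borel"
    "e \<in> borel_measurable borel" for i
    using m cc_smooth_measurable[OF e(1)] by auto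
  have iG: "integrable lborel (\<lambda>x. (cmod (?G i x))\<^sup>2)" for i by (rule H1_rep_integrable(2)[OF H1_rep_mult(2)[OF \<Omega> r e(1)]])
  have iu: "integrable lborel (\<lambda>x. (cmod (e x *\<^sub>R u0 x))\<^sup>2)" by (rule H1_rep_integrable(1)[OF H1_rep_mult(2)[OF \<Omega> r e(1)]])
  have iD: "integrable lborel (\<lambda>x. (cmod (?D i x *\<^sub>R u0 x))\<^sup>2)" for i
    by (rule H1_rep_integrable(1)[OF H1_rep_mult(2)[OF \<Omega> r cc_smooth_derivative[OF e(1)]]])
  \<comment> \<open>Completing the square: e^2 |w|^2 + 2 e D Re (w cnj u) = |e w + D u|^2 - |D u|^2,
    where D is the derivative of the real function e.\<close>
  have re: "Re (w i x * \<Phi> i x) = (cmod (?G i x))\<^sup>2 - (cmod (?D i x *\<^sub>R u0 x))\<^sup>2" for i x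
    unfolding \<Phi>_def cmod_power2 by (simp add: power2_eq_square algebra_simps)
  have iW: "integrable lborel (\<lambda>x. w i x * \<Phi> i x)" for i
  proof (rule Bochner_Integration.integrable_bound)
    show "integrable lborel (\<lambda>x. (cmod (w i x))\<^sup>2 + (cmod (\<Phi> i x))\<^sup>2)"
      by (intro Bochner_Integration.integrable_add H1_rep_integrable(2)[OF r] H1_rep_integrable(2)[OF R'])
    show "AE x in lborel. norm (w i x * \<Phi> i x) \<le> norm ((cmod (w i x))\<^sup>2 + (cmod (\<Phi> i x))\<^sup>2)"
    proof (rule AE_I2)
      fix x
      have "2 * (cmod (w i x) * cmod (\<Phi> i x)) \<le> (cmod (w i x))\<^sup>2 + (cmod (\<Phi> i x))\<^sup>2"
        using sum_squares_bound[of "cmod (w i x)" "cmod (\<Phi> i x)"] by simp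
      moreover have "0 \<le> cmod (w i x) * cmod (\<Phi> i x)" by simp
      ultimately have "cmod (w i x) * cmod (\<Phi> i x) \<le> (cmod (w i x))\<^sup>2 + (cmod (\<Phi> i x))\<^sup>2" by linarith
      then show "norm (w i x * \<Phi> i x) \<le> norm ((cmod (w i x))\<^sup>2 + (cmod (\<Phi> i x))\<^sup>2)" by (simp add: norm_mult)
    qed
  qed measurable
  define g where "g i = (LINT x|lborel. (cmod (?G i x))\<^sup>2)" for i
  define d where "d i = (LINT x|lborel. (cmod (?D i x *\<^sub>R u0 x))\<^sup>2)" for i
  define q where "q = (LINT x|lborel. (cmod (e x *\<^sub>R u0 x))\<^sup>2)"
  have "Re (LINT x|lebesgue_on \<Omega>. weak_partial \<Omega> i u x * weak_partial \<Omega> i ?\<phi> x) = g i - d i" for i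
  proof -
    have "rep \<Omega> (\<lambda>x. weak_partial \<Omega> i u x * weak_partial \<Omega> i ?\<phi> x) (\<lambda>x. w i x * \<Phi> i x)"
      by (rule rep_mult) (use r R' in \<open>simp_all add: H1_rep_def\<close>)
    from rep_integral(1)[OF \<Omega> this]
    have "(LINT x|lebesgue_on \<Omega>. weak_partial \<Omega> i u x * weak_partial \<Omega> i ?\<phi> x) = (LINT x|lborel. w i x * \<Phi> i x)" .
    also have "Re \<dots> = (LINT x|lborel. Re (w i x * \<Phi> i x))" by (rule integral_Re[OF iW, symmetric])
    also have "\<dots> = g i - d i" unfolding re g_def d_def by (rule Bochner_Integration.integral_diff[OF iG iD])
    finally show ?thesis .
  qed
  moreover have "Re (LINT x|lebesgue_on \<Omega>. u x * ?\<phi> x) = q"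
  proof -
    have "rep \<Omega> (\<lambda>x. u x * ?\<phi> x) (\<lambda>x. u0 x * (?e x *\<^sub>R cnj (u0 x)))"
      by (rule rep_mult) (use r R' in \<open>simp_all add: H1_rep_def\<close>)
    note ri = rep_integral(1)[OF \<Omega> this]
    have pt: "u0 x * (?e x *\<^sub>R cnj (u0 x)) = complex_of_real ((cmod (e x *\<^sub>R u0 x))\<^sup>2)" for x
    proof -
      have "u0 x * (?e x *\<^sub>R cnj (u0 x)) = of_real (?e x) * (u0 x * cnj (u0 x))" by (simp add: scaleR_conv_of_real)
      then show ?thesis unfolding complex_norm_square[symmetric] by (simp add: power_mult_distrib norm_mult)
    qed
    have "(LINT x|lebesgue_on \<Omega>. u x * ?\<phi> x) = (LINT x|lborel. complex_of_real ((cmod (e x *\<^sub>R u0 x))\<^sup>2))"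
      using ri unfolding pt .
    also have "\<dots> = complex_of_real q"
      unfolding q_def by (rule integral_complex_of_real)
    finally show ?thesis by simp
  qed
  moreover have "- (\<Sum>i\<in>UNIV. (LINT x|lebesgue_on \<Omega>. weak_partial \<Omega> i u x * weak_partial \<Omega> i ?\<phi> x))
        + of_real lam * (LINT x|lebesgue_on \<Omega>. u x * ?\<phi> x) - ?P = 0"
    using sol cutoff_test_H1_0[OF \<Omega> rc ce se] unfolding weak_solution_def by blast
  then have "Re (- (\<Sum>i\<in>UNIV. (LINT x|lebesgue_on \<Omega>. weak_partial \<Omega> i u x * weak_partial \<Omega> i ?\<phi> x))
        + of_real lam * (LINT x|lebesgue_on \<Omega>. u x * ?\<phi> x) - ?P) = 0" by (simp only: zero_complex.sel)
  ultimately have "- (\<Sum>i\<in>UNIV. g i - d i) + lam * q - Re ?P = 0" by simp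
  moreover have "- Re ?P \<le> cmod ?P" using abs_Re_le_cmod[of ?P] by linarith
  moreover have q0: "q \<ge> 0" and d0: "d i \<ge> 0" and g0: "g i \<ge> 0" for i unfolding q_def d_def g_def by simp_all
  moreover have "lam * q \<le> \<bar>lam\<bar> * q" using q0 by (intro mult_right_mono) auto
  ultimately have "(\<Sum>i\<in>UNIV. g i) \<le> (\<Sum>i\<in>UNIV. d i) + \<bar>lam\<bar> * q + cmod ?P" by (simp add: sum_subtractf)
  then have "ennreal (\<Sum>i\<in>UNIV. g i) \<le> ennreal ((\<Sum>i\<in>UNIV. d i) + \<bar>lam\<bar> * q + cmod ?P)" by (rule ennreal_leI)
  also have "\<dots> = (\<Sum>i\<in>UNIV. ennreal (d i)) + ennreal \<bar>lam\<bar> * ennreal q + ennreal (cmod ?P)"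
    using q0 d0 by (simp add: ennreal_mult sum_nonneg)
  finally have "(\<Sum>i\<in>UNIV. ennreal (g i)) \<le> (\<Sum>i\<in>UNIV. ennreal (d i)) + ennreal \<bar>lam\<bar> * ennreal q + ennreal (cmod ?P)"
    using g0 by simp
  moreover have "ennreal (g i) = sq_norm (?G i)" "ennreal (d i) = sq_norm (\<lambda>x. ?D i x *\<^sub>R u0 x)" for i
    unfolding g_def d_def sq_norm_def by (rule nn_integral_eq_integral[symmetric, OF iG], simp, rule nn_integral_eq_integral[symmetric, OF iD], simp)
  moreover have "ennreal q = sq_norm (\<lambda>x. e x *\<^sub>R u0 x)"
    unfolding q_def sq_norm_def by (rule nn_integral_eq_integral[symmetric, OF iu]) simp
  ultimately show ?thesis unfolding cut_energy_def by simp
qed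


lemma cut_energy_finite:
  assumes "open \<Omega>" "H1_rep \<Omega> u u0 w" "cc_smooth e"
  shows "cut_energy e u0 w < \<infinity>"
  using H1_rep_integrable(2)[OF H1_rep_mult(2)[OF assms]] H1_rep_measurable(2)[OF H1_rep_mult(2)[OF assms]]
  by (simp add: cut_energy_def sq_integrable_iff)

theorem lemma3p5:
  fixes lam :: real and V :: "'n::finite potential" and \<Omega> \<Omega>' :: "(real ^ 'n) set"
  assumes "CARD('n) \<ge> 3"
    and "lam > 0"
    and "admissible V"
    and "bounded \<Omega>" and "lipschitz_open \<Omega>"
    and "bounded \<Omega>'" and "lipschitz_open \<Omega>'"
    and "closure \<Omega>' \<subseteq> \<Omega>"
    and "supp V \<subseteq> \<Omega>'"
  shows "\<exists>C>0. \<forall>u\<in>H1 \<Omega>. weak_solution \<Omega> lam V u \<longrightarrow> H1_norm \<Omega>' u \<le> C * L2_norm \<Omega> u"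
proof -
  have \<Omega>: "open \<Omega>" "open \<Omega>'" using assms by (simp_all add: lipschitz_open_def)
  have sub: "\<Omega>' \<subseteq> \<Omega>" using assms(8) closure_subset by blast
  have "compact (closure \<Omega>')" using assms(6) by (simp add: compact_closure)
  then obtain e U where e: "cc_smooth e" "closure {x. e x \<noteq> (0::real)} \<subseteq> \<Omega>" "\<And>x. 0 \<le> e x" "\<And>x. e x \<le> 1"
      "open U" "closure \<Omega>' \<subseteq> U" "U \<subseteq> \<Omega>" "\<And>x. x \<in> U \<Longrightarrow> e x = 1"
    using smooth_cutoff_exists[OF _ \<Omega>(1) assms(8)] by metis
  have e1: "\<bar>e x\<bar> \<le> 1" for x using e(3,4)[of x] by simp
  \<comment> \<open>The cut-off is constant on an open set around \<Omega>', hence its gradient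
    vanishes there.\<close>
  have U: "e x = 1" "frechet_derivative e (at x) v = 0" if "x \<in> \<Omega>'" for x v
    using that e(6,8) closure_subset[of \<Omega>'] frechet_derivative_locally_const[OF e(5), of x e 1 v] by auto
  obtain L where L: "L > 0" "\<And>x v. norm (frechet_derivative e (at x) v) \<le> L * norm v"
    using cc_smooth_derivative_bounded[OF e(1)] by blast
  \<comment> \<open>Any value below 1 would allow the energy on the right to be absorbed.\<close>
  define h :: real where "h = 1 / 2"
  have h: "h > 0" by (simp add: h_def)
  obtain C where C: "C \<ge> 0" "\<And>u u0 w. H1_rep \<Omega> u u0 w \<Longrightarrow>
    ennreal (cmod (pairing \<Omega> V u (\<lambda>x. (e x)\<^sup>2 *\<^sub>R cnj (u x))))
      \<le> ennreal h * cut_energy e u0 w + ennreal C * sq_norm (\<lambda>x. e x *\<^sub>R u0 x)"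
    using pairing_bound[OF assms(1,3) \<Omega>(1) e(1) e1 e(2) h] by blast
  define A where "A = real CARD('n) * L\<^sup>2 + \<bar>lam\<bar> + C"
  have A: "A \<ge> 0" using C(1) by (simp add: A_def)
  have "H1_norm \<Omega>' u \<le> sqrt (1 + 2 * A) * L2_norm \<Omega> u" if u: "u \<in> H1 \<Omega>" and sol: "weak_solution \<Omega> lam V u" for u
  proof -
    obtain u0 w where r: "H1_rep \<Omega> u u0 w" by (rule H1_rep_exists[OF \<Omega>(1) u])
    note m = H1_rep_measurable(1)[OF r]
    define q where "q = (L2_norm \<Omega> u)\<^sup>2"
    have q: "sq_norm u0 = ennreal q" "q \<ge> 0"
      using rep_sq_norm(2)[OF \<Omega>(1), of u u0] r by (simp_all add: q_def H1_rep_def)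
    \<comment> \<open>The energy is finite because u is in H^1, so the absorption can be carried out
      in the reals.\<close>
    define E where "E = enn2real (cut_energy e u0 w)"
    have E: "cut_energy e u0 w = ennreal E" "E \<ge> 0"
      using cut_energy_finite[OF \<Omega>(1) r e(1)] by (simp_all add: E_def)
    have eq: "sq_norm (\<lambda>x. e x *\<^sub>R u0 x) \<le> ennreal q"
      using sq_norm_scaleR_le[OF m e1] by (simp add: q)
    have D: "sq_norm (\<lambda>x. frechet_derivative e (at x) (axis i 1) *\<^sub>R u0 x) \<le> ennreal (L\<^sup>2) * ennreal q" for i
      unfolding q(1)[symmetric] by (rule sq_norm_scaleR_le[OF m]) (use L(2)[of _ "axis i 1"] in simp)
    have "cut_energy e u0 w \<le> (\<Sum>i\<in>UNIV. sq_norm (\<lambda>x. frechet_derivative e (at x) (axis i 1) *\<^sub>R u0 x))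
      + ennreal \<bar>lam\<bar> * sq_norm (\<lambda>x. e x *\<^sub>R u0 x) + ennreal (cmod (pairing \<Omega> V u (\<lambda>x. (e x)\<^sup>2 *\<^sub>R cnj (u x))))"
      by (rule Caccioppoli_estimate[OF \<Omega>(1) r e(1,2) sol])
    also have "\<dots> \<le> (\<Sum>i\<in>(UNIV::'n set). ennreal (L\<^sup>2) * ennreal q) + ennreal \<bar>lam\<bar> * ennreal q
       + (ennreal h * cut_energy e u0 w + ennreal C * ennreal q)"
      by (intro add_mono sum_mono D order_trans[OF C(2)[OF r]] mult_left_mono eq order_refl) auto
    also have "\<dots> = ennreal (real CARD('n) * (L\<^sup>2 * q) + \<bar>lam\<bar> * q + (h * E + C * q))"
      using q(2) E(2) C(1) h unfolding E(1) by (simp add: ennreal_mult ennreal_of_nat_eq_real_of_nat)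
    finally have "ennreal E \<le> ennreal (real CARD('n) * (L\<^sup>2 * q) + \<bar>lam\<bar> * q + (h * E + C * q))" unfolding E(1) .
    then have "E \<le> real CARD('n) * (L\<^sup>2 * q) + \<bar>lam\<bar> * q + (h * E + C * q)"
      by (rule ennreal_le_iff[THEN iffD1, rotated]) (use q(2) E(2) C(1) h in \<open>intro add_nonneg_nonneg mult_nonneg_nonneg; simp\<close>)
    also have "\<dots> = A * q + E / 2" by (simp add: A_def h_def algebra_simps)
    finally have EA: "E \<le> 2 * A * q" by simp
    have "ennreal ((H1_norm \<Omega>' u)\<^sup>2) = sq_norm (\<lambda>x. indicator \<Omega>' x *\<^sub>R u0 x) + (\<Sum>i\<in>UNIV. sq_norm (\<lambda>x. indicator \<Omega>' x *\<^sub>R w i x))"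
      by (rule H1_rep_norm[OF \<Omega>(2) H1_rep_restrict(2)[OF \<Omega>(2) sub r]])
    \<comment> \<open>On \<Omega>' the integrands of \<open>cut_energy\<close> reduce to the
      derivatives of u, by the values of \<open>e\<close> and its gradient there.\<close>
    also have "\<dots> \<le> sq_norm u0 + cut_energy e u0 w"
      unfolding cut_energy_def by (intro add_mono sum_mono sq_norm_mono) (auto simp: indicator_def U)
    also have "\<dots> = ennreal (q + E)" unfolding q(1) E(1) using q(2) E(2) by simp
    finally have "(H1_norm \<Omega>' u)\<^sup>2 \<le> q + E" using q(2) E(2) by (simp add: ennreal_le_iff del: ennreal_plus)
    also have "\<dots> \<le> (1 + 2 * A) * q" using EA by (simp add: algebra_simps)
    also have "\<dots> = (sqrt (1 + 2 * A) * L2_norm \<Omega> u)\<^sup>2" using A by (simp add: power_mult_distrib q_def)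
    finally show ?thesis
      by (rule power2_le_imp_le) (use A in \<open>simp add: L2_norm_def integral_nonneg_AE\<close>)
  qed
  moreover have "sqrt (1 + 2 * A) > 0" using A by simp
  ultimately show ?thesis by blast
qed

end
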